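(* Let $\varphi,\psi:\mathbb{R}^d\to\mathbb{C}$ be measurable functions such that, for some constants $C,\varepsilon>0$, both $\gamma=\varphi$ and $\gamma=\psi$ satisfy $|\gamma(x)|\le C(1+|x|)^{-d-\varepsilon}$ for every $x\in\mathbb{R}^d$. Let $(h_k)$ be a scale, let $(u_k)$ be a bounded sequence in $L^2(\mathbb{R}^d)$, and suppose that $\mu$ is its Wigner measure at scale $(h_k)$. Suppose that the measures $|\widehat\varphi(\xi+2\pi n)|^2\mu(x,\xi+2\pi n)$, $n\in\mathbb{Z}^d$, are mutually singular. If, moreover, $|T_\psi^{h_k}S_\varphi^{h_k}u_k|^2dx$ weakly converges to a measure $\nu_{\varphi,\psi}$, then $$\nu_{\varphi,\psi}(x)=\int_{\mathbb{R}^d}\sum_{k\in\mathbb{Z}^d}|\widehat\psi(\xi+2\pi k)|^2|\widehat\varphi(\xi)|^2\,\mu(x,d\xi),$$ i.e. $\int\phi\,d\nu_{\varphi,\psi}=\int_{\mathbb{R}^d\times\mathbb{R}^d}\phi(x)\sum_{k\in\mathbb{Z}^d}|\widehat\psi(\xi+2\pi k)|^2|\widehat\varphi(\xi)|^2d\mu(x,\xi)$ for every $\phi\in C_c(\mathbb{R}^d)$.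
   Context: A scale is a sequence of positive numbers tending to $0$. Fourier transform: $\widehat u(\xi)=\int_{\mathbb{R}^d}u(x)e^{-ix\cdot\xi}dx$. For $u\in\mathcal{S}'(\mathbb{R}^d)$ and $\varepsilon>0$, $m^\varepsilon[u]\in\mathcal{S}'(\mathbb{R}^d\times\mathbb{R}^d)$ is $$m^\varepsilon[u](x,\xi)=\frac{1}{(2\pi\varepsilon)^d}\overline{u(x)}\,\widehat u(\xi/\varepsilon)e^{ix\cdot\xi/\varepsilon}.$$ A positive Radon measure $\mu$ on $\mathbb{R}^d\times\mathbb{R}^d$ is the Wigner measure at scale $(\varepsilon_k)$ of $(u_k)$ if $m^{\varepsilon_k}[u_k]\to\mu$ weakly in $\mathcal{S}'(\mathbb{R}^d\times\mathbb{R}^d)$. Sampling operator: $S_\varphi^hu(n)=h^{-d}\int_{\mathbb{R}^d}u(x)\overline{\varphi(x/h-n)}\,dx$, $n\in\mathbb{Z}^d$. Reconstruction operator: for $U=(U_n)_{n\in\mathbb{Z}^d}$ square-summable, $T_\psi^hU(x)=\sum_{n\in\mathbb{Z}^d}U_n\psi(x/h-n)$. $\mu(x,\xi+2\pi n)$ denotes the image of $\mu$ under $(x,\xi)\mapsto(x,\xi-2\pi n)$. "Mutually singular" means pairwise mutually singular. Weak convergence of measures is convergence tested against $C_c(\mathbb{R}^d)$. *)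

theory Defs
  imports "HOL-Analysis.Analysis"
begin

definition is_scale :: "(nat \<Rightarrow> real) \<Rightarrow> bool" where
  "is_scale h \<longleftrightarrow> (\<forall>k. 0 < h k) \<and> h \<longlonglongrightarrow> 0"

definition square_integrable :: "('a::euclidean_space \<Rightarrow> complex) \<Rightarrow> bool" where
  "square_integrable u \<longleftrightarrow>
     u \<in> borel_measurable lebesgue \<and> integrable lebesgue (\<lambda>x. (cmod (u x))\<^sup>2)"

definition L2_norm :: "('a::euclidean_space \<Rightarrow> complex) \<Rightarrow> real" where
  "L2_norm u = sqrt (\<integral>x. (cmod (u x))\<^sup>2 \<partial>lebesgue)"

definition fourier :: "('a::euclidean_space \<Rightarrow> complex) \<Rightarrow> 'a \<Rightarrow> complex" where
  "fourier u \<xi> = (\<integral>x. u x * exp (- \<i> * complex_of_real (x \<bullet> \<xi>)) \<partial>lebesgue)"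

primrec iter_deriv :: "'a list \<Rightarrow> ('a::euclidean_space \<Rightarrow> complex) \<Rightarrow> 'a \<Rightarrow> complex" where
  "iter_deriv [] f = f"
| "iter_deriv (v # vs) f = (\<lambda>x. frechet_derivative (iter_deriv vs f) (at x) v)"

definition schwartz :: "('a::euclidean_space \<Rightarrow> complex) \<Rightarrow> bool" where
  "schwartz f \<longleftrightarrow>
     (\<forall>vs. set vs \<subseteq> Basis \<longrightarrow>
        (\<forall>x. iter_deriv vs f differentiable (at x)) \<and>
        (\<forall>N::nat. \<exists>C. \<forall>x. (1 + norm x) ^ N * cmod (iter_deriv vs f x) \<le> C))"

text \<open>
  A tempered distribution is represented by its action on Schwartz functions; its values on
  other functions are irrelevant. The pairing is bilinear, and the operations below are the
  usual extensions of operations on functions: conjugation, Fourier transform, the dilation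
  from \<open>v(\<xi>)\<close> to \<open>v(\<xi>/\<epsilon>)\<close>, tensor product, and multiplication by a smooth function.
\<close>

type_synonym 'a distribution = "('a \<Rightarrow> complex) \<Rightarrow> complex"

definition dist_of_fun :: "('a::euclidean_space \<Rightarrow> complex) \<Rightarrow> 'a distribution" where
  "dist_of_fun u \<theta> = (\<integral>x. u x * \<theta> x \<partial>lebesgue)"

definition dist_cnj :: "'a distribution \<Rightarrow> 'a distribution" where
  "dist_cnj L \<theta> = cnj (L (\<lambda>x. cnj (\<theta> x)))"

definition dist_fourier :: "'a::euclidean_space distribution \<Rightarrow> 'a distribution" where
  "dist_fourier L \<theta> = L (fourier \<theta>)"

definition dist_dilate :: "real \<Rightarrow> 'a::euclidean_space distribution \<Rightarrow> 'a distribution" where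
  "dist_dilate \<epsilon> L \<theta> = complex_of_real (\<epsilon> ^ DIM('a)) * L (\<lambda>\<xi>. \<theta> (\<epsilon> *\<^sub>R \<xi>))"

definition dist_tensor :: "'a distribution \<Rightarrow> 'b distribution \<Rightarrow> ('a \<times> 'b) distribution" where
  "dist_tensor L M \<theta> = L (\<lambda>x. M (\<lambda>\<xi>. \<theta> (x, \<xi>)))"

definition dist_mult :: "('a \<Rightarrow> complex) \<Rightarrow> 'a distribution \<Rightarrow> 'a distribution" where
  "dist_mult g L \<theta> = L (\<lambda>x. g x * \<theta> x)"

definition wigner_distribution ::
    "real \<Rightarrow> 'a::euclidean_space distribution \<Rightarrow> ('a \<times> 'a) distribution" where
  "wigner_distribution \<epsilon> L \<theta> =
     complex_of_real (1 / (2 * pi * \<epsilon>) ^ DIM('a)) *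
     dist_mult (\<lambda>(x, \<xi>). exp (\<i> * complex_of_real ((x \<bullet> \<xi>) / \<epsilon>)))
       (dist_tensor (dist_cnj L) (dist_dilate \<epsilon> (dist_fourier L))) \<theta>"

text \<open>On a Euclidean space, a Borel measure that is finite on compact sets is regular.\<close>

definition radon_measure :: "'a::euclidean_space measure \<Rightarrow> bool" where
  "radon_measure \<mu> \<longleftrightarrow> sets \<mu> = sets borel \<and> (\<forall>K. compact K \<longrightarrow> emeasure \<mu> K < \<infinity>)"

text \<open>Integrability of every Schwartz function says that \<open>\<mu>\<close> defines a tempered distribution.\<close>

definition is_wigner_measure ::
    "('a::euclidean_space \<times> 'a) measure \<Rightarrow> (nat \<Rightarrow> real) \<Rightarrow> (nat \<Rightarrow> 'a \<Rightarrow> complex) \<Rightarrow> bool" where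
  "is_wigner_measure \<mu> \<epsilon> u \<longleftrightarrow>
     radon_measure \<mu> \<and>
     (\<forall>\<theta>. schwartz \<theta> \<longrightarrow>
        integrable \<mu> \<theta> \<and>
        (\<lambda>k. wigner_distribution (\<epsilon> k) (dist_of_fun (u k)) \<theta>) \<longlonglongrightarrow> (\<integral>z. \<theta> z \<partial>\<mu>))"

definition of_int_vec :: "int ^ 'n \<Rightarrow> real ^ 'n" where
  "of_int_vec n = (\<chi> i. real_of_int (n $ i))"

definition sampling ::
    "(real ^ 'n \<Rightarrow> complex) \<Rightarrow> real \<Rightarrow> (real ^ 'n \<Rightarrow> complex) \<Rightarrow> int ^ 'n \<Rightarrow> complex" where
  "sampling \<phi> h u n =
     complex_of_real (1 / h ^ CARD('n)) *
     (\<integral>x. u x * cnj (\<phi> (x /\<^sub>R h - of_int_vec n)) \<partial>lebesgue)"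

definition reconstruction ::
    "(real ^ 'n \<Rightarrow> complex) \<Rightarrow> real \<Rightarrow> (int ^ 'n \<Rightarrow> complex) \<Rightarrow> real ^ 'n \<Rightarrow> complex" where
  "reconstruction \<psi> h U x = (\<Sum>\<^sub>\<infinity>n. U n * \<psi> (x /\<^sub>R h - of_int_vec n))"

text \<open>The measure \<open>\<mu>(x, \<xi> + 2\<pi>n)\<close>.\<close>

definition freq_shift ::
    "((real ^ 'n) \<times> (real ^ 'n)) measure \<Rightarrow> int ^ 'n \<Rightarrow> ((real ^ 'n) \<times> (real ^ 'n)) measure" where
  "freq_shift \<mu> n = distr \<mu> borel (\<lambda>(x, \<xi>). (x, \<xi> - (2 * pi) *\<^sub>R of_int_vec n))"

definition mutually_singular :: "'a measure \<Rightarrow> 'a measure \<Rightarrow> bool" where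
  "mutually_singular M N \<longleftrightarrow>
     sets M = sets N \<and> (\<exists>A\<in>sets M. emeasure M A = 0 \<and> emeasure N (space N - A) = 0)"

definition test_function :: "('a::euclidean_space \<Rightarrow> complex) \<Rightarrow> bool" where
  "test_function f \<longleftrightarrow> continuous_on UNIV f \<and> compact (closure {x. f x \<noteq> 0})"

definition weakly_converges :: "(nat \<Rightarrow> 'a::euclidean_space measure) \<Rightarrow> 'a measure \<Rightarrow> bool" where
  "weakly_converges M \<nu> \<longleftrightarrow>
     (\<forall>f. test_function f \<longrightarrow> (\<lambda>k. \<integral>x. f x \<partial>M k) \<longlonglongrightarrow> (\<integral>x. f x \<partial>\<nu>))"

end

theory Submission
  imports Defs "HOL-Probability.Probability" "HOL-Real_Asymp.Real_Asymp"
begin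

text \<open>After rescaling to unit scale, the samples are the values on \<open>\<int>\<^sup>d\<close> of the filtered functions
  \<open>V\<^sub>k(x) = \<integral> w\<^sub>k(x + z) cnj (\<phi> z) dz\<close>, and the Wigner measure gives the limits of the correlations
  \<open>\<integral> f(h\<^sub>k x) V\<^sub>k(x) cnj (V\<^sub>k(x + p)) dx\<close>. Replacing this integral by the sum over \<open>\<int>\<^sup>d\<close> adds the terms with
  the oscillating factor \<open>exp (2 \<pi> i l \<bullet> x)\<close>, \<open>l \<noteq> 0\<close>. They couple \<open>|\<phi>^(\<xi>)|\<^sup>2 \<mu>(x, \<xi>)\<close> to its translate by
  \<open>2 \<pi> l\<close>, and mutual singularity makes them vanish in the limit. Expanding the square of the reconstruction in
  lags \<open>p\<close> then leaves the Fourier series with coefficients \<open>\<integral> \<psi>(x) cnj (\<psi>(x - p)) dx\<close>, which Poisson summation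
  identifies with the periodization of \<open>|\<psi>^|\<^sup>2\<close>.\<close>

subsection \<open>Integration on Euclidean space\<close>

text \<open>Nothing prevents the sequence from losing mass to infinite frequency at scale
  \<open>h k\<close>, so correlations at a fixed lag need not converge to their counterpart under
  \<mu>. They do after integration against an integrable kernel in the lag, whose transform decays,
  and filtering by \<phi> supplies such kernels: its shifted autocorrelations. Neither \<phi> and
  \<psi> nor their transforms are regular. The decay hypothesis gives a uniform bound on lattice
  sums, and this one bound yields integrability, square integrability, control of the samples and,
  through continuity of translations in L1, their equicontinuity. The periodization of the squared
  transform of \<psi> is summed by nonnegativity, because no decay of the transform is at hand.
  Singularity only provides a Borel set, which has no quantization; its indicator is replaced by
  trigonometric polynomials in phase space. For these the operators are finite combinations of
  translations and slow modulations, so adjoints and products are explicit up to displacements of a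
  slowly varying weight.\<close>

lemma (in pair_sigma_finite) Fubini_swap:
  fixes f :: "'a \<Rightarrow> 'b \<Rightarrow> 'c::{banach, second_countable_topology}"
  assumes f [measurable]: "case_prod f \<in> borel_measurable (M1 \<Otimes>\<^sub>M M2)"
    and fin: "(\<integral>\<^sup>+x. (\<integral>\<^sup>+y. norm (f x y) \<partial>M2) \<partial>M1) < \<infinity>"
  shows "integrable (M1 \<Otimes>\<^sub>M M2) (case_prod f)"
    and "integrable M1 (\<lambda>x. LINT y|M2. f x y)"
    and "integrable M2 (\<lambda>y. LINT x|M1. f x y)"
    and "(LINT x|M1. (LINT y|M2. f x y)) = (LINT y|M2. (LINT x|M1. f x y))"
proof -
  show *: "integrable (M1 \<Otimes>\<^sub>M M2) (case_prod f)"
  proof (rule integrableI_bounded)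
    have "(\<integral>\<^sup>+z. norm (case_prod f z) \<partial>(M1 \<Otimes>\<^sub>M M2)) = (\<integral>\<^sup>+x. (\<integral>\<^sup>+y. norm (case_prod f (x, y)) \<partial>M2) \<partial>M1)"
      by (rule M2.nn_integral_fst[symmetric]) measurable
    then show "(\<integral>\<^sup>+z. norm (case_prod f z) \<partial>(M1 \<Otimes>\<^sub>M M2)) < \<infinity>"
      using fin by simp
  qed measurable
  show "integrable M1 (\<lambda>x. LINT y|M2. f x y)"
    by (rule integrable_fst[OF *])
  show "integrable M2 (\<lambda>y. LINT x|M1. f x y)"
    by (rule integrable_snd[OF *])
  show "(LINT x|M1. (LINT y|M2. f x y)) = (LINT y|M2. (LINT x|M1. f x y))"
    by (rule Fubini_integral[OF *, symmetric])
qed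

section \<open>Affine changes of variables for Lebesgue measure\<close>

lemma nn_integral_lborel_translate:
  fixes f :: "'a::euclidean_space \<Rightarrow> ennreal"
  assumes [measurable]: "f \<in> borel_measurable borel"
  shows "(\<integral>\<^sup>+x. f (c + x) \<partial>lborel) = (\<integral>\<^sup>+x. f x \<partial>lborel)"
proof -
  have "(\<integral>\<^sup>+x. f x \<partial>lborel) = (\<integral>\<^sup>+x. f x \<partial>(distr lborel borel ((+) c)))"
    by (simp add: lborel_distr_plus)
  also have "\<dots> = (\<integral>\<^sup>+x. f (c + x) \<partial>lborel)"
    by (subst nn_integral_distr) auto
  finally show ?thesis ..
qed

lemma integral_lborel_translate:
  fixes f :: "'a::euclidean_space \<Rightarrow> 'b::{banach, second_countable_topology}"
  assumes [measurable]: "f \<in> borel_measurable borel"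
  shows "(LBINT x. f (c + x)) = (LBINT x. f x)"
proof -
  have "(LBINT x. f x) = (\<integral>x. f x \<partial>(distr lborel borel ((+) c)))"
    by (simp add: lborel_distr_plus)
  also have "\<dots> = (LBINT x. f (c + x))"
    by (subst integral_distr) auto
  finally show ?thesis ..
qed

lemma integrable_lborel_translate:
  fixes f :: "'a::euclidean_space \<Rightarrow> 'b::{banach, second_countable_topology}"
  assumes "integrable lborel f"
  shows "integrable lborel (\<lambda>x. f (c + x))"
  using assms nn_integral_lborel_translate[of "\<lambda>x. norm (f x)" c]
  unfolding integrable_iff_bounded by auto

lemma nn_integral_lborel_scale:
  fixes f :: "'a::euclidean_space \<Rightarrow> ennreal"
  assumes [measurable]: "f \<in> borel_measurable borel" and "c \<noteq> 0"
  shows "(\<integral>\<^sup>+x. f x \<partial>lborel) = ennreal (\<bar>c\<bar> ^ DIM('a)) * (\<integral>\<^sup>+x. f (c *\<^sub>R x) \<partial>lborel)"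
  by (subst lborel_affine[OF \<open>c \<noteq> 0\<close>, of 0])
    (simp add: nn_integral_density nn_integral_distr nn_integral_cmult)

lemma integral_lborel_scale:
  fixes f :: "'a::euclidean_space \<Rightarrow> 'b::{banach, second_countable_topology}"
  assumes [measurable]: "f \<in> borel_measurable borel" and "c \<noteq> 0"
  shows "(LBINT x. f x) = \<bar>c\<bar> ^ DIM('a) *\<^sub>R (LBINT x. f (c *\<^sub>R x))"
  by (subst lborel_affine[OF \<open>c \<noteq> 0\<close>, of 0])
    (simp add: integral_density integral_distr)

lemma integrable_lborel_scale:
  fixes f :: "'a::euclidean_space \<Rightarrow> 'b::{banach, second_countable_topology}"
  assumes "integrable lborel f" "c \<noteq> 0"
  shows "integrable lborel (\<lambda>x. f (c *\<^sub>R x))"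
  using assms nn_integral_lborel_scale[of "\<lambda>x. norm (f x)" c]
  unfolding integrable_iff_bounded
  by (auto simp: ennreal_mult_less_top)

lemma integral_lborel_reflect:
  fixes f :: "'a::euclidean_space \<Rightarrow> 'b::{banach, second_countable_topology}"
  assumes [measurable]: "f \<in> borel_measurable borel"
  shows "(LBINT x. f (c - x)) = (LBINT x. f x)"
proof -
  have "(LBINT x. f x) = (LBINT x. f (c + x))"
    by (simp add: integral_lborel_translate)
  also have "\<dots> = (LBINT x. f (c - x))"
    using integral_lborel_scale[of "\<lambda>x. f (c + x)" "-1"] by simp
  finally show ?thesis ..
qed

lemma integrable_lborel_translate_minus:
  fixes f :: "'a::euclidean_space \<Rightarrow> 'b::{banach, second_countable_topology}"
  assumes "integrable lborel f"
  shows "integrable lborel (\<lambda>x. f (x - c))"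
  using integrable_lborel_translate[OF assms, of "-c"] by simp

lemma integral_lborel_translate_minus:
  fixes f :: "'a::euclidean_space \<Rightarrow> 'b::{banach, second_countable_topology}"
  assumes [measurable]: "f \<in> borel_measurable borel"
  shows "(LBINT x. f (x - c)) = (LBINT x. f x)"
  using integral_lborel_translate[OF assms, of "-c"] by simp

text \<open>The error \<open>\<eta> N\<close> does not depend on \<open>k\<close>; this uniformity
  is what permits the limits in \<open>k\<close> and in \<open>N\<close> to be taken in the opposite
  order.\<close>

lemma tendsto_interchange:
  fixes a :: "nat \<Rightarrow> nat \<Rightarrow> 'a::real_normed_vector"
  assumes "\<And>N. (\<lambda>k. a N k) \<longlonglongrightarrow> b N" and "b \<longlonglongrightarrow> L"
    and "\<And>N k. norm (a N k - c k) \<le> \<eta> N" and "\<eta> \<longlonglongrightarrow> 0"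
  shows "c \<longlonglongrightarrow> L"
proof (rule metric_LIMSEQ_I)
  fix e :: real assume "e > 0"
  then have "\<forall>\<^sub>F N in sequentially. dist (b N) L < e/3" "\<forall>\<^sub>F N in sequentially. dist (\<eta> N) 0 < e/3"
    using tendstoD[OF assms(2), of "e/3"] tendstoD[OF assms(4), of "e/3"] by auto
  then have "\<forall>\<^sub>F N in sequentially. dist (b N) L < e/3 \<and> dist (\<eta> N) 0 < e/3"
    by eventually_elim auto
  then obtain N where N: "dist (b N) L < e/3" "dist (\<eta> N) 0 < e/3"
    by (auto simp: eventually_sequentially)
  obtain K where K: "\<And>k. k \<ge> K \<Longrightarrow> dist (a N k) (b N) < e/3"
    using metric_LIMSEQ_D[OF assms(1)[of N], of "e/3"] \<open>e > 0\<close> by auto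
  have "dist (c k) L < e" if "k \<ge> K" for k
  proof -
    have "dist (c k) L \<le> dist (a N k) (c k) + dist (a N k) (b N) + dist (b N) L"
      by (smt (verit) dist_commute dist_triangle)
    moreover have "dist (a N k) (c k) < e/3"
      using assms(3)[of N k] N(2) by (auto simp: dist_norm)
    ultimately show ?thesis using K[OF that] N(1) by linarith
  qed
  then show "\<exists>K. \<forall>k\<ge>K. dist (c k) L < e" by blast
qed

section \<open>Continuity of translations in L1\<close>

definition L1_trans_cont :: "('a::euclidean_space \<Rightarrow> complex) \<Rightarrow> bool" where
  "L1_trans_cont g \<longleftrightarrow> (\<forall>s. s \<longlonglongrightarrow> 0 \<longrightarrow> (\<lambda>n. LBINT x. norm (g (x - s n) - g x)) \<longlonglongrightarrow> 0)"

text \<open>Translation preserves the L1 norm, so replacing \<open>g\<close> by an approximant costs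
  the same for the translated and the untranslated copy, whatever the shift.\<close>

lemma L1_trans_cont_closure:
  fixes g :: "'a::euclidean_space \<Rightarrow> complex"
  assumes g: "integrable lborel g"
    and "\<And>e. e > 0 \<Longrightarrow> \<exists>g'. integrable lborel g' \<and> L1_trans_cont g' \<and> (LBINT x. norm (g x - g' x)) < e"
  shows "L1_trans_cont g"
  unfolding L1_trans_cont_def
proof (intro allI impI, rule metric_LIMSEQ_I)
  fix s :: "nat \<Rightarrow> 'a" and e :: real assume s: "s \<longlonglongrightarrow> 0" and "e > 0"
  then obtain g' where g': "integrable lborel g'" "L1_trans_cont g'" "(LBINT x. norm (g x - g' x)) < e/3"
    using assms(2)[of "e/3"] by auto
  then have "(\<lambda>n. LBINT x. norm (g' (x - s n) - g' x)) \<longlonglongrightarrow> 0"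
    using s by (auto simp: L1_trans_cont_def)
  then obtain K where K: "\<And>n. n \<ge> K \<Longrightarrow> (LBINT x. norm (g' (x - s n) - g' x)) < e/3"
    using metric_LIMSEQ_D[of _ 0 "e/3"] \<open>e > 0\<close> by (fastforce simp: dist_norm)
  have "norm (LBINT x. norm (g (x - s n) - g x)) < e" if "n \<ge> K" for n
  proof -
    have [measurable]: "g \<in> borel_measurable borel" "g' \<in> borel_measurable borel"
      using g g'(1) by auto
    note i = integrable_lborel_translate_minus[OF g, of "s n"]
      integrable_lborel_translate_minus[OF g'(1), of "s n"]
    have "(LBINT x. norm (g (x - s n) - g x)) \<le>
      (LBINT x. norm (g (x - s n) - g' (x - s n)) + norm (g' (x - s n) - g' x) + norm (g x - g' x))"
    proof (rule integral_mono)
      show "norm (g (x - s n) - g x) \<le> norm (g (x - s n) - g' (x - s n)) + norm (g' (x - s n) - g' x) + norm (g x - g' x)" for x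
        using norm_triangle_ineq[of "g (x - s n) - g' (x - s n)" "g' (x - s n) - g' x"]
          norm_triangle_ineq[of "g (x - s n) - g' (x - s n) + (g' (x - s n) - g' x)" "g' x - g x"]
        by (simp add: norm_minus_commute)
    qed (use i g g' in auto)
    also have "\<dots> = (LBINT x. norm (g (x - s n) - g' (x - s n))) + (LBINT x. norm (g' (x - s n) - g' x)) + (LBINT x. norm (g x - g' x))"
      using i g g' by (simp add: Bochner_Integration.integral_add)
    also have "(LBINT x. norm (g (x - s n) - g' (x - s n))) = (LBINT x. norm (g x - g' x))"
      by (rule integral_lborel_translate_minus) measurable
    finally have "(LBINT x. norm (g (x - s n) - g x)) \<le> (LBINT x. norm (g x - g' x)) + (LBINT x. norm (g' (x - s n) - g' x)) + (LBINT x. norm (g x - g' x))" .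
    moreover have "0 \<le> (LBINT x. norm (g (x - s n) - g x))" by simp
    ultimately show ?thesis using K[OF that] g'(3) by (simp only: real_norm_def abs_of_nonneg)
  qed
  then show "\<exists>no. \<forall>n\<ge>no. dist (LBINT x. norm (g (x - s n) - g x)) 0 < e" by auto
qed

text \<open>The L1 distance between the indicators of \<open>U\<close> and of its translate is twice
  the measure of \<open>U\<close> minus twice the measure of the overlap. Openness gives the
  pointwise limit of the overlap on all of \<open>U\<close>, and outside \<open>U\<close> the
  overlap vanishes, so boundary points cause no trouble.\<close>

lemma L1_trans_cont_open:
  fixes U :: "'a::euclidean_space set"
  assumes U: "open U" "emeasure lborel U < \<infinity>"
  shows "L1_trans_cont (indicator U)"
  unfolding L1_trans_cont_def
proof (intro allI impI)
  fix s :: "nat \<Rightarrow> 'a" assume s: "s \<longlonglongrightarrow> 0"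
  let ?I = "indicator U :: 'a \<Rightarrow> real"
  have [measurable]: "U \<in> sets borel" using U by auto
  have iI: "integrable lborel ?I" using U by auto
  have iI': "integrable lborel (\<lambda>x. ?I (x - c))" for c
    by (rule integrable_lborel_translate_minus[OF iI])
  have iII: "integrable lborel (\<lambda>x. ?I x * ?I (x - c))" for c
    by (rule Bochner_Integration.integrable_bound[OF iI]) (auto split: split_indicator)
  have eq: "(LBINT x. norm (indicator U (x - c) - indicator U x :: complex)) = 2 * (LBINT x. ?I x) - 2 * (LBINT x. ?I x * ?I (x - c))" for c
  proof -
    have "(LBINT x. norm (indicator U (x - c) - indicator U x :: complex)) = (LBINT x. ?I x + ?I (x - c) - 2 * (?I x * ?I (x - c)))"
      by (intro Bochner_Integration.integral_cong) (auto split: split_indicator)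
    also have "\<dots> = (LBINT x. ?I x) + (LBINT x. ?I (x - c)) - 2 * (LBINT x. ?I x * ?I (x - c))"
      using iI iI' iII by simp
    also have "(LBINT x. ?I (x - c)) = (LBINT x. ?I x)"
      by (rule integral_lborel_translate_minus) measurable
    finally show ?thesis by simp
  qed
  have "(\<lambda>n. LBINT x. ?I x * ?I (x - s n)) \<longlonglongrightarrow> (LBINT x. ?I x)"
  proof (rule integral_dominated_convergence[where w = ?I])
    show "AE x in lborel. (\<lambda>n. ?I x * ?I (x - s n)) \<longlonglongrightarrow> ?I x"
    proof (rule AE_I2)
      fix x
      show "(\<lambda>n. ?I x * ?I (x - s n)) \<longlonglongrightarrow> ?I x"
      proof (cases "x \<in> U")
        case True
        have "(\<lambda>n. x - s n) \<longlonglongrightarrow> x - 0" by (intro tendsto_intros s)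
        then have "\<forall>\<^sub>F n in sequentially. x - s n \<in> U"
          using U(1) True topological_tendstoD by fastforce
        then have "\<forall>\<^sub>F n in sequentially. ?I x * ?I (x - s n) = ?I x"
          by eventually_elim (use True in auto)
        then show ?thesis by (rule tendsto_eventually)
      qed auto
    qed
  qed (use iI in \<open>auto split: split_indicator\<close>)
  then have "(\<lambda>n. 2 * (LBINT x. ?I x) - 2 * (LBINT x. ?I x * ?I (x - s n))) \<longlonglongrightarrow> 2 * (LBINT x. ?I x) - 2 * (LBINT x. ?I x)"
    by (intro tendsto_intros)
  then show "(\<lambda>n. LBINT x. norm (indicator U (x - s n) - indicator U x :: complex)) \<longlonglongrightarrow> 0"
    unfolding eq by simp
qed

text \<open>Outer regularity: \<open>A\<close> differs from an open superset of finite measure by a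
  set of small measure.\<close>

lemma L1_trans_cont_indicator:
  fixes A :: "'a::euclidean_space set"
  assumes A: "A \<in> sets borel" "emeasure lborel A < \<infinity>"
  shows "L1_trans_cont (indicator A)"
proof (rule L1_trans_cont_closure)
  have ind: "integrable lborel (indicator B :: 'a \<Rightarrow> complex)" if "B \<in> sets borel" "emeasure lborel B < \<infinity>" for B
  proof -
    have "integrable lborel (\<lambda>x. complex_of_real (indicator B x))"
      using that by (intro integrable_of_real integrable_real_indicator) auto
    then show ?thesis by (simp add: of_real_indicator)
  qed
  show "integrable lborel (indicator A :: 'a \<Rightarrow> complex)"
    using A by (rule ind)
  fix e :: real assume "e > 0"
  then obtain T where T: "open T" "A \<subseteq> T" "(T - A) \<in> lmeasurable" "emeasure lebesgue (T - A) < ennreal e"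
    using sets_lebesgue_outer_open[of A e] A by auto
  have [measurable]: "T \<in> sets borel" "A \<in> sets borel" using T A by auto
  have em: "emeasure lborel (T - A) < ennreal e" using T(4) by simp
  then have f: "emeasure lborel (T - A) < \<infinity>" using less_trans[OF em] by auto
  have "emeasure lborel T = emeasure lborel A + emeasure lborel (T - A)"
    using T(2) by (subst plus_emeasure) (auto simp: Un_absorb1)
  then have fT: "emeasure lborel T < \<infinity>" using f A by simp
  have "(LBINT x. norm (indicator A x - indicator T x :: complex)) = (LBINT x. indicator (T - A) x)"
    using T(2) by (intro Bochner_Integration.integral_cong) (auto split: split_indicator)
  also have "\<dots> < e"
    using em f \<open>e > 0\<close> by (simp add: emeasure_eq_ennreal_measure ennreal_less_iff)
  finally show "\<exists>g'. integrable lborel g' \<and> L1_trans_cont g' \<and> (LBINT x. norm (indicator A x - g' x)) < e"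
    using L1_trans_cont_open[OF T(1) fT] fT
    by (intro exI[of _ "indicator T"]) (auto intro!: ind)
qed

lemma L1_trans_cont_integrable:
  fixes g :: "'a::euclidean_space \<Rightarrow> complex"
  assumes "integrable lborel g"
  shows "L1_trans_cont g"
  using assms
proof (induct rule: integrable_induct)
  case (base A c)
  show ?case unfolding L1_trans_cont_def
  proof (intro allI impI)
    fix s :: "nat \<Rightarrow> 'a" assume s: "s \<longlonglongrightarrow> 0"
    have "L1_trans_cont (indicator A)" using base by (intro L1_trans_cont_indicator) auto
    then have "(\<lambda>n. (LBINT x. norm (indicator A (x - s n) - indicator A x :: complex)) * norm c) \<longlonglongrightarrow> 0 * norm c"
      using s unfolding L1_trans_cont_def by (intro tendsto_intros) auto
    moreover have "norm (indicator A (x - t) *\<^sub>R c - indicator A x *\<^sub>R c) = norm (indicator A (x - t) - indicator A x :: complex) * norm c" for x t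
      by (auto split: split_indicator)
    ultimately show "(\<lambda>n. LBINT x. norm (indicator A (x - s n) *\<^sub>R c - indicator A x *\<^sub>R c)) \<longlonglongrightarrow> 0"
      by simp
  qed
next
  case (add f g)
  show ?case unfolding L1_trans_cont_def
  proof (intro allI impI)
    fix s :: "nat \<Rightarrow> 'a" assume s: "s \<longlonglongrightarrow> 0"
    have 1: "(\<lambda>n. (LBINT x. norm (f (x - s n) - f x)) + (LBINT x. norm (g (x - s n) - g x))) \<longlonglongrightarrow> 0 + 0"
      using add s unfolding L1_trans_cont_def by (intro tendsto_add) auto
    show "(\<lambda>n. LBINT x. norm (f (x - s n) + g (x - s n) - (f x + g x))) \<longlonglongrightarrow> 0"
    proof (rule tendsto_sandwich[OF _ _ tendsto_const 1[simplified]])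
      show "\<forall>\<^sub>F n in sequentially. (LBINT x. norm (f (x - s n) + g (x - s n) - (f x + g x))) \<le> (LBINT x. norm (f (x - s n) - f x)) + (LBINT x. norm (g (x - s n) - g x))"
      proof (intro always_eventually allI)
        fix n
        note i = integrable_lborel_translate_minus[OF add(1), of "s n"] integrable_lborel_translate_minus[OF add(3), of "s n"]
        have "(LBINT x. norm (f (x - s n) + g (x - s n) - (f x + g x))) \<le> (LBINT x. norm (f (x - s n) - f x) + norm (g (x - s n) - g x))"
          using i add by (intro integral_mono) (auto simp: norm_diff_triangle_ineq)
        then show "(LBINT x. norm (f (x - s n) + g (x - s n) - (f x + g x))) \<le> (LBINT x. norm (f (x - s n) - f x)) + (LBINT x. norm (g (x - s n) - g x))"
          using i add by simp
      qed
    qed auto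
  qed
next
  case (lim f s)
  show ?case
  proof (rule L1_trans_cont_closure)
    fix e :: real assume "e > 0"
    have "(\<lambda>i. LBINT x. norm (f x - s i x)) \<longlonglongrightarrow> (\<integral>x. 0 \<partial>(lborel :: 'a measure))"
    \<comment> \<open>The approximants in this induction principle are bounded by
      \<open>2 * norm (f x)\<close>, hence the factor 3.\<close>
    proof (rule integral_dominated_convergence[where w = "\<lambda>x. 3 * norm (f x)"])
      show "AE x in lborel. (\<lambda>i. norm (f x - s i x)) \<longlonglongrightarrow> 0"
      proof (rule AE_I2)
        fix x :: 'a
        have "(\<lambda>i. s i x) \<longlonglongrightarrow> f x" using lim by auto
        then have "(\<lambda>i. norm (f x - s i x)) \<longlonglongrightarrow> norm (f x - f x)" by (intro tendsto_intros)
        then show "(\<lambda>i. norm (f x - s i x)) \<longlonglongrightarrow> 0" by simp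
      qed
      show "AE x in lborel. norm (norm (f x - s i x)) \<le> 3 * norm (f x)" for i
      proof (rule AE_I2)
        fix x :: 'a
        have "norm (s i x) \<le> 2 * norm (f x)" using lim by auto
        then show "norm (norm (f x - s i x)) \<le> 3 * norm (f x)"
          using norm_triangle_ineq4[of "f x" "s i x"] by simp
      qed
    qed (use lim in auto)
    then have "\<forall>\<^sub>F i in sequentially. (LBINT x. norm (f x - s i x)) < e"
      using \<open>e > 0\<close> by (intro order_tendstoD(2)) auto
    then obtain i where "(LBINT x. norm (f x - s i x)) < e"
      by (meson eventually_happens trivial_limit_sequentially)
    then show "\<exists>g'. integrable lborel g' \<and> L1_trans_cont g' \<and> (LBINT x. norm (f x - g' x)) < e"
      using lim by blast
  qed (use lim in auto)
qed

theorem tendsto_L1_translation: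
  fixes g :: "'a::euclidean_space \<Rightarrow> complex"
  assumes "integrable lborel g" and "s \<longlonglongrightarrow> 0"
  shows "(\<lambda>n. LBINT x. norm (g (x - s n) - g x)) \<longlonglongrightarrow> 0"
  using L1_trans_cont_integrable[OF assms(1)] assms(2) unfolding L1_trans_cont_def by blast

subsection \<open>Gaussians\<close>

text \<open>The centred normal density with standard deviation \<open>r\<close> in every coordinate.
  Its total mass is 1, so integration against it is an average.\<close>

definition gauss :: "real \<Rightarrow> 'a::euclidean_space \<Rightarrow> real" where
  "gauss r z = (1 / (sqrt (2 * pi) * r)) ^ DIM('a) * exp (- (norm z)\<^sup>2 / (2 * r\<^sup>2))"

lemma gauss_nonneg: "r > 0 \<Longrightarrow> 0 \<le> gauss r z"
  by (simp add: gauss_def)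

lemma measurable_gauss [measurable]: "gauss r \<in> borel_measurable borel"
  unfolding gauss_def [abs_def] by measurable

lemma gauss_minus: "gauss r (- z) = gauss r z"
  by (simp add: gauss_def)

text \<open>Lebesgue measure is the image of the product measure on coordinate functions, which
  reduces the claim to the product formula for one-dimensional integrals.\<close>

lemma integral_lborel_prod:
  fixes f :: "'a::euclidean_space \<Rightarrow> real \<Rightarrow> 'b::{real_normed_field, banach, second_countable_topology}"
  assumes "\<And>b. b \<in> Basis \<Longrightarrow> integrable lborel (f b)"
  shows "(LBINT x. (\<Prod>b\<in>Basis. f b (x \<bullet> b))) = (\<Prod>b\<in>Basis. LBINT x. f b x)"
    and "integrable lborel (\<lambda>x. \<Prod>b\<in>Basis. f b (x \<bullet> b))"
proof -
  interpret product_sigma_finite "\<lambda>_ :: 'a. lborel :: real measure"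
    by standard
  have m: "f b \<in> borel_measurable borel" if "b \<in> Basis" for b
    using assms[OF that] by auto
  have [measurable]: "(\<lambda>x. f b (x \<bullet> b)) \<in> borel_measurable borel" if "b \<in> Basis" for b
    using measurable_compose[OF _ m[OF that], of "\<lambda>x. x \<bullet> b" borel] by simp
  have m2: "(\<lambda>x :: 'a. \<Prod>b\<in>Basis. f b (x \<bullet> b)) \<in> borel_measurable borel"
    by (intro borel_measurable_prod) simp
  have T: "(\<lambda>g. \<Sum>b\<in>Basis. g b *\<^sub>R b) \<in> Pi\<^sub>M Basis (\<lambda>_. lborel) \<rightarrow>\<^sub>M (borel :: 'a measure)"
    by measurable
  have eq: "f b ((\<Sum>c\<in>Basis. g c *\<^sub>R c) \<bullet> b) = f b (g b)" if "b \<in> Basis" for g and b :: 'a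
    using that by (simp add: inner_sum_left inner_Basis if_distrib cong: if_cong)
  show "(LBINT x. (\<Prod>b\<in>Basis. f b (x \<bullet> b))) = (\<Prod>b\<in>Basis. LBINT x. f b x)"
    by (subst lborel_eq, subst integral_distr[OF T m2])
      (simp add: eq product_integral_prod assms cong: prod.cong)
  show "integrable lborel (\<lambda>x. \<Prod>b\<in>Basis. f b (x \<bullet> b))"
    by (subst lborel_eq, subst integrable_distr_eq[OF T m2])
      (simp add: eq product_integrable_prod assms cong: prod.cong)
qed

lemma prod_cis: "finite A \<Longrightarrow> (\<Prod>b\<in>A. cis (f b)) = cis (\<Sum>b\<in>A. f b)"
  by (induct A rule: finite_induct) (auto simp: cis_mult)

lemma gauss1_prod: "gauss 1 z = (\<Prod>b\<in>Basis. std_normal_density (z \<bullet> b))"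
proof -
  have "(\<Prod>b\<in>Basis. std_normal_density (z \<bullet> b)) = (\<Prod>b\<in>(Basis::'a set). 1 / sqrt (2 * pi)) * (\<Prod>b\<in>Basis. exp (- (z \<bullet> b)\<^sup>2 / 2))"
    unfolding std_normal_density_def by (simp only: prod.distrib)
  also have "(\<Prod>b\<in>Basis. exp (- (z \<bullet> b)\<^sup>2 / 2)) = exp (\<Sum>b\<in>Basis. - (z \<bullet> b)\<^sup>2 / 2)"
    by (simp add: exp_sum)
  also have "(\<Sum>b\<in>Basis. - (z \<bullet> b)\<^sup>2 / 2) = - (norm z)\<^sup>2 / 2"
  proof -
    have "(norm z)\<^sup>2 = (\<Sum>b\<in>Basis. (z \<bullet> b)\<^sup>2)"
      by (subst norm_eq_sqrt_inner, subst euclidean_inner) (simp add: power2_eq_square sum_nonneg)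
    then show ?thesis by (simp add: sum_negf sum_divide_distrib)
  qed
  finally show ?thesis by (simp add: gauss_def)
qed

lemma borel_measurable_cis [measurable]:
  "f \<in> borel_measurable M \<Longrightarrow> (\<lambda>x. cis (f x)) \<in> borel_measurable M"
  by (rule measurable_compose[where g = cis]) (auto intro!: borel_measurable_continuous_onI continuous_intros)

lemma integral_std_normal_cis:
  "(LBINT x. complex_of_real (std_normal_density x) * cis (t * x)) = complex_of_real (exp (- t\<^sup>2 / 2))"
  "integrable lborel (\<lambda>x. complex_of_real (std_normal_density x) * cis (t * x))"
proof -
  have i: "integrable lborel std_normal_density"
    using integrable_normal_density[of 1 0] by simp
  show "integrable lborel (\<lambda>x. complex_of_real (std_normal_density x) * cis (t * x))"
    by (rule Bochner_Integration.integrable_bound[OF i])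
      (auto simp: norm_mult)
  have "char std_normal_distribution t = (LBINT x. std_normal_density x *\<^sub>R iexp (t * x))"
    unfolding char_def by (subst integral_density) auto
  then show "(LBINT x. complex_of_real (std_normal_density x) * cis (t * x)) = complex_of_real (exp (- t\<^sup>2 / 2))"
    by (simp add: char_std_normal_distribution cis_conv_exp scaleR_conv_of_real)
qed

text \<open>The integrand factorizes over coordinates, and each factor is the characteristic
  function of the standard normal distribution.\<close>

lemma gauss1_cis:
  fixes \<xi> :: "'a::euclidean_space"
  shows "(LBINT z. complex_of_real (gauss 1 z) * cis (z \<bullet> \<xi>)) = complex_of_real (exp (- (norm \<xi>)\<^sup>2 / 2))"
    and "integrable lborel (\<lambda>z. complex_of_real (gauss 1 z) * cis (z \<bullet> \<xi>))"
proof -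
  define f where "f b x = complex_of_real (std_normal_density x) * cis ((\<xi> \<bullet> b) * x)" for b x
  have eq: "complex_of_real (gauss 1 z) * cis (z \<bullet> \<xi>) = (\<Prod>b\<in>Basis. f b (z \<bullet> b))" for z
  proof -
    have "cis (z \<bullet> \<xi>) = (\<Prod>b\<in>Basis. cis ((\<xi> \<bullet> b) * (z \<bullet> b)))"
      by (subst prod_cis) (simp_all add: euclidean_inner[of z \<xi>] mult.commute)
    then show ?thesis by (simp add: gauss1_prod f_def prod.distrib)
  qed
  have i: "integrable lborel (f b)" for b unfolding f_def by (rule integral_std_normal_cis)
  show "integrable lborel (\<lambda>z. complex_of_real (gauss 1 z) * cis (z \<bullet> \<xi>))"
    unfolding eq by (rule integral_lborel_prod(2)) (rule i)
  have "(LBINT z. complex_of_real (gauss 1 z) * cis (z \<bullet> \<xi>)) = (\<Prod>b\<in>Basis. LBINT x. f b x)"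
    unfolding eq by (rule integral_lborel_prod(1)) (rule i)
  also have "\<dots> = (\<Prod>b\<in>Basis. complex_of_real (exp (- (\<xi> \<bullet> b)\<^sup>2 / 2)))"
    by (simp add: f_def integral_std_normal_cis)
  also have "\<dots> = complex_of_real (exp (\<Sum>b\<in>Basis. - (\<xi> \<bullet> b)\<^sup>2 / 2))"
    by (simp add: exp_sum)
  also have "(\<Sum>b\<in>Basis. - (\<xi> \<bullet> b)\<^sup>2 / 2) = - (norm \<xi>)\<^sup>2 / 2"
  proof -
    have "(norm \<xi>)\<^sup>2 = (\<Sum>b\<in>Basis. (\<xi> \<bullet> b)\<^sup>2)"
      by (subst norm_eq_sqrt_inner, subst euclidean_inner) (simp add: power2_eq_square sum_nonneg)
    then show ?thesis by (simp add: sum_negf sum_divide_distrib)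
  qed
  finally show "(LBINT z. complex_of_real (gauss 1 z) * cis (z \<bullet> \<xi>)) = complex_of_real (exp (- (norm \<xi>)\<^sup>2 / 2))" .
qed

lemma gauss_scale:
  fixes z :: "'a::euclidean_space"
  assumes "r > 0" shows "r ^ DIM('a) * gauss r (r *\<^sub>R z) = gauss 1 z"
  using assms by (simp add: gauss_def power_mult_distrib power_divide)

lemma integral_gauss_mult:
  fixes f :: "'a::euclidean_space \<Rightarrow> complex"
  assumes "r > 0" and [measurable]: "f \<in> borel_measurable borel"
  shows "(LBINT z. complex_of_real (gauss r z) * f z) = (LBINT z. complex_of_real (gauss 1 z) * f (r *\<^sub>R z))"
proof -
  have "(LBINT z. complex_of_real (gauss r z) * f z) = r ^ DIM('a) *\<^sub>R (LBINT z. complex_of_real (gauss r (r *\<^sub>R z)) * f (r *\<^sub>R z))"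
    using assms by (subst integral_lborel_scale[of _ r]) auto
  also have "\<dots> = (LBINT z. complex_of_real (r ^ DIM('a)) * (complex_of_real (gauss r (r *\<^sub>R z)) * f (r *\<^sub>R z)))"
    by (simp add: scaleR_conv_of_real)
  also have "\<dots> = (LBINT z. complex_of_real (gauss 1 z) * f (r *\<^sub>R z))"
    using gauss_scale[OF assms(1), where 'a='a]
    by (simp add: mult.assoc[symmetric] flip: of_real_mult of_real_power)
  finally show ?thesis .
qed

lemma gauss_cis:
  fixes \<xi> :: "'a::euclidean_space"
  assumes "r > 0"
  shows "(LBINT z. complex_of_real (gauss r z) * cis (z \<bullet> \<xi>)) = complex_of_real (exp (- r\<^sup>2 * (norm \<xi>)\<^sup>2 / 2))"
proof -
  have "(LBINT z. complex_of_real (gauss r z) * cis (z \<bullet> \<xi>)) = (LBINT z. complex_of_real (gauss 1 z) * cis (z \<bullet> (r *\<^sub>R \<xi>)))"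
    using assms by (subst integral_gauss_mult) auto
  then show ?thesis using gauss1_cis(1)[of "r *\<^sub>R \<xi>"] by (simp add: power_mult_distrib)
qed

lemma integral_gauss:
  assumes "r > 0"
  shows "integrable lborel (gauss r :: 'a::euclidean_space \<Rightarrow> real)"
    and "(LBINT z. gauss r (z :: 'a)) = 1"
proof -
  have 1: "integrable lborel (\<lambda>z::'a. complex_of_real (gauss 1 z))"
    using gauss1_cis(2)[of "0 :: 'a"] by simp
  have "integrable lborel (\<lambda>z::'a. gauss 1 ((1/r) *\<^sub>R z))"
    using 1 assms integrable_lborel_scale[of "gauss 1 :: 'a \<Rightarrow> real" "1/r"] by (simp add: complex_of_real_integrable_eq)
  moreover have "gauss r z = (1/r) ^ DIM('a) * gauss 1 ((1/r) *\<^sub>R z)" for z :: 'a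
    using gauss_scale[OF assms, of "(1/r) *\<^sub>R z"] assms by (simp add: field_simps)
  then have "gauss r = (\<lambda>z :: 'a. (1/r) ^ DIM('a) * gauss 1 ((1/r) *\<^sub>R z))" by (rule ext)
  ultimately show i: "integrable lborel (gauss r :: 'a \<Rightarrow> real)"
    by simp
  have "complex_of_real (LBINT z. gauss r (z :: 'a)) = 1"
    using gauss_cis[OF assms, of "0 :: 'a"] by (simp add: integral_of_real)
  then show "(LBINT z. gauss r (z :: 'a)) = 1"
    by (metis of_real_eq_1_iff)
qed

text \<open>Fourier inversion for Gaussians: up to a constant the weight is
  \<open>gauss (1/r)\<close>, so the transform already computed applies with the reciprocal
  width.\<close>

lemma integral_exp_cis:
  fixes z :: "'a::euclidean_space"
  assumes "r > 0"
  shows "(LBINT \<eta>. complex_of_real (exp (- r\<^sup>2 * (norm \<eta>)\<^sup>2 / 2)) * cis (\<eta> \<bullet> z)) = complex_of_real ((2 * pi) ^ DIM('a) * gauss r z)"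
proof -
  have e: "exp (- r\<^sup>2 * (norm \<eta>)\<^sup>2 / 2) = (sqrt (2 * pi) / r) ^ DIM('a) * gauss (1/r) \<eta>" for \<eta> :: 'a
    using assms by (simp add: gauss_def power_divide power_mult_distrib field_simps)
  have "(LBINT \<eta>. complex_of_real (exp (- r\<^sup>2 * (norm \<eta>)\<^sup>2 / 2)) * cis (\<eta> \<bullet> z))
    = (LBINT \<eta>. complex_of_real ((sqrt (2 * pi) / r) ^ DIM('a)) * (complex_of_real (gauss (1/r) \<eta>) * cis (\<eta> \<bullet> z)))"
    unfolding e by (simp add: mult.assoc)
  also have "\<dots> = complex_of_real ((sqrt (2 * pi) / r) ^ DIM('a)) * complex_of_real (exp (- (1/r)\<^sup>2 * (norm z)\<^sup>2 / 2))"
    using assms by (subst integral_mult_right_zero, subst gauss_cis) auto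
  also have "\<dots> = complex_of_real ((sqrt (2 * pi) / r) ^ DIM('a) * exp (- (1/r)\<^sup>2 * (norm z)\<^sup>2 / 2))"
    by simp
  also have "(sqrt (2 * pi) / r) ^ DIM('a) * exp (- (1/r)\<^sup>2 * (norm z)\<^sup>2 / 2) = (2 * pi) ^ DIM('a) * gauss r z"
  proof -
    have "sqrt (2 * pi) / r = (2 * pi) * (1 / (sqrt (2 * pi) * r))"
      by (simp add: real_div_sqrt divide_simps)
    then have "(sqrt (2 * pi) / r) ^ DIM('a) = (2 * pi) ^ DIM('a) * (1 / (sqrt (2 * pi) * r)) ^ DIM('a)"
      by (metis power_mult_distrib)
    then show ?thesis by (simp add: gauss_def power_divide)
  qed
  finally show ?thesis .
qed

text \<open>After rescaling to unit width the evaluation points \<open>s n *\<^sub>R z\<close> tend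
  to 0 for every fixed \<open>z\<close>, and boundedness of \<open>f\<close> dominates the
  integrand.\<close>

lemma tendsto_gauss_convolution:
  fixes f :: "'a::euclidean_space \<Rightarrow> complex"
  assumes [measurable]: "f \<in> borel_measurable borel" and b: "\<And>x. norm (f x) \<le> B"
    and s: "s \<longlonglongrightarrow> 0" "\<And>n. s n > 0"
    and f: "\<And>z. z \<longlonglongrightarrow> 0 \<Longrightarrow> (\<lambda>n. f (z n)) \<longlonglongrightarrow> L"
  shows "(\<lambda>n. LBINT z. complex_of_real (gauss (s n) z) * f z) \<longlonglongrightarrow> L"
proof -
  have "(\<lambda>n. LBINT z. complex_of_real (gauss 1 z) * f (s n *\<^sub>R z)) \<longlonglongrightarrow> (LBINT z. complex_of_real (gauss 1 (z::'a)) * L)"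
  proof (rule integral_dominated_convergence[where w = "\<lambda>z. gauss 1 z * B"])
    show "integrable lborel (\<lambda>z::'a. gauss 1 z * B)" by (simp add: integral_gauss)
    show "AE z in lborel. (\<lambda>n. complex_of_real (gauss 1 z) * f (s n *\<^sub>R z)) \<longlonglongrightarrow> complex_of_real (gauss 1 z) * L"
    proof (rule AE_I2)
      fix z :: 'a
      have "(\<lambda>n. s n *\<^sub>R z) \<longlonglongrightarrow> 0 *\<^sub>R z" by (intro tendsto_intros s)
      then show "(\<lambda>n. complex_of_real (gauss 1 z) * f (s n *\<^sub>R z)) \<longlonglongrightarrow> complex_of_real (gauss 1 z) * L"
        by (intro tendsto_intros f) simp
    qed
    show "AE z in lborel. norm (complex_of_real (gauss 1 z) * f (s n *\<^sub>R z)) \<le> gauss 1 z * B" for n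
      by (auto simp: norm_mult gauss_nonneg intro!: mult_left_mono b)
  qed measurable
  also have "(LBINT z. complex_of_real (gauss 1 (z::'a)) * L) = L"
    using integral_gauss(2)[of 1, where 'a='a] by (simp add: integral_of_real)
  finally show ?thesis using integral_gauss_mult[OF s(2), of f] by simp
qed


subsection \<open>Density of trigonometric polynomials in L2\<close>

text \<open>The frequencies \<open>a i\<close> are arbitrary vectors, not lattice points. The class
  is an algebra, and since periods may grow without bound it can approximate sets in a noncompact
  space.\<close>

definition trig_poly :: "('a::euclidean_space \<Rightarrow> complex) \<Rightarrow> bool" where
  "trig_poly g \<longleftrightarrow> (\<exists>n::nat. \<exists>c a. \<forall>x. g x = (\<Sum>i<n. c i * cis (a i \<bullet> x)))"

lemma trig_polyE:
  assumes "trig_poly g"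
  obtains n :: nat and c a where "g = (\<lambda>x. \<Sum>i<n. c i * cis (a i \<bullet> x))"
proof -
  obtain n :: nat and c a where "\<forall>x. g x = (\<Sum>i<n. c i * cis (a i \<bullet> x))"
    using assms unfolding trig_poly_def by blast
  then have "g = (\<lambda>x. \<Sum>i<n. c i * cis (a i \<bullet> x))" by blast
  then show thesis by (rule that)
qed

lemma trig_poly_single: "trig_poly (\<lambda>x. c * cis (a \<bullet> x))"
  unfolding trig_poly_def by (intro exI[of _ 1] exI[of _ "\<lambda>_. c"] exI[of _ "\<lambda>_. a"]) simp

lemma trig_poly_const: "trig_poly (\<lambda>x. c)"
  using trig_poly_single[of c 0] by simp

lemma trig_poly_add:
  assumes "trig_poly f" "trig_poly g" shows "trig_poly (\<lambda>x. f x + g x)"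
proof -
  obtain n :: nat and c a where "\<forall>x. f x = (\<Sum>i<n. c i * cis (a i \<bullet> x))"
    using assms(1) unfolding trig_poly_def by blast
  then have f: "f x = (\<Sum>i<n. c i * cis (a i \<bullet> x))" for x by blast
  obtain m :: nat and c' a' where "\<forall>x. g x = (\<Sum>i<m. c' i * cis (a' i \<bullet> x))"
    using assms(2) unfolding trig_poly_def by blast
  then have g: "g x = (\<Sum>i<m. c' i * cis (a' i \<bullet> x))" for x by blast
  have "f x + g x = (\<Sum>i<n+m. (if i < n then c i else c' (i - n)) * cis ((if i < n then a i else a' (i - n)) \<bullet> x))" for x
  proof -
    have "(\<Sum>i<n+m. (if i < n then c i else c' (i - n)) * cis ((if i < n then a i else a' (i - n)) \<bullet> x))
      = (\<Sum>i<n. c i * cis (a i \<bullet> x)) + (\<Sum>i<m. c' i * cis (a' i \<bullet> x))"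
      by (induct m) auto
    then show ?thesis by (simp only: f g)
  qed
  then show ?thesis unfolding trig_poly_def by (intro exI allI)
qed

lemma trig_poly_sum:
  "finite I \<Longrightarrow> (\<And>i. i \<in> I \<Longrightarrow> trig_poly (f i)) \<Longrightarrow> trig_poly (\<lambda>x. \<Sum>i\<in>I. f i x)"
  by (induct I rule: finite_induct) (auto intro: trig_poly_add trig_poly_const)

lemma trig_poly_mult:
  assumes "trig_poly f" "trig_poly g" shows "trig_poly (\<lambda>x. f x * g x)"
proof -
  obtain n :: nat and c a where "\<forall>x. f x = (\<Sum>i<n. c i * cis (a i \<bullet> x))"
    using assms(1) unfolding trig_poly_def by blast
  then have f: "f x = (\<Sum>i<n. c i * cis (a i \<bullet> x))" for x by blast
  obtain m :: nat and c' a' where "\<forall>x. g x = (\<Sum>i<m. c' i * cis (a' i \<bullet> x))"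
    using assms(2) unfolding trig_poly_def by blast
  then have g: "g x = (\<Sum>i<m. c' i * cis (a' i \<bullet> x))" for x by blast
  have "f x * g x = (\<Sum>i<n. \<Sum>j<m. (c i * c' j) * cis ((a i + a' j) \<bullet> x))" for x
    unfolding f g sum_product by (simp add: inner_add_left cis_mult[symmetric] mult_ac)
  then have "(\<lambda>x. f x * g x) = (\<lambda>x. \<Sum>i<n. \<Sum>j<m. (c i * c' j) * cis ((a i + a' j) \<bullet> x))" by (rule ext)
  then show ?thesis by (simp only:) (intro trig_poly_sum trig_poly_single; simp)
qed

lemma trig_poly_prod:
  "finite I \<Longrightarrow> (\<And>i. i \<in> I \<Longrightarrow> trig_poly (f i)) \<Longrightarrow> trig_poly (\<lambda>x. \<Prod>i\<in>I. f i x)"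
  by (induct I rule: finite_induct) (auto intro: trig_poly_mult trig_poly_const)

lemma trig_poly_measurable: "trig_poly g \<Longrightarrow> g \<in> borel_measurable borel"
  by (erule trig_polyE) simp

lemma trig_poly_sin: "trig_poly (\<lambda>x. complex_of_real (sin (a \<bullet> x + s)))"
proof -
  have *: "- \<i> / 2 * cis t + \<i> / 2 * cis (- t) = complex_of_real (sin t)" for t
    by (simp add: complex_eq_iff)
  have "complex_of_real (sin (a \<bullet> x + s)) = (- \<i> / 2 * cis s) * cis (a \<bullet> x) + (\<i> / 2 * cis (- s)) * cis ((- a) \<bullet> x)" for x
  proof -
    have "(- \<i> / 2 * cis s) * cis (a \<bullet> x) + (\<i> / 2 * cis (- s)) * cis ((- a) \<bullet> x) = - \<i> / 2 * cis (a \<bullet> x + s) + \<i> / 2 * cis (- (a \<bullet> x + s))"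
      by (simp add: mult.assoc cis_mult add.commute)
    also have "\<dots> = complex_of_real (sin (a \<bullet> x + s))"
      using *[of "a \<bullet> x + s"] by simp
    finally show ?thesis ..
  qed
  then have "(\<lambda>x. complex_of_real (sin (a \<bullet> x + s))) = (\<lambda>x. (- \<i> / 2 * cis s) * cis (a \<bullet> x) + (\<i> / 2 * cis (- s)) * cis ((- a) \<bullet> x))" by (rule ext)
  then show ?thesis by (simp only:) (intro trig_poly_add trig_poly_single)
qed

lemma trig_poly_real_polynomial:
  fixes p :: "real \<Rightarrow> real"
  assumes "real_polynomial_function p" and "trig_poly (\<lambda>x. complex_of_real (g x))"
  shows "trig_poly (\<lambda>x. complex_of_real (p (g x)))"
  using assms(1)
proof induct
  case (linear f)
  then have "f y = y * f 1" for y
    using bounded_linear.linear linear_cmul[of f y 1] by (simp add: bounded_linear.linear linear_cmul)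
  then have "(\<lambda>x. complex_of_real (f (g x))) = (\<lambda>x. complex_of_real (g x) * complex_of_real (f 1))"
    by (metis of_real_mult)
  then show ?case using assms(2) by (simp add: trig_poly_mult trig_poly_const)
qed (auto intro: trig_poly_add trig_poly_mult trig_poly_const)

definition clamp01 :: "real \<Rightarrow> real" where
  "clamp01 y = max 0 (min 1 y)"

text \<open>A function of \<open>sin (r / (n + 1))\<close> has a period growing with
  \<open>n\<close>, so every fixed \<open>r\<close> eventually satisfies
  \<open>\<bar>r\<bar> / (n + 1) < pi\<close>, where the sine has the sign of \<open>r\<close>. A
  Weierstrass approximation of a steep ramp detects this sign.\<close>

lemma half_line_approx:
  obtains q :: "nat \<Rightarrow> real \<Rightarrow> real"
  where "\<And>n. real_polynomial_function (q n)"
    and "\<And>n y. \<bar>q n (sin y)\<bar> \<le> 2"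
    and "\<And>r. (\<lambda>n. q n (sin (r / real (Suc n)))) \<longlonglongrightarrow> indicator {0<..} r"
proof -
  \<comment> \<open>One factor \<open>Suc n\<close> undoes the scaling of the argument of the sine;
    the other drives positive values past 1, where the ramp saturates.\<close>
  let ?F = "\<lambda>n y. clamp01 (real (Suc n) ^ 2 * y)"
  have "\<exists>g. real_polynomial_function g \<and> (\<forall>x\<in>{-1..1::real}. \<bar>?F n x - g x\<bar> < 1 / real (Suc n))" for n
    by (rule Stone_Weierstrass_real_polynomial_function[of "{-1..1}" "?F n" "1 / real (Suc n)"])
      (auto simp: clamp01_def intro!: continuous_intros)
  then obtain q where q: "\<And>n. real_polynomial_function (q n)"
    and q2: "\<And>n x. x \<in> {-1..1} \<Longrightarrow> \<bar>?F n x - q n x\<bar> < 1 / real (Suc n)"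
    by metis
  have F: "0 \<le> ?F n y" "?F n y \<le> 1" for n y by (auto simp: clamp01_def)
  show ?thesis
  proof
    show "real_polynomial_function (q n)" for n by (rule q)
    show "\<bar>q n (sin y)\<bar> \<le> 2" for n y
    proof -
      have "1 / real (Suc n) \<le> 1" by simp
      moreover have "\<bar>?F n (sin y) - q n (sin y)\<bar> < 1 / real (Suc n)" by (rule q2) auto
      ultimately show ?thesis using F[of n "sin y"] by linarith
    qed
    fix r :: real
    have 1: "(\<lambda>n. ?F n (sin (r / real (Suc n))) - q n (sin (r / real (Suc n)))) \<longlonglongrightarrow> 0"
    proof (rule Lim_null_comparison)
      show "\<forall>\<^sub>F n in sequentially. norm (?F n (sin (r / real (Suc n))) - q n (sin (r / real (Suc n)))) \<le> 1 / real (Suc n)"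
        using q2 by (intro always_eventually allI) (auto intro!: less_imp_le)
      show "(\<lambda>n. 1 / real (Suc n)) \<longlonglongrightarrow> 0" by real_asymp
    qed
    have 2: "(\<lambda>n. ?F n (sin (r / real (Suc n)))) \<longlonglongrightarrow> indicator {0<..} r"
    proof (cases "r > 0")
      case True
      have "filterlim (\<lambda>n. real (Suc n) ^ 2 * sin (r / real (Suc n))) at_top sequentially"
        using True by real_asymp
      then have "\<forall>\<^sub>F n in sequentially. 1 \<le> real (Suc n) ^ 2 * sin (r / real (Suc n))"
        by (simp add: filterlim_at_top)
      then have "\<forall>\<^sub>F n in sequentially. ?F n (sin (r / real (Suc n))) = indicator {0<..} r"
        by eventually_elim (use True in \<open>auto simp: clamp01_def\<close>)
      then show ?thesis by (rule tendsto_eventually)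
    next
      case False
      have "(\<lambda>n. r / real (Suc n)) \<longlonglongrightarrow> 0" by real_asymp
      then have "\<forall>\<^sub>F n in sequentially. - pi < r / real (Suc n)"
        by (rule order_tendstoD) simp
      then have "\<forall>\<^sub>F n in sequentially. ?F n (sin (r / real (Suc n))) = indicator {0<..} r"
      proof eventually_elim
        case (elim n)
        have "0 \<le> sin (- (r / real (Suc n)))"
          by (rule sin_ge_zero) (use elim False in \<open>auto simp: divide_nonpos_pos\<close>)
        then have "real (Suc n) ^ 2 * sin (r / real (Suc n)) \<le> 0"
          by (intro mult_nonneg_nonpos) auto
        then show ?case using False by (auto simp: clamp01_def)
      qed
      then show ?thesis by (rule tendsto_eventually)
    qed
    from tendsto_diff[OF 2 1] show "(\<lambda>n. q n (sin (r / real (Suc n)))) \<longlonglongrightarrow> indicator {0<..} r"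
      by simp
  qed
qed

text \<open>A box is an intersection of half-spaces, two per coordinate. Each of the two factors is
  bounded by 2, whence the constant \<open>4 ^ DIM('a)\<close>.\<close>

lemma box_trig_approx:
  fixes a b :: "'a::euclidean_space"
  obtains P where "\<And>n. trig_poly (P n)" "\<And>n x. norm (P n x) \<le> 4 ^ DIM('a)"
    "\<And>x. (\<lambda>n. P n x) \<longlonglongrightarrow> indicator (box a b) x"
proof -
  obtain q :: "nat \<Rightarrow> real \<Rightarrow> real" where q: "\<And>n. real_polynomial_function (q n)"
    "\<And>n y. \<bar>q n (sin y)\<bar> \<le> 2"
    "\<And>r. (\<lambda>n. q n (sin (r / real (Suc n)))) \<longlonglongrightarrow> indicator {0<..} r"
    by (rule half_line_approx) blast
  define P where "P n x = (\<Prod>i\<in>Basis. complex_of_real (q n (sin ((x \<bullet> i - a \<bullet> i) / real (Suc n))))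
      * complex_of_real (q n (sin ((b \<bullet> i - x \<bullet> i) / real (Suc n)))))" for n and x :: 'a
  show ?thesis
  proof
    show "trig_poly (P n)" for n
    proof -
      have s: "trig_poly (\<lambda>x::'a. complex_of_real (q n (sin (c \<bullet> x + s))))" for c s
        by (rule trig_poly_real_polynomial[OF q(1) trig_poly_sin])
      have e: "sin ((x \<bullet> i - a \<bullet> i) / real (Suc n)) = sin (((1 / real (Suc n)) *\<^sub>R i) \<bullet> x + (- (a \<bullet> i) / real (Suc n)))"
        "sin ((b \<bullet> i - x \<bullet> i) / real (Suc n)) = sin ((- (1 / real (Suc n)) *\<^sub>R i) \<bullet> x + ((b \<bullet> i) / real (Suc n)))" for x i
        by (simp_all add: diff_divide_distrib inner_commute)
      show ?thesis unfolding P_def [abs_def] e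
        by (intro trig_poly_prod trig_poly_mult s) auto
    qed
    show "norm (P n x) \<le> 4 ^ DIM('a)" for n x
    proof -
      have "norm (P n x) = (\<Prod>i\<in>Basis. \<bar>q n (sin ((x \<bullet> i - a \<bullet> i) / real (Suc n)))\<bar>
        * \<bar>q n (sin ((b \<bullet> i - x \<bullet> i) / real (Suc n)))\<bar>)"
        by (simp add: P_def prod_norm[symmetric] norm_mult)
      also have "\<dots> \<le> (\<Prod>i\<in>(Basis::'a set). 2 * 2)"
        by (intro prod_mono conjI mult_mono q(2)) auto
      finally show ?thesis by simp
    qed
    fix x :: 'a
    have "(\<lambda>n. P n x) \<longlonglongrightarrow> (\<Prod>i\<in>Basis. complex_of_real (indicator {0<..} (x \<bullet> i - a \<bullet> i)) * complex_of_real (indicator {0<..} (b \<bullet> i - x \<bullet> i)))"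
      unfolding P_def by (intro tendsto_intros q(3))
    also have "(\<Prod>i\<in>Basis. complex_of_real (indicator {0<..} (x \<bullet> i - a \<bullet> i)) * complex_of_real (indicator {0<..} (b \<bullet> i - x \<bullet> i))) = indicator (box a b) x"
    proof (cases "x \<in> box a b")
      case True then show ?thesis by (auto simp: box_def intro!: prod.neutral)
    next
      case False
      then obtain i where "i \<in> Basis" "\<not> (a \<bullet> i < x \<bullet> i \<and> x \<bullet> i < b \<bullet> i)" by (auto simp: box_def)
      then show ?thesis using False by (auto intro!: bexI[of _ i] simp: indicator_def)
    qed
    finally show "(\<lambda>n. P n x) \<longlonglongrightarrow> indicator (box a b) x" .
  qed
qed

text \<open>One polynomial has to serve all measures of the family at once: it will be used for a
  spectral measure together with a translate of it in frequency.\<close>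

definition trig_approx :: "'a::euclidean_space measure set \<Rightarrow> ('a \<Rightarrow> complex) \<Rightarrow> bool" where
  "trig_approx \<M> f \<longleftrightarrow>
    (\<forall>e>0. \<exists>g. trig_poly g \<and> (\<forall>M\<in>\<M>. (\<integral>\<^sup>+x. ennreal ((norm (f x - g x))\<^sup>2) \<partial>M) < ennreal e))"

lemma norm_add_sq_le: "(norm (x + y))\<^sup>2 \<le> 2 * (norm x)\<^sup>2 + 2 * (norm (y::'a::real_normed_vector))\<^sup>2"
proof -
  have "(norm (x + y))\<^sup>2 \<le> (norm x + norm y)\<^sup>2" by (intro power_mono norm_triangle_ineq) auto
  also have "\<dots> \<le> 2 * (norm x)\<^sup>2 + 2 * (norm y)\<^sup>2"
    using sum_squares_bound[of "norm x" "norm y"] by (simp add: power2_sum)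
  finally show ?thesis .
qed

lemma nn_integral_norm_add_sq:
  fixes f g :: "'a \<Rightarrow> complex"
  assumes [measurable]: "f \<in> borel_measurable M" "g \<in> borel_measurable M"
    and "(\<integral>\<^sup>+x. ennreal ((norm (f x))\<^sup>2) \<partial>M) < ennreal (e/4)"
    and "(\<integral>\<^sup>+x. ennreal ((norm (g x))\<^sup>2) \<partial>M) < ennreal (e/4)"
  shows "(\<integral>\<^sup>+x. ennreal ((norm (f x + g x))\<^sup>2) \<partial>M) < ennreal e"
proof -
  have e: "e > 0" using assms(3) by (metis ennreal_neg linorder_not_less not_less_zero divide_nonpos_pos zero_less_numeral)
  have "(\<integral>\<^sup>+x. ennreal ((norm (f x + g x))\<^sup>2) \<partial>M) \<le> (\<integral>\<^sup>+x. 2 * ennreal ((norm (f x))\<^sup>2) + 2 * ennreal ((norm (g x))\<^sup>2) \<partial>M)"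
  proof (rule nn_integral_mono)
    fix x
    have "ennreal ((norm (f x + g x))\<^sup>2) \<le> ennreal (2 * (norm (f x))\<^sup>2 + 2 * (norm (g x))\<^sup>2)"
      by (intro ennreal_leI norm_add_sq_le)
    then show "ennreal ((norm (f x + g x))\<^sup>2) \<le> 2 * ennreal ((norm (f x))\<^sup>2) + 2 * ennreal ((norm (g x))\<^sup>2)"
      by (simp add: ennreal_mult)
  qed
  also have "\<dots> = 2 * (\<integral>\<^sup>+x. ennreal ((norm (f x))\<^sup>2) \<partial>M) + 2 * (\<integral>\<^sup>+x. ennreal ((norm (g x))\<^sup>2) \<partial>M)"
    by (simp add: nn_integral_add nn_integral_cmult)
  also have "\<dots> < 2 * ennreal (e/4) + 2 * ennreal (e/4)"
    using assms(3,4) by (intro add_strict_mono ennreal_mult_strict_left_mono) auto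
  also have "\<dots> = ennreal e"
  proof -
    have "2 * ennreal (e/4) = ennreal (e/2)" using e ennreal_mult[of 2 "e/4"] by simp
    then show ?thesis using e by (simp add: ennreal_plus[symmetric] del: ennreal_plus)
  qed
  finally show ?thesis .
qed

lemma trig_approx_closure:
  assumes fin: "\<And>M. M \<in> \<M> \<Longrightarrow> sets M = sets borel"
    and [measurable]: "f \<in> borel_measurable borel"
    and "\<And>e. e > 0 \<Longrightarrow> \<exists>f'. f' \<in> borel_measurable borel \<and> trig_approx \<M> f' \<and> (\<forall>M\<in>\<M>. (\<integral>\<^sup>+x. ennreal ((norm (f x - f' x))\<^sup>2) \<partial>M) < ennreal e)"
  shows "trig_approx \<M> f"
  unfolding trig_approx_def
proof (intro allI impI)
  fix e :: real assume "e > 0"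
  then obtain f' where f' [measurable]: "f' \<in> borel_measurable borel" and f2: "trig_approx \<M> f'"
    "\<And>M. M\<in>\<M> \<Longrightarrow> (\<integral>\<^sup>+x. ennreal ((norm (f x - f' x))\<^sup>2) \<partial>M) < ennreal (e/4)"
    using assms(3)[of "e/4"] by auto
  then obtain g where g: "trig_poly g" "\<And>M. M \<in> \<M> \<Longrightarrow> (\<integral>\<^sup>+x. ennreal ((norm (f' x - g x))\<^sup>2) \<partial>M) < ennreal (e/4)"
    using \<open>e > 0\<close> unfolding trig_approx_def by (meson divide_pos_pos zero_less_numeral)
  have "(\<integral>\<^sup>+x. ennreal ((norm (f x - g x))\<^sup>2) \<partial>M) < ennreal e" if M: "M \<in> \<M>" for M
  proof -
    have [measurable_cong]: "sets M = sets borel" using fin M by auto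
    have [measurable]: "g \<in> borel_measurable borel" by (rule trig_poly_measurable) fact
    have "(\<integral>\<^sup>+x. ennreal ((norm ((f x - f' x) + (f' x - g x)))\<^sup>2) \<partial>M) < ennreal e"
      by (rule nn_integral_norm_add_sq) (use M f2 g in auto)
    then show ?thesis by simp
  qed
  then show "\<exists>g. trig_poly g \<and> (\<forall>M\<in>\<M>. (\<integral>\<^sup>+x. ennreal ((norm (f x - g x))\<^sup>2) \<partial>M) < ennreal e)"
    using g by blast
qed

lemma nn_integral_sq_tendsto_zero:
  fixes f :: "'a \<Rightarrow> complex"
  assumes "finite_measure M" and [measurable]: "f \<in> borel_measurable M" "\<And>n. P n \<in> borel_measurable M"
    and b: "\<And>n x. norm (f x - P n x) \<le> K" and l: "\<And>x. (\<lambda>n. P n x) \<longlonglongrightarrow> f x"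
  shows "(\<lambda>n. \<integral>\<^sup>+x. ennreal ((norm (f x - P n x))\<^sup>2) \<partial>M) \<longlonglongrightarrow> 0"
proof -
  interpret finite_measure M by fact
  have "(\<lambda>n. \<integral>\<^sup>+x. ennreal ((norm (f x - P n x))\<^sup>2) \<partial>M) \<longlonglongrightarrow> (\<integral>\<^sup>+x. 0 \<partial>M)"
  proof (rule nn_integral_dominated_convergence[where w = "\<lambda>_. ennreal (K\<^sup>2)"])
    show "AE x in M. ennreal ((norm (f x - P n x))\<^sup>2) \<le> ennreal (K\<^sup>2)" for n
      using b by (intro AE_I2 ennreal_leI power_mono) auto
    show "(\<integral>\<^sup>+x. ennreal (K\<^sup>2) \<partial>M) < \<infinity>"
      by (simp add: ennreal_mult_less_top emeasure_eq_measure)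
    show "AE x in M. (\<lambda>n. ennreal ((norm (f x - P n x))\<^sup>2)) \<longlonglongrightarrow> 0"
    proof (rule AE_I2)
      fix x
      have "(\<lambda>n. (norm (f x - P n x))\<^sup>2) \<longlonglongrightarrow> (norm (f x - f x))\<^sup>2" by (intro tendsto_intros l)
      then show "(\<lambda>n. ennreal ((norm (f x - P n x))\<^sup>2)) \<longlonglongrightarrow> 0"
        using tendsto_ennrealI by fastforce
    qed
  qed auto
  then show ?thesis by simp
qed

text \<open>A pointwise limit with bounded errors is a limit in L2 of each finite measure, and
  finitely many measures admit a common index.\<close>

lemma trig_approx_limit:
  assumes fin: "finite \<M>" "\<And>M. M \<in> \<M> \<Longrightarrow> finite_measure M \<and> sets M = sets borel"
    and f: "f \<in> borel_measurable borel" and P: "\<And>n. P n \<in> borel_measurable borel" "\<And>n. trig_approx \<M> (P n)"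
    and b: "\<And>n x. norm (f x - P n x) \<le> K" and l: "\<And>x. (\<lambda>n. P n x) \<longlonglongrightarrow> f x"
  shows "trig_approx \<M> f"
proof (rule trig_approx_closure)
  fix e :: real assume "e > 0"
  have "\<forall>\<^sub>F n in sequentially. \<forall>M\<in>\<M>. (\<integral>\<^sup>+x. ennreal ((norm (f x - P n x))\<^sup>2) \<partial>M) < ennreal e"
  proof (rule eventually_ball_finite[OF fin(1)], rule ballI)
    fix M assume M: "M \<in> \<M>"
    then have [measurable_cong]: "sets M = sets borel" using fin by auto
    note [measurable] = f P(1)
    have "(\<lambda>n. \<integral>\<^sup>+x. ennreal ((norm (f x - P n x))\<^sup>2) \<partial>M) \<longlonglongrightarrow> 0"
      by (rule nn_integral_sq_tendsto_zero[OF _ _ _ b l]) (use fin(2) M in auto)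
    then show "\<forall>\<^sub>F n in sequentially. (\<integral>\<^sup>+x. ennreal ((norm (f x - P n x))\<^sup>2) \<partial>M) < ennreal e"
      by (rule order_tendstoD(2)) (use \<open>e > 0\<close> in simp)
  qed
  from eventually_happens'[OF sequentially_bot this]
  obtain n where "\<forall>M\<in>\<M>. (\<integral>\<^sup>+x. ennreal ((norm (f x - P n x))\<^sup>2) \<partial>M) < ennreal e" ..
  then show "\<exists>f'. f' \<in> borel_measurable borel \<and> trig_approx \<M> f' \<and> (\<forall>M\<in>\<M>. (\<integral>\<^sup>+x. ennreal ((norm (f x - f' x))\<^sup>2) \<partial>M) < ennreal e)"
    using P by blast
qed (use fin f in auto)

lemma trig_approx_trig_poly: "trig_poly f \<Longrightarrow> trig_approx \<M> f"
  unfolding trig_approx_def by (auto intro!: exI[of _ f])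

lemma trig_approx_add:
  assumes fin: "\<And>M. M \<in> \<M> \<Longrightarrow> sets M = sets borel"
    and [measurable]: "f \<in> borel_measurable borel" "g \<in> borel_measurable borel"
    and "trig_approx \<M> f" "trig_approx \<M> g"
  shows "trig_approx \<M> (\<lambda>x. f x + g x)"
  unfolding trig_approx_def
proof (intro allI impI)
  fix e :: real assume "e > 0"
  then have "e / 4 > 0" by simp
  then obtain f' g' where f': "trig_poly f'" "\<And>M. M \<in> \<M> \<Longrightarrow> (\<integral>\<^sup>+x. ennreal ((norm (f x - f' x))\<^sup>2) \<partial>M) < ennreal (e/4)"
    and g': "trig_poly g'" "\<And>M. M \<in> \<M> \<Longrightarrow> (\<integral>\<^sup>+x. ennreal ((norm (g x - g' x))\<^sup>2) \<partial>M) < ennreal (e/4)"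
    using assms(4,5) unfolding trig_approx_def by meson
  have "(\<integral>\<^sup>+x. ennreal ((norm (f x + g x - (f' x + g' x)))\<^sup>2) \<partial>M) < ennreal e" if M: "M \<in> \<M>" for M
  proof -
    have [measurable_cong]: "sets M = sets borel" using fin M by auto
    have [measurable]: "g' \<in> borel_measurable borel" "f' \<in> borel_measurable borel"
      using f' g' by (auto intro: trig_poly_measurable)
    have "(\<integral>\<^sup>+x. ennreal ((norm ((f x - f' x) + (g x - g' x)))\<^sup>2) \<partial>M) < ennreal e"
      by (rule nn_integral_norm_add_sq) (use M f' g' in auto)
    then show ?thesis by (simp add: algebra_simps)
  qed
  then show "\<exists>g'. trig_poly g' \<and> (\<forall>M\<in>\<M>. (\<integral>\<^sup>+x. ennreal ((norm (f x + g x - g' x))\<^sup>2) \<partial>M) < ennreal e)"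
    using f' g' by (intro exI[of _ "\<lambda>x. f' x + g' x"]) (auto intro: trig_poly_add)
qed

lemma trig_approx_uminus:
  assumes "trig_approx \<M> f" shows "trig_approx \<M> (\<lambda>x. - f x)"
  unfolding trig_approx_def
proof (intro allI impI)
  fix e :: real assume "e > 0"
  then obtain g where g: "trig_poly g" "\<And>M. M \<in> \<M> \<Longrightarrow> (\<integral>\<^sup>+x. ennreal ((norm (f x - g x))\<^sup>2) \<partial>M) < ennreal e"
    using assms unfolding trig_approx_def by meson
  moreover have "norm (- f x - (- 1) * g x) = norm (f x - g x)" for x
    by (simp add: norm_minus_commute)
  ultimately show "\<exists>g. trig_poly g \<and> (\<forall>M\<in>\<M>. (\<integral>\<^sup>+x. ennreal ((norm (- f x - g x))\<^sup>2) \<partial>M) < ennreal e)"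
    by (intro exI[of _ "\<lambda>x. (- 1) * g x"]) (simp only: trig_poly_mult trig_poly_const, simp)
qed

text \<open>Dynkin's argument: boxes are stable under intersection and generate the Borel sets,
  while sets with approximable indicator are closed under complements and countable disjoint
  unions.\<close>

theorem trig_approx_indicator:
  fixes A :: "'a::euclidean_space set"
  assumes fin: "finite \<M>" "\<And>M. M \<in> \<M> \<Longrightarrow> finite_measure M \<and> sets M = sets borel"
    and "A \<in> sets borel"
  shows "trig_approx \<M> (indicator A)"
proof -
  let ?G = "range (\<lambda>(a, b). box a b :: 'a set)"
  have sb: "sets (borel :: 'a measure) = sigma_sets UNIV ?G"
    unfolding borel_eq_box by simp
  have st: "Int_stable ?G"
  proof (rule Int_stableI)
    fix S T assume "S \<in> ?G" "T \<in> ?G"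
    then obtain a b c d where "S = box a b" "T = box c d" by auto
    then have "S \<inter> T = box (\<Sum>i\<in>Basis. max (a \<bullet> i) (c \<bullet> i) *\<^sub>R i) (\<Sum>i\<in>Basis. min (b \<bullet> i) (d \<bullet> i) *\<^sub>R i)"
      by (simp add: box_Int_box)
    then show "S \<inter> T \<in> ?G" by (auto intro!: range_eqI[where x = "(_, _)"])
  qed
  have m: "B \<in> sets borel \<Longrightarrow> (indicator B :: 'a \<Rightarrow> complex) \<in> borel_measurable borel" for B by simp
  have sub: "?G \<subseteq> Pow UNIV" by simp
  from st sub assms(3)[unfolded sb]
  show ?thesis
  proof (induct A rule: sigma_sets_induct_disjoint)
    case (basic A)
    then obtain a b where A: "A = box a b" by auto
    obtain P :: "nat \<Rightarrow> 'a \<Rightarrow> complex" where P: "\<And>n. trig_poly (P n)" "\<And>n x. norm (P n x) \<le> 4 ^ DIM('a)"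
      "\<And>x. (\<lambda>n. P n x) \<longlonglongrightarrow> indicator (box a b) x"
      by (rule box_trig_approx[of a b]) (erule (2) that | blast)
    show ?case unfolding A
    proof (rule trig_approx_limit[OF fin _ _ _ _ P(3), where K = "1 + 4 ^ DIM('a)"])
      show "norm (indicator (box a b) x - P n x) \<le> 1 + 4 ^ DIM('a)" for n x
        using norm_triangle_ineq4[of "indicator (box a b) x" "P n x"] P(2)[of n x]
        by (auto simp: indicator_def split: if_splits)
    qed (auto intro: P trig_approx_trig_poly trig_poly_measurable)
  next
    case empty
    show ?case using trig_approx_trig_poly[OF trig_poly_const[of 0]] by (simp add: indicator_def [abs_def])
  next
    case (compl A)
    have A: "A \<in> sets borel" using compl(1) by (simp only: sb)
    have "trig_approx \<M> (\<lambda>x. 1 + - indicator A x)"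
      by (rule trig_approx_add[OF _ _ _ trig_approx_trig_poly[OF trig_poly_const] trig_approx_uminus[OF compl(2)]])
        (use fin(2) A in auto)
    moreover have "(\<lambda>x. 1 + - indicator A x :: complex) = indicator (UNIV - A)"
      by (auto simp: indicator_def fun_eq_iff)
    ultimately show ?case by simp
  next
    case (union A)
    have Ab: "A i \<in> sets borel" for i using union(2) by (auto simp only: sb)
    define P where "P n x = (\<Sum>i<n. indicator (A i) x :: complex)" for n :: nat and x
    have P: "P n x = indicator (\<Union>i<n. A i) x" for n x
      unfolding P_def using union(1) by (subst indicator_UN_disjoint) (auto simp: disjoint_family_on_def)
    have ta: "trig_approx \<M> (P n)" for n
    proof (induct n)
      case 0 show ?case using trig_approx_trig_poly[OF trig_poly_const[of 0]] by (simp add: P_def [abs_def])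
    next
      case (Suc n)
      have "trig_approx \<M> (\<lambda>x. P n x + indicator (A n) x)"
        using Suc union(3) fin(2) Ab by (intro trig_approx_add) (auto simp: P_def [abs_def])
      then show ?case by (simp add: P_def [abs_def])
    qed
    show ?case
    proof (rule trig_approx_limit[OF fin _ _ ta, where K = 2])
      show "norm (indicator (\<Union> (range A)) x - P n x) \<le> 2" for n x
        unfolding P by (auto simp: indicator_def)
      show "(\<lambda>n. P n x) \<longlonglongrightarrow> indicator (\<Union> (range A)) x" for x
      proof (cases "x \<in> \<Union> (range A)")
        case True
        then obtain i where "x \<in> A i" by auto
        then have "\<forall>\<^sub>F n in sequentially. P n x = indicator (\<Union> (range A)) x"
          unfolding P by (intro eventually_sequentiallyI[of "Suc i"]) (auto simp: indicator_def intro!: bexI[of _ i])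
        then show ?thesis by (rule tendsto_eventually)
      next
        case False
        then show ?thesis unfolding P by (auto simp: indicator_def)
      qed
    qed (use Ab in \<open>auto simp: P_def [abs_def]\<close>)
  qed
qed

subsection \<open>Gaussian Schwartz functions\<close>

text \<open>Polynomials times a fixed \<open>E\<close>. When the derivative of \<open>E\<close> is
  an affine function times \<open>E\<close>, the class is closed under differentiation, so all
  Schwartz bounds reduce to the decay of \<open>E\<close> itself.\<close>

inductive poly_multiple :: "('a::euclidean_space \<Rightarrow> complex) \<Rightarrow> ('a \<Rightarrow> complex) \<Rightarrow> bool" for E where
  base: "poly_multiple E E"
| inner: "poly_multiple E f \<Longrightarrow> poly_multiple E (\<lambda>z. complex_of_real (z \<bullet> b) * f z)"
| cmult: "poly_multiple E f \<Longrightarrow> poly_multiple E (\<lambda>z. c * f z)"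
| add: "poly_multiple E f \<Longrightarrow> poly_multiple E g \<Longrightarrow> poly_multiple E (\<lambda>z. f z + g z)"

lemma poly_multiple_deriv:
  assumes "poly_multiple E f"
    and E: "\<And>z. (E has_derivative (\<lambda>v. (complex_of_real (z \<bullet> m v) + k v) * E z)) (at z)"
  shows "\<exists>f'. (\<forall>z. (f has_derivative f' z) (at z)) \<and> (\<forall>v. poly_multiple E (\<lambda>z. f' z v))"
  using assms(1)
proof induct
  case base
  have "poly_multiple E (\<lambda>z. complex_of_real (z \<bullet> m v) * E z + k v * E z)" for v
    by (rule poly_multiple.add[OF poly_multiple.inner[OF poly_multiple.base] poly_multiple.cmult[OF poly_multiple.base]])
  then have "poly_multiple E (\<lambda>z. (complex_of_real (z \<bullet> m v) + k v) * E z)" for v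
    by (simp add: distrib_right)
  then show ?case using E
    by (intro exI[of _ "\<lambda>z v. (complex_of_real (z \<bullet> m v) + k v) * E z"]) auto
next
  case (inner f b)
  then obtain f' where f': "\<And>z. (f has_derivative f' z) (at z)" "\<And>v. poly_multiple E (\<lambda>z. f' z v)" by blast
  have "((\<lambda>z. complex_of_real (z \<bullet> b) * f z) has_derivative (\<lambda>v. complex_of_real (z \<bullet> b) * f' z v + complex_of_real (v \<bullet> b) * f z)) (at z)" for z
    by (auto intro!: derivative_eq_intros f')
  moreover have "poly_multiple E (\<lambda>z. complex_of_real (z \<bullet> b) * f' z v + complex_of_real (v \<bullet> b) * f z)" for v
    by (rule poly_multiple.add[OF poly_multiple.inner[OF f'(2)] poly_multiple.cmult[OF inner(1)]])
  ultimately show ?case by (intro exI[of _ "\<lambda>z v. complex_of_real (z \<bullet> b) * f' z v + complex_of_real (v \<bullet> b) * f z"]) auto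
next
  case (cmult f c)
  then obtain f' where f': "\<And>z. (f has_derivative f' z) (at z)" "\<And>v. poly_multiple E (\<lambda>z. f' z v)" by blast
  have "((\<lambda>z. c * f z) has_derivative (\<lambda>v. c * f' z v)) (at z)" for z
    by (auto intro!: derivative_eq_intros f')
  moreover have "poly_multiple E (\<lambda>z. c * f' z v)" for v
    by (rule poly_multiple.cmult[OF f'(2)])
  ultimately show ?case by (intro exI[of _ "\<lambda>z v. c * f' z v"]) auto
next
  case (add f g)
  then obtain f' g' where f': "\<And>z. (f has_derivative f' z) (at z)" "\<And>v. poly_multiple E (\<lambda>z. f' z v)"
    and g': "\<And>z. (g has_derivative g' z) (at z)" "\<And>v. poly_multiple E (\<lambda>z. g' z v)" by blast
  have "((\<lambda>z. f z + g z) has_derivative (\<lambda>v. f' z v + g' z v)) (at z)" for z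
    by (intro derivative_intros f' g')
  moreover have "poly_multiple E (\<lambda>z. f' z v + g' z v)" for v
    by (rule poly_multiple.add[OF f'(2) g'(2)])
  ultimately show ?case by (intro exI[of _ "\<lambda>z v. f' z v + g' z v"]) auto
qed

text \<open>Each factor \<open>z \<bullet> b\<close> costs one power of \<open>1 + norm z\<close>,
  which is paid by the induction hypothesis at \<open>Suc N\<close>.\<close>

lemma poly_multiple_decay:
  assumes "poly_multiple E f" and "\<And>N. \<exists>C. \<forall>z. (1 + norm z) ^ N * norm (E z) \<le> C"
  shows "\<exists>C. \<forall>z. (1 + norm z) ^ N * norm (f z) \<le> C"
  using assms(1)
proof (induct arbitrary: N)
  case base show ?case by (rule assms(2))
next
  case (inner f b)
  then obtain C where C: "\<And>z. (1 + norm z) ^ Suc N * norm (f z) \<le> C" by meson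
  have "(1 + norm z) ^ N * norm (complex_of_real (z \<bullet> b) * f z) \<le> norm b * C" for z
  proof -
    have "\<bar>z \<bullet> b\<bar> \<le> norm b * (1 + norm z)"
      using Cauchy_Schwarz_ineq2[of z b] by (simp add: algebra_simps add_increasing)
    then have "(1 + norm z) ^ N * norm (complex_of_real (z \<bullet> b) * f z) \<le> (1 + norm z) ^ N * ((norm b * (1 + norm z)) * norm (f z))"
      by (intro mult_left_mono) (auto simp: norm_mult intro!: mult_right_mono)
    also have "\<dots> = norm b * ((1 + norm z) ^ Suc N * norm (f z))" by simp
    also have "\<dots> \<le> norm b * C" by (intro mult_left_mono C) auto
    finally show ?thesis .
  qed
  then show ?case by blast
next
  case (cmult f c)
  then obtain C where C: "\<And>z. (1 + norm z) ^ N * norm (f z) \<le> C" by meson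
  have "(1 + norm z) ^ N * norm (c * f z) \<le> norm c * C" for z
    using mult_left_mono[OF C[of z], of "norm c"] by (simp add: norm_mult mult_ac)
  then show ?case by blast
next
  case (add f g)
  then obtain C D where C: "\<And>z. (1 + norm z) ^ N * norm (f z) \<le> C" "\<And>z. (1 + norm z) ^ N * norm (g z) \<le> D" by meson
  have "(1 + norm z) ^ N * norm (f z + g z) \<le> C + D" for z
  proof -
    have "(1 + norm z) ^ N * norm (f z + g z) \<le> (1 + norm z) ^ N * (norm (f z) + norm (g z))"
      by (intro mult_left_mono norm_triangle_ineq) auto
    also have "\<dots> \<le> C + D" using C(1)[of z] C(2)[of z] by (simp add: distrib_left)
    finally show ?thesis .
  qed
  then show ?case by blast
qed

lemma schwartz_poly_multiple:
  assumes f: "poly_multiple E f"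
    and E: "\<And>z. (E has_derivative (\<lambda>v. (complex_of_real (z \<bullet> m v) + k v) * E z)) (at z)"
    and decay: "\<And>N. \<exists>C. \<forall>z. (1 + norm z) ^ N * norm (E z) \<le> C"
  shows "schwartz f"
proof -
  have i: "poly_multiple E (iter_deriv vs f)" for vs
  proof (induct vs)
    case (Cons v vs)
    obtain f' where f': "\<And>z. (iter_deriv vs f has_derivative f' z) (at z)" "\<And>v. poly_multiple E (\<lambda>z. f' z v)"
      using poly_multiple_deriv[OF Cons E] by blast
    have "frechet_derivative (iter_deriv vs f) (at z) = f' z" for z
      using frechet_derivative_at[OF f'(1)] by simp
    then show ?case using f'(2) by simp
  qed (simp add: f)
  have "iter_deriv vs f differentiable (at z)" for vs z
    using poly_multiple_deriv[OF i E, of vs] by (auto simp: differentiable_def)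
  then show ?thesis
    unfolding schwartz_def using poly_multiple_decay[OF i decay] by auto
qed

text \<open>After \<open>1 + r \<le> exp r\<close>, the constant is the exponential of the maximum
  of \<open>N * r - c * r\<^sup>2\<close>, attained at \<open>r = N / (2 * c)\<close>.\<close>

lemma power_exp_neg_square_bounded:
  assumes "c > 0" "r \<ge> (0::real)"
  shows "(1 + r) ^ N * exp (- c * r\<^sup>2) \<le> exp ((real N)\<^sup>2 / (4 * c))"
proof -
  have "(1 + r) ^ N \<le> exp r ^ N" using assms by (intro power_mono) auto
  then have "(1 + r) ^ N * exp (- c * r\<^sup>2) \<le> exp (real N * r) * exp (- c * r\<^sup>2)"
    by (simp add: exp_of_nat_mult)
  also have "\<dots> = exp (real N * r - c * r\<^sup>2)" by (simp add: exp_add[symmetric])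
  also have "\<dots> \<le> exp ((real N)\<^sup>2 / (4 * c))"
  proof -
    have "0 \<le> (2 * c * r - real N)\<^sup>2" by simp
    then have "(real N * r - c * r\<^sup>2) * (4 * c) \<le> (real N)\<^sup>2"
      by (simp add: power2_eq_square algebra_simps)
    then show ?thesis using assms by (simp add: pos_le_divide_eq)
  qed
  finally show ?thesis .
qed

text \<open>The frequency factor is a transform: integrating
  \<open>gauss s (z - a) * cis (z \<bullet> \<xi>)\<close> over \<open>z\<close> gives it. Testing a
  Wigner distribution on this function therefore averages correlations over lags near
  \<open>a\<close>, localized in position near \<open>y\<close>.\<close>

definition gauss_pair :: "real \<Rightarrow> 'a::euclidean_space \<Rightarrow> real \<Rightarrow> 'a \<Rightarrow> 'a \<times> 'a \<Rightarrow> complex" where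
  "gauss_pair \<sigma> y s a = (\<lambda>(x, \<xi>). complex_of_real (gauss \<sigma> (x - y)) * (cis (a \<bullet> \<xi>) * complex_of_real (exp (- s\<^sup>2 * (norm \<xi>)\<^sup>2 / 2))))"

lemma schwartz_gauss_pair:
  fixes y a :: "'a::euclidean_space"
  assumes "\<sigma> > 0" "s > 0"
  shows "schwartz (gauss_pair \<sigma> y s a)"
proof -
  define \<alpha> where "\<alpha> = 1 / (2 * \<sigma>\<^sup>2)"
  define \<beta> where "\<beta> = s\<^sup>2 / 2"
  have pos: "\<alpha> > 0" "\<beta> > 0" using assms by (auto simp: \<alpha>_def \<beta>_def)
  define E :: "'a \<times> 'a \<Rightarrow> complex" where
    "E z = exp (complex_of_real (- \<alpha> * ((fst z - y) \<bullet> (fst z - y)) - \<beta> * (snd z \<bullet> snd z)) + \<i> * complex_of_real (a \<bullet> snd z))" for z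
  \<comment> \<open>Differentiating the exponent of \<open>E\<close> in direction \<open>v\<close>
    gives an affine function of \<open>z\<close>: \<open>z \<bullet> m v\<close> is its linear part
    and \<open>k v\<close> its constant part.\<close>
  define m where "m v = ((- 2 * \<alpha>) *\<^sub>R fst v, (- 2 * \<beta>) *\<^sub>R snd v)" for v :: "'a \<times> 'a"
  define k where "k v = complex_of_real (2 * \<alpha> * (y \<bullet> fst v)) + \<i> * complex_of_real (a \<bullet> snd v)" for v :: "'a \<times> 'a"
  have E': "(E has_derivative (\<lambda>v. (complex_of_real (z \<bullet> m v) + k v) * E z)) (at z)" for z
  proof -
    let ?q = "\<lambda>z. complex_of_real (- \<alpha> * ((fst z - y) \<bullet> (fst z - y)) - \<beta> * (snd z \<bullet> snd z)) + \<i> * complex_of_real (a \<bullet> snd z)"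
    have "(?q has_derivative (\<lambda>v. complex_of_real (- \<alpha> * (2 * ((fst z - y) \<bullet> fst v)) - \<beta> * (2 * (snd z \<bullet> snd v))) + \<i> * complex_of_real (a \<bullet> snd v))) (at z)"
      by (auto intro!: derivative_eq_intros simp: inner_commute)
    moreover have "complex_of_real (- \<alpha> * (2 * ((fst z - y) \<bullet> fst v)) - \<beta> * (2 * (snd z \<bullet> snd v))) + \<i> * complex_of_real (a \<bullet> snd v) = complex_of_real (z \<bullet> m v) + k v" for v
      by (simp add: m_def k_def inner_prod_def inner_diff_left algebra_simps)
    ultimately have q: "(?q has_derivative (\<lambda>v. complex_of_real (z \<bullet> m v) + k v)) (at z)" by simp
    have e: "(exp has_derivative (\<lambda>v. v * exp c)) (at c)" for c :: complex
      using DERIV_exp[of c] unfolding has_field_derivative_def by (simp add: mult.commute[of _ "exp c"])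
    have "((\<lambda>z. exp (?q z)) has_derivative (\<lambda>v. (complex_of_real (z \<bullet> m v) + k v) * exp (?q z))) (at z)"
      by (rule has_derivative_compose[OF q e])
    then show ?thesis unfolding E_def .
  qed
  have normE: "norm (E z) = exp (- \<alpha> * (norm (fst z - y))\<^sup>2 - \<beta> * (norm (snd z))\<^sup>2)" for z
    unfolding E_def norm_exp_eq_Re power2_norm_eq_inner by simp
  have decay: "\<exists>C. \<forall>z. (1 + norm z) ^ N * norm (E z) \<le> C" for N
  proof -
    define c where "c = min \<alpha> \<beta>"
    have c: "c > 0" "c \<le> \<alpha>" "c \<le> \<beta>" using pos by (auto simp: c_def)
    have "(1 + norm z) ^ N * norm (E z) \<le> (1 + norm y) ^ N * exp ((real N)\<^sup>2 / (4 * c))" for z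
    proof -
      \<comment> \<open>Recentring at the peak: the polynomial weight at \<open>z\<close> is
        compared with the weight at \<open>z - (y, 0)\<close>, at the price of a factor
        \<open>(1 + norm y) ^ N\<close>.\<close>
      let ?w = "z - (y, 0)"
      have "norm z \<le> norm ?w + norm (y, 0::'a)" using norm_triangle_ineq[of ?w "(y,0)"] by simp
      moreover have "norm (y, 0::'a) = norm y" by (simp add: norm_prod_def)
      moreover have "0 \<le> norm y * norm ?w" by simp
      ultimately have "1 + norm z \<le> (1 + norm y) * (1 + norm ?w)" unfolding distrib_left distrib_right by linarith
      then have "(1 + norm z) ^ N \<le> ((1 + norm y) * (1 + norm ?w)) ^ N" by (intro power_mono) auto
      then have 1: "(1 + norm z) ^ N \<le> (1 + norm y) ^ N * (1 + norm ?w) ^ N" by (simp add: power_mult_distrib)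
      have "(norm ?w)\<^sup>2 = (norm (fst z - y))\<^sup>2 + (norm (snd z))\<^sup>2" by (simp add: norm_prod_def)
      moreover have "c * (norm (fst z - y))\<^sup>2 \<le> \<alpha> * (norm (fst z - y))\<^sup>2" "c * (norm (snd z))\<^sup>2 \<le> \<beta> * (norm (snd z))\<^sup>2"
        using c by (auto intro!: mult_right_mono)
      ultimately have 2: "norm (E z) \<le> exp (- c * (norm ?w)\<^sup>2)" unfolding normE by (simp add: algebra_simps)
      have "(1 + norm z) ^ N * norm (E z) \<le> ((1 + norm y) ^ N * (1 + norm ?w) ^ N) * exp (- c * (norm ?w)\<^sup>2)"
        by (intro mult_mono 1 2) auto
      also have "\<dots> = (1 + norm y) ^ N * ((1 + norm ?w) ^ N * exp (- c * (norm ?w)\<^sup>2))" by simp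
      also have "\<dots> \<le> (1 + norm y) ^ N * exp ((real N)\<^sup>2 / (4 * c))"
        by (intro mult_left_mono power_exp_neg_square_bounded c) auto
      finally show ?thesis .
    qed
    then show ?thesis by blast
  qed
  have "poly_multiple E (\<lambda>z. complex_of_real ((1 / (sqrt (2 * pi) * \<sigma>)) ^ DIM('a)) * E z)"
    by (rule poly_multiple.cmult[OF poly_multiple.base])
  also have "(\<lambda>z. complex_of_real ((1 / (sqrt (2 * pi) * \<sigma>)) ^ DIM('a)) * E z) = gauss_pair \<sigma> y s a"
  proof (rule ext)
    fix z :: "'a \<times> 'a"
    have "E z = complex_of_real (exp (- \<alpha> * (norm (fst z - y))\<^sup>2)) * (cis (a \<bullet> snd z) * complex_of_real (exp (- \<beta> * (norm (snd z))\<^sup>2)))"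
      unfolding E_def cis_conv_exp exp_of_real[symmetric] exp_add[symmetric]
      by (simp add: power2_norm_eq_inner algebra_simps)
    then show "complex_of_real ((1 / (sqrt (2 * pi) * \<sigma>)) ^ DIM('a)) * E z = gauss_pair \<sigma> y s a z"
      by (cases z) (simp add: gauss_pair_def gauss_def \<alpha>_def \<beta>_def)
  qed
  finally show ?thesis by (rule schwartz_poly_multiple[OF _ E' decay])
qed

subsection \<open>Correlations of square integrable functions\<close>

definition sq_int :: "('a::euclidean_space \<Rightarrow> complex) \<Rightarrow> bool" where
  "sq_int w \<longleftrightarrow> w \<in> borel_measurable borel \<and> integrable lborel (\<lambda>x. (norm (w x))\<^sup>2)"

text \<open>The weight \<open>f\<close> is evaluated at the base point \<open>x\<close> of the
  conjugated factor, not at a midpoint. This mirrors the Wigner distribution, where position belongs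
  to the conjugated factor and frequency to the other one.\<close>

definition corr :: "('a::euclidean_space \<Rightarrow> complex) \<Rightarrow> ('a \<Rightarrow> complex) \<Rightarrow> 'a \<Rightarrow> complex" where
  "corr w f z = (LBINT x. cnj (w x) * f x * w (x + z))"

lemma sq_int_measurable [measurable_dest]: "sq_int w \<Longrightarrow> w \<in> borel_measurable borel"
  by (simp add: sq_int_def)

lemma borel_measurable_cnj [measurable]:
  "f \<in> borel_measurable M \<Longrightarrow> (\<lambda>x. cnj (f x)) \<in> borel_measurable M"
  by (rule measurable_compose[where g = cnj]) (auto intro!: borel_measurable_continuous_onI continuous_intros)

lemma sq_int_translate: "sq_int w \<Longrightarrow> sq_int (\<lambda>x. w (x + z))"
  unfolding sq_int_def using integrable_lborel_translate[of "\<lambda>x. (norm (w x))\<^sup>2" z] by (auto simp: add.commute)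

lemma integral_sq_translate:
  "sq_int w \<Longrightarrow> (LBINT x. (norm (w (x + z)))\<^sup>2) = (LBINT x. (norm (w x))\<^sup>2)"
  using integral_lborel_translate[of "\<lambda>x. (norm (w x))\<^sup>2" z] by (auto simp: add.commute sq_int_def)

lemma nn_integral_sq_eq:
  assumes "sq_int w" shows "(\<integral>\<^sup>+x. ennreal ((norm (w x))\<^sup>2) \<partial>lborel) = ennreal (LBINT x. (norm (w x))\<^sup>2)"
  using assms by (intro nn_integral_eq_integral) (auto simp: sq_int_def)

lemma norm_mult_le_sq: "norm a * norm b \<le> ((norm a)\<^sup>2 + (norm b)\<^sup>2) / 2"
  using sum_squares_bound[of "norm a" "norm b"] by (simp add: field_simps)

lemma sq_int_prod_integrable:
  assumes "sq_int v" "sq_int w" and [measurable]: "f \<in> borel_measurable borel" and "\<And>x. norm (f x) \<le> K"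
  shows "integrable lborel (\<lambda>x. v x * f x * w x)"
    and "integrable lborel (\<lambda>x. cnj (v x) * f x * w x)"
    and "integrable lborel (\<lambda>x. v x * f x * cnj (w x))"
    and "integrable lborel (\<lambda>x. norm (v x) * norm (w x))"
proof -
  have [measurable]: "v \<in> borel_measurable borel" "w \<in> borel_measurable borel" using assms by (auto simp: sq_int_def)
  have K: "0 \<le> K" using assms(4)[of undefined] norm_ge_zero order_trans by blast
  have i: "integrable lborel (\<lambda>x. K * (((norm (v x))\<^sup>2 + (norm (w x))\<^sup>2) / 2))"
    using assms by (auto simp: sq_int_def)
  have le: "norm (v x) * norm (f x) * norm (w x) \<le> K * (((norm (v x))\<^sup>2 + (norm (w x))\<^sup>2) / 2)" for x
  proof -
    have "norm (v x) * norm (f x) * norm (w x) = norm (f x) * (norm (v x) * norm (w x))" by simp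
    also have "\<dots> \<le> K * (((norm (v x))\<^sup>2 + (norm (w x))\<^sup>2) / 2)"
      by (intro mult_mono assms norm_mult_le_sq K) auto
    finally show ?thesis .
  qed
  have le': "norm (v x) * norm (f x) * norm (w x) \<le> norm (K * (((norm (v x))\<^sup>2 + (norm (w x))\<^sup>2) / 2))" for x
    using le[of x] unfolding real_norm_def by linarith
  show "integrable lborel (\<lambda>x. v x * f x * w x)" "integrable lborel (\<lambda>x. cnj (v x) * f x * w x)" "integrable lborel (\<lambda>x. v x * f x * cnj (w x))"
    by (rule Bochner_Integration.integrable_bound[OF i], measurable, rule AE_I2, use le' in \<open>simp only: norm_mult[of "_ * _"] norm_mult[of _ "f _"] complex_mod_cnj\<close>)+
  have i': "integrable lborel (\<lambda>x. ((norm (v x))\<^sup>2 + (norm (w x))\<^sup>2) / 2)"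
    using assms by (auto simp: sq_int_def)
  show "integrable lborel (\<lambda>x. norm (v x) * norm (w x))"
  proof (rule Bochner_Integration.integrable_bound[OF i'], measurable, rule AE_I2)
    fix x show "norm (norm (v x) * norm (w x)) \<le> norm (((norm (v x))\<^sup>2 + (norm (w x))\<^sup>2) / 2)"
      using norm_mult_le_sq[of "v x" "w x"] by simp
  qed
qed

lemma measurable_corr [measurable (raw)]:
  assumes [measurable]: "w \<in> borel_measurable borel" "f \<in> borel_measurable borel"
  shows "corr w f \<in> borel_measurable borel"
  unfolding corr_def [abs_def] by measurable

text \<open>In the pointwise AM-GM inequality the two squares have equal integrals by translation
  invariance.\<close>

lemma corr_nn_bound:
  assumes w: "sq_int w"
  shows "(\<integral>\<^sup>+x. ennreal (norm (w x) * norm (w (x + z))) \<partial>lborel) \<le> ennreal (LBINT x. (norm (w x))\<^sup>2)"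
proof -
  have [measurable]: "w \<in> borel_measurable borel" using w by (auto simp: sq_int_def)
  have "(\<integral>\<^sup>+x. ennreal (norm (w x) * norm (w (x + z))) \<partial>lborel) = ennreal (LBINT x. norm (w x) * norm (w (x + z)))"
    using sq_int_prod_integrable(4)[OF w sq_int_translate[OF w], of "\<lambda>_. 0" 0] by (intro nn_integral_eq_integral) auto
  also have "(LBINT x. norm (w x) * norm (w (x + z))) \<le> (LBINT x. ((norm (w x))\<^sup>2 + (norm (w (x + z)))\<^sup>2) / 2)"
    using sq_int_prod_integrable(4)[OF w sq_int_translate[OF w], of "\<lambda>_. 0" 0] w sq_int_translate[OF w, of z]
    by (intro integral_mono norm_mult_le_sq) (auto simp: sq_int_def)
  also have "\<dots> = (LBINT x. (norm (w x))\<^sup>2)"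
    using w sq_int_translate[OF w, of z] integral_sq_translate[OF w, of z] by (simp add: sq_int_def)
  finally show ?thesis by (simp add: ennreal_leI)
qed

lemma corr_bound:
  assumes w: "sq_int w" and f [measurable]: "f \<in> borel_measurable borel" and K: "\<And>x. norm (f x) \<le> K"
  shows "norm (corr w f z) \<le> K * (LBINT x. (norm (w x))\<^sup>2)"
proof -
  have [measurable]: "w \<in> borel_measurable borel" using w by (auto simp: sq_int_def)
  have K0: "0 \<le> K" using K[of undefined] norm_ge_zero order_trans by blast
  note i = sq_int_prod_integrable(2)[OF w sq_int_translate[OF w] f K, of z]
  have "ennreal (norm (corr w f z)) \<le> (\<integral>\<^sup>+x. norm (cnj (w x) * f x * w (x + z)) \<partial>lborel)"
    unfolding corr_def by (rule integral_norm_bound_ennreal[OF i])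
  also have "\<dots> \<le> (\<integral>\<^sup>+x. ennreal K * ennreal (norm (w x) * norm (w (x + z))) \<partial>lborel)"
  proof (rule nn_integral_mono)
    fix x
    have "norm (cnj (w x) * f x * w (x + z)) = norm (f x) * (norm (w x) * norm (w (x + z)))" by (simp add: norm_mult)
    also have "\<dots> \<le> K * (norm (w x) * norm (w (x + z)))" by (intro mult_right_mono K) auto
    finally show "ennreal (norm (cnj (w x) * f x * w (x + z))) \<le> ennreal K * ennreal (norm (w x) * norm (w (x + z)))"
      using K0 by (simp add: ennreal_mult[symmetric] ennreal_leI)
  qed
  also have "\<dots> \<le> ennreal K * ennreal (LBINT x. (norm (w x))\<^sup>2)"
    by (subst nn_integral_cmult) (auto intro!: mult_left_mono corr_nn_bound w)
  finally show ?thesis using K0 by (simp add: ennreal_mult[symmetric])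
qed

lemma corr_diff:
  assumes w: "sq_int w" and f: "f \<in> borel_measurable borel" "\<And>x. norm (f x) \<le> K"
    and g: "g \<in> borel_measurable borel" "\<And>x. norm (g x) \<le> K'"
  shows "corr w f z - corr w g z = corr w (\<lambda>x. f x - g x) z"
proof -
  have "corr w f z - corr w g z = (LBINT x. cnj (w x) * f x * w (x + z) - cnj (w x) * g x * w (x + z))"
    unfolding corr_def
    by (rule Bochner_Integration.integral_diff[symmetric])
      (intro sq_int_prod_integrable(2)[OF w sq_int_translate[OF w] f] sq_int_prod_integrable(2)[OF w sq_int_translate[OF w] g])+
  also have "\<dots> = corr w (\<lambda>x. f x - g x) z"
    unfolding corr_def by (intro Bochner_Integration.integral_cong) (simp_all add: left_diff_distrib right_diff_distrib)
  finally show ?thesis .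
qed

lemma corr_Fubini:
  fixes w :: "'a::euclidean_space \<Rightarrow> complex"
  assumes w: "sq_int w" and f [measurable]: "f \<in> borel_measurable borel" and K: "\<And>x. norm (f x) \<le> K"
    and \<kappa>: "integrable lborel \<kappa>"
  shows "integrable lborel (\<lambda>z. \<kappa> z * corr w f z)"
    and "(LBINT z. \<kappa> z * corr w f z) = (LBINT x. (LBINT z. \<kappa> z * (cnj (w x) * f x * w (x + z))))"
proof -
  have [measurable]: "w \<in> borel_measurable borel" "\<kappa> \<in> borel_measurable borel" using w \<kappa> by (auto simp: sq_int_def)
  have K0: "0 \<le> K" using K[of undefined] norm_ge_zero order_trans by blast
  let ?N = "LBINT x. (norm (w x))\<^sup>2"
  let ?f = "\<lambda>z x. \<kappa> z * (cnj (w x) * f x * w (x + z))"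
  have m: "case_prod ?f \<in> borel_measurable (lborel \<Otimes>\<^sub>M lborel)" by measurable
  have "(\<integral>\<^sup>+z. (\<integral>\<^sup>+x. norm (?f z x) \<partial>lborel) \<partial>lborel) \<le> (\<integral>\<^sup>+z. ennreal (norm (\<kappa> z)) * ennreal (K * ?N) \<partial>lborel)"
  proof (rule nn_integral_mono)
    fix z
    have "(\<integral>\<^sup>+x. norm (?f z x) \<partial>lborel) \<le> (\<integral>\<^sup>+x. ennreal (norm (\<kappa> z) * K) * ennreal (norm (w x) * norm (w (x + z))) \<partial>lborel)"
    proof (rule nn_integral_mono)
      fix x
      have "norm (?f z x) = norm (\<kappa> z) * norm (f x) * (norm (w x) * norm (w (x + z)))" by (simp add: norm_mult)
      also have "\<dots> \<le> norm (\<kappa> z) * K * (norm (w x) * norm (w (x + z)))" by (intro mult_right_mono mult_left_mono K) auto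
      finally show "ennreal (norm (?f z x)) \<le> ennreal (norm (\<kappa> z) * K) * ennreal (norm (w x) * norm (w (x + z)))"
        using K0 by (simp add: ennreal_mult[symmetric] ennreal_leI)
    qed
    also have "\<dots> \<le> ennreal (norm (\<kappa> z) * K) * ennreal ?N"
      by (subst nn_integral_cmult) (auto intro!: mult_left_mono corr_nn_bound w)
    also have "\<dots> = ennreal (norm (\<kappa> z)) * ennreal (K * ?N)"
      using K0 by (simp add: ennreal_mult[symmetric] mult.assoc)
    finally show "(\<integral>\<^sup>+x. norm (?f z x) \<partial>lborel) \<le> ennreal (norm (\<kappa> z)) * ennreal (K * ?N)" .
  qed
  also have "\<dots> = (\<integral>\<^sup>+z. ennreal (norm (\<kappa> z)) \<partial>lborel) * ennreal (K * ?N)"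
    by (subst nn_integral_multc) auto
  also have "\<dots> < \<infinity>"
    using \<kappa> by (auto simp: integrable_iff_bounded ennreal_mult_less_top)
  finally have fin: "(\<integral>\<^sup>+z. (\<integral>\<^sup>+x. norm (?f z x) \<partial>lborel) \<partial>lborel) < \<infinity>" .
  have e: "(LBINT x. ?f z x) = \<kappa> z * corr w f z" for z
    unfolding corr_def by (rule integral_mult_right_zero)
  show "integrable lborel (\<lambda>z. \<kappa> z * corr w f z)"
    using lborel_pair.Fubini_swap(2)[OF m fin] by (simp only: e)
  show "(LBINT z. \<kappa> z * corr w f z) = (LBINT x. (LBINT z. ?f z x))"
    using lborel_pair.Fubini_swap(4)[OF m fin] by (simp only: e)
qed

subsection \<open>Wigner distributions tested against Gaussians\<close>

text \<open>Rescaling by the scale of the sequence: the Wigner measure becomes the limit of correlations at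
  unit scale, localized by the slowly varying weights \<open>f (h k *\<^sub>R x)\<close>.\<close>

definition unit_scale :: "real \<Rightarrow> ('a::euclidean_space \<Rightarrow> complex) \<Rightarrow> 'a \<Rightarrow> complex" where
  "unit_scale \<epsilon> u X = complex_of_real (sqrt \<epsilon> ^ DIM('a)) * u (\<epsilon> *\<^sub>R X)"

lemma sq_int_unit_scale:
  fixes u :: "'a::euclidean_space \<Rightarrow> complex"
  assumes u: "sq_int u" and "\<epsilon> > 0"
  shows "sq_int (unit_scale \<epsilon> u)"
    and "(LBINT x. (norm (unit_scale \<epsilon> u x))\<^sup>2) = (LBINT x. (norm (u x))\<^sup>2)"
proof -
  have [measurable]: "u \<in> borel_measurable borel" using u by (auto simp: sq_int_def)
  have e: "(norm (unit_scale \<epsilon> u x))\<^sup>2 = \<epsilon> ^ DIM('a) * (norm (u (\<epsilon> *\<^sub>R x)))\<^sup>2" for x :: 'a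
  proof -
    have "(sqrt \<epsilon> ^ DIM('a))\<^sup>2 = \<epsilon> ^ DIM('a)"
      using assms(2) by (simp add: power_mult[symmetric] mult.commute[of _ 2]) (simp add: power_mult)
    then show ?thesis using assms(2) by (simp add: unit_scale_def norm_mult power_mult_distrib norm_power)
  qed
  have "integrable lborel (\<lambda>x. (norm (u (\<epsilon> *\<^sub>R x)))\<^sup>2)"
    using integrable_lborel_scale[of "\<lambda>x. (norm (u x))\<^sup>2" \<epsilon>] assms by (auto simp: sq_int_def)
  then show "sq_int (unit_scale \<epsilon> u)"
    unfolding sq_int_def e by (auto simp: unit_scale_def [abs_def])
  show "(LBINT x. (norm (unit_scale \<epsilon> u x))\<^sup>2) = (LBINT x. (norm (u x))\<^sup>2)"
    unfolding e using assms(2) by (subst (2) integral_lborel_scale[of _ \<epsilon>]) auto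
qed

lemma gauss_le: "r > 0 \<Longrightarrow> gauss r z \<le> (1 / (sqrt (2 * pi) * r)) ^ DIM('a)" for z :: "'a::euclidean_space"
  unfolding gauss_def by (rule mult_left_le) auto

lemma gauss_translate:
  assumes "r > 0"
  shows "integrable lborel (\<lambda>z::'a::euclidean_space. gauss r (z - a))" "(LBINT z. gauss r (z - a :: 'a)) = 1"
  using integrable_lborel_translate_minus[OF integral_gauss(1)[OF assms], of a]
    integral_lborel_translate_minus[OF measurable_gauss, of r a] integral_gauss(2)[OF assms, where 'a='a] by auto

text \<open>The oscillating factor of the Wigner distribution and the Fourier kernel together move
  the modulation from \<open>a\<close> to \<open>a + (x - y') / \<epsilon>\<close>, so the frequency
  integral is an inverse Gaussian transform evaluated there.\<close>

lemma fourier_gauss_pair: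
  fixes x y y' a :: "'a::euclidean_space"
  assumes "\<epsilon> > 0" "s > 0"
  shows "fourier (\<lambda>\<xi>. exp (\<i> * complex_of_real ((x \<bullet> (\<epsilon> *\<^sub>R \<xi>)) / \<epsilon>)) * gauss_pair \<sigma> y s a (x, \<epsilon> *\<^sub>R \<xi>)) y'
    = complex_of_real (gauss \<sigma> (x - y)) * complex_of_real ((2 * pi / \<epsilon>) ^ DIM('a) * gauss s (a + (x - y') /\<^sub>R \<epsilon>))"
proof -
  define F where "F \<eta> = complex_of_real (exp (- s\<^sup>2 * (norm \<eta>)\<^sup>2 / 2)) * cis (\<eta> \<bullet> (a + (x - y') /\<^sub>R \<epsilon>))" for \<eta> :: 'a
  have [measurable]: "F \<in> borel_measurable borel" unfolding F_def [abs_def] by measurable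
  have "exp (\<i> * complex_of_real ((x \<bullet> (\<epsilon> *\<^sub>R \<xi>)) / \<epsilon>)) * gauss_pair \<sigma> y s a (x, \<epsilon> *\<^sub>R \<xi>) * exp (- \<i> * complex_of_real (\<xi> \<bullet> y'))
    = complex_of_real (gauss \<sigma> (x - y)) * F (\<epsilon> *\<^sub>R \<xi>)" for \<xi>
  proof -
    have e1: "\<epsilon> * (inverse \<epsilon> * t) = t" for t using assms by simp
    have "cis ((\<epsilon> *\<^sub>R \<xi>) \<bullet> (a + (x - y') /\<^sub>R \<epsilon>)) = cis (x \<bullet> \<xi>) * cis (a \<bullet> (\<epsilon> *\<^sub>R \<xi>)) * cis (- (\<xi> \<bullet> y'))"
      using assms by (simp add: cis_mult inner_add_right inner_diff_right inner_commute algebra_simps e1)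
    moreover have "exp (\<i> * complex_of_real ((x \<bullet> (\<epsilon> *\<^sub>R \<xi>)) / \<epsilon>)) = cis (x \<bullet> \<xi>)"
      using assms by (simp add: cis_conv_exp)
    moreover have "exp (- \<i> * complex_of_real (\<xi> \<bullet> y')) = cis (- (\<xi> \<bullet> y'))"
      by (simp add: cis_conv_exp)
    ultimately show ?thesis by (simp add: F_def gauss_pair_def mult_ac)
  qed
  then have "fourier (\<lambda>\<xi>. exp (\<i> * complex_of_real ((x \<bullet> (\<epsilon> *\<^sub>R \<xi>)) / \<epsilon>)) * gauss_pair \<sigma> y s a (x, \<epsilon> *\<^sub>R \<xi>)) y'
     = (LINT \<xi>|lebesgue. complex_of_real (gauss \<sigma> (x - y)) * F (\<epsilon> *\<^sub>R \<xi>))"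
    unfolding fourier_def by simp
  also have "\<dots> = (LBINT \<xi>. complex_of_real (gauss \<sigma> (x - y)) * F (\<epsilon> *\<^sub>R \<xi>))"
    by (rule integral_completion) measurable
  also have "\<dots> = complex_of_real (gauss \<sigma> (x - y)) * (LBINT \<xi>. F (\<epsilon> *\<^sub>R \<xi>))"
    by (rule integral_mult_right_zero)
  also have "(LBINT \<xi>. F (\<epsilon> *\<^sub>R \<xi>)) = complex_of_real ((2 * pi / \<epsilon>) ^ DIM('a) * gauss s (a + (x - y') /\<^sub>R \<epsilon>))"
  proof -
    have "(LBINT \<xi>. F \<xi>) = complex_of_real (\<epsilon> ^ DIM('a)) * (LBINT \<xi>. F (\<epsilon> *\<^sub>R \<xi>))"
      using assms by (subst integral_lborel_scale[of _ \<epsilon>]) (auto simp: scaleR_conv_of_real)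
    moreover have "(LBINT \<xi>. F \<xi>) = complex_of_real ((2 * pi) ^ DIM('a) * gauss s (a + (x - y') /\<^sub>R \<epsilon>))"
      unfolding F_def by (rule integral_exp_cis) fact
    ultimately show ?thesis using assms by (simp add: power_divide field_simps)
  qed
  finally show ?thesis .
qed

text \<open>Once the frequency integral is evaluated, a double integral over \<open>x\<close> and
  \<open>y'\<close> remains, with a kernel concentrated where \<open>y' - x\<close> is close to
  \<open>\<epsilon> *\<^sub>R a\<close>. The substitutions \<open>x = \<epsilon> *\<^sub>R X\<close>
  and \<open>y' = \<epsilon> *\<^sub>R (X + z)\<close> turn it into an average of correlations over
  lags \<open>z\<close> near \<open>a\<close>.\<close>

lemma wigner_gauss:
  fixes u :: "'a::euclidean_space \<Rightarrow> complex" and y a :: 'a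
  assumes u: "sq_int u" and pos: "\<epsilon> > 0" "\<sigma> > 0" "s > 0"
  shows "wigner_distribution \<epsilon> (dist_of_fun u) (gauss_pair \<sigma> y s a)
    = (LBINT z. complex_of_real (gauss s (z - a)) * corr (unit_scale \<epsilon> u) (\<lambda>X. complex_of_real (gauss \<sigma> (\<epsilon> *\<^sub>R X - y))) z)"
proof -
  have [measurable]: "u \<in> borel_measurable borel" using u by (auto simp: sq_int_def)
  let ?d = "DIM('a)"
  define g where "g x = complex_of_real (gauss \<sigma> (x - y))" for x :: 'a
  define k where "k x y' = complex_of_real (gauss s (a + (x - y') /\<^sub>R \<epsilon>))" for x y' :: 'a
  have [measurable]: "g \<in> borel_measurable borel" unfolding g_def [abs_def] by measurable
  have k [measurable]: "case_prod k \<in> borel_measurable (borel \<Otimes>\<^sub>M borel)" unfolding k_def [abs_def] by measurable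
  have [measurable]: "(\<lambda>x. LBINT y'. u y' * k x y') \<in> borel_measurable borel" by measurable
  have 1: "(LINT y'|lebesgue. u y' * (g x * complex_of_real ((2 * pi / \<epsilon>) ^ ?d * gauss s (a + (x - y') /\<^sub>R \<epsilon>))))
     = complex_of_real ((2 * pi / \<epsilon>) ^ ?d) * (g x * (LBINT y'. u y' * k x y'))" for x
  proof -
    have "(LINT y'|lebesgue. u y' * (g x * complex_of_real ((2 * pi / \<epsilon>) ^ ?d * gauss s (a + (x - y') /\<^sub>R \<epsilon>))))
      = (LBINT y'. (complex_of_real ((2 * pi / \<epsilon>) ^ ?d) * g x) * (u y' * k x y'))"
      by (subst integral_completion) (auto simp: k_def mult_ac)
    then show ?thesis by (simp only: integral_mult_right_zero mult.assoc)
  qed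
  have inner: "(LBINT y'. u y' * k (\<epsilon> *\<^sub>R X) y') = complex_of_real (\<epsilon> ^ ?d) * (LBINT z. u (\<epsilon> *\<^sub>R (X + z)) * complex_of_real (gauss s (z - a)))" for X
  proof -
    have "(LBINT y'. u y' * k (\<epsilon> *\<^sub>R X) y') = (LBINT y'. u (\<epsilon> *\<^sub>R X + y') * k (\<epsilon> *\<^sub>R X) (\<epsilon> *\<^sub>R X + y'))"
      by (rule integral_lborel_translate[symmetric]) measurable
    also have "\<dots> = complex_of_real (\<epsilon> ^ ?d) * (LBINT z. u (\<epsilon> *\<^sub>R X + \<epsilon> *\<^sub>R z) * k (\<epsilon> *\<^sub>R X) (\<epsilon> *\<^sub>R X + \<epsilon> *\<^sub>R z))"
      using pos by (subst integral_lborel_scale[of _ \<epsilon>]) (auto simp: scaleR_conv_of_real)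
    also have "\<dots> = complex_of_real (\<epsilon> ^ ?d) * (LBINT z. u (\<epsilon> *\<^sub>R (X + z)) * complex_of_real (gauss s (z - a)))"
    proof -
      have "k (\<epsilon> *\<^sub>R X) (\<epsilon> *\<^sub>R X + \<epsilon> *\<^sub>R z) = complex_of_real (gauss s (z - a))" for z
        using pos gauss_minus[of s "z - a"] by (simp add: k_def)
      then show ?thesis by (simp add: scaleR_add_right)
    qed
    finally show ?thesis .
  qed
  have "wigner_distribution \<epsilon> (dist_of_fun u) (gauss_pair \<sigma> y s a)
     = complex_of_real (1 / (2 * pi * \<epsilon>) ^ ?d) * cnj (LINT x|lebesgue. u x * cnj (complex_of_real (\<epsilon> ^ ?d) *
        (complex_of_real ((2 * pi / \<epsilon>) ^ ?d) * (g x * (LBINT y'. u y' * k x y')))))"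
    unfolding wigner_distribution_def dist_mult_def dist_tensor_def dist_cnj_def dist_dilate_def dist_fourier_def dist_of_fun_def
    by (simp only: prod.case fourier_gauss_pair[OF pos(1,3)] flip: g_def) (simp only: 1)
  also have "cnj (LINT x|lebesgue. u x * cnj (complex_of_real (\<epsilon> ^ ?d) *
        (complex_of_real ((2 * pi / \<epsilon>) ^ ?d) * (g x * (LBINT y'. u y' * k x y')))))
     = (LBINT x. complex_of_real (\<epsilon> ^ ?d * (2 * pi / \<epsilon>) ^ ?d) * (cnj (u x) * (g x * (LBINT y'. u y' * k x y'))))"
  proof -
    let ?Z = "\<lambda>x. complex_of_real (\<epsilon> ^ ?d) * (complex_of_real ((2 * pi / \<epsilon>) ^ ?d) * (g x * (LBINT y'. u y' * k x y')))"
    have "cnj (LINT x|lebesgue. u x * cnj (?Z x)) = (LINT x|lebesgue. cnj (u x * cnj (?Z x)))"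
      by (rule Bochner_Integration.integral_cnj[symmetric])
    also have "\<dots> = (LINT x|lebesgue. cnj (u x) * ?Z x)" by simp
    also have "\<dots> = (LBINT x. cnj (u x) * ?Z x)"
      by (rule integral_completion) measurable
    finally show ?thesis by (simp only: of_real_mult mult_ac)
  qed
  also have "\<dots> = complex_of_real (\<epsilon> ^ ?d * (2 * pi / \<epsilon>) ^ ?d) * (LBINT x. cnj (u x) * (g x * (LBINT y'. u y' * k x y')))"
    by (rule integral_mult_right_zero)
  \<comment> \<open>The prefactor of the distribution, the Jacobian of the dilation and the constant
    of the Gaussian transform combine to \<open>1 / \<epsilon> ^ ?d\<close>.\<close>
  also have "complex_of_real (1 / (2 * pi * \<epsilon>) ^ ?d) * (complex_of_real (\<epsilon> ^ ?d * (2 * pi / \<epsilon>) ^ ?d) * (LBINT x. cnj (u x) * (g x * (LBINT y'. u y' * k x y'))))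
    = complex_of_real (1 / \<epsilon> ^ ?d) * (LBINT x. cnj (u x) * (g x * (LBINT y'. u y' * k x y')))"
    using pos by (simp add: power_mult_distrib power_divide field_simps)
  also have "(LBINT x. cnj (u x) * (g x * (LBINT y'. u y' * k x y')))
    = complex_of_real (\<epsilon> ^ ?d) * (LBINT X. cnj (u (\<epsilon> *\<^sub>R X)) * (g (\<epsilon> *\<^sub>R X) * (LBINT y'. u y' * k (\<epsilon> *\<^sub>R X) y')))"
    using pos by (subst integral_lborel_scale[of _ \<epsilon>]) (auto simp: scaleR_conv_of_real)
  also have "complex_of_real (1 / \<epsilon> ^ ?d) * (complex_of_real (\<epsilon> ^ ?d) * (LBINT X. cnj (u (\<epsilon> *\<^sub>R X)) * (g (\<epsilon> *\<^sub>R X) * (LBINT y'. u y' * k (\<epsilon> *\<^sub>R X) y'))))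
    = (LBINT X. cnj (u (\<epsilon> *\<^sub>R X)) * (g (\<epsilon> *\<^sub>R X) * (complex_of_real (\<epsilon> ^ ?d) * (LBINT z. u (\<epsilon> *\<^sub>R (X + z)) * complex_of_real (gauss s (z - a))))))"
    using pos by (simp add: inner)
  also have "\<dots> = (LBINT X. (LBINT z. complex_of_real (gauss s (z - a)) * (cnj (unit_scale \<epsilon> u X) * g (\<epsilon> *\<^sub>R X) * unit_scale \<epsilon> u (X + z))))"
  proof (rule Bochner_Integration.integral_cong[OF refl])
    fix X
    \<comment> \<open>The remaining power of \<epsilon> is shared equally by the two copies of
      \<open>u\<close>, which is the normalization in \<open>unit_scale\<close>.\<close>
    have sq: "complex_of_real (\<epsilon> ^ ?d) = complex_of_real (sqrt \<epsilon> ^ ?d) * complex_of_real (sqrt \<epsilon> ^ ?d)"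
      using pos by (simp add: power_mult_distrib[symmetric] flip: of_real_mult of_real_power)
    have "cnj (u (\<epsilon> *\<^sub>R X)) * (g (\<epsilon> *\<^sub>R X) * (complex_of_real (\<epsilon> ^ ?d) * (LBINT z. u (\<epsilon> *\<^sub>R (X + z)) * complex_of_real (gauss s (z - a)))))
     = (cnj (u (\<epsilon> *\<^sub>R X)) * g (\<epsilon> *\<^sub>R X) * complex_of_real (\<epsilon> ^ ?d)) * (LBINT z. u (\<epsilon> *\<^sub>R (X + z)) * complex_of_real (gauss s (z - a)))"
      by (simp add: mult_ac)
    also have "\<dots> = (LBINT z. (cnj (u (\<epsilon> *\<^sub>R X)) * g (\<epsilon> *\<^sub>R X) * complex_of_real (\<epsilon> ^ ?d)) * (u (\<epsilon> *\<^sub>R (X + z)) * complex_of_real (gauss s (z - a))))"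
      by (rule integral_mult_right_zero[symmetric])
    also have "\<dots> = (LBINT z. complex_of_real (gauss s (z - a)) * (cnj (unit_scale \<epsilon> u X) * g (\<epsilon> *\<^sub>R X) * unit_scale \<epsilon> u (X + z)))"
      unfolding unit_scale_def sq by (simp add: mult_ac)
    finally show "cnj (u (\<epsilon> *\<^sub>R X)) * (g (\<epsilon> *\<^sub>R X) * (complex_of_real (\<epsilon> ^ ?d) * (LBINT z. u (\<epsilon> *\<^sub>R (X + z)) * complex_of_real (gauss s (z - a)))))
      = (LBINT z. complex_of_real (gauss s (z - a)) * (cnj (unit_scale \<epsilon> u X) * g (\<epsilon> *\<^sub>R X) * unit_scale \<epsilon> u (X + z)))" .
  qed
  also have "\<dots> = (LBINT z. complex_of_real (gauss s (z - a)) * corr (unit_scale \<epsilon> u) (\<lambda>X. g (\<epsilon> *\<^sub>R X)) z)"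
  proof (rule corr_Fubini(2)[symmetric])
    show "sq_int (unit_scale \<epsilon> u)" by (rule sq_int_unit_scale) fact+
    show "norm (g (\<epsilon> *\<^sub>R X)) \<le> (1 / (sqrt (2 * pi) * \<sigma>)) ^ ?d" for X
      using gauss_le[OF pos(2), of "\<epsilon> *\<^sub>R X - y"] gauss_nonneg[OF pos(2), of "\<epsilon> *\<^sub>R X - y"] by (simp add: g_def)
    show "complex_integrable lborel (\<lambda>z. complex_of_real (gauss s (z - a)))"
      using gauss_translate(1)[OF pos(3), of a] by (rule integrable_of_real)
  qed measurable
  finally show ?thesis by (simp add: g_def)
qed

section \<open>Continuous functions of compact support\<close>

definition Cc :: "('a::euclidean_space \<Rightarrow> complex) \<Rightarrow> bool" where
  "Cc f \<longleftrightarrow> continuous_on UNIV f \<and> (\<exists>R. \<forall>x. norm x > R \<longrightarrow> f x = 0)"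

lemma Cc_measurable: "Cc f \<Longrightarrow> f \<in> borel_measurable borel"
  by (auto simp: Cc_def intro: borel_measurable_continuous_onI)

lemma Cc_bounded:
  assumes "Cc f" obtains K where "K \<ge> 0" "\<And>x. norm (f x) \<le> K"
proof -
  obtain R where R: "\<And>x. norm x > R \<Longrightarrow> f x = 0" using assms by (auto simp: Cc_def)
  have "compact (f ` cball 0 R)"
    using assms by (intro compact_continuous_image) (auto simp: Cc_def intro: continuous_on_subset)
  then obtain K where "\<forall>y\<in>f ` cball 0 R. norm y \<le> K"
    using compact_imp_bounded bounded_iff by blast
  then have "\<And>x. x \<in> cball 0 R \<Longrightarrow> norm (f x) \<le> K" by blast
  then have "norm (f x) \<le> max K 0" for x
    using R[of x] by (cases "norm x > R") (auto intro: order_trans[OF _ max.cobounded1])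
  then show thesis using that[of "max K 0"] by auto
qed

lemma Cc_uniform:
  assumes "Cc f" "e > 0" obtains \<delta> where "\<delta> > 0" "\<And>x y. norm (x - y) < \<delta> \<Longrightarrow> norm (f x - f y) < e"
proof -
  obtain R where R: "\<And>x. norm x > R \<Longrightarrow> f x = 0" using assms by (auto simp: Cc_def)
  \<comment> \<open>With a margin 1 around the support and points closer than 1, only two cases are
    left: both points lie in the larger ball, or \<open>f\<close> vanishes at both.\<close>
  have "uniformly_continuous_on (cball 0 (R + 1)) f"
    using assms by (intro compact_uniformly_continuous) (auto simp: Cc_def intro: continuous_on_subset)
  then obtain \<delta> where \<delta>: "\<delta> > 0" "\<And>x y. x \<in> cball 0 (R+1) \<Longrightarrow> y \<in> cball 0 (R+1) \<Longrightarrow> dist x y < \<delta> \<Longrightarrow> dist (f x) (f y) < e"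
    using assms(2) unfolding uniformly_continuous_on_def by metis
  have "norm (f x - f y) < e" if "norm (x - y) < min \<delta> 1" for x y
  proof (cases "x \<in> cball 0 (R+1) \<and> y \<in> cball 0 (R+1)")
    case True then show ?thesis using \<delta>(2)[of x y] that by (auto simp: dist_norm)
  next
    case False
    then have "norm x > R" "norm y > R"
      using that norm_triangle_ineq2[of x y] norm_triangle_ineq2[of y x] by (auto simp: norm_minus_commute)
    then show ?thesis using R assms(2) by simp
  qed
  then show thesis using that[of "min \<delta> 1"] \<delta>(1) by auto
qed

lemma Cc_integrable:
  assumes "Cc f" shows "integrable lborel f"
proof -
  obtain R where R: "\<And>x. norm x > R \<Longrightarrow> f x = 0" using assms by (auto simp: Cc_def)
  obtain K where K: "\<And>x. norm (f x) \<le> K" using Cc_bounded[OF assms] by auto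
  have i: "integrable lborel (\<lambda>x::'a. K * indicator (cball 0 R) x)"
    using emeasure_lborel_cball_finite[of "0::'a" R] by (intro integrable_mult_right integrable_real_indicator) auto
  show ?thesis
  proof (rule Bochner_Integration.integrable_bound[OF i])
    show "f \<in> borel_measurable lborel" using Cc_measurable[OF assms] by simp
    show "AE x in lborel. norm (f x) \<le> norm (K * indicator (cball 0 R) x)"
    proof (rule AE_I2)
      fix x show "norm (f x) \<le> norm (K * indicator (cball 0 R) x)"
      proof (cases "norm x > R")
        case False
        then show ?thesis using K[of x] by (simp add: indicator_def)
      qed (simp add: R)
    qed
  qed
qed

lemma Cc_mult_bounded_uniform:
  assumes "Cc f" "continuous_on UNIV g"
  shows "Cc (\<lambda>x. f x * g x)"
  using assms by (auto simp: Cc_def intro!: continuous_intros)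

lemma Cc_norm: "Cc f \<Longrightarrow> Cc (\<lambda>x. complex_of_real (norm (f x)))"
  by (auto simp: Cc_def intro!: continuous_intros)

text \<open>The exchange of limits with an approximating sequence, and a limit of it, chosen afresh
  for each error \<open>e\<close>.\<close>

lemma tendsto_approx:
  fixes c :: "nat \<Rightarrow> 'a::real_normed_vector"
  assumes "\<And>e. e > 0 \<Longrightarrow> \<exists>a b. a \<longlonglongrightarrow> b \<and> (\<forall>k. norm (a k - c k) \<le> e) \<and> norm (b - L) \<le> e"
  shows "c \<longlonglongrightarrow> L"
proof (rule metric_LIMSEQ_I)
  fix e :: real assume "e > 0"
  then obtain a b where ab: "a \<longlonglongrightarrow> b" "\<And>k. norm (a k - c k) \<le> e/4" "norm (b - L) \<le> e/4"
    using assms[of "e/4"] by auto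
  obtain K where K: "\<And>k. k \<ge> K \<Longrightarrow> dist (a k) b < e/4"
    using metric_LIMSEQ_D[OF ab(1), of "e/4"] \<open>e > 0\<close> by auto
  have "dist (c k) L < e" if "k \<ge> K" for k
  proof -
    have "dist (c k) L \<le> dist (a k) (c k) + dist (a k) b + dist b L"
      by (smt (verit) dist_commute dist_triangle)
    then show ?thesis using K[OF that] ab(2)[of k] ab(3) \<open>e > 0\<close> by (simp add: dist_norm)
  qed
  then show "\<exists>K. \<forall>k\<ge>K. dist (c k) L < e" by blast
qed

text \<open>The sign of the exponent is opposite to that of \<open>fourier\<close>; it matches the
  lag convention \<open>w (x + z)\<close> in \<open>corr\<close>, so that integrating correlations
  against \<kappa> corresponds to the symbol \<open>ctr \<kappa>\<close>.\<close>

definition ctr :: "('a::euclidean_space \<Rightarrow> complex) \<Rightarrow> 'a \<Rightarrow> complex" where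
  "ctr \<kappa> \<xi> = (LBINT a. \<kappa> a * cis (a \<bullet> \<xi>))"

lemma ctr_bound:
  assumes "integrable lborel \<kappa>"
  shows "norm (ctr \<kappa> \<xi>) \<le> (LBINT a. norm (\<kappa> a))"
proof -
  have "norm (ctr \<kappa> \<xi>) \<le> (LBINT a. norm (\<kappa> a * cis (a \<bullet> \<xi>)))"
    unfolding ctr_def by (rule integral_norm_bound)
  then show ?thesis by (simp add: norm_mult)
qed

lemma measurable_ctr [measurable (raw)]:
  assumes [measurable]: "\<kappa> \<in> borel_measurable borel"
  shows "ctr \<kappa> \<in> borel_measurable borel"
  unfolding ctr_def [abs_def] by measurable

lemma measurable_ctr_compose [measurable]:
  assumes "\<kappa> \<in> borel_measurable borel" and "g \<in> borel_measurable M"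
  shows "(\<lambda>x. ctr \<kappa> (g x)) \<in> borel_measurable M"
  using measurable_compose[OF assms(2) measurable_ctr[OF assms(1)]] .

lemma measurable_corr_compose [measurable]:
  assumes "w \<in> borel_measurable borel" "f \<in> borel_measurable borel" and "g \<in> borel_measurable M"
  shows "(\<lambda>x. corr w f (g x)) \<in> borel_measurable M"
  using measurable_compose[OF assms(3) measurable_corr[OF assms(1,2)]] .

lemma integrable_mult_bounded:
  fixes f g :: "'a \<Rightarrow> complex"
  assumes "integrable M f" "g \<in> borel_measurable M" "\<And>x. norm (g x) \<le> K"
  shows "integrable M (\<lambda>x. f x * g x)"
proof (rule Bochner_Integration.integrable_bound)
  show "integrable M (\<lambda>x. norm (f x) * K)" using assms by simp
  show "AE x in M. norm (f x * g x) \<le> norm (norm (f x) * K)"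
    using assms(3) by (intro AE_I2) (auto simp: norm_mult intro!: order_trans[OF mult_left_mono[OF assms(3)]] order_trans[OF _ abs_ge_self])
qed (use assms in auto)

lemma norm_integral_mult_bound:
  fixes f g :: "'a \<Rightarrow> complex"
  assumes "integrable M f" "g \<in> borel_measurable M" "\<And>x. norm (g x) \<le> K"
  shows "norm (LINT x|M. f x * g x) \<le> (LINT x|M. norm (f x)) * K"
proof -
  have "norm (LINT x|M. f x * g x) \<le> (LINT x|M. norm (f x * g x))" by (rule integral_norm_bound)
  also have "\<dots> \<le> (LINT x|M. norm (f x) * K)"
  proof (rule integral_mono)
    show "integrable M (\<lambda>x. norm (f x * g x))"
      using integrable_mult_bounded[OF assms] by (rule integrable_norm)
    show "integrable M (\<lambda>x. norm (f x) * K)" using assms(1) by simp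
    show "norm (f x * g x) \<le> norm (f x) * K" for x
      by (simp add: norm_mult mult_left_mono assms(3))
  qed
  finally show ?thesis by simp
qed

subsection \<open>Limits of correlations\<close>

text \<open>The Wigner measure is tested on Gaussian pairs only. For these the distributional pairing is an
  absolutely convergent integral, and they already determine all the limits needed.\<close>

locale wigner_seq =
  fixes w :: "nat \<Rightarrow> 'a::euclidean_space \<Rightarrow> complex" and h :: "nat \<Rightarrow> real"
    and \<mu> :: "('a \<times> 'a) measure" and B :: real
  assumes w: "\<And>k. sq_int (w k)" and wB: "\<And>k. (LBINT x. (norm (w k x))\<^sup>2) \<le> B"
    and hpos: "\<And>k. 0 < h k" and h0: "h \<longlonglongrightarrow> 0" and sets_mu: "sets \<mu> = sets borel"
    and wig_int: "\<And>\<sigma> y s a. \<sigma> > 0 \<Longrightarrow> s > 0 \<Longrightarrow> integrable \<mu> (gauss_pair \<sigma> y s a)"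
    and wig: "\<And>\<sigma> y s a. \<sigma> > 0 \<Longrightarrow> s > 0 \<Longrightarrow>
      (\<lambda>k. LBINT z. complex_of_real (gauss s (z - a)) * corr (w k) (\<lambda>X. complex_of_real (gauss \<sigma> (h k *\<^sub>R X - y))) z)
      \<longlonglongrightarrow> (LINT p|\<mu>. gauss_pair \<sigma> y s a p)"
begin

declare sets_mu [measurable_cong]

lemma B_nonneg: "0 \<le> B"
  using wB[of 0] by (rule order_trans[rotated]) simp

lemma measurable_w [measurable]: "w k \<in> borel_measurable borel"
  using w by (auto simp: sq_int_def)

lemma measurable_fst_mu [measurable]: "fst \<in> \<mu> \<rightarrow>\<^sub>M borel" "snd \<in> \<mu> \<rightarrow>\<^sub>M borel"
proof -
  have "fst \<in> (borel :: ('a \<times> 'a) measure) \<rightarrow>\<^sub>M borel" "snd \<in> (borel :: ('a \<times> 'a) measure) \<rightarrow>\<^sub>M borel"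
    unfolding borel_prod[symmetric] by simp_all
  then show "fst \<in> \<mu> \<rightarrow>\<^sub>M borel" "snd \<in> \<mu> \<rightarrow>\<^sub>M borel"
    using measurable_cong_sets[OF sets_mu refl, of borel] by simp_all
qed

lemma space_mu: "space \<mu> = UNIV"
  using sets_eq_imp_space_eq[OF sets_mu] by simp

lemma gauss_norm_le: "r > 0 \<Longrightarrow> norm (complex_of_real (gauss r z)) \<le> (1 / (sqrt (2 * pi) * r)) ^ DIM('a)" for z :: 'a
  using gauss_le[of r z] gauss_nonneg[of r z] by simp

lemma corr_le:
  assumes "f \<in> borel_measurable borel" "\<And>x. norm (f x) \<le> K"
  shows "norm (corr (w k) f z) \<le> K * B"
proof -
  have "0 \<le> K" using assms(2)[of undefined] norm_ge_zero order_trans by blast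
  then have "K * (LBINT x. (norm (w k x))\<^sup>2) \<le> K * B" by (intro mult_left_mono wB)
  then show ?thesis using corr_bound[OF w assms, of k z] by simp
qed

text \<open>Gaussian pairs with \<open>y = 0\<close> and \<open>a = 0\<close>, position width
  \<open>n + 1\<close> and \<open>s = 1 / (n + 1)\<close>, divided by their peak value, tend to 1
  pointwise. Against each of them the limit of the correlations is at most \<open>B\<close>, and
  Fatou's lemma passes to the total mass.\<close>

lemma mu_finite: "emeasure \<mu> (space \<mu>) \<le> ennreal B"
proof -
  define g where "g n p = exp (- (norm (fst p))\<^sup>2 / (2 * (real (Suc n))\<^sup>2)) * exp (- (1 / real (Suc n))\<^sup>2 * (norm (snd p))\<^sup>2 / 2)" for n and p :: "'a \<times> 'a"
  have [measurable]: "g n \<in> borel_measurable \<mu>" for n unfolding g_def [abs_def] by measurable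
  have g0: "0 \<le> g n p" for n p by (simp add: g_def)
  have le: "(\<integral>\<^sup>+p. ennreal (g n p) \<partial>\<mu>) \<le> ennreal B" for n
  proof -
    define \<sigma> where "\<sigma> = real (Suc n)"
    define s where "s = 1 / real (Suc n)"
    have pos: "\<sigma> > 0" "s > 0" by (auto simp: \<sigma>_def s_def)
    define K where "K = (1 / (sqrt (2 * pi) * \<sigma>)) ^ DIM('a)"
    have K: "K > 0" using pos by (simp add: K_def)
    have e: "gauss_pair \<sigma> 0 s 0 p = complex_of_real (K * g n p)" for p
      by (cases p) (simp add: gauss_pair_def gauss_def K_def g_def s_def \<sigma>_def)
    have i: "integrable \<mu> (\<lambda>p. K * g n p)"
      using wig_int[OF pos, of 0 0] unfolding e complex_of_real_integrable_eq .
    have b: "norm (LBINT z. complex_of_real (gauss s (z - 0)) * corr (w k) (\<lambda>X. complex_of_real (gauss \<sigma> (h k *\<^sub>R X - 0))) z) \<le> K * B" for k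
    proof -
      have "norm (LBINT z. complex_of_real (gauss s z) * corr (w k) (\<lambda>X. complex_of_real (gauss \<sigma> (h k *\<^sub>R X - 0))) z) \<le> (LBINT z. norm (complex_of_real (gauss s (z::'a)))) * (K * B)"
        using gauss_norm_le[OF pos(1)] integral_gauss(1)[OF pos(2), where 'a='a]
        by (intro norm_integral_mult_bound corr_le integrable_of_real) (auto simp: K_def)
      then show ?thesis using integral_gauss(2)[OF pos(2), where 'a='a] gauss_nonneg[OF pos(2), where 'a='a] by simp
    qed
    have "norm (LINT p|\<mu>. gauss_pair \<sigma> 0 s 0 p) \<le> K * B"
      by (rule Lim_bounded[OF tendsto_norm[OF wig[OF pos, of 0 0]]]) (use b in blast)
    moreover have "(LINT p|\<mu>. complex_of_real (K * g n p)) = complex_of_real (LINT p|\<mu>. K * g n p)"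
      by (rule integral_complex_of_real)
    ultimately have "\<bar>(LINT p|\<mu>. K * g n p)\<bar> \<le> K * B"
      unfolding e by (simp only: norm_of_real)
    then have "K * (LINT p|\<mu>. g n p) \<le> K * B" by simp
    then have "(LINT p|\<mu>. g n p) \<le> B" using K by simp
    moreover have "integrable \<mu> (g n)" using i K by simp
    ultimately show ?thesis using g0 by (subst nn_integral_eq_integral) (auto intro: ennreal_leI)
  qed
  have "emeasure \<mu> (space \<mu>) = (\<integral>\<^sup>+p. 1 \<partial>\<mu>)" by simp
  also have "\<dots> = (\<integral>\<^sup>+p. liminf (\<lambda>n. ennreal (g n p)) \<partial>\<mu>)"
  proof (rule nn_integral_cong)
    fix p :: "'a \<times> 'a"
    have "(\<lambda>n. g n p) \<longlonglongrightarrow> exp 0 * exp 0"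
    proof -
      have "(\<lambda>n. - (norm (fst p))\<^sup>2 / (2 * (real (Suc n))\<^sup>2)) \<longlonglongrightarrow> 0" "(\<lambda>n. - (1 / real (Suc n))\<^sup>2 * (norm (snd p))\<^sup>2 / 2) \<longlonglongrightarrow> 0"
        by real_asymp+
      then show ?thesis unfolding g_def by (intro tendsto_intros)
    qed
    then have "(\<lambda>n. ennreal (g n p)) \<longlonglongrightarrow> ennreal 1" by (intro tendsto_ennrealI) simp
    then show "1 = liminf (\<lambda>n. ennreal (g n p))" by (simp add: lim_imp_Liminf)
  qed
  also have "\<dots> \<le> liminf (\<lambda>n. \<integral>\<^sup>+p. ennreal (g n p) \<partial>\<mu>)"
    by (rule nn_integral_liminf) measurable
  also have "\<dots> \<le> ennreal B"
    by (rule Liminf_le) (use le in \<open>auto intro!: always_eventually\<close>)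
  finally show ?thesis .
qed

sublocale finite_measure \<mu>
  by standard (use mu_finite in \<open>auto simp: top_unique\<close>)

sublocale P: pair_sigma_finite lborel \<mu> ..

lemma measurable_gauss_pair_P [measurable]:
  "(\<lambda>(a, p). gauss_pair \<sigma> y s a p) \<in> borel_measurable (lborel \<Otimes>\<^sub>M \<mu>)"
  unfolding gauss_pair_def case_prod_beta by measurable

lemma norm_gauss_pair:
  "\<sigma> > 0 \<Longrightarrow> norm (gauss_pair \<sigma> y s a p) \<le> (1 / (sqrt (2 * pi) * \<sigma>)) ^ DIM('a)" for y a :: 'a
  unfolding gauss_pair_def case_prod_beta norm_mult
  using mult_mono[OF gauss_norm_le[of \<sigma> "fst p - y"], of "norm (cis (a \<bullet> snd p)) * norm (complex_of_real (exp (- s\<^sup>2 * (norm (snd p))\<^sup>2 / 2)))" 1]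
  by simp

text \<open>The hypotheses on the sequence cover only Gaussian kernels in the lag. A general kernel
  is reached by averaging the correlation over a narrow Gaussian. To keep the error uniform in
  \<open>k\<close> the average is moved onto \<kappa>: the correlations have no common modulus of
  continuity in the lag, whereas \<kappa> has one in L1.\<close>

lemma corr_gauss_limit:
  assumes \<kappa>: "integrable lborel \<kappa>" and \<sigma>: "\<sigma> > 0"
  shows "(\<lambda>k. LBINT a. \<kappa> a * corr (w k) (\<lambda>X. complex_of_real (gauss \<sigma> (h k *\<^sub>R X - y))) a)
    \<longlonglongrightarrow> (LINT p|\<mu>. complex_of_real (gauss \<sigma> (fst p - y)) * ctr \<kappa> (snd p))"
proof -
  have [measurable]: "\<kappa> \<in> borel_measurable borel" using \<kappa> by auto
  define K where "K = (1 / (sqrt (2 * pi) * \<sigma>)) ^ DIM('a)"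
  have K0: "K \<ge> 0" using \<sigma> by (simp add: K_def)
  define c where "c k = corr (w k) (\<lambda>X. complex_of_real (gauss \<sigma> (h k *\<^sub>R X - y)))" for k
  have [measurable]: "c k \<in> borel_measurable borel" for k unfolding c_def by measurable
  have cb: "norm (c k z) \<le> K * B" for k z
    unfolding c_def by (rule corr_le) (use gauss_norm_le[OF \<sigma>] in \<open>auto simp: K_def\<close>)
  define s where "s N = 1 / real (Suc N)" for N
  have s: "s N > 0" for N by (simp add: s_def)
  have s0: "s \<longlonglongrightarrow> 0" unfolding s_def by real_asymp
  let ?q = "\<lambda>p. complex_of_real (gauss \<sigma> (fst p - y)) * ctr \<kappa> (snd p)"
  let ?g = "\<lambda>N k a. LBINT z. complex_of_real (gauss (s N) (z - a)) * c k z"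
  let ?e = "\<lambda>r p. complex_of_real (exp (- r\<^sup>2 * (norm (snd (p :: 'a \<times> 'a)))\<^sup>2 / 2))"
  \<comment> \<open>The L1 modulus of continuity of \<kappa>. Averaged against a narrow Gaussian it
    bounds the error for all \<open>k\<close> at once.\<close>
  define \<rho> where "\<rho> z = (LBINT a. norm (\<kappa> (a - z) - \<kappa> a))" for z
  let ?R = "\<lambda>N. LBINT z. complex_of_real (gauss (s N) z) * complex_of_real (\<rho> z * (K * B))"
  let ?h = "\<lambda>N z. complex_of_real (gauss (s N) z)"
  have [measurable]: "\<rho> \<in> borel_measurable borel" unfolding \<rho>_def [abs_def] by measurable
  have \<rho>0: "0 \<le> \<rho> z" for z by (simp add: \<rho>_def)
  have i\<kappa>: "integrable lborel (\<lambda>a. \<kappa> (a - z))" for z by (rule integrable_lborel_translate_minus[OF \<kappa>])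
  have \<rho>b: "\<rho> z \<le> 2 * (LBINT a. norm (\<kappa> a))" for z
  proof -
    have "\<rho> z \<le> (LBINT a. norm (\<kappa> (a - z)) + norm (\<kappa> a))"
      unfolding \<rho>_def using \<kappa> i\<kappa> by (intro integral_mono norm_triangle_ineq4) auto
    also have "\<dots> = (LBINT a. norm (\<kappa> (a - z))) + (LBINT a. norm (\<kappa> a))"
      using \<kappa> i\<kappa> by simp
    also have "(LBINT a. norm (\<kappa> (a - z))) = (LBINT a. norm (\<kappa> a))"
      by (rule integral_lborel_translate_minus) measurable
    finally show ?thesis by simp
  qed
  have ig: "integrable lborel (\<lambda>z. complex_of_real (gauss r (z - a)))" if "r > 0" for r and a :: 'a
    using gauss_translate(1)[OF that, of a] by (rule integrable_of_real)
  have ng: "(LBINT z. norm (complex_of_real (gauss r (z - a)))) = 1" if "r > 0" for r and a :: 'a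
    using gauss_translate(2)[OF that, of a] gauss_nonneg[OF that, where 'a='a] by simp
  show ?thesis
  proof (rule tendsto_interchange[where a = "\<lambda>N k. LBINT a. \<kappa> a * (?g N k a)"
      and b = "\<lambda>N. LBINT a. \<kappa> a * (LINT p|\<mu>. gauss_pair \<sigma> y (s N) a p)"
      and \<eta> = "\<lambda>N. norm (?R N)"])
    show "(\<lambda>k. LBINT a. \<kappa> a * (?g N k a)) \<longlonglongrightarrow> (LBINT a. \<kappa> a * (LINT p|\<mu>. gauss_pair \<sigma> y (s N) a p))" for N
    proof (rule integral_dominated_convergence[where w = "\<lambda>a. norm (\<kappa> a) * (K * B)"])
      show "AE a in lborel. (\<lambda>k. \<kappa> a * (?g N k a)) \<longlonglongrightarrow> \<kappa> a * (LINT p|\<mu>. gauss_pair \<sigma> y (s N) a p)"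
        unfolding c_def by (intro AE_I2 tendsto_intros wig \<sigma> s)
      show "AE a in lborel. norm (\<kappa> a * (?g N k a)) \<le> norm (\<kappa> a) * (K * B)" for k
      proof (rule AE_I2)
        fix a
        have "norm (?g N k a) \<le> K * B"
          using norm_integral_mult_bound[OF ig[OF s], of "c k" "K * B" N a] cb ng[OF s] by simp
        then show "norm (\<kappa> a * (?g N k a)) \<le> norm (\<kappa> a) * (K * B)"
          by (simp add: norm_mult mult_left_mono)
      qed
    qed (use \<kappa> in auto)
    show "(\<lambda>N. LBINT a. \<kappa> a * (LINT p|\<mu>. gauss_pair \<sigma> y (s N) a p)) \<longlonglongrightarrow> (LINT p|\<mu>. ?q p)"
    proof -
      \<comment> \<open>Integrating the Gaussian pairs against \<kappa> over the centre
        \<open>a\<close> produces \<open>ctr \<kappa>\<close> times a damping factor in frequency,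
        which tends to 1 as the width goes to 0.\<close>
      have eq: "(LBINT a. \<kappa> a * (LINT p|\<mu>. gauss_pair \<sigma> y r a p)) = (LINT p|\<mu>. ?e r p * (?q p))" for r
      proof -
        let ?f = "\<lambda>a p. \<kappa> a * gauss_pair \<sigma> y r a p"
        have m: "case_prod ?f \<in> borel_measurable (lborel \<Otimes>\<^sub>M \<mu>)"
          using measurable_gauss_pair_P[of \<sigma> y r] by measurable
        have "(\<integral>\<^sup>+a. (\<integral>\<^sup>+p. norm (?f a p) \<partial>\<mu>) \<partial>lborel) \<le> (\<integral>\<^sup>+a. (\<integral>\<^sup>+p. ennreal (norm (\<kappa> a)) * ennreal K \<partial>\<mu>) \<partial>lborel)"
        proof (intro nn_integral_mono)
          fix a p
          show "ennreal (norm (?f a p)) \<le> ennreal (norm (\<kappa> a)) * ennreal K"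
            using norm_gauss_pair[OF \<sigma>, of y r a p] K0
            by (auto simp: norm_mult K_def ennreal_mult[symmetric] intro!: ennreal_leI mult_left_mono)
        qed
        also have "\<dots> = (\<integral>\<^sup>+a. ennreal (norm (\<kappa> a)) \<partial>lborel) * (ennreal K * emeasure \<mu> (space \<mu>))"
          by (simp add: nn_integral_multc mult.assoc)
        also have "\<dots> < \<infinity>"
          using \<kappa> by (auto simp: integrable_iff_bounded ennreal_mult_less_top emeasure_eq_measure)
        finally have fin: "(\<integral>\<^sup>+a. (\<integral>\<^sup>+p. norm (?f a p) \<partial>\<mu>) \<partial>lborel) < \<infinity>" .
        have "(LBINT a. \<kappa> a * (LINT p|\<mu>. gauss_pair \<sigma> y r a p)) = (LBINT a. (LINT p|\<mu>. ?f a p))"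
          by simp
        also have "\<dots> = (LINT p|\<mu>. (LBINT a. ?f a p))"
          by (rule P.Fubini_swap(4)[OF m fin])
        also have "\<dots> = (LINT p|\<mu>. ?e r p * (?q p))"
        proof (rule Bochner_Integration.integral_cong[OF refl])
          fix p :: "'a \<times> 'a"
          have "(LBINT a. ?f a p) = (LBINT a. (?e r p * complex_of_real (gauss \<sigma> (fst p - y))) * (\<kappa> a * cis (a \<bullet> snd p)))"
            by (intro Bochner_Integration.integral_cong) (auto simp: gauss_pair_def case_prod_beta)
          then show "(LBINT a. ?f a p) = ?e r p * (?q p)"
            by (simp only: integral_mult_right_zero ctr_def mult.assoc)
        qed
        finally show ?thesis .
      qed
      show ?thesis unfolding eq
      proof (rule integral_dominated_convergence[where w = "\<lambda>_. K * (LBINT a. norm (\<kappa> a))"])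
        show "AE p in \<mu>. (\<lambda>N. ?e (s N) p * (?q p)) \<longlonglongrightarrow> ?q p"
        proof (rule AE_I2)
          fix p :: "'a \<times> 'a"
          have "(\<lambda>N. ?e (s N) p * (?q p)) \<longlonglongrightarrow> ?e 0 p * (?q p)"
            by (intro tendsto_intros s0) auto
          then show "(\<lambda>N. ?e (s N) p * (?q p)) \<longlonglongrightarrow> ?q p" by simp
        qed
        show "AE p in \<mu>. norm (?e (s N) p * (?q p)) \<le> K * (LBINT a. norm (\<kappa> a))" for N
        proof (rule AE_I2)
          fix p :: "'a \<times> 'a"
          have "norm (?e (s N) p) * (norm (complex_of_real (gauss \<sigma> (fst p - y))) * norm (ctr \<kappa> (snd p))) \<le> 1 * (K * (LBINT a. norm (\<kappa> a)))"
            using gauss_norm_le[OF \<sigma>, of "fst p - y"] ctr_bound[OF \<kappa>, of "snd p"] K0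
            by (intro mult_mono) (auto simp: K_def)
          then show "norm (?e (s N) p * (?q p)) \<le> K * (LBINT a. norm (\<kappa> a))"
            by (simp only: norm_mult mult_1_left)
        qed
      qed auto
    qed
    \<comment> \<open>The shift \<open>z\<close> is carried by \<kappa> instead of the correlation;
      \<open>D k 0\<close> is the quantity whose limit is sought.\<close>
    define D where "D k z = (LBINT a. \<kappa> (a - z) * c k a)" for k z
    have iD: "integrable lborel (\<lambda>a. \<kappa> (a - z) * c k a)" for k z
      by (rule integrable_mult_bounded[OF i\<kappa> _ cb]) measurable
    have Ddiff: "norm (D k z - D k 0) \<le> \<rho> z * (K * B)" for k z
    proof -
      have "D k z - D k 0 = (LBINT a. \<kappa> (a - z) * c k a - \<kappa> (a - 0) * c k a)"
        unfolding D_def by (rule Bochner_Integration.integral_diff[symmetric]) (rule iD)+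
      also have "\<dots> = (LBINT a. (\<kappa> (a - z) - \<kappa> a) * c k a)" by (simp add: left_diff_distrib)
      also have "norm \<dots> \<le> (LBINT a. norm (\<kappa> (a - z) - \<kappa> a)) * (K * B)"
        using i\<kappa> \<kappa> by (intro norm_integral_mult_bound cb) auto
      finally show ?thesis by (simp add: \<rho>_def)
    qed
    have [measurable]: "D k \<in> borel_measurable borel" for k unfolding D_def [abs_def] by measurable
    have Db: "norm (D k z) \<le> (LBINT a. norm (\<kappa> a)) * (K * B)" for k z
    proof -
      have "norm (D k z) \<le> (LBINT a. norm (\<kappa> (a - z))) * (K * B)"
        unfolding D_def by (rule norm_integral_mult_bound[OF i\<kappa> _ cb]) measurable
      also have "(LBINT a. norm (\<kappa> (a - z))) = (LBINT a. norm (\<kappa> a))"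
        by (rule integral_lborel_translate_minus) measurable
      finally show ?thesis .
    qed
    show "norm ((LBINT a. \<kappa> a * (?g N k a)) -
       (LBINT a. \<kappa> a * corr (w k) (\<lambda>X. complex_of_real (gauss \<sigma> (h k *\<^sub>R X - y))) a)) \<le> norm (?R N)" for N k
    proof -
      let ?f = "\<lambda>a z. \<kappa> a * (?h N z * c k (a + z))"
      have m: "case_prod ?f \<in> borel_measurable (lborel \<Otimes>\<^sub>M lborel)" by measurable
      have "(\<integral>\<^sup>+a. (\<integral>\<^sup>+z. norm (?f a z) \<partial>lborel) \<partial>lborel) \<le> (\<integral>\<^sup>+a. (\<integral>\<^sup>+z. ennreal (norm (\<kappa> a)) * (ennreal (gauss (s N) (z::'a)) * ennreal (K * B)) \<partial>lborel) \<partial>lborel)"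
      proof (intro nn_integral_mono)
        fix a z
        have "norm (?f a z) \<le> norm (\<kappa> a) * (gauss (s N) z * (K * B))"
          using cb[of k "a + z"] gauss_nonneg[OF s, of N z] by (auto simp: norm_mult intro!: mult_left_mono)
        then show "ennreal (norm (?f a z)) \<le> ennreal (norm (\<kappa> a)) * (ennreal (gauss (s N) z) * ennreal (K * B))"
          using K0 B_nonneg gauss_nonneg[OF s, of N z] by (simp add: ennreal_mult[symmetric] ennreal_leI)
      qed
      also have "\<dots> = (\<integral>\<^sup>+a. ennreal (norm (\<kappa> a)) \<partial>lborel) * ((\<integral>\<^sup>+z. ennreal (gauss (s N) (z::'a)) \<partial>lborel) * ennreal (K * B))"
        by (simp add: nn_integral_multc nn_integral_cmult)
      also have "\<dots> < \<infinity>"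
        using \<kappa> integral_gauss(1)[OF s[of N], where 'a='a] gauss_nonneg[OF s[of N], where 'a='a]
        by (auto simp: integrable_iff_bounded ennreal_mult_less_top)
      finally have fin: "(\<integral>\<^sup>+a. (\<integral>\<^sup>+z. norm (?f a z) \<partial>lborel) \<partial>lborel) < \<infinity>" .
      have "(LBINT a. \<kappa> a * (?g N k a))
        = (LBINT a. (LBINT z. ?f a z))"
      proof (rule Bochner_Integration.integral_cong[OF refl])
        fix a
        have "(?g N k a) = (LBINT z. complex_of_real (gauss (s N) ((a + z) - a)) * c k (a + z))"
          by (rule integral_lborel_translate[symmetric]) measurable
        then show "\<kappa> a * (?g N k a) = (LBINT z. ?f a z)"
          by simp
      qed
      also have "\<dots> = (LBINT z. (LBINT a. ?f a z))"
        by (rule lborel_pair.Fubini_swap(4)[OF m fin])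
      also have "\<dots> = (LBINT z. ?h N z * D k z)"
      proof (rule Bochner_Integration.integral_cong[OF refl])
        fix z
        have "(LBINT a. ?f a z) = (LBINT a. ?h N z * (\<kappa> a * c k (a + z)))"
          by (simp add: mult_ac)
        also have "\<dots> = ?h N z * (LBINT a. \<kappa> a * c k (a + z))"
          by (rule integral_mult_right_zero)
        also have "(LBINT a. \<kappa> a * c k (a + z)) = D k z"
        proof -
          have "D k z = (LBINT a. \<kappa> ((z + a) - z) * c k (z + a))"
            unfolding D_def by (rule integral_lborel_translate[symmetric]) measurable
          then show ?thesis by (simp add: add.commute)
        qed
        finally show "(LBINT a. ?f a z) = ?h N z * D k z" .
      qed
      finally have 1: "(LBINT a. \<kappa> a * (?g N k a)) = (LBINT z. ?h N z * D k z)" .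
      have ig0: "integrable lborel (\<lambda>z::'a. ?h N z)" using ig[OF s, of N 0] by simp
      have 2: "(LBINT a. \<kappa> a * corr (w k) (\<lambda>X. complex_of_real (gauss \<sigma> (h k *\<^sub>R X - y))) a) = (LBINT z. ?h N (z::'a) * D k 0)"
      proof -
        have "(LBINT z. ?h N (z::'a) * D k 0) = D k 0"
          using integral_gauss(2)[OF s[of N], where 'a='a] by (simp add: integral_of_real)
        then show ?thesis by (simp add: D_def c_def)
      qed
      have i1: "integrable lborel (\<lambda>z. ?h N z * D k z)"
        by (rule integrable_mult_bounded[OF ig0 _ Db]) measurable
      have i3: "integrable lborel (\<lambda>z::'a. ?h N z * complex_of_real (\<rho> z * (K * B)))"
      proof (rule integrable_mult_bounded[OF ig0])
        show "norm (complex_of_real (\<rho> z * (K * B))) \<le> 2 * (LBINT a. norm (\<kappa> a)) * (K * B)" for z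
          unfolding norm_of_real using \<rho>0[of z] K0 B_nonneg \<rho>b[of z] by (subst abs_of_nonneg) (auto intro!: mult_right_mono)
      qed measurable
      have "norm ((LBINT z. ?h N z * D k z) - (LBINT z. ?h N (z::'a) * D k 0))
        = norm (LBINT z. ?h N z * (D k z - D k 0))"
        using i1 ig0 by (subst Bochner_Integration.integral_diff[symmetric]) (auto simp: right_diff_distrib)
      also have "\<dots> \<le> (LBINT z. norm (?h N z * (D k z - D k 0)))"
        by (rule integral_norm_bound)
      also have "\<dots> \<le> (LBINT z. Re (?h N z * complex_of_real (\<rho> z * (K * B))))"
      proof (rule integral_mono)
        show "integrable lborel (\<lambda>z. norm (?h N z * (D k z - D k 0)))"
          using i1 ig0 by (simp add: right_diff_distrib)
        show "integrable lborel (\<lambda>z::'a. Re (?h N z * complex_of_real (\<rho> z * (K * B))))"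
          using i3 by (rule integrable_Re)
        show "norm (?h N z * (D k z - D k 0)) \<le> Re (?h N z * complex_of_real (\<rho> z * (K * B)))" for z
          using mult_left_mono[OF Ddiff[of k z] gauss_nonneg[OF s[of N], of z]] gauss_nonneg[OF s[of N], of z] by (simp add: norm_mult)
      qed
      also have "\<dots> = Re (?R N)"
        using i3 by (rule integral_Re)
      also have "\<dots> \<le> norm (?R N)"
        by (rule complex_Re_le_cmod)
      finally show ?thesis unfolding 1 2 .
    qed
    have "(\<lambda>N. ?R N) \<longlonglongrightarrow> 0"
    proof (rule tendsto_gauss_convolution[OF _ _ s0 s])
      show "norm (complex_of_real (\<rho> z * (K * B))) \<le> 2 * (LBINT a. norm (\<kappa> a)) * (K * B)" for z
        unfolding norm_of_real using \<rho>0[of z] K0 B_nonneg \<rho>b[of z] by (subst abs_of_nonneg) (auto intro!: mult_right_mono)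
      fix t :: "nat \<Rightarrow> 'a" assume "t \<longlonglongrightarrow> 0"
      then have "(\<lambda>n. \<rho> (t n)) \<longlonglongrightarrow> 0" unfolding \<rho>_def by (rule tendsto_L1_translation[OF \<kappa>])
      then have "(\<lambda>n. complex_of_real (\<rho> (t n) * (K * B))) \<longlonglongrightarrow> complex_of_real (0 * (K * B))" by (intro tendsto_intros)
      then show "(\<lambda>n. complex_of_real (\<rho> (t n) * (K * B))) \<longlonglongrightarrow> 0" by simp
    qed measurable
    then show "(\<lambda>N. norm (?R N)) \<longlonglongrightarrow> 0"
      by (rule tendsto_norm_zero)
  qed
qed

end

text \<open>Uniform continuity handles shifts shorter than \<delta>, and the Gaussian mass beyond
  \<delta> is small for a small width, so the approximation is uniform in \<open>x\<close>.\<close>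

lemma gauss_mollify:
  fixes f :: "'a::euclidean_space \<Rightarrow> complex"
  assumes f: "Cc f" and e: "e > 0"
  obtains \<sigma> where "\<sigma> > 0" "\<And>x. norm ((LBINT y. f y * complex_of_real (gauss \<sigma> (x - y))) - f x) \<le> e"
proof -
  have [measurable]: "f \<in> borel_measurable borel" by (rule Cc_measurable[OF f])
  obtain K where K: "K \<ge> 0" "\<And>x. norm (f x) \<le> K" using Cc_bounded[OF f] by blast
  obtain \<delta> where \<delta>: "\<delta> > 0" "\<And>x y. norm (x - y) < \<delta> \<Longrightarrow> norm (f x - f y) < e/2"
    using Cc_uniform[OF f, of "e/2"] e by auto
  define s where "s n = 1 / real (Suc n)" for n
  have s: "s n > 0" for n by (simp add: s_def)
  have s0: "s \<longlonglongrightarrow> 0" unfolding s_def by real_asymp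
  define I where "I = (indicator {t::'a. \<delta> \<le> norm t} :: 'a \<Rightarrow> real)"
  have [measurable]: "I \<in> borel_measurable borel" unfolding I_def by measurable
  have I01: "0 \<le> I t" "I t \<le> 1" for t by (auto simp: I_def indicator_def)
  have "(\<lambda>n. LBINT z. complex_of_real (gauss (s n) z) * complex_of_real (I z)) \<longlonglongrightarrow> 0"
  proof (rule tendsto_gauss_convolution[OF _ _ s0 s])
    show "norm (complex_of_real (I z)) \<le> 1" for z using I01[of z] by simp
    fix t :: "nat \<Rightarrow> 'a" assume "t \<longlonglongrightarrow> 0"
    then have "(\<lambda>n. norm (t n)) \<longlonglongrightarrow> 0" by (rule tendsto_norm_zero)
    then have "\<forall>\<^sub>F n in sequentially. norm (t n) < \<delta>" using \<delta>(1) by (rule order_tendstoD)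
    then have "\<forall>\<^sub>F n in sequentially. complex_of_real (I (t n)) = 0"
      by eventually_elim (auto simp: I_def)
    then show "(\<lambda>n. complex_of_real (I (t n))) \<longlonglongrightarrow> 0" by (rule tendsto_eventually)
  qed measurable
  then have "(\<lambda>n. norm (LBINT z. complex_of_real (gauss (s n) z) * complex_of_real (I z))) \<longlonglongrightarrow> 0" by (rule tendsto_norm_zero)
  \<comment> \<open>With this bound \<open>2 * K\<close> times the tail mass stays below
    \<open>e / 2\<close>; the summand 1 covers \<open>K = 0\<close>.\<close>
  then have "\<forall>\<^sub>F n in sequentially. norm (LBINT z. complex_of_real (gauss (s n) z) * complex_of_real (I z)) < e / (4 * K + 1)"
    using e K by (intro order_tendstoD(2)) auto
  from eventually_happens'[OF sequentially_bot this]
  obtain n where n: "norm (LBINT z. complex_of_real (gauss (s n) z) * complex_of_real (I z)) < e / (4 * K + 1)" ..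
  define \<sigma> where "\<sigma> = s n"
  have \<sigma>: "\<sigma> > 0" using s by (simp add: \<sigma>_def)
  note ig = integral_gauss(1)[OF \<sigma>, where 'a='a]
  have igI: "integrable lborel (\<lambda>z. gauss \<sigma> z * I z)"
    by (rule Bochner_Integration.integrable_bound[OF ig])
      (use I01 gauss_nonneg[OF \<sigma>, where 'a='a] in \<open>auto simp: abs_mult intro!: mult_left_le\<close>)
  have tail: "2 * K * (LBINT z. gauss \<sigma> z * I z) \<le> e/2"
  proof -
    have "(LBINT z. complex_of_real (gauss \<sigma> z) * complex_of_real (I z)) = complex_of_real (LBINT z. gauss \<sigma> z * I z)"
      unfolding of_real_mult[symmetric] by (rule integral_complex_of_real)
    then have t: "(LBINT z. gauss \<sigma> z * I z) < e / (4 * K + 1)"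
      using n by (simp add: \<sigma>_def)
    have "2 * K * (LBINT z. gauss \<sigma> z * I z) \<le> 2 * K * (e / (4 * K + 1))"
      using t K by (intro mult_left_mono) auto
    also have "\<dots> \<le> e/2" using K e by (simp add: field_simps)
    finally show ?thesis .
  qed
  have "norm ((LBINT y. f y * complex_of_real (gauss \<sigma> (x - y))) - f x) \<le> e" for x
  proof -
    have ic: "integrable lborel (\<lambda>t. complex_of_real (gauss \<sigma> (t::'a)))" using ig by (rule integrable_of_real)
    have i1: "integrable lborel (\<lambda>t. complex_of_real (gauss \<sigma> t) * f (x - t))"
      by (rule integrable_mult_bounded[OF ic _ K(2)]) measurable
    have "(LBINT y. f y * complex_of_real (gauss \<sigma> (x - y))) = (LBINT t. f (x - t) * complex_of_real (gauss \<sigma> (x - (x - t))))"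
      by (rule integral_lborel_reflect[symmetric]) measurable
    also have "\<dots> = (LBINT t. complex_of_real (gauss \<sigma> t) * f (x - t))" by (simp add: mult.commute)
    moreover have "f x = (LBINT t. complex_of_real (gauss \<sigma> (t::'a)) * f x)"
      using integral_gauss(2)[OF \<sigma>, where 'a='a] by (simp add: integral_of_real)
    ultimately have "(LBINT y. f y * complex_of_real (gauss \<sigma> (x - y))) - f x = (LBINT t. complex_of_real (gauss \<sigma> t) * f (x - t)) - (LBINT t. complex_of_real (gauss \<sigma> (t::'a)) * f x)"
      by simp
    also have "\<dots> = (LBINT t. complex_of_real (gauss \<sigma> t) * (f (x - t) - f x))"
      using i1 ic by (subst Bochner_Integration.integral_diff[symmetric]) (auto simp: right_diff_distrib)
    also have "norm \<dots> \<le> (LBINT t. norm (complex_of_real (gauss \<sigma> t) * (f (x - t) - f x)))"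
      by (rule integral_norm_bound)
    also have "\<dots> \<le> (LBINT t. gauss \<sigma> t * (e/2) + 2 * K * (gauss \<sigma> t * I t))"
    proof (rule integral_mono)
      show "integrable lborel (\<lambda>t. norm (complex_of_real (gauss \<sigma> t) * (f (x - t) - f x)))"
        using i1 ic by (simp add: right_diff_distrib)
      show "integrable lborel (\<lambda>t::'a. gauss \<sigma> t * (e/2) + 2 * K * (gauss \<sigma> t * I t))"
        using ig igI by simp
      fix t :: 'a
      have "norm (f (x - t) - f x) \<le> e/2 + 2 * K * I t"
      proof (cases "norm t < \<delta>")
        case True
        then have "norm (f (x - t) - f x) < e/2" by (intro \<delta>) simp
        then show ?thesis using K I01[of t] by (smt (verit) mult_nonneg_nonneg)
      next
        case False
        have "norm (f (x - t) - f x) \<le> 2 * K" using norm_triangle_ineq4[of "f (x - t)" "f x"] K(2)[of "x - t"] K(2)[of x] by linarith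
        then show ?thesis using False e by (simp add: I_def)
      qed
      then have "gauss \<sigma> t * norm (f (x - t) - f x) \<le> gauss \<sigma> t * (e/2 + 2 * K * I t)"
        by (rule mult_left_mono) (rule gauss_nonneg[OF \<sigma>])
      then show "norm (complex_of_real (gauss \<sigma> t) * (f (x - t) - f x)) \<le> gauss \<sigma> t * (e/2) + 2 * K * (gauss \<sigma> t * I t)"
        using gauss_nonneg[OF \<sigma>, of t] unfolding norm_mult norm_of_real by (simp add: distrib_left mult_ac)
    qed
    also have "\<dots> = e/2 + 2 * K * (LBINT z. gauss \<sigma> z * I z)"
      using ig igI integral_gauss(2)[OF \<sigma>, where 'a='a] by simp
    also have "\<dots> \<le> e" using tail by simp
    finally show ?thesis .
  qed
  then show thesis using that \<sigma> by blast
qed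

lemma nn_integral_norm_finite:
  fixes f :: "'a \<Rightarrow> complex"
  shows
  "integrable M f \<Longrightarrow> (\<integral>\<^sup>+x. ennreal (norm (f x)) \<partial>M) < \<infinity>"
  unfolding integrable_iff_bounded by auto

context wigner_seq
begin

text \<open>The mollification of \<open>f\<close> is a superposition of Gaussians centred at
  \<open>y\<close>, for which the limit is known, and dominated convergence in \<open>y\<close>
  yields the limit for the mollified weight. The mollification error is uniform in position, so the
  bound on the sequence controls it for all \<open>k\<close>, and finiteness of \<mu> controls it in
  the limit.\<close>

theorem corr_limit:
  assumes \<kappa>: "integrable lborel \<kappa>" and f: "Cc f"
  shows "(\<lambda>k. LBINT a. \<kappa> a * corr (w k) (\<lambda>X. f (h k *\<^sub>R X)) a) \<longlonglongrightarrow> (LINT p|\<mu>. f (fst p) * ctr \<kappa> (snd p))"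
proof (rule tendsto_approx)
  fix e :: real assume e: "e > 0"
  have [measurable]: "\<kappa> \<in> borel_measurable borel" using \<kappa> by auto
  have [measurable]: "f \<in> borel_measurable borel" by (rule Cc_measurable[OF f])
  have fi: "integrable lborel f" by (rule Cc_integrable[OF f])
  obtain K where K: "K \<ge> 0" "\<And>x. norm (f x) \<le> K" using Cc_bounded[OF f] by blast
  define N where "N = (LBINT a. norm (\<kappa> a))"
  have N0: "0 \<le> N" by (simp add: N_def)
  \<comment> \<open>Dominates the two factors that multiply the mollification error, one on the side
    of the correlations and one on the side of \<mu>; the summand 1 keeps it positive.\<close>
  define C where "C = N * B + N * measure \<mu> (space \<mu>) + 1"
  have C: "N * B \<le> C" "N * measure \<mu> (space \<mu>) \<le> C" "0 < C" using N0 B_nonneg by (auto simp: C_def add_nonneg_pos)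
  define e' where "e' = e / C"
  have e': "e' > 0" "e' * (N * B) \<le> e" "e' * (N * measure \<mu> (space \<mu>)) \<le> e"
    using e C by (auto simp: e'_def divide_simps mult_left_mono)
  obtain \<sigma> where \<sigma>: "\<sigma> > 0" and moll: "\<And>x. norm ((LBINT y. f y * complex_of_real (gauss \<sigma> (x - y))) - f x) \<le> e'"
    using gauss_mollify[OF f e'(1)] by blast
  define f\<sigma> where "f\<sigma> x = (LBINT y. f y * complex_of_real (gauss \<sigma> (x - y)))" for x
  have [measurable]: "f\<sigma> \<in> borel_measurable borel" unfolding f\<sigma>_def [abs_def] by measurable
  have f\<sigma>b: "norm (f\<sigma> x) \<le> K + e'" for x
    using moll[of x] K(2)[of x] norm_triangle_ineq2[of "f\<sigma> x" "f x"] by (simp add: f\<sigma>_def)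
  define L where "L = (1 / (sqrt (2 * pi) * \<sigma>)) ^ DIM('a)"
  have L0: "L \<ge> 0" using \<sigma> by (simp add: L_def)
  have gL: "norm (complex_of_real (gauss \<sigma> (z::'a))) \<le> L" for z unfolding L_def by (rule gauss_norm_le[OF \<sigma>])
  define cy where "cy k y a = corr (w k) (\<lambda>X. complex_of_real (gauss \<sigma> (h k *\<^sub>R X - y))) a" for k y a
  have m1 [measurable]: "(\<lambda>(y, a). cy k y a) \<in> borel_measurable (borel \<Otimes>\<^sub>M borel)" for k
    unfolding cy_def corr_def by measurable
  have m2 [measurable]: "(\<lambda>a. cy k y a) \<in> borel_measurable borel" for k y
    unfolding cy_def by measurable
  have cyb: "norm (cy k y a) \<le> L * B" for k y a
    unfolding cy_def by (rule corr_le) (use gL in auto)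
  define G where "G y = (LINT p|\<mu>. complex_of_real (gauss \<sigma> (fst p - y)) * ctr \<kappa> (snd p))" for y
  have lim: "(\<lambda>k. LBINT y. f y * (LBINT a. \<kappa> a * cy k y a)) \<longlonglongrightarrow> (LBINT y. f y * G y)"
  proof (rule integral_dominated_convergence[where w = "\<lambda>y. norm (f y) * (N * (L * B))"])
    show "AE y in lborel. (\<lambda>k. f y * (LBINT a. \<kappa> a * cy k y a)) \<longlonglongrightarrow> f y * G y"
      unfolding cy_def G_def by (intro AE_I2 tendsto_intros corr_gauss_limit[OF \<kappa> \<sigma>])
    show "AE y in lborel. norm (f y * (LBINT a. \<kappa> a * cy k y a)) \<le> norm (f y) * (N * (L * B))" for k
    proof (rule AE_I2)
      fix y
      have "norm (LBINT a. \<kappa> a * cy k y a) \<le> N * (L * B)"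
        unfolding N_def by (rule norm_integral_mult_bound[OF \<kappa> _ cyb]) measurable
      then show "norm (f y * (LBINT a. \<kappa> a * cy k y a)) \<le> norm (f y) * (N * (L * B))"
        unfolding norm_mult by (rule mult_left_mono) simp
    qed
  qed (use fi in \<open>auto simp: G_def [abs_def]\<close>)
  have eq1: "(LBINT y. f y * (LBINT a. \<kappa> a * cy k y a)) = (LBINT a. \<kappa> a * corr (w k) (\<lambda>X. f\<sigma> (h k *\<^sub>R X)) a)" for k
  proof -
    let ?f = "\<lambda>y a. f y * (\<kappa> a * cy k y a)"
    have m: "case_prod ?f \<in> borel_measurable (lborel \<Otimes>\<^sub>M lborel)" by measurable
    have "(\<integral>\<^sup>+y. (\<integral>\<^sup>+a. norm (?f y a) \<partial>lborel) \<partial>lborel) \<le> (\<integral>\<^sup>+y. (\<integral>\<^sup>+a. ennreal (norm (f y)) * (ennreal (norm (\<kappa> a)) * ennreal (L * B)) \<partial>lborel) \<partial>lborel)"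
      using cyb L0 B_nonneg by (intro nn_integral_mono) (auto simp: norm_mult ennreal_mult[symmetric] intro!: ennreal_leI mult_left_mono)
    also have "\<dots> = (\<integral>\<^sup>+y. ennreal (norm (f y)) \<partial>lborel) * ((\<integral>\<^sup>+a. ennreal (norm (\<kappa> a)) \<partial>lborel) * ennreal (L * B))"
      by (simp add: nn_integral_multc nn_integral_cmult)
    also have "\<dots> < \<infinity>" using nn_integral_norm_finite[OF \<kappa>] nn_integral_norm_finite[OF fi] by (auto simp: ennreal_mult_less_top)
    finally have fin: "(\<integral>\<^sup>+y. (\<integral>\<^sup>+a. norm (?f y a) \<partial>lborel) \<partial>lborel) < \<infinity>" .
    have "(LBINT y. f y * (LBINT a. \<kappa> a * cy k y a)) = (LBINT y. (LBINT a. ?f y a))" by simp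
    also have "\<dots> = (LBINT a. (LBINT y. ?f y a))" by (rule lborel_pair.Fubini_swap(4)[OF m fin])
    also have "\<dots> = (LBINT a. \<kappa> a * corr (w k) (\<lambda>X. f\<sigma> (h k *\<^sub>R X)) a)"
    proof (rule Bochner_Integration.integral_cong[OF refl])
      fix a
      let ?g = "\<lambda>y X. f y * (cnj (w k X) * complex_of_real (gauss \<sigma> (h k *\<^sub>R X - y)) * w k (X + a))"
      have m': "case_prod ?g \<in> borel_measurable (lborel \<Otimes>\<^sub>M lborel)" by measurable
      have "(\<integral>\<^sup>+y. (\<integral>\<^sup>+X. norm (?g y X) \<partial>lborel) \<partial>lborel) \<le> (\<integral>\<^sup>+y. (\<integral>\<^sup>+X. (ennreal (norm (f y)) * ennreal L) * ennreal (norm (w k X) * norm (w k (X + a))) \<partial>lborel) \<partial>lborel)"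
      proof (intro nn_integral_mono)
        fix y X
        have "norm (?g y X) = norm (f y) * (norm (complex_of_real (gauss \<sigma> (h k *\<^sub>R X - y))) * (norm (w k X) * norm (w k (X + a))))"
          by (simp add: norm_mult mult_ac)
        also have "\<dots> \<le> norm (f y) * (L * (norm (w k X) * norm (w k (X + a))))"
          by (intro mult_left_mono mult_right_mono gL) auto
        finally show "ennreal (norm (?g y X)) \<le> (ennreal (norm (f y)) * ennreal L) * ennreal (norm (w k X) * norm (w k (X + a)))"
          using L0 by (simp add: ennreal_mult[symmetric] ennreal_leI mult.assoc)
      qed
      also have "\<dots> = (\<integral>\<^sup>+y. ennreal (norm (f y)) \<partial>lborel) * ennreal L * (\<integral>\<^sup>+X. ennreal (norm (w k X) * norm (w k (X + a))) \<partial>lborel)"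
        by (simp add: nn_integral_multc nn_integral_cmult)
      also have "\<dots> < \<infinity>"
        using nn_integral_norm_finite[OF fi] order_le_less_trans[OF corr_nn_bound[OF w, of k a] ennreal_less_top] by (auto simp: ennreal_mult_less_top)
      finally have fin': "(\<integral>\<^sup>+y. (\<integral>\<^sup>+X. norm (?g y X) \<partial>lborel) \<partial>lborel) < \<infinity>" .
      have "(LBINT y. ?f y a) = \<kappa> a * (LBINT y. f y * cy k y a)"
      proof -
        have "(LBINT y. ?f y a) = (LBINT y. \<kappa> a * (f y * cy k y a))" by (intro Bochner_Integration.integral_cong refl) (simp only: mult_ac)
        then show ?thesis by (simp only: integral_mult_right_zero)
      qed
      also have "(LBINT y. f y * cy k y a) = (LBINT y. (LBINT X. ?g y X))"
        unfolding cy_def corr_def by simp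
      also have "\<dots> = (LBINT X. (LBINT y. ?g y X))" by (rule lborel_pair.Fubini_swap(4)[OF m' fin'])
      also have "\<dots> = corr (w k) (\<lambda>X. f\<sigma> (h k *\<^sub>R X)) a"
        unfolding corr_def
      proof (rule Bochner_Integration.integral_cong[OF refl])
        fix X
        have "(LBINT y. ?g y X) = (LBINT y. (cnj (w k X) * w k (X + a)) * (f y * complex_of_real (gauss \<sigma> (h k *\<^sub>R X - y))))"
          by (intro Bochner_Integration.integral_cong refl) (simp only: mult_ac)
        also have "\<dots> = (cnj (w k X) * w k (X + a)) * f\<sigma> (h k *\<^sub>R X)"
          unfolding f\<sigma>_def by (rule integral_mult_right_zero)
        finally show "(LBINT y. ?g y X) = cnj (w k X) * f\<sigma> (h k *\<^sub>R X) * w k (X + a)"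
          by (simp only: mult_ac)
      qed
      finally show "(LBINT y. ?f y a) = \<kappa> a * corr (w k) (\<lambda>X. f\<sigma> (h k *\<^sub>R X)) a" .
    qed
    finally show ?thesis .
  qed
  have eq2: "(LBINT y. f y * G y) = (LINT p|\<mu>. ctr \<kappa> (snd p) * f\<sigma> (fst p))"
  proof -
    let ?f = "\<lambda>y p. f y * (complex_of_real (gauss \<sigma> (fst p - y)) * ctr \<kappa> (snd p))"
    have m: "case_prod ?f \<in> borel_measurable (lborel \<Otimes>\<^sub>M \<mu>)" by measurable
    have "(\<integral>\<^sup>+y. (\<integral>\<^sup>+p. norm (?f y p) \<partial>\<mu>) \<partial>lborel) \<le> (\<integral>\<^sup>+y. (\<integral>\<^sup>+p. ennreal (norm (f y)) * ennreal (L * N) \<partial>\<mu>) \<partial>lborel)"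
    proof (intro nn_integral_mono)
      fix y :: 'a and p :: "'a \<times> 'a"
      have "norm (ctr \<kappa> (snd p)) \<le> N" using ctr_bound[OF \<kappa>] by (simp add: N_def)
      then have "norm (complex_of_real (gauss \<sigma> (fst p - y))) * norm (ctr \<kappa> (snd p)) \<le> L * N"
        by (intro mult_mono) (simp_all only: gL L0 norm_ge_zero)
      then have "norm (complex_of_real (gauss \<sigma> (fst p - y)) * ctr \<kappa> (snd p)) \<le> L * N"
        by (simp only: norm_mult)
      then show "ennreal (norm (?f y p)) \<le> ennreal (norm (f y)) * ennreal (L * N)"
        using L0 N0 by (auto simp: norm_mult[of "f y"] ennreal_mult[symmetric] intro!: ennreal_leI mult_left_mono)
    qed
    also have "\<dots> = (\<integral>\<^sup>+y. ennreal (norm (f y)) \<partial>lborel) * (ennreal (L * N) * emeasure \<mu> (space \<mu>))"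
      by (simp add: nn_integral_multc mult.assoc)
    also have "\<dots> < \<infinity>" using nn_integral_norm_finite[OF fi] by (auto simp: ennreal_mult_less_top emeasure_eq_measure)
    finally have fin: "(\<integral>\<^sup>+y. (\<integral>\<^sup>+p. norm (?f y p) \<partial>\<mu>) \<partial>lborel) < \<infinity>" .
    have "(LBINT y. f y * G y) = (LBINT y. (LINT p|\<mu>. ?f y p))" unfolding G_def by simp
    also have "\<dots> = (LINT p|\<mu>. (LBINT y. ?f y p))" by (rule P.Fubini_swap(4)[OF m fin])
    also have "\<dots> = (LINT p|\<mu>. ctr \<kappa> (snd p) * f\<sigma> (fst p))"
    proof (rule Bochner_Integration.integral_cong[OF refl])
      fix p :: "'a \<times> 'a"
      have "(LBINT y. ?f y p) = (LBINT y. ctr \<kappa> (snd p) * (f y * complex_of_real (gauss \<sigma> (fst p - y))))"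
        by (intro Bochner_Integration.integral_cong refl) (simp only: mult_ac)
      then show "(LBINT y. ?f y p) = ctr \<kappa> (snd p) * f\<sigma> (fst p)" by (simp only: integral_mult_right_zero f\<sigma>_def)
    qed
    finally show ?thesis .
  qed
  show "\<exists>a b. a \<longlonglongrightarrow> b \<and> (\<forall>k. norm (a k - (LBINT a. \<kappa> a * corr (w k) (\<lambda>X. f (h k *\<^sub>R X)) a)) \<le> e) \<and> norm (b - (LINT p|\<mu>. f (fst p) * ctr \<kappa> (snd p))) \<le> e"
  proof (intro exI conjI allI)
    show "(\<lambda>k. LBINT a. \<kappa> a * corr (w k) (\<lambda>X. f\<sigma> (h k *\<^sub>R X)) a) \<longlonglongrightarrow> (LINT p|\<mu>. ctr \<kappa> (snd p) * f\<sigma> (fst p))"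
      using lim unfolding eq1 eq2 .
    fix k
    have i1: "integrable lborel (\<lambda>a. \<kappa> a * corr (w k) (\<lambda>X. f\<sigma> (h k *\<^sub>R X)) a)"
      by (rule corr_Fubini(1)[OF w _ f\<sigma>b \<kappa>]) measurable
    have i2: "integrable lborel (\<lambda>a. \<kappa> a * corr (w k) (\<lambda>X. f (h k *\<^sub>R X)) a)"
      by (rule corr_Fubini(1)[OF w _ K(2) \<kappa>]) measurable
    have "(LBINT a. \<kappa> a * corr (w k) (\<lambda>X. f\<sigma> (h k *\<^sub>R X)) a) - (LBINT a. \<kappa> a * corr (w k) (\<lambda>X. f (h k *\<^sub>R X)) a)
      = (LBINT a. \<kappa> a * corr (w k) (\<lambda>X. f\<sigma> (h k *\<^sub>R X) - f (h k *\<^sub>R X)) a)"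
    proof -
      have "corr (w k) (\<lambda>X. f\<sigma> (h k *\<^sub>R X)) a - corr (w k) (\<lambda>X. f (h k *\<^sub>R X)) a = corr (w k) (\<lambda>X. f\<sigma> (h k *\<^sub>R X) - f (h k *\<^sub>R X)) a" for a
        by (rule corr_diff[OF w _ f\<sigma>b _ K(2)]) measurable
      then show ?thesis
        by (subst Bochner_Integration.integral_diff[OF i1 i2, symmetric]) (simp flip: right_diff_distrib)
    qed
    also have "norm \<dots> \<le> N * (e' * B)"
      unfolding N_def by (rule norm_integral_mult_bound[OF \<kappa>]) (auto intro!: corr_le moll[folded f\<sigma>_def])
    also have "\<dots> \<le> e" using e'(2) by (simp add: mult_ac)
    finally show "norm ((LBINT a. \<kappa> a * corr (w k) (\<lambda>X. f\<sigma> (h k *\<^sub>R X)) a) - (LBINT a. \<kappa> a * corr (w k) (\<lambda>X. f (h k *\<^sub>R X)) a)) \<le> e" .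
  next
    have ic: "integrable \<mu> (\<lambda>p. ctr \<kappa> (snd p))"
      by (rule integrable_const_bound[where B = N]) (use ctr_bound[OF \<kappa>] in \<open>auto simp: N_def\<close>)
    have i1: "integrable \<mu> (\<lambda>p. ctr \<kappa> (snd p) * f\<sigma> (fst p))"
      by (rule integrable_mult_bounded[OF ic _ f\<sigma>b]) measurable
    have i2: "integrable \<mu> (\<lambda>p. ctr \<kappa> (snd p) * f (fst p))"
      by (rule integrable_mult_bounded[OF ic _ K(2)]) measurable
    have "(LINT p|\<mu>. ctr \<kappa> (snd p) * f\<sigma> (fst p)) - (LINT p|\<mu>. f (fst p) * ctr \<kappa> (snd p)) = (LINT p|\<mu>. ctr \<kappa> (snd p) * (f\<sigma> (fst p) - f (fst p)))"
      unfolding right_diff_distrib by (subst Bochner_Integration.integral_diff[OF i1 i2]) (simp add: mult.commute)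
    also have "norm \<dots> \<le> (LINT p|\<mu>. norm (ctr \<kappa> (snd p))) * e'"
      by (rule norm_integral_mult_bound[OF ic]) (auto intro!: moll[folded f\<sigma>_def])
    also have "\<dots> \<le> (LINT p|\<mu>. N) * e'"
      using ic e' ctr_bound[OF \<kappa>] by (intro mult_right_mono integral_mono) (auto simp: N_def)
    also have "\<dots> \<le> e" using e'(3) by (simp add: mult_ac)
    finally show "norm ((LINT p|\<mu>. ctr \<kappa> (snd p) * f\<sigma> (fst p)) - (LINT p|\<mu>. f (fst p) * ctr \<kappa> (snd p))) \<le> e" .
  qed
qed

end

subsection \<open>Filtered sequences\<close>

text \<open>Cauchy-Schwarz with respect to the weight \<open>norm (g x)\<close>, written as a
  product of square roots. Only \<open>f\<close> is squared, as suits a kernel \<open>g\<close>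
  controlled in L1.\<close>

lemma norm_integral_Cauchy_Schwarz:
  fixes f g :: "'a \<Rightarrow> complex"
  assumes [measurable]: "f \<in> borel_measurable M" "g \<in> borel_measurable M"
  shows "ennreal ((norm (LINT x|M. f x * g x))\<^sup>2)
    \<le> (\<integral>\<^sup>+x. ennreal ((norm (f x))\<^sup>2 * norm (g x)) \<partial>M) * (\<integral>\<^sup>+x. ennreal (norm (g x)) \<partial>M)"
proof -
  have "ennreal (norm (LINT x|M. f x * g x)) \<le> (\<integral>\<^sup>+x. ennreal (norm (f x * g x)) \<partial>M)"
    by (cases "integrable M (\<lambda>x. f x * g x)") (auto intro: integral_norm_bound_ennreal simp: not_integrable_integral_eq)
  also have "\<dots> = (\<integral>\<^sup>+x. ennreal (norm (f x) * sqrt (norm (g x))) * ennreal (sqrt (norm (g x))) \<partial>M)"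
    by (intro nn_integral_cong) (simp add: ennreal_mult[symmetric] norm_mult mult.assoc)
  finally have "(ennreal (norm (LINT x|M. f x * g x)))\<^sup>2 \<le> (\<integral>\<^sup>+x. ennreal (norm (f x) * sqrt (norm (g x))) * ennreal (sqrt (norm (g x))) \<partial>M)\<^sup>2"
    by (rule power_mono) simp
  also have "\<dots> \<le> (\<integral>\<^sup>+x. (ennreal (norm (f x) * sqrt (norm (g x))))\<^sup>2 \<partial>M) * (\<integral>\<^sup>+x. (ennreal (sqrt (norm (g x))))\<^sup>2 \<partial>M)"
    by (rule Cauchy_Schwarz_nn_integral) measurable
  finally show ?thesis
    by (simp add: ennreal_power power_mult_distrib)
qed

definition filt :: "('a::euclidean_space \<Rightarrow> complex) \<Rightarrow> ('a \<Rightarrow> complex) \<Rightarrow> 'a \<Rightarrow> complex" where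
  "filt \<phi> w x = (LBINT z. w (x + z) * cnj (\<phi> z))"

lemma measurable_filt [measurable]:
  assumes [measurable]: "\<phi> \<in> borel_measurable borel" "w \<in> borel_measurable borel" and g: "g \<in> borel_measurable M"
  shows "(\<lambda>x. filt \<phi> w (g x)) \<in> borel_measurable M"
proof -
  have "filt \<phi> w \<in> borel_measurable borel" unfolding filt_def [abs_def] by measurable
  then show ?thesis by (rule measurable_compose[OF g])
qed

lemma filt_cnj: "cnj (filt \<phi> w x) = filt (\<lambda>z. cnj (\<phi> z)) (\<lambda>x. cnj (w x)) x"
  unfolding filt_def by (subst Bochner_Integration.integral_cnj[symmetric]) simp

lemma sq_int_cnj: "sq_int w \<Longrightarrow> sq_int (\<lambda>x. cnj (w x))"
  by (auto simp: sq_int_def intro: borel_measurable_cnj)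

lemma nn_integral_sq_translate:
  assumes "sq_int w"
  shows "(\<integral>\<^sup>+x. ennreal ((norm (w (x + z)))\<^sup>2) \<partial>lborel) = ennreal (LBINT x. (norm (w x))\<^sup>2)"
  using nn_integral_sq_eq[OF sq_int_translate[OF assms, of z]] integral_sq_translate[OF assms, of z] by simp

text \<open>Young's inequality for an L1 kernel acting on L2, from Cauchy-Schwarz weighted by the
  kernel and Tonelli.\<close>

lemma filt_sq_int:
  assumes \<phi>: "integrable lborel \<phi>" and w: "sq_int w"
  shows "sq_int (filt \<phi> w)"
    and "(LBINT x. (norm (filt \<phi> w x))\<^sup>2) \<le> (LBINT z. norm (\<phi> z))\<^sup>2 * (LBINT x. (norm (w x))\<^sup>2)"
proof -
  have [measurable]: "\<phi> \<in> borel_measurable borel" "w \<in> borel_measurable borel" using \<phi> w by (auto simp: sq_int_def)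
  let ?N = "LBINT z. norm (\<phi> z)" and ?W = "LBINT x. (norm (w x))\<^sup>2"
  have N: "(\<integral>\<^sup>+z. ennreal (norm (\<phi> z)) \<partial>lborel) = ennreal ?N"
    using \<phi> by (intro nn_integral_eq_integral) auto
  have "(\<integral>\<^sup>+x. ennreal ((norm (filt \<phi> w x))\<^sup>2) \<partial>lborel)
    \<le> (\<integral>\<^sup>+x. (\<integral>\<^sup>+z. ennreal ((norm (w (x + z)))\<^sup>2 * norm (\<phi> z)) \<partial>lborel) * ennreal ?N \<partial>lborel)"
  proof (rule nn_integral_mono)
    fix x
    show "ennreal ((norm (filt \<phi> w x))\<^sup>2) \<le> (\<integral>\<^sup>+z. ennreal ((norm (w (x + z)))\<^sup>2 * norm (\<phi> z)) \<partial>lborel) * ennreal ?N"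
      using norm_integral_Cauchy_Schwarz[of "\<lambda>z. w (x + z)" lborel "\<lambda>z. cnj (\<phi> z)"] N by (simp add: filt_def)
  qed
  also have "\<dots> = (\<integral>\<^sup>+x. (\<integral>\<^sup>+z. ennreal ((norm (w (x + z)))\<^sup>2 * norm (\<phi> z)) \<partial>lborel) \<partial>lborel) * ennreal ?N"
    by (rule nn_integral_multc) measurable
  also have "(\<integral>\<^sup>+x. (\<integral>\<^sup>+z. ennreal ((norm (w (x + z)))\<^sup>2 * norm (\<phi> z)) \<partial>lborel) \<partial>lborel)
    = (\<integral>\<^sup>+z. (\<integral>\<^sup>+x. ennreal ((norm (w (x + z)))\<^sup>2 * norm (\<phi> z)) \<partial>lborel) \<partial>lborel)"
    by (rule lborel_pair.Fubini'[symmetric]) measurable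
  also have "\<dots> = (\<integral>\<^sup>+z. ennreal ?W * ennreal (norm (\<phi> z)) \<partial>lborel)"
    by (intro nn_integral_cong) (simp add: ennreal_mult nn_integral_multc nn_integral_sq_translate[OF w])
  also have "\<dots> = ennreal ?W * ennreal ?N" by (simp add: nn_integral_cmult N)
  finally have le: "(\<integral>\<^sup>+x. ennreal ((norm (filt \<phi> w x))\<^sup>2) \<partial>lborel) \<le> ennreal (?N\<^sup>2 * ?W)"
    by (simp add: ennreal_mult[symmetric] power2_eq_square mult_ac)
  have i: "integrable lborel (\<lambda>x. (norm (filt \<phi> w x))\<^sup>2)"
    by (rule integrableI_bounded) (use order_le_less_trans[OF le ennreal_less_top] in auto)
  then show "sq_int (filt \<phi> w)" by (auto simp: sq_int_def)
  show "(LBINT x. (norm (filt \<phi> w x))\<^sup>2) \<le> ?N\<^sup>2 * ?W"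
    using le nn_integral_eq_integral[OF i] by simp
qed

lemma nn_integral_prod_finite:
  assumes v: "sq_int v" and w: "sq_int w"
  shows "(\<integral>\<^sup>+x. ennreal (norm (v x) * norm (w (x + z))) \<partial>lborel) \<le> ennreal ((LBINT x. (norm (v x))\<^sup>2) + (LBINT x. (norm (w x))\<^sup>2))"
proof -
  have [measurable]: "v \<in> borel_measurable borel" "w \<in> borel_measurable borel" using v w by (auto simp: sq_int_def)
  have "(\<integral>\<^sup>+x. ennreal (norm (v x) * norm (w (x + z))) \<partial>lborel) \<le> (\<integral>\<^sup>+x. ennreal ((norm (v x))\<^sup>2) + ennreal ((norm (w (x + z)))\<^sup>2) \<partial>lborel)"
  proof (rule nn_integral_mono)
    fix x
    have "norm (v x) * norm (w (x + z)) \<le> (norm (v x))\<^sup>2 + (norm (w (x + z)))\<^sup>2"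
    proof (rule order_trans[OF norm_mult_le_sq])
      have "(A + B) / 2 \<le> A + B" if "0 \<le> A" "0 \<le> B" for A B :: real using that by simp
      then show "((norm (v x))\<^sup>2 + (norm (w (x + z)))\<^sup>2) / 2 \<le> (norm (v x))\<^sup>2 + (norm (w (x + z)))\<^sup>2" by simp
    qed
    then show "ennreal (norm (v x) * norm (w (x + z))) \<le> ennreal ((norm (v x))\<^sup>2) + ennreal ((norm (w (x + z)))\<^sup>2)"
      by (simp add: ennreal_plus[symmetric] ennreal_leI del: ennreal_plus)
  qed
  also have "\<dots> = ennreal (LBINT x. (norm (v x))\<^sup>2) + ennreal (LBINT x. (norm (w x))\<^sup>2)"
    by (simp add: nn_integral_add nn_integral_sq_eq[OF v] nn_integral_sq_translate[OF w])
  finally show ?thesis by simp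
qed

lemma filt_Fubini:
  assumes \<phi>: "integrable lborel \<phi>" and w: "sq_int w" and v: "sq_int v"
    and G [measurable]: "G \<in> borel_measurable borel" and K: "\<And>x. norm (G x) \<le> K"
  shows "(LBINT x. G x * v x * filt \<phi> w (x + a)) = (LBINT z. cnj (\<phi> z) * (LBINT x. G x * v x * w (x + a + z)))"
proof -
  have [measurable]: "\<phi> \<in> borel_measurable borel" "w \<in> borel_measurable borel" "v \<in> borel_measurable borel"
    using \<phi> w v by (auto simp: sq_int_def)
  have K0: "0 \<le> K" using K[of undefined] norm_ge_zero order_trans by blast
  let ?C = "(LBINT x. (norm (v x))\<^sup>2) + (LBINT x. (norm (w x))\<^sup>2)"
  let ?f = "\<lambda>z x. cnj (\<phi> z) * (G x * v x * w (x + a + z))"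
  have m: "case_prod ?f \<in> borel_measurable (lborel \<Otimes>\<^sub>M lborel)" by measurable
  have "(\<integral>\<^sup>+z. (\<integral>\<^sup>+x. norm (?f z x) \<partial>lborel) \<partial>lborel) \<le> (\<integral>\<^sup>+z. ennreal (norm (\<phi> z)) * ennreal (K * ?C) \<partial>lborel)"
  proof (rule nn_integral_mono)
    fix z
    have "(\<integral>\<^sup>+x. norm (?f z x) \<partial>lborel) \<le> (\<integral>\<^sup>+x. ennreal (norm (\<phi> z) * K) * ennreal (norm (v x) * norm (w (x + (a + z)))) \<partial>lborel)"
    proof (rule nn_integral_mono)
      fix x
      have "norm (?f z x) = norm (\<phi> z) * norm (G x) * (norm (v x) * norm (w (x + (a + z))))" by (simp add: norm_mult add.assoc)
      also have "\<dots> \<le> norm (\<phi> z) * K * (norm (v x) * norm (w (x + (a + z))))" by (intro mult_right_mono mult_left_mono K) auto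
      finally show "ennreal (norm (?f z x)) \<le> ennreal (norm (\<phi> z) * K) * ennreal (norm (v x) * norm (w (x + (a + z))))"
        using K0 by (simp add: ennreal_mult[symmetric] ennreal_leI)
    qed
    also have "\<dots> \<le> ennreal (norm (\<phi> z) * K) * ennreal ?C"
      by (subst nn_integral_cmult, measurable) (intro mult_left_mono nn_integral_prod_finite v w, simp)
    also have "\<dots> = ennreal (norm (\<phi> z)) * ennreal (K * ?C)"
      using K0 by (simp add: ennreal_mult[symmetric] mult.assoc del: ennreal_plus)
    finally show "(\<integral>\<^sup>+x. norm (?f z x) \<partial>lborel) \<le> ennreal (norm (\<phi> z)) * ennreal (K * ?C)" .
  qed
  also have "\<dots> = (\<integral>\<^sup>+z. ennreal (norm (\<phi> z)) \<partial>lborel) * ennreal (K * ?C)"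
    by (rule nn_integral_multc) measurable
  also have "\<dots> < \<infinity>"
    using nn_integral_norm_finite[OF \<phi>] by (auto simp: ennreal_mult_less_top)
  finally have fin: "(\<integral>\<^sup>+z. (\<integral>\<^sup>+x. norm (?f z x) \<partial>lborel) \<partial>lborel) < \<infinity>" .
  have "(LBINT x. G x * v x * filt \<phi> w (x + a)) = (LBINT x. (LBINT z. ?f z x))"
  proof (rule Bochner_Integration.integral_cong[OF refl])
    fix x
    have "(LBINT z. ?f z x) = (LBINT z. (G x * v x) * (w (x + a + z) * cnj (\<phi> z)))"
      by (intro Bochner_Integration.integral_cong refl) (simp only: mult_ac)
    then show "G x * v x * filt \<phi> w (x + a) = (LBINT z. ?f z x)"
      by (simp only: filt_def integral_mult_right_zero)
  qed
  also have "\<dots> = (LBINT z. (LBINT x. ?f z x))" by (rule lborel_pair.Fubini_swap(4)[OF m fin, symmetric])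
  also have "\<dots> = (LBINT z. cnj (\<phi> z) * (LBINT x. G x * v x * w (x + a + z)))"
    by (simp only: integral_mult_right_zero)
  finally show ?thesis .
qed

text \<open>When two copies of the filter with variables \<open>z\<close> and \<open>z'\<close> are
  combined, only \<open>\<zeta> = d + z - z'\<close> enters the correlation. This is the density of
  that combination.\<close>

definition autocorr :: "('a::euclidean_space \<Rightarrow> complex) \<Rightarrow> 'a \<Rightarrow> 'a \<Rightarrow> complex" where
  "autocorr \<phi> d \<zeta> = (LBINT z'. \<phi> z' * cnj (\<phi> (\<zeta> - d + z')))"

lemma autocorr_Fubini:
  assumes \<phi>: "integrable lborel \<phi>" and [measurable]: "c \<in> borel_measurable borel" and K: "\<And>x. norm (c x) \<le> K"
  shows "(LBINT z'. \<phi> z' * (LBINT z. cnj (\<phi> z) * c (d + z - z'))) = (LBINT \<zeta>. autocorr \<phi> d \<zeta> * c \<zeta>)"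
    and "integrable lborel (\<lambda>\<zeta>. autocorr \<phi> d \<zeta> * c \<zeta>)"
proof -
  have [measurable]: "\<phi> \<in> borel_measurable borel" using \<phi> by auto
  have K0: "0 \<le> K" using K[of undefined] norm_ge_zero order_trans by blast
  let ?f = "\<lambda>z' \<zeta>. \<phi> z' * cnj (\<phi> (\<zeta> - d + z')) * c \<zeta>"
  have m: "case_prod ?f \<in> borel_measurable (lborel \<Otimes>\<^sub>M lborel)" by measurable
  have "(\<integral>\<^sup>+z'. (\<integral>\<^sup>+\<zeta>. norm (?f z' \<zeta>) \<partial>lborel) \<partial>lborel) \<le> (\<integral>\<^sup>+z'. ennreal (norm (\<phi> z')) * ((\<integral>\<^sup>+z. ennreal (norm (\<phi> z)) \<partial>lborel) * ennreal K) \<partial>lborel)"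
  proof (rule nn_integral_mono)
    fix z'
    have "(\<integral>\<^sup>+\<zeta>. norm (?f z' \<zeta>) \<partial>lborel) \<le> (\<integral>\<^sup>+\<zeta>. ennreal (norm (\<phi> z')) * (ennreal (norm (\<phi> ((z' - d) + \<zeta>))) * ennreal K) \<partial>lborel)"
    proof (rule nn_integral_mono)
      fix \<zeta>
      have "norm (?f z' \<zeta>) = norm (\<phi> z') * (norm (\<phi> ((z' - d) + \<zeta>)) * norm (c \<zeta>))"
        by (simp add: norm_mult algebra_simps)
      also have "\<dots> \<le> norm (\<phi> z') * (norm (\<phi> ((z' - d) + \<zeta>)) * K)"
        by (intro mult_left_mono K) auto
      finally have "norm (?f z' \<zeta>) \<le> norm (\<phi> z') * (norm (\<phi> ((z' - d) + \<zeta>)) * K)" .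
      then show "ennreal (norm (?f z' \<zeta>)) \<le> ennreal (norm (\<phi> z')) * (ennreal (norm (\<phi> ((z' - d) + \<zeta>))) * ennreal K)"
        using K0 by (simp add: ennreal_mult[symmetric] ennreal_leI)
    qed
    also have "\<dots> = ennreal (norm (\<phi> z')) * ((\<integral>\<^sup>+\<zeta>. ennreal (norm (\<phi> ((z' - d) + \<zeta>))) \<partial>lborel) * ennreal K)"
      by (simp add: nn_integral_cmult nn_integral_multc)
    also have "(\<integral>\<^sup>+\<zeta>. ennreal (norm (\<phi> ((z' - d) + \<zeta>))) \<partial>lborel) = (\<integral>\<^sup>+z. ennreal (norm (\<phi> z)) \<partial>lborel)"
      by (rule nn_integral_lborel_translate) measurable
    finally show "(\<integral>\<^sup>+\<zeta>. norm (?f z' \<zeta>) \<partial>lborel) \<le> ennreal (norm (\<phi> z')) * ((\<integral>\<^sup>+z. ennreal (norm (\<phi> z)) \<partial>lborel) * ennreal K)" .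
  qed
  also have "\<dots> = (\<integral>\<^sup>+z'. ennreal (norm (\<phi> z')) \<partial>lborel) * ((\<integral>\<^sup>+z. ennreal (norm (\<phi> z)) \<partial>lborel) * ennreal K)"
    by (rule nn_integral_multc) measurable
  also have "\<dots> < \<infinity>"
    using nn_integral_norm_finite[OF \<phi>] by (auto simp: ennreal_mult_less_top)
  finally have fin: "(\<integral>\<^sup>+z'. (\<integral>\<^sup>+\<zeta>. norm (?f z' \<zeta>) \<partial>lborel) \<partial>lborel) < \<infinity>" .
  have e: "(LBINT z'. ?f z' \<zeta>) = autocorr \<phi> d \<zeta> * c \<zeta>" for \<zeta>
    unfolding autocorr_def by (rule integral_mult_left_zero)
  show "integrable lborel (\<lambda>\<zeta>. autocorr \<phi> d \<zeta> * c \<zeta>)"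
    using lborel_pair.Fubini_swap(3)[OF m fin] by (simp only: e)
  have "(LBINT z'. \<phi> z' * (LBINT z. cnj (\<phi> z) * c (d + z - z'))) = (LBINT z'. (LBINT \<zeta>. ?f z' \<zeta>))"
  proof (rule Bochner_Integration.integral_cong[OF refl])
    fix z'
    have "(LBINT \<zeta>. ?f z' \<zeta>) = (LBINT z. ?f z' ((d - z') + z))"
      by (rule integral_lborel_translate[symmetric]) measurable
    also have "\<dots> = (LBINT z. \<phi> z' * (cnj (\<phi> z) * c (d + z - z')))"
      by (intro Bochner_Integration.integral_cong refl) (simp add: algebra_simps)
    also have "\<dots> = \<phi> z' * (LBINT z. cnj (\<phi> z) * c (d + z - z'))" by (rule integral_mult_right_zero)
    finally show "\<phi> z' * (LBINT z. cnj (\<phi> z) * c (d + z - z')) = (LBINT \<zeta>. ?f z' \<zeta>)" ..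
  qed
  also have "\<dots> = (LBINT \<zeta>. (LBINT z'. ?f z' \<zeta>))" by (rule lborel_pair.Fubini_swap(4)[OF m fin])
  finally show "(LBINT z'. \<phi> z' * (LBINT z. cnj (\<phi> z) * c (d + z - z'))) = (LBINT \<zeta>. autocorr \<phi> d \<zeta> * c \<zeta>)"
    by (simp only: e)
qed

text \<open>The squared modulus of the Fourier transform of \<phi>: with the sign convention of
  \<open>ctr\<close>, the transform of the conjugate is the conjugate of the Fourier
  transform.\<close>

definition power_spec :: "('a::euclidean_space \<Rightarrow> complex) \<Rightarrow> 'a \<Rightarrow> real" where
  "power_spec \<phi> \<xi> = (norm (ctr (\<lambda>z. cnj (\<phi> z)) \<xi>))\<^sup>2"

text \<open>The Wiener-Khinchin identity; the displacement \<open>d\<close> turns into a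
  phase.\<close>

lemma ctr_autocorr:
  assumes \<phi>: "integrable lborel \<phi>"
  shows "ctr (autocorr \<phi> d) \<xi> = cis (d \<bullet> \<xi>) * complex_of_real (power_spec \<phi> \<xi>)"
proof -
  have [measurable]: "\<phi> \<in> borel_measurable borel" using \<phi> by auto
  have "ctr (autocorr \<phi> d) \<xi> = (LBINT z'. \<phi> z' * (LBINT z. cnj (\<phi> z) * cis ((d + z - z') \<bullet> \<xi>)))"
    unfolding ctr_def by (rule autocorr_Fubini(1)[OF \<phi>, where K = 1, symmetric]) auto
  also have "\<dots> = (LBINT z'. (cis (d \<bullet> \<xi>) * ctr (\<lambda>z. cnj (\<phi> z)) \<xi>) * cnj (cnj (\<phi> z') * cis (z' \<bullet> \<xi>)))"
  proof (rule Bochner_Integration.integral_cong[OF refl])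
    fix z'
    have "(LBINT z. cnj (\<phi> z) * cis ((d + z - z') \<bullet> \<xi>)) = (LBINT z. (cis (d \<bullet> \<xi>) * cis (- (z' \<bullet> \<xi>))) * (cnj (\<phi> z) * cis (z \<bullet> \<xi>)))"
      by (intro Bochner_Integration.integral_cong refl) (simp add: inner_add_left inner_diff_left cis_mult algebra_simps)
    also have "\<dots> = (cis (d \<bullet> \<xi>) * cis (- (z' \<bullet> \<xi>))) * ctr (\<lambda>z. cnj (\<phi> z)) \<xi>"
      unfolding ctr_def by (rule integral_mult_right_zero)
    finally show "\<phi> z' * (LBINT z. cnj (\<phi> z) * cis ((d + z - z') \<bullet> \<xi>)) = (cis (d \<bullet> \<xi>) * ctr (\<lambda>z. cnj (\<phi> z)) \<xi>) * cnj (cnj (\<phi> z') * cis (z' \<bullet> \<xi>))"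
      by (simp add: cis_cnj mult_ac)
  qed
  also have "\<dots> = (cis (d \<bullet> \<xi>) * ctr (\<lambda>z. cnj (\<phi> z)) \<xi>) * (LBINT z'. cnj (cnj (\<phi> z') * cis (z' \<bullet> \<xi>)))"
    by (rule integral_mult_right_zero)
  also have "(LBINT z'. cnj (cnj (\<phi> z') * cis (z' \<bullet> \<xi>))) = cnj (ctr (\<lambda>z. cnj (\<phi> z)) \<xi>)"
    unfolding ctr_def by (rule Bochner_Integration.integral_cnj)
  finally show ?thesis
    unfolding power_spec_def by (simp add: complex_norm_square mult.assoc del: of_real_power)
qed

lemma measurable_power_spec [measurable]:
  assumes [measurable]: "\<phi> \<in> borel_measurable borel" "g \<in> borel_measurable M"
  shows "(\<lambda>x. power_spec \<phi> (g x)) \<in> borel_measurable M"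
  unfolding power_spec_def by measurable

lemma power_spec_bound:
  assumes "integrable lborel \<phi>"
  shows "0 \<le> power_spec \<phi> \<xi>" "power_spec \<phi> \<xi> \<le> (LBINT z. norm (\<phi> z))\<^sup>2"
  using ctr_bound[of "\<lambda>z. cnj (\<phi> z)" \<xi>] assms by (auto simp: power_spec_def intro!: power_mono)

context wigner_seq
begin

text \<open>Expanding both filters leaves correlations of \<open>w k\<close> whose weight is
  displaced by \<open>h k\<close> times a filter variable. The displacement disappears in the limit,
  and then the two filter variables collapse into one autocorrelation, an integrable kernel to which
  \<open>corr_limit\<close> applies.\<close>

theorem filt_limit:
  assumes \<phi>: "integrable lborel \<phi>" and F: "Cc F"
  shows "(\<lambda>k. LBINT x. F (h k *\<^sub>R x) * filt \<phi> (w k) (x + a) * cnj (filt \<phi> (w k) (x + b)))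
    \<longlonglongrightarrow> (LINT p|\<mu>. F (fst p) * (cis ((a - b) \<bullet> snd p) * complex_of_real (power_spec \<phi> (snd p))))"
proof -
  let ?V = "\<lambda>k. filt \<phi> (w k)"
  have [measurable]: "\<phi> \<in> borel_measurable borel" using \<phi> by auto
  have \<phi>c: "integrable lborel (\<lambda>z. cnj (\<phi> z))" using \<phi> by simp
  have [measurable]: "F \<in> borel_measurable borel" by (rule Cc_measurable[OF F])
  obtain K where K: "K \<ge> 0" "\<And>x. norm (F x) \<le> K" using Cc_bounded[OF F] by blast
  \<comment> \<open>The new base point is \<open>x + b + z'\<close>, the argument of the conjugated
    factor. The weight is therefore evaluated at \<open>X - (b + z')\<close>, and the lag is the
    difference of the two arguments.\<close>
  define J where "J k z' z = corr (w k) (\<lambda>X. F (h k *\<^sub>R (X - (b + z')))) (a - b + z - z')" for k z' z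
  define c where "c k = corr (w k) (\<lambda>X. F (h k *\<^sub>R X))" for k
  have [measurable]: "c k \<in> borel_measurable borel" for k unfolding c_def by measurable
  have cb: "norm (c k z) \<le> K * B" for k z unfolding c_def by (rule corr_le) (use K in auto)
  have J1 [measurable]: "(\<lambda>(z', z). J k z' z) \<in> borel_measurable (borel \<Otimes>\<^sub>M borel)" for k
    unfolding J_def corr_def by measurable
  have J2 [measurable]: "(\<lambda>z. J k z' z) \<in> borel_measurable borel" for k z'
    unfolding J_def corr_def by measurable
  have Jb: "norm (J k z' z) \<le> K * B" for k z' z
    unfolding J_def by (rule corr_le) (use K in auto)
  have Jc: "(\<lambda>k. J k z' z - c k (a - b + z - z')) \<longlonglongrightarrow> 0" for z' z
  proof (rule metric_LIMSEQ_I)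
    fix e :: real assume e: "e > 0"
    define e' where "e' = e / (2 * (B + 1))"
    have e': "e' > 0" "e' * B < e"
      using e B_nonneg by (auto simp: e'_def divide_simps)
    obtain \<delta> where \<delta>: "\<delta> > 0" "\<And>x y. norm (x - y) < \<delta> \<Longrightarrow> norm (F x - F y) < e'"
      using Cc_uniform[OF F e'(1)] by blast
    have "(\<lambda>k. h k * norm (b + z')) \<longlonglongrightarrow> 0 * norm (b + z')" by (intro tendsto_intros h0)
    then have "\<forall>\<^sub>F k in sequentially. h k * norm (b + z') < \<delta>" using \<delta>(1) by (intro order_tendstoD) auto
    then obtain k0 where k0: "\<And>k. k \<ge> k0 \<Longrightarrow> h k * norm (b + z') < \<delta>" by (auto simp: eventually_sequentially)
    have "dist (J k z' z - c k (a - b + z - z')) 0 < e" if "k \<ge> k0" for k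
    proof -
      have "J k z' z - c k (a - b + z - z') = corr (w k) (\<lambda>X. F (h k *\<^sub>R (X - (b + z'))) - F (h k *\<^sub>R X)) (a - b + z - z')"
        unfolding J_def c_def by (rule corr_diff[OF w _ K(2) _ K(2)]) measurable
      also have "norm \<dots> \<le> e' * B"
      proof (rule corr_le)
        fix X
        have "norm (h k *\<^sub>R (X - (b + z')) - h k *\<^sub>R X) = h k * norm (b + z')"
          unfolding scaleR_diff_right[symmetric] using hpos[of k] by (simp add: norm_minus_commute add.commute)
        then show "norm (F (h k *\<^sub>R (X - (b + z'))) - F (h k *\<^sub>R X)) \<le> e'"
          using k0[OF that] by (intro less_imp_le \<delta>(2)) simp
      qed measurable
      finally show ?thesis using e'(2) by simp
    qed
    then show "\<exists>no. \<forall>k\<ge>no. dist (J k z' z - c k (a - b + z - z')) 0 < e" by blast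
  qed
  have eqJ: "(LBINT x. F (h k *\<^sub>R x) * ?V k (x + a) * cnj (?V k (x + b)))
    = (LBINT z'. \<phi> z' * (LBINT z. cnj (\<phi> z) * J k z' z))" for k
  proof -
    have "(LBINT x. F (h k *\<^sub>R x) * ?V k (x + a) * cnj (?V k (x + b)))
      = (LBINT z'. cnj (cnj (\<phi> z')) * (LBINT x. F (h k *\<^sub>R x) * ?V k (x + a) * cnj (w k (x + b + z'))))"
      unfolding filt_cnj
      by (rule filt_Fubini[OF \<phi>c sq_int_cnj[OF w] sq_int_translate[OF filt_sq_int(1)[OF \<phi> w]] _ K(2)]) measurable
    also have "\<dots> = (LBINT z'. \<phi> z' * (LBINT z. cnj (\<phi> z) * J k z' z))"
    proof (rule Bochner_Integration.integral_cong[OF refl])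
      fix z'
      have "(LBINT x. F (h k *\<^sub>R x) * ?V k (x + a) * cnj (w k (x + b + z')))
        = (LBINT x. F (h k *\<^sub>R x) * cnj (w k (x + (b + z'))) * ?V k (x + a))"
        by (intro Bochner_Integration.integral_cong refl) (simp add: mult_ac add.assoc)
      also have "\<dots> = (LBINT z. cnj (\<phi> z) * (LBINT x. F (h k *\<^sub>R x) * cnj (w k (x + (b + z'))) * w k (x + a + z)))"
        by (rule filt_Fubini[OF \<phi> w sq_int_cnj[OF sq_int_translate[OF w]] _ K(2)]) measurable
      also have "\<dots> = (LBINT z. cnj (\<phi> z) * J k z' z)"
      proof (intro Bochner_Integration.integral_cong refl arg_cong2[where f = "(*)"])
        fix z
        have "J k z' z = (LBINT x. cnj (w k ((b + z') + x)) * F (h k *\<^sub>R ((b + z') + x - (b + z'))) * w k ((b + z') + x + (a - b + z - z')))"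
          unfolding J_def corr_def by (rule integral_lborel_translate[symmetric]) measurable
        also have "\<dots> = (LBINT x. F (h k *\<^sub>R x) * cnj (w k (x + (b + z'))) * w k (x + a + z))"
          by (intro Bochner_Integration.integral_cong refl) (simp add: algebra_simps)
        finally show "(LBINT x. F (h k *\<^sub>R x) * cnj (w k (x + (b + z'))) * w k (x + a + z)) = J k z' z" ..
      qed
      finally show "cnj (cnj (\<phi> z')) * (LBINT x. F (h k *\<^sub>R x) * ?V k (x + a) * cnj (w k (x + b + z'))) = \<phi> z' * (LBINT z. cnj (\<phi> z) * J k z' z)" by simp
    qed
    finally show ?thesis .
  qed
  \<comment> \<open>The error of ignoring the displacement tends to 0 only pointwise, since the
    displacement grows with \<open>z'\<close>. Dominated convergence, in \<open>z\<close> and then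
    in \<open>z'\<close>, takes the place of uniformity.\<close>
  define E where "E k z' = (LBINT z. cnj (\<phi> z) * (J k z' z - c k (a - b + z - z')))" for k z'
  have Mb: "norm (J k z' z - c k (a - b + z - z')) \<le> 2 * K * B" for k z' z
    using norm_triangle_ineq4[of "J k z' z" "c k (a - b + z - z')"] Jb[of k z' z] cb[of k "a - b + z - z'"] by linarith
  define N where "N = (LBINT z. norm (\<phi> z))"
  have Eb: "norm (E k z') \<le> N * (2 * K * B)" for k z'
  proof -
    have "norm (E k z') \<le> (LBINT z. norm (cnj (\<phi> z))) * (2 * K * B)"
      unfolding E_def by (rule norm_integral_mult_bound[OF \<phi>c _ Mb]) measurable
    then show ?thesis by (simp add: N_def)
  qed
  have [measurable]: "E k \<in> borel_measurable borel" for k unfolding E_def [abs_def] by measurable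
  have E0: "(\<lambda>k. E k z') \<longlonglongrightarrow> 0" for z'
  proof -
    have "(\<lambda>k. E k z') \<longlonglongrightarrow> (LBINT z. cnj (\<phi> z) * 0)"
      unfolding E_def
    proof (rule integral_dominated_convergence[where w = "\<lambda>z. norm (\<phi> z) * (2 * K * B)"])
      show "AE z in lborel. (\<lambda>k. cnj (\<phi> z) * (J k z' z - c k (a - b + z - z'))) \<longlonglongrightarrow> cnj (\<phi> z) * 0"
        by (intro AE_I2 tendsto_mult tendsto_const Jc)
      show "AE z in lborel. norm (cnj (\<phi> z) * (J k z' z - c k (a - b + z - z'))) \<le> norm (\<phi> z) * (2 * K * B)" for k
        unfolding norm_mult complex_mod_cnj by (intro AE_I2 mult_left_mono Mb norm_ge_zero)
    qed (use \<phi> in auto)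
    then show ?thesis by simp
  qed
  have D0: "(\<lambda>k. LBINT z'. \<phi> z' * E k z') \<longlonglongrightarrow> 0"
  proof -
    have "(\<lambda>k. LBINT z'. \<phi> z' * E k z') \<longlonglongrightarrow> (LBINT z'. \<phi> z' * 0)"
    proof (rule integral_dominated_convergence[where w = "\<lambda>z'. norm (\<phi> z') * (N * (2 * K * B))"])
      show "AE z' in lborel. (\<lambda>k. \<phi> z' * E k z') \<longlonglongrightarrow> \<phi> z' * 0"
        by (intro AE_I2 tendsto_mult tendsto_const E0)
      show "AE z' in lborel. norm (\<phi> z' * E k z') \<le> norm (\<phi> z') * (N * (2 * K * B))" for k
        unfolding norm_mult by (intro AE_I2 mult_left_mono Eb norm_ge_zero)
    qed (use \<phi> in auto)
    then show ?thesis by simp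
  qed
  have split: "(LBINT z'. \<phi> z' * (LBINT z. cnj (\<phi> z) * J k z' z)) = (LBINT z'. \<phi> z' * E k z') + (LBINT \<zeta>. autocorr \<phi> (a - b) \<zeta> * c k \<zeta>)" for k
  proof -
    have i1: "integrable lborel (\<lambda>z. cnj (\<phi> z) * (J k z' z - c k (a - b + z - z')))" for z'
      by (rule integrable_mult_bounded[OF \<phi>c _ Mb]) measurable
    have i2: "integrable lborel (\<lambda>z. cnj (\<phi> z) * c k (a - b + z - z'))" for z'
      by (rule integrable_mult_bounded[OF \<phi>c _ cb]) measurable
    have e: "(LBINT z. cnj (\<phi> z) * J k z' z) = E k z' + (LBINT z. cnj (\<phi> z) * c k (a - b + z - z'))" for z'
      unfolding E_def by (subst Bochner_Integration.integral_add[OF i1 i2, symmetric]) (simp add: algebra_simps)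
    have i3: "integrable lborel (\<lambda>z'. \<phi> z' * E k z')"
      by (rule integrable_mult_bounded[OF \<phi> _ Eb]) measurable
    have cb2: "norm (LBINT z. cnj (\<phi> z) * c k (a - b + z - z')) \<le> N * (K * B)" for z'
    proof -
      have "norm (LBINT z. cnj (\<phi> z) * c k (a - b + z - z')) \<le> (LBINT z. norm (cnj (\<phi> z))) * (K * B)"
        by (rule norm_integral_mult_bound[OF \<phi>c _ cb]) measurable
      then show ?thesis by (simp add: N_def)
    qed
    have i4: "integrable lborel (\<lambda>z'. \<phi> z' * (LBINT z. cnj (\<phi> z) * c k (a - b + z - z')))"
      by (rule integrable_mult_bounded[OF \<phi> _ cb2]) measurable
    show ?thesis
      unfolding e distrib_left Bochner_Integration.integral_add[OF i3 i4]
      by (subst autocorr_Fubini(1)[OF \<phi> _ cb]) auto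
  qed
  have iA: "integrable lborel (autocorr \<phi> (a - b))"
    using autocorr_Fubini(2)[OF \<phi>, of "\<lambda>_. 1" 1 "a - b"] by simp
  have "(\<lambda>k. (LBINT z'. \<phi> z' * E k z') + (LBINT \<zeta>. autocorr \<phi> (a - b) \<zeta> * c k \<zeta>)) \<longlonglongrightarrow> 0 + (LINT p|\<mu>. F (fst p) * ctr (autocorr \<phi> (a - b)) (snd p))"
    unfolding c_def by (intro tendsto_add D0 corr_limit iA F)
  then show ?thesis
    unfolding eqJ split ctr_autocorr[OF \<phi>] by simp
qed

end

section \<open>Products of square integrable functions with bounded weights\<close>

lemma sq_int_bounded_mult:
  assumes f: "sq_int f" and [measurable]: "c \<in> borel_measurable borel" and K: "\<And>x. norm (c x) \<le> K"
  shows "sq_int (\<lambda>x. c x * f x)"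
proof -
  have [measurable]: "f \<in> borel_measurable borel" using f by (auto simp: sq_int_def)
  have i: "integrable lborel (\<lambda>x. K\<^sup>2 * (norm (f x))\<^sup>2)" using f by (auto simp: sq_int_def)
  have "integrable lborel (\<lambda>x. (norm (c x * f x))\<^sup>2)"
  proof (rule Bochner_Integration.integrable_bound[OF i])
    show "AE x in lborel. norm ((norm (c x * f x))\<^sup>2) \<le> norm (K\<^sup>2 * (norm (f x))\<^sup>2)"
      using K by (intro AE_I2) (auto simp: norm_mult power_mult_distrib intro!: mult_right_mono power_mono)
  qed measurable
  then show ?thesis by (auto simp: sq_int_def)
qed

lemma sq_int_add:
  assumes f: "sq_int f" and g: "sq_int g"
  shows "sq_int (\<lambda>x. f x + g x)"
proof -
  have [measurable]: "f \<in> borel_measurable borel" "g \<in> borel_measurable borel" using f g by (auto simp: sq_int_def)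
  have i: "integrable lborel (\<lambda>x. 2 * (norm (f x))\<^sup>2 + 2 * (norm (g x))\<^sup>2)" using f g by (auto simp: sq_int_def)
  have "integrable lborel (\<lambda>x. (norm (f x + g x))\<^sup>2)"
    by (rule Bochner_Integration.integrable_bound[OF i]) (auto intro!: AE_I2 order_trans[OF norm_add_sq_le])
  then show ?thesis by (auto simp: sq_int_def)
qed

lemma sq_int_zero: "sq_int (\<lambda>x. 0)"
  by (simp add: sq_int_def)

lemma sq_int_sum:
  "finite I \<Longrightarrow> (\<And>i. i \<in> I \<Longrightarrow> sq_int (f i)) \<Longrightarrow> sq_int (\<lambda>x. \<Sum>i\<in>I. f i x)"
  by (induct I rule: finite_induct) (auto intro: sq_int_add sq_int_zero)

lemma integrable_sq_int_mult:
  assumes "sq_int u" "sq_int v" and [measurable]: "G \<in> borel_measurable borel" and K: "\<And>x. norm (G x) \<le> K"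
  shows "integrable lborel (\<lambda>x. G x * u x * cnj (v x))"
proof -
  have "(\<lambda>x. G x * u x * cnj (v x)) = (\<lambda>x. u x * G x * cnj (v x))" by (simp add: fun_eq_iff)
  then show ?thesis using sq_int_prod_integrable(3)[OF assms(1,2,3) K] by simp
qed

text \<open>Only \<open>norm (G x)\<close> survives on the right, so oscillating factors inside
  \<open>G\<close> cost nothing.\<close>

lemma weighted_Cauchy_Schwarz:
  assumes u: "sq_int u" and v: "sq_int v" and [measurable]: "G \<in> borel_measurable borel" and K: "\<And>x. norm (G x) \<le> K"
  shows "norm (LBINT x. G x * u x * cnj (v x)) \<le>
    sqrt ((LBINT x. norm (G x) * (norm (u x))\<^sup>2) * (LBINT x. norm (G x) * (norm (v x))\<^sup>2))"
proof -
  have [measurable]: "u \<in> borel_measurable borel" "v \<in> borel_measurable borel" using u v by (auto simp: sq_int_def)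
  have i: "integrable lborel (\<lambda>x. norm (G x) * (norm (f x))\<^sup>2)" if f: "sq_int f" for f
  proof -
    have [measurable]: "f \<in> borel_measurable borel" using f by (auto simp: sq_int_def)
    have K0: "K \<ge> 0" using K[of undefined] norm_ge_zero order_trans by blast
    have i: "integrable lborel (\<lambda>x. K * (norm (f x))\<^sup>2)" using f by (auto simp: sq_int_def)
    show ?thesis
    proof (rule Bochner_Integration.integrable_bound[OF i])
      show "AE x in lborel. norm (norm (G x) * (norm (f x))\<^sup>2) \<le> norm (K * (norm (f x))\<^sup>2)"
        using K K0 by (intro AE_I2) (simp add: abs_mult mult_right_mono)
    qed measurable
  qed
  let ?A = "LBINT x. norm (G x) * (norm (u x))\<^sup>2" and ?B = "LBINT x. norm (G x) * (norm (v x))\<^sup>2"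
  have n: "(\<integral>\<^sup>+x. (ennreal (sqrt (norm (G x)) * norm (f x)))\<^sup>2 \<partial>lborel) = ennreal (LBINT x. norm (G x) * (norm (f x))\<^sup>2)" if "sq_int f" for f
    by (subst nn_integral_eq_integral[OF i[OF that], symmetric]) (auto simp: ennreal_power power_mult_distrib)
  have "ennreal (norm (LBINT x. G x * u x * cnj (v x))) \<le> (\<integral>\<^sup>+x. ennreal (norm (G x * u x * cnj (v x))) \<partial>lborel)"
    by (rule integral_norm_bound_ennreal[OF integrable_sq_int_mult[OF u v _ K]]) measurable
  also have "\<dots> = (\<integral>\<^sup>+x. ennreal (sqrt (norm (G x)) * norm (u x)) * ennreal (sqrt (norm (G x)) * norm (v x)) \<partial>lborel)"
  proof (rule nn_integral_cong)
    fix x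
    have "norm (G x * u x * cnj (v x)) = (sqrt (norm (G x)) * sqrt (norm (G x))) * (norm (u x) * norm (v x))"
      by (simp add: norm_mult)
    also have "\<dots> = (sqrt (norm (G x)) * norm (u x)) * (sqrt (norm (G x)) * norm (v x))" by (simp only: mult_ac)
    finally show "ennreal (norm (G x * u x * cnj (v x))) = ennreal (sqrt (norm (G x)) * norm (u x)) * ennreal (sqrt (norm (G x)) * norm (v x))"
      by (simp only: ennreal_mult mult_nonneg_nonneg real_sqrt_ge_zero norm_ge_zero)
  qed
  finally have "(ennreal (norm (LBINT x. G x * u x * cnj (v x))))\<^sup>2 \<le> (\<integral>\<^sup>+x. ennreal (sqrt (norm (G x)) * norm (u x)) * ennreal (sqrt (norm (G x)) * norm (v x)) \<partial>lborel)\<^sup>2"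
    by (rule power_mono) simp
  also have "\<dots> \<le> ennreal ?A * ennreal ?B"
    unfolding n[OF u, symmetric] n[OF v, symmetric] by (rule Cauchy_Schwarz_nn_integral) measurable
  finally have "ennreal ((norm (LBINT x. G x * u x * cnj (v x)))\<^sup>2) \<le> ennreal (?A * ?B)"
    by (simp add: ennreal_power ennreal_mult)
  then have "(norm (LBINT x. G x * u x * cnj (v x)))\<^sup>2 \<le> ?A * ?B"
    by (subst (asm) ennreal_le_iff) (auto intro!: mult_nonneg_nonneg)
  then show ?thesis by (rule real_le_rsqrt)
qed

lemma mult_sum_cnj_sum:
  "F * (\<Sum>i\<in>I. A i) * cnj (\<Sum>j\<in>I. A j) = (\<Sum>i\<in>I. \<Sum>j\<in>I. F * (A i * cnj (A j)))"
proof -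
  have "F * (\<Sum>i\<in>I. A i) * cnj (\<Sum>j\<in>I. A j) = F * ((\<Sum>i\<in>I. A i) * (\<Sum>j\<in>I. cnj (A j)))"
    by (simp only: mult.assoc cnj_sum)
  also have "\<dots> = (\<Sum>i\<in>I. \<Sum>j\<in>I. F * (A i * cnj (A j)))"
    by (subst sum_product) (simp only: sum_distrib_left)
  finally show ?thesis .
qed

section \<open>Quantized trigonometric symbols acting on the filtered sequence\<close>

context wigner_seq
begin

text \<open>The left quantization of the symbol \<open>\<Sum>i<n. c i * cis (\<alpha> i \<bullet> (x, \<xi>))\<close>, applied to the filtered sequence.\<close>

definition opt :: "nat \<Rightarrow> (nat \<Rightarrow> complex) \<Rightarrow> (nat \<Rightarrow> 'a \<times> 'a) \<Rightarrow> ('a \<Rightarrow> complex) \<Rightarrow> nat \<Rightarrow> 'a \<Rightarrow> complex" where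
  "opt n c \<alpha> \<phi> k x = (\<Sum>i<n. c i * cis (fst (\<alpha> i) \<bullet> (h k *\<^sub>R x)) * filt \<phi> (w k) (x + snd (\<alpha> i)))"

lemma sq_int_filt: "integrable lborel \<phi> \<Longrightarrow> sq_int (\<lambda>x. filt \<phi> (w k) (x + a))"
  by (intro sq_int_translate filt_sq_int w)

lemma filt_norm_le:
  assumes "integrable lborel \<phi>"
  shows "(LBINT x. (norm (filt \<phi> (w k) (x + a)))\<^sup>2) \<le> (LBINT z. norm (\<phi> z))\<^sup>2 * B"
proof -
  have "(LBINT x. (norm (filt \<phi> (w k) (x + a)))\<^sup>2) = (LBINT x. (norm (filt \<phi> (w k) x))\<^sup>2)"
    by (rule integral_sq_translate[OF filt_sq_int(1)[OF assms w]])
  also have "\<dots> \<le> (LBINT z. norm (\<phi> z))\<^sup>2 * (LBINT x. (norm (w k x))\<^sup>2)"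
    by (rule filt_sq_int(2)[OF assms w])
  also have "\<dots> \<le> (LBINT z. norm (\<phi> z))\<^sup>2 * B" by (intro mult_left_mono wB) simp
  finally show ?thesis .
qed

lemma sq_int_opt:
  assumes "integrable lborel \<phi>" shows "sq_int (opt n c \<alpha> \<phi> k)"
  unfolding opt_def [abs_def]
  by (intro sq_int_sum sq_int_bounded_mult[where K = "norm (c _)"] sq_int_filt assms) (auto simp: norm_mult)

text \<open>The squared quantization expands into finitely many products of two translated filtered
  functions with a modulated slow weight. Each limit contains a character of phase space, and the
  double sum recombines into the squared modulus of the symbol.\<close>

lemma opt_limit:
  assumes \<phi>: "integrable lborel \<phi>" and F: "Cc F"
  shows "(\<lambda>k. LBINT x. F (h k *\<^sub>R x) * opt n c \<alpha> \<phi> k x * cnj (opt n c \<alpha> \<phi> k x))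
    \<longlonglongrightarrow> (LINT p|\<mu>. F (fst p) * (complex_of_real ((norm (\<Sum>i<n. c i * cis (\<alpha> i \<bullet> p)))\<^sup>2) * complex_of_real (power_spec \<phi> (snd p))))"
proof -
  let ?V = "\<lambda>k. filt \<phi> (w k)"
  have [measurable]: "\<phi> \<in> borel_measurable borel" using \<phi> by auto
  have [measurable]: "F \<in> borel_measurable borel" by (rule Cc_measurable[OF F])
  obtain K where K: "K \<ge> 0" "\<And>x. norm (F x) \<le> K" using Cc_bounded[OF F] by blast
  define Fij where "Fij i j x = F x * cis ((fst (\<alpha> i) - fst (\<alpha> j)) \<bullet> x)" for i j x
  have Fc: "Cc (Fij i j)" for i j
    unfolding Fij_def by (rule Cc_mult_bounded_uniform[OF F]) (auto intro!: continuous_intros)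
  have [measurable]: "Fij i j \<in> borel_measurable borel" for i j by (rule Cc_measurable[OF Fc])
  have Fb: "norm (Fij i j x) \<le> K" for i j x using K(2)[of x] by (simp add: Fij_def norm_mult)
  have int: "integrable lborel (\<lambda>x. Fij i j (h k *\<^sub>R x) * ?V k (x + snd (\<alpha> i)) * cnj (?V k (x + snd (\<alpha> j))))" for i j k
    by (rule integrable_sq_int_mult[OF sq_int_filt[OF \<phi>] sq_int_filt[OF \<phi>] _ Fb]) measurable
  have eq: "(LBINT x. F (h k *\<^sub>R x) * opt n c \<alpha> \<phi> k x * cnj (opt n c \<alpha> \<phi> k x))
    = (\<Sum>i<n. \<Sum>j<n. (c i * cnj (c j)) * (LBINT x. Fij i j (h k *\<^sub>R x) * ?V k (x + snd (\<alpha> i)) * cnj (?V k (x + snd (\<alpha> j)))))" for k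
  proof -
    have "F (h k *\<^sub>R x) * opt n c \<alpha> \<phi> k x * cnj (opt n c \<alpha> \<phi> k x)
      = (\<Sum>i<n. \<Sum>j<n. (c i * cnj (c j)) * (Fij i j (h k *\<^sub>R x) * ?V k (x + snd (\<alpha> i)) * cnj (?V k (x + snd (\<alpha> j)))))" for x
    proof -
      have "F (h k *\<^sub>R x) * opt n c \<alpha> \<phi> k x * cnj (opt n c \<alpha> \<phi> k x)
        = (\<Sum>i<n. \<Sum>j<n. F (h k *\<^sub>R x) * ((c i * cis (fst (\<alpha> i) \<bullet> (h k *\<^sub>R x)) * ?V k (x + snd (\<alpha> i))) * cnj (c j * cis (fst (\<alpha> j) \<bullet> (h k *\<^sub>R x)) * ?V k (x + snd (\<alpha> j)))))"
        unfolding opt_def by (rule mult_sum_cnj_sum)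
      also have "\<dots> = (\<Sum>i<n. \<Sum>j<n. (c i * cnj (c j)) * (Fij i j (h k *\<^sub>R x) * ?V k (x + snd (\<alpha> i)) * cnj (?V k (x + snd (\<alpha> j)))))"
      proof (intro sum.cong refl)
        fix i j
        have "cis ((fst (\<alpha> i) - fst (\<alpha> j)) \<bullet> (h k *\<^sub>R x)) = cis (fst (\<alpha> i) \<bullet> (h k *\<^sub>R x)) * cnj (cis (fst (\<alpha> j) \<bullet> (h k *\<^sub>R x)))"
          by (simp add: cis_cnj cis_mult inner_diff_left right_diff_distrib)
        then show "F (h k *\<^sub>R x) * ((c i * cis (fst (\<alpha> i) \<bullet> (h k *\<^sub>R x)) * ?V k (x + snd (\<alpha> i))) * cnj (c j * cis (fst (\<alpha> j) \<bullet> (h k *\<^sub>R x)) * ?V k (x + snd (\<alpha> j))))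
          = (c i * cnj (c j)) * (Fij i j (h k *\<^sub>R x) * ?V k (x + snd (\<alpha> i)) * cnj (?V k (x + snd (\<alpha> j))))"
          unfolding Fij_def complex_cnj_mult by (simp only: mult_ac)
      qed
      finally show ?thesis .
    qed
    then show ?thesis using int by (simp add: Bochner_Integration.integral_sum)
  qed
  define L where "L i j p = Fij i j (fst p) * (cis ((snd (\<alpha> i) - snd (\<alpha> j)) \<bullet> snd p) * complex_of_real (power_spec \<phi> (snd p)))" for i j and p :: "'a \<times> 'a"
  define N where "N = (LBINT z. norm (\<phi> z))"
  have Li: "integrable \<mu> (L i j)" for i j
  proof (rule integrable_const_bound[where B = "K * N\<^sup>2"])
    show "AE p in \<mu>. norm (L i j p) \<le> K * N\<^sup>2"
    proof (rule AE_I2)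
      fix p
      have "norm (Fij i j (fst p)) * \<bar>power_spec \<phi> (snd p)\<bar> \<le> K * N\<^sup>2"
        using power_spec_bound[OF \<phi>, of "snd p"] K by (intro mult_mono Fb) (auto simp: N_def)
      then show "norm (L i j p) \<le> K * N\<^sup>2" by (simp add: L_def norm_mult)
    qed
  qed (unfold L_def, measurable)
  have "(\<lambda>k. \<Sum>i<n. \<Sum>j<n. (c i * cnj (c j)) * (LBINT x. Fij i j (h k *\<^sub>R x) * ?V k (x + snd (\<alpha> i)) * cnj (?V k (x + snd (\<alpha> j)))))
    \<longlonglongrightarrow> (\<Sum>i<n. \<Sum>j<n. (c i * cnj (c j)) * (LINT p|\<mu>. L i j p))"
    unfolding L_def by (intro tendsto_sum tendsto_mult tendsto_const filt_limit \<phi> Fc)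
  also have "(\<Sum>i<n. \<Sum>j<n. (c i * cnj (c j)) * (LINT p|\<mu>. L i j p)) = (LINT p|\<mu>. (\<Sum>i<n. \<Sum>j<n. (c i * cnj (c j)) * L i j p))"
    using Li by (simp add: Bochner_Integration.integral_sum)
  also have "(\<lambda>p. \<Sum>i<n. \<Sum>j<n. (c i * cnj (c j)) * L i j p) = (\<lambda>p. F (fst p) * (complex_of_real ((norm (\<Sum>i<n. c i * cis (\<alpha> i \<bullet> p)))\<^sup>2) * complex_of_real (power_spec \<phi> (snd p))))"
  proof (rule ext)
    fix p :: "'a \<times> 'a"
    have "complex_of_real ((norm (\<Sum>i<n. c i * cis (\<alpha> i \<bullet> p)))\<^sup>2) = (\<Sum>i<n. \<Sum>j<n. (c i * cis (\<alpha> i \<bullet> p)) * cnj (c j * cis (\<alpha> j \<bullet> p)))"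
      unfolding complex_norm_square cnj_sum sum_product ..
    then have "F (fst p) * (complex_of_real ((norm (\<Sum>i<n. c i * cis (\<alpha> i \<bullet> p)))\<^sup>2) * complex_of_real (power_spec \<phi> (snd p)))
      = (\<Sum>i<n. \<Sum>j<n. F (fst p) * (((c i * cis (\<alpha> i \<bullet> p)) * cnj (c j * cis (\<alpha> j \<bullet> p))) * complex_of_real (power_spec \<phi> (snd p))))"
      by (simp only: sum_distrib_left sum_distrib_right)
    also have "\<dots> = (\<Sum>i<n. \<Sum>j<n. (c i * cnj (c j)) * L i j p)"
    proof (intro sum.cong refl)
      fix i j
      have "cis ((fst (\<alpha> i) - fst (\<alpha> j)) \<bullet> fst p) * cis ((snd (\<alpha> i) - snd (\<alpha> j)) \<bullet> snd p) = cis (\<alpha> i \<bullet> p) * cnj (cis (\<alpha> j \<bullet> p))"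
        by (simp add: cis_cnj cis_mult inner_diff_left inner_prod_def algebra_simps)
      then have "F (fst p) * (c i * cnj (c j)) * complex_of_real (power_spec \<phi> (snd p)) * (cis ((fst (\<alpha> i) - fst (\<alpha> j)) \<bullet> fst p) * cis ((snd (\<alpha> i) - snd (\<alpha> j)) \<bullet> snd p))
        = F (fst p) * (c i * cnj (c j)) * complex_of_real (power_spec \<phi> (snd p)) * (cis (\<alpha> i \<bullet> p) * cnj (cis (\<alpha> j \<bullet> p)))" by simp
      then show "F (fst p) * (((c i * cis (\<alpha> i \<bullet> p)) * cnj (c j * cis (\<alpha> j \<bullet> p))) * complex_of_real (power_spec \<phi> (snd p))) = (c i * cnj (c j)) * L i j p"
        unfolding L_def Fij_def complex_cnj_mult by (simp only: mult_ac)
    qed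
    finally show "(\<Sum>i<n. \<Sum>j<n. (c i * cnj (c j)) * L i j p) = F (fst p) * (complex_of_real ((norm (\<Sum>i<n. c i * cis (\<alpha> i \<bullet> p)))\<^sup>2) * complex_of_real (power_spec \<phi> (snd p)))" ..
  qed
  finally show ?thesis unfolding eq .
qed

lemma opt_norm_limit:
  assumes \<phi>: "integrable lborel \<phi>" and f: "Cc f"
  shows "(\<lambda>k. LBINT x. norm (f (h k *\<^sub>R x)) * (norm (opt n c \<alpha> \<phi> k x))\<^sup>2)
    \<longlonglongrightarrow> (LINT p|\<mu>. norm (f (fst p)) * ((norm (\<Sum>i<n. c i * cis (\<alpha> i \<bullet> p)))\<^sup>2 * power_spec \<phi> (snd p)))"
proof -
  let ?F = "\<lambda>x. complex_of_real (norm (f x))"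
  have e1: "(LBINT x. ?F (h k *\<^sub>R x) * opt n c \<alpha> \<phi> k x * cnj (opt n c \<alpha> \<phi> k x)) = complex_of_real (LBINT x. norm (f (h k *\<^sub>R x)) * (norm (opt n c \<alpha> \<phi> k x))\<^sup>2)" for k
  proof -
    have "(LBINT x. ?F (h k *\<^sub>R x) * opt n c \<alpha> \<phi> k x * cnj (opt n c \<alpha> \<phi> k x)) = (LBINT x. complex_of_real (norm (f (h k *\<^sub>R x)) * (norm (opt n c \<alpha> \<phi> k x))\<^sup>2))"
      unfolding of_real_mult complex_norm_square by (simp only: mult.assoc)
    also have "\<dots> = complex_of_real (LBINT x. norm (f (h k *\<^sub>R x)) * (norm (opt n c \<alpha> \<phi> k x))\<^sup>2)"
      by (rule integral_complex_of_real)
    finally show ?thesis .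
  qed
  have e2: "(LINT p|\<mu>. ?F (fst p) * (complex_of_real ((norm (\<Sum>i<n. c i * cis (\<alpha> i \<bullet> p)))\<^sup>2) * complex_of_real (power_spec \<phi> (snd p))))
    = complex_of_real (LINT p|\<mu>. norm (f (fst p)) * ((norm (\<Sum>i<n. c i * cis (\<alpha> i \<bullet> p)))\<^sup>2 * power_spec \<phi> (snd p)))"
    unfolding of_real_mult[symmetric] by (rule integral_complex_of_real)
  show ?thesis using opt_limit[OF \<phi> Cc_norm[OF f], of n c \<alpha>] unfolding e1 e2 tendsto_of_real_iff .
qed

end

subsection \<open>Vanishing of oscillating terms\<close>

lemma weighted_sq_bound:
  assumes u: "sq_int u" and [measurable]: "G \<in> borel_measurable borel" and K: "\<And>x. norm (G x) \<le> K"
    and "(LBINT x. (norm (u x))\<^sup>2) \<le> D"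
  shows "(LBINT x. norm (G x) * (norm (u x))\<^sup>2) \<le> K * D"
proof -
  have [measurable]: "u \<in> borel_measurable borel" using u by (auto simp: sq_int_def)
  have K0: "K \<ge> 0" using K[of undefined] norm_ge_zero order_trans by blast
  have i: "integrable lborel (\<lambda>x. K * (norm (u x))\<^sup>2)" using u by (auto simp: sq_int_def)
  have "integrable lborel (\<lambda>x. norm (G x) * (norm (u x))\<^sup>2)"
  proof (rule Bochner_Integration.integrable_bound[OF i])
    show "AE x in lborel. norm (norm (G x) * (norm (u x))\<^sup>2) \<le> norm (K * (norm (u x))\<^sup>2)"
      using K K0 by (intro AE_I2) (simp add: abs_mult mult_right_mono)
  qed measurable
  then have "(LBINT x. norm (G x) * (norm (u x))\<^sup>2) \<le> (LBINT x. K * (norm (u x))\<^sup>2)"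
    using i K by (intro integral_mono) (auto intro!: mult_right_mono)
  also have "\<dots> = K * (LBINT x. (norm (u x))\<^sup>2)" by simp
  also have "\<dots> \<le> K * D" by (intro mult_left_mono assms K0)
  finally show ?thesis .
qed

lemma integral_le_of_nn_integral:
  fixes q r :: "'a \<Rightarrow> real"
  assumes [measurable]: "q \<in> borel_measurable M" "r \<in> borel_measurable M"
    and q: "\<And>x. 0 \<le> q x" "\<And>x. q x \<le> K * r x" and "0 \<le> K" "0 \<le> e"
    and r: "(\<integral>\<^sup>+x. ennreal (r x) \<partial>M) \<le> ennreal e"
  shows "(LINT x|M. q x) \<le> K * e"
proof -
  have "(\<integral>\<^sup>+x. ennreal (q x) \<partial>M) \<le> (\<integral>\<^sup>+x. ennreal K * ennreal (r x) \<partial>M)"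
    using q \<open>0 \<le> K\<close> by (intro nn_integral_mono) (simp add: ennreal_mult'[symmetric] ennreal_leI)
  also have "\<dots> \<le> ennreal (K * e)"
    using r \<open>0 \<le> K\<close> \<open>0 \<le> e\<close> by (simp add: nn_integral_cmult ennreal_mult mult_left_mono)
  finally have le: "(\<integral>\<^sup>+x. ennreal (q x) \<partial>M) \<le> ennreal (K * e)" .
  have "(LINT x|M. q x) = enn2real (\<integral>\<^sup>+x. ennreal (q x) \<partial>M)"
    using q by (intro integral_eq_nn_integral) auto
  also have "\<dots> \<le> enn2real (ennreal (K * e))"
    using le by (intro enn2real_mono) auto
  also have "\<dots> = K * e" using assms by simp
  finally show ?thesis .
qed

context wigner_seq
begin

text \<open>Only the slow factor is displaced, by \<open>h k *\<^sub>R a\<close>, which is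
  negligible by uniform continuity. The factor \<open>c\<close> may oscillate at unit scale; the
  character of frequency \<theta> is later placed there.\<close>

lemma slow_variation:
  assumes \<phi>: "integrable lborel \<phi>" and F: "Cc F"
    and c: "c \<in> borel_measurable borel" "\<And>x. norm (c x) \<le> 1"
  shows "(\<lambda>k. (LBINT x. F (h k *\<^sub>R (x - a)) * c x * filt \<phi> (w k) (x + p) * cnj (filt \<phi> (w k) (x + q)))
     - (LBINT x. F (h k *\<^sub>R x) * c x * filt \<phi> (w k) (x + p) * cnj (filt \<phi> (w k) (x + q)))) \<longlonglongrightarrow> 0"
proof (rule metric_LIMSEQ_I)
  let ?V = "\<lambda>k. filt \<phi> (w k)"
  note [measurable] = c(1)
  have [measurable]: "\<phi> \<in> borel_measurable borel" using \<phi> by auto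
  have [measurable]: "F \<in> borel_measurable borel" by (rule Cc_measurable[OF F])
  obtain K where K: "K \<ge> 0" "\<And>x. norm (F x) \<le> K" using Cc_bounded[OF F] by blast
  define N where "N = (LBINT z. norm (\<phi> z))"
  have fN: "(LBINT x. (norm (?V k (x + a)))\<^sup>2) \<le> N\<^sup>2 * B" for k a
    unfolding N_def by (rule filt_norm_le[OF \<phi>])
  have NB: "0 \<le> N\<^sup>2 * B" using B_nonneg by simp
  fix e :: real assume e: "e > 0"
  define e' where "e' = e / (N\<^sup>2 * B + 1)"
  have p1: "0 < N\<^sup>2 * B + 1" using NB by linarith
  have e': "e' > 0" "e' * (N\<^sup>2 * B) < e"
  proof -
    show "e' > 0" using p1 e by (simp add: e'_def)
    have "e * (N\<^sup>2 * B) / (N\<^sup>2 * B + 1) < e"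
      unfolding pos_divide_less_eq[OF p1] using e by (simp add: distrib_left)
    then show "e' * (N\<^sup>2 * B) < e" by (simp add: e'_def)
  qed
  obtain \<delta> where \<delta>: "\<delta> > 0" "\<And>x y. norm (x - y) < \<delta> \<Longrightarrow> norm (F x - F y) < e'"
    using Cc_uniform[OF F e'(1)] by blast
  have "(\<lambda>k. h k * norm a) \<longlonglongrightarrow> 0 * norm a" by (intro tendsto_intros h0)
  then have "\<forall>\<^sub>F k in sequentially. h k * norm a < \<delta>" using \<delta>(1) by (intro order_tendstoD) auto
  then obtain k0 where k0: "\<And>k. k \<ge> k0 \<Longrightarrow> h k * norm a < \<delta>" by (auto simp: eventually_sequentially)
  have "dist ((LBINT x. F (h k *\<^sub>R (x - a)) * c x * ?V k (x + p) * cnj (?V k (x + q)))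
     - (LBINT x. F (h k *\<^sub>R x) * c x * ?V k (x + p) * cnj (?V k (x + q)))) 0 < e" if "k \<ge> k0" for k
  proof -
    note sq = sq_int_filt[OF \<phi>, of k]
    let ?G = "\<lambda>x. (F (h k *\<^sub>R (x - a)) - F (h k *\<^sub>R x)) * c x"
    have G: "norm (?G x) \<le> e'" for x
    proof -
      have "norm (h k *\<^sub>R (x - a) - h k *\<^sub>R x) = h k * norm a"
        unfolding scaleR_diff_right[symmetric] using hpos[of k] by simp
      then have "norm (F (h k *\<^sub>R (x - a)) - F (h k *\<^sub>R x)) \<le> e'"
        using k0[OF that] by (intro less_imp_le \<delta>(2)) simp
      then have "norm (F (h k *\<^sub>R (x - a)) - F (h k *\<^sub>R x)) * norm (c x) \<le> e' * 1"
        by (intro mult_mono c) (use e' in auto)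
      then show ?thesis by (simp add: norm_mult)
    qed
    have cK: "norm (F y * c x) \<le> K" for x y
      using mult_mono[OF K(2)[of y] c(2)[of x]] K(1) by (simp add: norm_mult)
    have i1: "integrable lborel (\<lambda>x. F (h k *\<^sub>R (x - a)) * c x * ?V k (x + p) * cnj (?V k (x + q)))"
      by (rule integrable_sq_int_mult[OF sq sq _ cK]) measurable
    have i2: "integrable lborel (\<lambda>x. F (h k *\<^sub>R x) * c x * ?V k (x + p) * cnj (?V k (x + q)))"
      by (rule integrable_sq_int_mult[OF sq sq _ cK]) measurable
    have d: "(LBINT x. F (h k *\<^sub>R (x - a)) * c x * ?V k (x + p) * cnj (?V k (x + q)))
     - (LBINT x. F (h k *\<^sub>R x) * c x * ?V k (x + p) * cnj (?V k (x + q)))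
     = (LBINT x. ?G x * ?V k (x + p) * cnj (?V k (x + q)))"
      by (subst Bochner_Integration.integral_diff[OF i1 i2, symmetric]) (simp add: left_diff_distrib)
    have "norm (LBINT x. ?G x * ?V k (x + p) * cnj (?V k (x + q))) \<le> sqrt ((LBINT x. norm (?G x) * (norm (?V k (x + p)))\<^sup>2) * (LBINT x. norm (?G x) * (norm (?V k (x + q)))\<^sup>2))"
      by (rule weighted_Cauchy_Schwarz[OF sq sq _ G]) measurable
    also have "\<dots> \<le> sqrt ((e' * (N\<^sup>2 * B)) * (e' * (N\<^sup>2 * B)))"
    proof (rule real_sqrt_le_mono, rule mult_mono)
      show "(LBINT x. norm (?G x) * (norm (?V k (x + p)))\<^sup>2) \<le> e' * (N\<^sup>2 * B)"
        by (rule weighted_sq_bound[OF sq _ G fN]) measurable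
      show "(LBINT x. norm (?G x) * (norm (?V k (x + q)))\<^sup>2) \<le> e' * (N\<^sup>2 * B)"
        by (rule weighted_sq_bound[OF sq _ G fN]) measurable
      show "0 \<le> e' * (N\<^sup>2 * B)" using e'(1) NB by (rule mult_nonneg_nonneg[OF less_imp_le])
      show "0 \<le> (LBINT x. norm (?G x) * (norm (?V k (x + q)))\<^sup>2)"
        by (rule integral_nonneg_AE) (intro AE_I2 mult_nonneg_nonneg norm_ge_zero zero_le_power2)
    qed
    also have "\<dots> = e' * (N\<^sup>2 * B)"
      using mult_nonneg_nonneg[OF less_imp_le[OF e'(1)] NB] by (rule real_sqrt_abs2[THEN trans, OF abs_of_nonneg])
    finally have "norm (LBINT x. ?G x * ?V k (x + p) * cnj (?V k (x + q))) \<le> e' * (N\<^sup>2 * B)" .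
    then show ?thesis using e'(2) unfolding dist_norm d diff_0_right by (rule order_le_less_trans)
  qed
  then show "\<exists>no. \<forall>k\<ge>no. dist ((LBINT x. F (h k *\<^sub>R (x - a)) * c x * ?V k (x + p) * cnj (?V k (x + q)))
     - (LBINT x. F (h k *\<^sub>R x) * c x * ?V k (x + p) * cnj (?V k (x + q)))) 0 < e"
    by blast
qed

text \<open>The indicator of \<open>S\<close> equals 1 almost everywhere for the spectral measure
  \<open>m0\<close> and 0 almost everywhere for its image \<open>m1\<close> under the shift by
  \<theta>. A polynomial close to the indicator in L2 of both measures inherits this
  separation.\<close>

lemma trig_approx_spectrum:
  assumes \<phi>: "integrable lborel \<phi>" and S: "S \<in> sets borel"
    and S1: "AE p in \<mu>. power_spec \<phi> (snd p) = 0 \<or> p \<in> S"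
    and S2: "AE p in \<mu>. power_spec \<phi> (snd p) = 0 \<or> (fst p, snd p - \<theta>) \<notin> S"
    and e: "e > 0"
  obtains n :: nat and c \<alpha> where
    "(\<integral>\<^sup>+p. ennreal ((norm (1 - (\<Sum>i<n. c i * cis (\<alpha> i \<bullet> p))))\<^sup>2 * power_spec \<phi> (snd p)) \<partial>\<mu>) \<le> ennreal e"
    "(\<integral>\<^sup>+p. ennreal ((norm (\<Sum>i<n. c i * cis (\<alpha> i \<bullet> (fst p, snd p - \<theta>))))\<^sup>2 * power_spec \<phi> (snd p)) \<partial>\<mu>) \<le> ennreal e"
proof -
  have [measurable]: "\<phi> \<in> borel_measurable borel" using \<phi> by auto
  note [measurable] = S
  define N where "N = (LBINT z. norm (\<phi> z))"
  define m0 where "m0 = density \<mu> (\<lambda>p. ennreal (power_spec \<phi> (snd p)))"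
  define \<tau> where "\<tau> p = (fst p, snd p - \<theta>)" for p :: "'a \<times> 'a"
  have \<tau> [measurable]: "\<tau> \<in> \<mu> \<rightarrow>\<^sub>M borel" unfolding \<tau>_def borel_prod[symmetric] by measurable
  have s0: "sets m0 = sets borel" by (simp add: m0_def sets_mu)
  have \<tau>0 [measurable]: "\<tau> \<in> m0 \<rightarrow>\<^sub>M borel" unfolding m0_def by simp
  define m1 where "m1 = distr m0 borel \<tau>"
  have f0: "finite_measure m0"
  proof (rule finite_measureI)
    have "emeasure m0 (space m0) = (\<integral>\<^sup>+p. ennreal (power_spec \<phi> (snd p)) \<partial>\<mu>)"
      unfolding m0_def by (subst emeasure_density) (auto simp: space_mu intro!: nn_integral_cong)
    also have "\<dots> \<le> (\<integral>\<^sup>+p. ennreal (N\<^sup>2) \<partial>\<mu>)"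
      using power_spec_bound(2)[OF \<phi>] by (intro nn_integral_mono ennreal_leI) (simp add: N_def)
    also have "\<dots> < \<infinity>" by (simp add: ennreal_mult_less_top emeasure_eq_measure)
    finally show "emeasure m0 (space m0) \<noteq> \<infinity>" by simp
  qed
  have f1: "finite_measure m1" unfolding m1_def by (rule finite_measure.finite_measure_distr[OF f0 \<tau>0])
  have "trig_approx {m0, m1} (indicator S)"
  proof (rule trig_approx_indicator[OF _ _ S])
    have "sets m1 = sets borel" by (simp add: m1_def)
    then show "finite_measure M \<and> sets M = sets borel" if "M \<in> {m0, m1}" for M
      using that f0 f1 s0 by blast
  qed simp
  from this[unfolded trig_approx_def, rule_format, OF e]
  obtain g where g0: "trig_poly g" "\<forall>M\<in>{m0, m1}. (\<integral>\<^sup>+x. ennreal ((norm (indicator S x - g x))\<^sup>2) \<partial>M) < ennreal e"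
    by blast
  then have g: "trig_poly g" "(\<integral>\<^sup>+x. ennreal ((norm (indicator S x - g x))\<^sup>2) \<partial>m0) < ennreal e"
    "(\<integral>\<^sup>+x. ennreal ((norm (indicator S x - g x))\<^sup>2) \<partial>m1) < ennreal e"
    by (blast, blast, blast)
  obtain n :: nat and c \<alpha> where gs: "g = (\<lambda>x. \<Sum>i<n. c i * cis (\<alpha> i \<bullet> x))"
    using g(1) by (rule trig_polyE)
  have gm [measurable]: "g \<in> borel_measurable borel" by (rule trig_poly_measurable[OF g(1)])
  have gm' [measurable]: "g \<in> borel_measurable \<mu>" using gm measurable_cong_sets[OF sets_mu refl, of borel] by simp
  have Sm [measurable]: "S \<in> sets \<mu>" using S sets_mu by simp
  have "(\<integral>\<^sup>+p. ennreal ((norm (1 - g p))\<^sup>2 * power_spec \<phi> (snd p)) \<partial>\<mu>) = (\<integral>\<^sup>+p. ennreal (power_spec \<phi> (snd p)) * ennreal ((norm (indicator S p - g p))\<^sup>2) \<partial>\<mu>)"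
  proof (rule nn_integral_cong_AE)
    show "AE p in \<mu>. ennreal ((norm (1 - g p))\<^sup>2 * power_spec \<phi> (snd p)) = ennreal (power_spec \<phi> (snd p)) * ennreal ((norm (indicator S p - g p))\<^sup>2)"
      using S1 by eventually_elim (use power_spec_bound(1)[OF \<phi>] in \<open>auto simp: ennreal_mult[symmetric] mult.commute\<close>)
  qed
  also have "\<dots> = (\<integral>\<^sup>+x. ennreal ((norm (indicator S x - g x))\<^sup>2) \<partial>m0)"
    unfolding m0_def by (rule nn_integral_density[symmetric]) measurable
  finally have 1: "(\<integral>\<^sup>+p. ennreal ((norm (1 - g p))\<^sup>2 * power_spec \<phi> (snd p)) \<partial>\<mu>) \<le> ennreal e" using g(2) by simp
  have "(\<integral>\<^sup>+p. ennreal ((norm (g (\<tau> p)))\<^sup>2 * power_spec \<phi> (snd p)) \<partial>\<mu>) = (\<integral>\<^sup>+p. ennreal (power_spec \<phi> (snd p)) * ennreal ((norm (indicator S (\<tau> p) - g (\<tau> p)))\<^sup>2) \<partial>\<mu>)"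
  proof (rule nn_integral_cong_AE)
    show "AE p in \<mu>. ennreal ((norm (g (\<tau> p)))\<^sup>2 * power_spec \<phi> (snd p)) = ennreal (power_spec \<phi> (snd p)) * ennreal ((norm (indicator S (\<tau> p) - g (\<tau> p)))\<^sup>2)"
      using S2 by eventually_elim (use power_spec_bound(1)[OF \<phi>] in \<open>auto simp: ennreal_mult[symmetric] mult.commute \<tau>_def\<close>)
  qed
  also have "\<dots> = (\<integral>\<^sup>+p. ennreal ((norm (indicator S (\<tau> p) - g (\<tau> p)))\<^sup>2) \<partial>m0)"
    unfolding m0_def by (rule nn_integral_density[symmetric]) measurable
  also have "\<dots> = (\<integral>\<^sup>+x. ennreal ((norm (indicator S x - g x))\<^sup>2) \<partial>m1)"
    unfolding m1_def by (rule nn_integral_distr[symmetric]) measurable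
  finally have 2: "(\<integral>\<^sup>+p. ennreal ((norm (g (\<tau> p)))\<^sup>2 * power_spec \<phi> (snd p)) \<partial>\<mu>) \<le> ennreal e" using g(3) by simp
  show thesis using 1 2 unfolding gs \<tau>_def by (rule that)
qed

text \<open>Approximate \<open>indicator S\<close> by a trigonometric polynomial symbol \<open>g\<close>, simultaneously for the spectral
  measure and its translate. Up to small errors the quantization of \<open>g\<close> fixes the filtered sequence, while its
  adjoint, moved across the oscillation \<open>cis (\<theta> \<bullet> x)\<close>, annihilates it.\<close>

theorem oscillation_vanishes:
  assumes \<phi>: "integrable lborel \<phi>" and f: "Cc f" and S: "S \<in> sets borel"
    and S1: "AE p in \<mu>. power_spec \<phi> (snd p) = 0 \<or> p \<in> S"
    and S2: "AE p in \<mu>. power_spec \<phi> (snd p) = 0 \<or> (fst p, snd p - \<theta>) \<notin> S"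
  shows "(\<lambda>k. LBINT x. f (h k *\<^sub>R x) * cis (\<theta> \<bullet> x) * filt \<phi> (w k) x * cnj (filt \<phi> (w k) (x + p))) \<longlonglongrightarrow> 0"
proof (rule metric_LIMSEQ_I)
  let ?V = "\<lambda>k. filt \<phi> (w k)"
  fix \<eta> :: real assume \<eta>: "\<eta> > 0"
  have [measurable]: "\<phi> \<in> borel_measurable borel" using \<phi> by auto
  have [measurable]: "f \<in> borel_measurable borel" by (rule Cc_measurable[OF f])
  obtain K where K: "K \<ge> 0" "\<And>x. norm (f x) \<le> K" using Cc_bounded[OF f] by blast
  define N where "N = (LBINT z. norm (\<phi> z))"
  have fN: "(LBINT x. (norm (?V k (x + a)))\<^sup>2) \<le> N\<^sup>2 * B" for k a
    unfolding N_def by (rule filt_norm_le[OF \<phi>])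
  define C where "C = K * (N\<^sup>2 * B)"
  have C0: "C \<ge> 0" using K B_nonneg by (simp add: C_def)
  \<comment> \<open>In the limit each of the two Cauchy-Schwarz terms is the square root of at most
    \<open>K * e * C\<close>, hence at most \<open>\<eta> / 4\<close>.\<close>
  define e where "e = (\<eta> / 4)\<^sup>2 / (K * C + 1)"
  have KC: "0 \<le> K * C" using K C0 by simp
  have e: "e > 0" "K * e * C \<le> (\<eta> / 4)\<^sup>2"
  proof -
    show "e > 0" using KC \<eta> by (simp add: e_def add_nonneg_pos)
    have "K * C * (\<eta> / 4)\<^sup>2 \<le> (\<eta> / 4)\<^sup>2 * (K * C + 1)" unfolding distrib_left mult.commute[of "K * C"] by simp
    then show "K * e * C \<le> (\<eta> / 4)\<^sup>2"
      using KC by (simp add: e_def pos_divide_le_eq mult_ac)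
  qed
  obtain n :: nat and c \<alpha> where
    g1: "(\<integral>\<^sup>+p. ennreal ((norm (1 - (\<Sum>i<n. c i * cis (\<alpha> i \<bullet> p))))\<^sup>2 * power_spec \<phi> (snd p)) \<partial>\<mu>) \<le> ennreal e" and
    g2: "(\<integral>\<^sup>+p. ennreal ((norm (\<Sum>i<n. c i * cis (\<alpha> i \<bullet> (fst p, snd p - \<theta>))))\<^sup>2 * power_spec \<phi> (snd p)) \<partial>\<mu>) \<le> ennreal e"
    by (rule trig_approx_spectrum[OF \<phi> S S1 S2 e(1)])
  \<comment> \<open>Coefficients and frequencies of the complementary symbol \<open>1 - g\<close>:
    the constant 1 is appended at index \<open>n\<close> with frequency 0.\<close>
  define c1 where "c1 i = (if i < n then - c i else 1)" for i
  define \<alpha>1 where "\<alpha>1 i = (if i < n then \<alpha> i else 0)" for i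
  \<comment> \<open>The formal adjoint of the quantization of \<open>g\<close>, conjugated by the
    oscillation and displaced by the lag \<open>p\<close>. The modulus of its symbol at
    \<open>(x, \<xi>)\<close> is that of \<open>g\<close> at
    \<open>(x, \<xi> - \<theta>)\<close>.\<close>
  define c2 where "c2 i = cnj (c i) * cis (\<theta> \<bullet> snd (\<alpha> i))" for i
  define \<alpha>2 where "\<alpha>2 i = (- fst (\<alpha> i), p - snd (\<alpha> i))" for i
  have opt1: "opt (Suc n) c1 \<alpha>1 \<phi> k x = ?V k x - opt n c \<alpha> \<phi> k x" for k x
  proof -
    have "(\<Sum>i<n. c1 i * cis (fst (\<alpha>1 i) \<bullet> (h k *\<^sub>R x)) * ?V k (x + snd (\<alpha>1 i))) = - (\<Sum>i<n. c i * cis (fst (\<alpha> i) \<bullet> (h k *\<^sub>R x)) * ?V k (x + snd (\<alpha> i)))"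
      unfolding sum_negf[symmetric] by (intro sum.cong) (auto simp: c1_def \<alpha>1_def)
    then show ?thesis by (simp add: opt_def c1_def \<alpha>1_def)
  qed
  have sum1: "(\<Sum>i<Suc n. c1 i * cis (\<alpha>1 i \<bullet> q)) = 1 - (\<Sum>i<n. c i * cis (\<alpha> i \<bullet> q))" for q
  proof -
    have "(\<Sum>i<n. c1 i * cis (\<alpha>1 i \<bullet> q)) = - (\<Sum>i<n. c i * cis (\<alpha> i \<bullet> q))"
      unfolding sum_negf[symmetric] by (intro sum.cong) (auto simp: c1_def \<alpha>1_def)
    then show ?thesis by (simp add: c1_def \<alpha>1_def)
  qed
  have sum2: "norm (\<Sum>i<n. c2 i * cis (\<alpha>2 i \<bullet> q)) = norm (\<Sum>i<n. c i * cis (\<alpha> i \<bullet> (fst q, snd q - \<theta>)))" for q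
  proof -
    have "(\<Sum>i<n. c2 i * cis (\<alpha>2 i \<bullet> q)) = (\<Sum>i<n. cis (p \<bullet> snd q) * cnj (c i * cis (\<alpha> i \<bullet> (fst q, snd q - \<theta>))))"
    proof (intro sum.cong refl)
      fix i
      have "cis (\<theta> \<bullet> snd (\<alpha> i)) * cis (\<alpha>2 i \<bullet> q) = cis (p \<bullet> snd q) * cis (- (\<alpha> i \<bullet> (fst q, snd q - \<theta>)))"
        by (simp add: \<alpha>2_def cis_mult inner_prod_def inner_diff_left inner_diff_right inner_commute algebra_simps)
      then show "c2 i * cis (\<alpha>2 i \<bullet> q) = cis (p \<bullet> snd q) * cnj (c i * cis (\<alpha> i \<bullet> (fst q, snd q - \<theta>)))"
        by (simp add: c2_def cis_cnj mult_ac)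
    qed
    also have "\<dots> = cis (p \<bullet> snd q) * cnj (\<Sum>i<n. c i * cis (\<alpha> i \<bullet> (fst q, snd q - \<theta>)))"
      unfolding cnj_sum sum_distrib_left ..
    finally show ?thesis by (simp only: norm_mult norm_cis complex_mod_cnj mult_1_left)
  qed
  define X where "X k = (LBINT x. norm (f (h k *\<^sub>R x)) * (norm (opt (Suc n) c1 \<alpha>1 \<phi> k x))\<^sup>2)" for k
  define Z where "Z k = (LBINT x. norm (f (h k *\<^sub>R x)) * (norm (opt n c2 \<alpha>2 \<phi> k x))\<^sup>2)" for k
  define LX where "LX = (LINT q|\<mu>. norm (f (fst q)) * ((norm (1 - (\<Sum>i<n. c i * cis (\<alpha> i \<bullet> q))))\<^sup>2 * power_spec \<phi> (snd q)))"
  define LZ where "LZ = (LINT q|\<mu>. norm (f (fst q)) * ((norm (\<Sum>i<n. c i * cis (\<alpha> i \<bullet> (fst q, snd q - \<theta>))))\<^sup>2 * power_spec \<phi> (snd q)))"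
  have XL: "X \<longlonglongrightarrow> LX"
    using opt_norm_limit[OF \<phi> f, of "Suc n" c1 \<alpha>1] unfolding X_def LX_def sum1 .
  have ZL: "Z \<longlonglongrightarrow> LZ"
    using opt_norm_limit[OF \<phi> f, of n c2 \<alpha>2] unfolding Z_def LZ_def sum2 .
  have inn: "(\<lambda>q. \<alpha> i \<bullet> q) \<in> borel_measurable \<mu>" "(\<lambda>q. \<alpha> i \<bullet> (fst q, snd q - \<theta>)) \<in> borel_measurable \<mu>" for i
    unfolding inner_prod_def by measurable
  note [measurable] = inn
  have LX: "LX \<le> K * e" unfolding LX_def
    by (rule integral_le_of_nn_integral[OF _ _ _ _ K(1) _ g1])
      (use e power_spec_bound(1)[OF \<phi>] in \<open>auto intro!: mult_right_mono K mult_nonneg_nonneg\<close>)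
  have LZ: "LZ \<le> K * e" unfolding LZ_def
    by (rule integral_le_of_nn_integral[OF _ _ _ _ K(1) _ g2])
      (use e power_spec_bound(1)[OF \<phi>] in \<open>auto intro!: mult_right_mono K mult_nonneg_nonneg\<close>)
  define F where "F i x = f x * cis (fst (\<alpha> i) \<bullet> x)" for i x
  have Fc: "Cc (F i)" for i unfolding F_def by (rule Cc_mult_bounded_uniform[OF f]) (auto intro!: continuous_intros)
  have [measurable]: "F i \<in> borel_measurable borel" for i by (rule Cc_measurable[OF Fc])
  have FK: "norm (F i x) \<le> K" for i x using K(2)[of x] by (simp add: F_def norm_mult)
  \<comment> \<open>\<open>A\<close> is the exact result of transferring a translation to the other
    factor, and \<open>A'\<close> is what the adjoint symbol produces. They differ only in the
    argument of the slow weight.\<close>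
  define A where "A i k = (LBINT x. F i (h k *\<^sub>R (x - snd (\<alpha> i))) * cis (\<theta> \<bullet> (x - snd (\<alpha> i))) * ?V k (x + 0) * cnj (?V k (x + (p - snd (\<alpha> i)))))" for i k
  define A' where "A' i k = (LBINT x. F i (h k *\<^sub>R x) * cis (\<theta> \<bullet> (x - snd (\<alpha> i))) * ?V k (x + 0) * cnj (?V k (x + (p - snd (\<alpha> i)))))" for i k
  have AA: "(\<lambda>k. A i k - A' i k) \<longlonglongrightarrow> 0" for i
    unfolding A_def A'_def by (rule slow_variation[OF \<phi> Fc]) auto
  have Err: "(\<lambda>k. \<Sum>i<n. c i * (A i k - A' i k)) \<longlonglongrightarrow> 0"
  proof -
    have "(\<lambda>k. \<Sum>i<n. c i * (A i k - A' i k)) \<longlonglongrightarrow> (\<Sum>i<n. c i * 0)"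
      by (intro tendsto_sum tendsto_mult tendsto_const AA)
    then show ?thesis by simp
  qed
  define G where "G k x = f (h k *\<^sub>R x) * cis (\<theta> \<bullet> x)" for k x
  have [measurable]: "G k \<in> borel_measurable borel" for k unfolding G_def [abs_def] by measurable
  have GK: "norm (G k x) \<le> K" for k x using K(2)[of "h k *\<^sub>R x"] by (simp add: G_def norm_mult)
  have nG: "norm (G k x) = norm (f (h k *\<^sub>R x))" for k x by (simp add: G_def norm_mult)
  have GV: "(LBINT x. norm (G k x) * (norm (?V k (x + a)))\<^sup>2) \<le> C" for k a
    unfolding C_def by (rule weighted_sq_bound[OF sq_int_filt[OF \<phi>] _ GK fN]) measurable
  define I where "I k = (LBINT x. f (h k *\<^sub>R x) * cis (\<theta> \<bullet> x) * ?V k x * cnj (?V k (x + p)))" for k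
  have sf: "sq_int (\<lambda>x. ?V k (x + a))" for k a by (rule sq_int_filt[OF \<phi>])
  have bound: "norm (I k) \<le> sqrt (X k * C) + norm (\<Sum>i<n. c i * (A i k - A' i k)) + sqrt (C * Z k)" for k
  proof -
    define T1 where "T1 = (LBINT x. G k x * opt (Suc n) c1 \<alpha>1 \<phi> k x * cnj (?V k (x + p)))"
    define T2 where "T2 = (LBINT x. G k x * opt n c \<alpha> \<phi> k x * cnj (?V k (x + p)))"
    define T3 where "T3 = (LBINT x. G k x * ?V k (x + 0) * cnj (opt n c2 \<alpha>2 \<phi> k x))"
    have i1: "integrable lborel (\<lambda>x. G k x * opt (Suc n) c1 \<alpha>1 \<phi> k x * cnj (?V k (x + p)))"
      by (rule integrable_sq_int_mult[OF sq_int_opt[OF \<phi>] sf _ GK]) measurable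
    have i2: "integrable lborel (\<lambda>x. G k x * opt n c \<alpha> \<phi> k x * cnj (?V k (x + p)))"
      by (rule integrable_sq_int_mult[OF sq_int_opt[OF \<phi>] sf _ GK]) measurable
    have I12: "I k = T1 + T2"
      unfolding T1_def T2_def Bochner_Integration.integral_add[OF i1 i2, symmetric] I_def
      by (intro Bochner_Integration.integral_cong refl) (simp add: opt1 G_def algebra_simps)
    have T1: "norm T1 \<le> sqrt (X k * C)"
    proof -
      have "norm T1 \<le> sqrt ((LBINT x. norm (G k x) * (norm (opt (Suc n) c1 \<alpha>1 \<phi> k x))\<^sup>2) * (LBINT x. norm (G k x) * (norm (?V k (x + p)))\<^sup>2))"
        unfolding T1_def by (rule weighted_Cauchy_Schwarz[OF sq_int_opt[OF \<phi>] sf _ GK]) measurable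
      also have "\<dots> \<le> sqrt (X k * C)"
        unfolding nG X_def[symmetric] by (intro real_sqrt_le_mono mult_left_mono GV[unfolded nG]) (simp add: X_def)
      finally show ?thesis .
    qed
    have T3: "norm T3 \<le> sqrt (C * Z k)"
    proof -
      have "norm T3 \<le> sqrt ((LBINT x. norm (G k x) * (norm (?V k (x + 0)))\<^sup>2) * (LBINT x. norm (G k x) * (norm (opt n c2 \<alpha>2 \<phi> k x))\<^sup>2))"
        unfolding T3_def by (rule weighted_Cauchy_Schwarz[OF sf sq_int_opt[OF \<phi>] _ GK]) measurable
      also have "\<dots> \<le> sqrt (C * Z k)"
        unfolding nG Z_def[symmetric] by (intro real_sqrt_le_mono mult_right_mono GV[unfolded nG]) (simp add: Z_def)
      finally show ?thesis .
    qed
    have T2: "T2 = (\<Sum>i<n. c i * A i k)"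
    proof -
      have int: "integrable lborel (\<lambda>x. (F i (h k *\<^sub>R x) * cis (\<theta> \<bullet> x)) * ?V k (x + snd (\<alpha> i)) * cnj (?V k (x + p)))" for i
        by (rule integrable_sq_int_mult[OF sf sf, where K = K]) (use FK in \<open>auto simp: norm_mult\<close>)
      have "T2 = (LBINT x. (\<Sum>i<n. c i * ((F i (h k *\<^sub>R x) * cis (\<theta> \<bullet> x)) * ?V k (x + snd (\<alpha> i)) * cnj (?V k (x + p)))))"
        unfolding T2_def opt_def G_def F_def sum_distrib_left sum_distrib_right
        by (intro Bochner_Integration.integral_cong refl sum.cong) (simp only: mult_ac)
      also have "\<dots> = (\<Sum>i<n. c i * (LBINT x. (F i (h k *\<^sub>R x) * cis (\<theta> \<bullet> x)) * ?V k (x + snd (\<alpha> i)) * cnj (?V k (x + p))))"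
        using int by (simp add: Bochner_Integration.integral_sum)
      also have "\<dots> = (\<Sum>i<n. c i * A i k)"
      proof (intro sum.cong refl arg_cong2[where f = "(*)"])
        fix i
        have "A i k = (LBINT x. F i (h k *\<^sub>R (snd (\<alpha> i) + x - snd (\<alpha> i))) * cis (\<theta> \<bullet> (snd (\<alpha> i) + x - snd (\<alpha> i))) * ?V k (snd (\<alpha> i) + x + 0) * cnj (?V k (snd (\<alpha> i) + x + (p - snd (\<alpha> i)))))"
          unfolding A_def by (rule integral_lborel_translate[symmetric]) measurable
        also have "\<dots> = (LBINT x. (F i (h k *\<^sub>R x) * cis (\<theta> \<bullet> x)) * ?V k (x + snd (\<alpha> i)) * cnj (?V k (x + p)))"
          by (intro Bochner_Integration.integral_cong refl) (simp add: algebra_simps)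
        finally show "(LBINT x. (F i (h k *\<^sub>R x) * cis (\<theta> \<bullet> x)) * ?V k (x + snd (\<alpha> i)) * cnj (?V k (x + p))) = A i k" ..
      qed
      finally show ?thesis .
    qed
    have T3': "T3 = (\<Sum>i<n. c i * A' i k)"
    proof -
      have int: "integrable lborel (\<lambda>x. (F i (h k *\<^sub>R x) * cis (\<theta> \<bullet> (x - snd (\<alpha> i)))) * ?V k (x + 0) * cnj (?V k (x + (p - snd (\<alpha> i)))))" for i
        by (rule integrable_sq_int_mult[OF sf sf, where K = K]) (use FK in \<open>auto simp: norm_mult\<close>)
      have "T3 = (LBINT x. (\<Sum>i<n. c i * ((F i (h k *\<^sub>R x) * cis (\<theta> \<bullet> (x - snd (\<alpha> i)))) * ?V k (x + 0) * cnj (?V k (x + (p - snd (\<alpha> i)))))))"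
        unfolding T3_def opt_def G_def cnj_sum sum_distrib_left
      proof (intro Bochner_Integration.integral_cong refl sum.cong)
        fix x i
        have "cis (\<theta> \<bullet> x) * (cnj (cis (\<theta> \<bullet> snd (\<alpha> i))) * cnj (cis (fst (\<alpha>2 i) \<bullet> (h k *\<^sub>R x)))) = cis (fst (\<alpha> i) \<bullet> (h k *\<^sub>R x)) * cis (\<theta> \<bullet> (x - snd (\<alpha> i)))"
          by (simp add: \<alpha>2_def cis_cnj cis_mult inner_diff_right algebra_simps)
        then have "(f (h k *\<^sub>R x) * c i * ?V k (x + 0) * cnj (?V k (x + (p - snd (\<alpha> i))))) * (cis (\<theta> \<bullet> x) * (cnj (cis (\<theta> \<bullet> snd (\<alpha> i))) * cnj (cis (fst (\<alpha>2 i) \<bullet> (h k *\<^sub>R x)))))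
          = (f (h k *\<^sub>R x) * c i * ?V k (x + 0) * cnj (?V k (x + (p - snd (\<alpha> i))))) * (cis (fst (\<alpha> i) \<bullet> (h k *\<^sub>R x)) * cis (\<theta> \<bullet> (x - snd (\<alpha> i))))"
          by simp
        then show "f (h k *\<^sub>R x) * cis (\<theta> \<bullet> x) * ?V k (x + 0) * cnj (c2 i * cis (fst (\<alpha>2 i) \<bullet> (h k *\<^sub>R x)) * ?V k (x + snd (\<alpha>2 i)))
          = c i * ((F i (h k *\<^sub>R x) * cis (\<theta> \<bullet> (x - snd (\<alpha> i)))) * ?V k (x + 0) * cnj (?V k (x + (p - snd (\<alpha> i)))))"
          unfolding F_def c2_def complex_cnj_mult complex_cnj_cnj
          by (simp only: mult_ac \<alpha>2_def snd_conv)
      qed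
      also have "\<dots> = (\<Sum>i<n. c i * A' i k)"
        using int by (simp add: Bochner_Integration.integral_sum A'_def)
      finally show ?thesis .
    qed
    have "I k = T1 + (\<Sum>i<n. c i * (A i k - A' i k)) + T3"
      unfolding I12 T2 T3' right_diff_distrib sum_subtractf by simp
    moreover have "norm (a + b + d) \<le> norm a + norm b + norm d" for a b d :: complex
      using norm_triangle_ineq[of "a + b" d] norm_triangle_ineq[of a b] by linarith
    ultimately have "norm (I k) \<le> norm T1 + norm (\<Sum>i<n. c i * (A i k - A' i k)) + norm T3" by (simp only:)
    also have "\<dots> \<le> sqrt (X k * C) + norm (\<Sum>i<n. c i * (A i k - A' i k)) + sqrt (C * Z k)"
      by (rule add_mono[OF add_mono[OF T1 order_refl] T3])
    finally show ?thesis .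
  qed
  have "(\<lambda>k. sqrt (X k * C) + norm (\<Sum>i<n. c i * (A i k - A' i k)) + sqrt (C * Z k)) \<longlonglongrightarrow> sqrt (LX * C) + norm (0::complex) + sqrt (C * LZ)"
    by (intro tendsto_intros XL ZL Err)
  moreover have "sqrt (LX * C) + norm (0::complex) + sqrt (C * LZ) < \<eta>"
  proof -
    have "LX * C \<le> K * e * C" "C * LZ \<le> K * e * C"
      using LX LZ C0 by (auto simp: mult.commute[of C] intro!: mult_right_mono)
    then have "LX * C \<le> (\<eta> / 4)\<^sup>2" "C * LZ \<le> (\<eta> / 4)\<^sup>2"
      using e(2) order_trans by blast+
    then have "sqrt (LX * C) \<le> sqrt ((\<eta> / 4)\<^sup>2)" "sqrt (C * LZ) \<le> sqrt ((\<eta> / 4)\<^sup>2)"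
      by (auto simp only: real_sqrt_le_iff)
    then show ?thesis using \<eta> by simp
  qed
  ultimately have "\<forall>\<^sub>F k in sequentially. sqrt (X k * C) + norm (\<Sum>i<n. c i * (A i k - A' i k)) + sqrt (C * Z k) < \<eta>"
    by (rule order_tendstoD)
  then have "\<forall>\<^sub>F k in sequentially. dist (I k) 0 < \<eta>"
    by eventually_elim (use bound in \<open>auto intro: order_le_less_trans\<close>)
  then show "\<exists>no. \<forall>k\<ge>no. dist (LBINT x. f (h k *\<^sub>R x) * cis (\<theta> \<bullet> x) * ?V k x * cnj (?V k (x + p))) 0 < \<eta>"
    unfolding I_def eventually_sequentially .
qed

end

subsection \<open>The integer lattice\<close>

abbreviation lattice :: "(int ^ 'n) measure" where
  "lattice \<equiv> count_space UNIV"

lemma of_int_vec_simps [simp]: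
  "of_int_vec 0 = 0" "of_int_vec (m + n) = of_int_vec m + of_int_vec n"
  "of_int_vec (- n) = - of_int_vec n" "of_int_vec (m - n) = of_int_vec m - of_int_vec n"
  by (simp_all add: of_int_vec_def vec_eq_iff)

lemma measurable_of_int_vec [measurable]: "of_int_vec \<in> lattice \<rightarrow>\<^sub>M borel"
  by simp

lemma sigma_finite_lattice: "sigma_finite_measure (lattice :: (int ^ 'n) measure)"
  by (rule sigma_finite_measure_count_space_countable) simp

interpretation lattice: sigma_finite_measure "lattice :: (int ^ 'n::finite) measure"
  by (rule sigma_finite_lattice)

interpretation LL: pair_sigma_finite "lattice :: (int ^ 'n::finite) measure" "lborel :: (real ^ 'n) measure" ..

interpretation LL2: pair_sigma_finite "lattice :: (int ^ 'n::finite) measure" "lattice :: (int ^ 'n) measure" ..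

section \<open>Characters of the torus, the fundamental cell and unfolding\<close>

definition lchar :: "int ^ 'n \<Rightarrow> real ^ 'n \<Rightarrow> complex" where
  "lchar l t = cis ((2 * pi) * (of_int_vec l \<bullet> t))"

lemma norm_lchar [simp]: "norm (lchar l t) = 1"
  by (simp add: lchar_def)

lemma lchar_lattice [simp]: "lchar l (of_int_vec n) = 1"
proof -
  have "of_int_vec l \<bullet> of_int_vec n = real_of_int (\<Sum>i\<in>UNIV. l $ i * n $ i)"
    by (simp add: inner_vec_def of_int_vec_def)
  then have "lchar l (of_int_vec n) = cis (2 * pi * real_of_int (\<Sum>i\<in>UNIV. l $ i * n $ i))"
    unfolding lchar_def by simp
  also have "\<dots> = 1" by (rule cis_multiple_2pi) (rule Ints_of_int)
  finally show ?thesis .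
qed

lemma lchar_add: "lchar l (s + t) = lchar l s * lchar l t"
  by (simp add: lchar_def cis_mult inner_add_right distrib_left)

lemma lchar_add_left: "lchar (l + m) t = lchar l t * lchar m t"
  by (simp add: lchar_def cis_mult inner_add_left distrib_left)

lemma lchar_0 [simp]: "lchar 0 t = 1" "lchar l 0 = 1"
  by (simp_all add: lchar_def)

lemma lchar_minus: "lchar (- l) t = cnj (lchar l t)"
  by (simp add: lchar_def cis_cnj)

lemma measurable_lchar [measurable]:
  assumes [measurable]: "g \<in> borel_measurable M"
  shows "(\<lambda>x. lchar l (g x)) \<in> borel_measurable M"
  unfolding lchar_def by measurable

text \<open>Half open, so that the lattice translates tile without overlap, and centred at 0, so
  that it contains a ball around the point where the kernels will concentrate.\<close>

definition unit_cube :: "(real ^ 'n) set" where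
  "unit_cube = {x. \<forall>i. - (1/2) \<le> x $ i \<and> x $ i < 1/2}"

lemma unit_cube_sets [measurable]: "(unit_cube :: (real ^ 'n) set) \<in> sets borel"
proof -
  have "(unit_cube :: (real ^ 'n) set) = (\<Inter>i. {x :: real ^ 'n. - (1/2) \<le> x $ i} \<inter> {x. x $ i < 1/2})"
    by (auto simp: unit_cube_def)
  moreover have "{x :: real ^ 'n. - (1/2) \<le> x $ i} \<in> sets borel" "{x :: real ^ 'n. x $ i < 1/2} \<in> sets borel" for i
    by (auto intro!: borel_closed borel_open closed_Collect_le open_Collect_less continuous_intros)
  then have "(\<Inter>i\<in>UNIV. {x :: real ^ 'n. - (1/2) \<le> x $ i} \<inter> {x. x $ i < 1/2}) \<in> sets borel"
    by (intro sets.finite_INT sets.Int) auto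
  ultimately show ?thesis by (simp only:)
qed

text \<open>Rounding to the nearest lattice point, with half-integers rounded up as the half open
  cell demands.\<close>

lemma unit_cube_ex1:
  fixes x :: "real ^ 'n"
  shows "\<exists>!n :: int ^ 'n. x - of_int_vec n \<in> unit_cube"
proof (rule ex1I)
  let ?n = "\<chi> i. \<lfloor>x $ i + 1/2\<rfloor>"
  show "x - of_int_vec ?n \<in> unit_cube"
    unfolding unit_cube_def of_int_vec_def by (auto; linarith)
  fix n :: "int ^ 'n" assume "x - of_int_vec n \<in> unit_cube"
  then have *: "- (1/2) \<le> x $ i - real_of_int (n $ i) \<and> x $ i - real_of_int (n $ i) < 1/2" for i
    by (auto simp: unit_cube_def of_int_vec_def)
  have "n $ i = \<lfloor>x $ i + 1/2\<rfloor>" for i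
  proof (rule floor_unique[symmetric])
    show "real_of_int (n $ i) \<le> x $ i + 1/2" "x $ i + 1/2 < real_of_int (n $ i) + 1"
      using *[of i] by linarith+
  qed
  then show "n = ?n" by (simp add: vec_eq_iff)
qed

lemma unit_cubeE:
  fixes x :: "real ^ 'n"
  obtains n :: "int ^ 'n" where "x - of_int_vec n \<in> unit_cube" "\<forall>m. x - of_int_vec m \<in> unit_cube \<longrightarrow> m = n"
  using ex1E[OF unit_cube_ex1[of x]] by metis

lemma sum_unit_cube:
  fixes x :: "real ^ 'n"
  shows "(\<integral>\<^sup>+n. indicator unit_cube (x - of_int_vec n) \<partial>lattice) = 1"
proof -
  obtain n where n: "x - of_int_vec n \<in> unit_cube" "\<forall>m. x - of_int_vec m \<in> unit_cube \<longrightarrow> m = n"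
    by (rule unit_cubeE[of x])
  have eq: "(x - of_int_vec m \<in> unit_cube) = (m = n)" for m using n by blast
  have "(\<integral>\<^sup>+n. indicator unit_cube (x - of_int_vec n) \<partial>lattice) = (\<integral>\<^sup>+m. indicator {n} m \<partial>lattice)"
    by (intro nn_integral_cong) (simp add: indicator_def eq)
  then show ?thesis by simp
qed

text \<open>The indicators of the translated cells sum to 1; inserting this sum and translating each
  summand back to the cell gives the formula.\<close>

lemma nn_integral_unfold:
  fixes g :: "real ^ 'n \<Rightarrow> ennreal"
  assumes [measurable]: "g \<in> borel_measurable borel"
  shows "(\<integral>\<^sup>+x. g x \<partial>lborel) = (\<integral>\<^sup>+x. indicator unit_cube x * (\<integral>\<^sup>+n. g (x + of_int_vec n) \<partial>lattice) \<partial>lborel)"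
proof -
  have "(\<integral>\<^sup>+x. g x \<partial>lborel) = (\<integral>\<^sup>+x. (\<integral>\<^sup>+n. g x * indicator unit_cube (x - of_int_vec n) \<partial>lattice) \<partial>lborel)"
    by (simp add: nn_integral_cmult sum_unit_cube)
  also have "\<dots> = (\<integral>\<^sup>+n. (\<integral>\<^sup>+x. g x * indicator unit_cube (x - of_int_vec n) \<partial>lborel) \<partial>lattice)"
    by (rule LL.Fubini') measurable
  also have "\<dots> = (\<integral>\<^sup>+n. (\<integral>\<^sup>+x. g (x + of_int_vec n) * indicator unit_cube x \<partial>lborel) \<partial>lattice)"
  proof (rule nn_integral_cong)
    fix n :: "int ^ 'n"
    have "(\<integral>\<^sup>+x. g x * indicator unit_cube (x - of_int_vec n) \<partial>lborel) = (\<integral>\<^sup>+x. g (of_int_vec n + x) * indicator unit_cube (of_int_vec n + x - of_int_vec n) \<partial>lborel)"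
      by (rule nn_integral_lborel_translate[symmetric]) measurable
    then show "(\<integral>\<^sup>+x. g x * indicator unit_cube (x - of_int_vec n) \<partial>lborel) = (\<integral>\<^sup>+x. g (x + of_int_vec n) * indicator unit_cube x \<partial>lborel)"
      by (simp add: add.commute)
  qed
  also have "\<dots> = (\<integral>\<^sup>+x. (\<integral>\<^sup>+n. g (x + of_int_vec n) * indicator unit_cube x \<partial>lattice) \<partial>lborel)"
    by (rule LL.Fubini'[symmetric]) measurable
  also have "\<dots> = (\<integral>\<^sup>+x. indicator unit_cube x * (\<integral>\<^sup>+n. g (x + of_int_vec n) \<partial>lattice) \<partial>lborel)"
    by (simp add: nn_integral_cmult mult.commute)
  finally show ?thesis .
qed

lemma emeasure_unit_cube: "emeasure lborel (unit_cube :: (real ^ 'n) set) = 1"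
proof (rule antisym)
  let ?a = "(\<chi> i. - (1/2)) :: real ^ 'n" and ?b = "(\<chi> i. 1/2) :: real ^ 'n"
  have B: "?a \<bullet> b = - (1/2)" "?b \<bullet> b = 1/2" if "b \<in> Basis" for b
    using that by (auto simp: Basis_vec_def inner_axis)
  have s: "box ?a ?b \<subseteq> unit_cube" "unit_cube \<subseteq> cbox ?a ?b"
    by (auto simp: unit_cube_def mem_box_cart less_imp_le)
  have "emeasure lborel (cbox ?a ?b) = 1"
    by (subst emeasure_lborel_cbox) (auto simp: inner_diff_left B)
  then show "emeasure lborel (unit_cube :: (real ^ 'n) set) \<le> 1"
    using emeasure_mono[OF s(2)] by (metis sets_lborel borel_closed closed_cbox)
  have "emeasure lborel (box ?a ?b) = 1"
    by (subst emeasure_lborel_box) (auto simp: inner_diff_left B)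
  then show "1 \<le> emeasure lborel (unit_cube :: (real ^ 'n) set)"
    using emeasure_mono[OF s(1), of lborel] by simp
qed

lemma integrable_unit_cube_mult:
  fixes g :: "real ^ 'n \<Rightarrow> complex"
  assumes [measurable]: "g \<in> borel_measurable borel" and "\<And>x. norm (g x) \<le> K"
  shows "integrable lborel (\<lambda>x. indicator unit_cube x * g x)"
    and "norm (LBINT x. indicator unit_cube x * g x) \<le> K"
proof -
  have i: "integrable lborel (\<lambda>x::real^'n. complex_of_real (indicator unit_cube x))"
    by (intro integrable_of_real integrable_real_indicator) (auto simp: emeasure_unit_cube)
  then have i': "integrable lborel (indicator unit_cube :: real ^ 'n \<Rightarrow> complex)"
    by (simp add: of_real_indicator)
  show "integrable lborel (\<lambda>x. indicator unit_cube x * g x)"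
    by (rule integrable_mult_bounded[OF i' _ assms(2)]) measurable
  have "norm (LBINT x. indicator unit_cube x * g x) \<le> (LBINT x. norm (indicator unit_cube (x::real^'n) :: complex)) * K"
    by (rule norm_integral_mult_bound[OF i' _ assms(2)]) measurable
  also have "(LBINT x. norm (indicator unit_cube (x::real^'n) :: complex)) = 1"
  proof -
    have "norm (indicator unit_cube (x::real^'n) :: complex) = indicator unit_cube x" for x
      by (simp add: indicator_def)
    then show ?thesis by (simp add: measure_def emeasure_unit_cube)
  qed
  finally show "norm (LBINT x. indicator unit_cube x * g x) \<le> K" by simp
qed

lemma lattice_norm_finite_unfold:
  fixes H :: "real ^ 'n \<Rightarrow> complex"
  assumes H: "integrable lborel H"
  shows "(\<integral>\<^sup>+n. (\<integral>\<^sup>+t. norm (indicator unit_cube t * H (t + of_int_vec n)) \<partial>lborel) \<partial>lattice) < \<infinity>"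
proof -
  have [measurable]: "H \<in> borel_measurable borel" using H by auto
  have "(\<integral>\<^sup>+n. (\<integral>\<^sup>+t. norm (indicator unit_cube t * H (t + of_int_vec n)) \<partial>lborel) \<partial>lattice)
    = (\<integral>\<^sup>+t. (\<integral>\<^sup>+n. norm (indicator unit_cube t * H (t + of_int_vec n)) \<partial>lattice) \<partial>lborel)"
    by (rule LL.Fubini'[symmetric]) measurable
  also have "\<dots> = (\<integral>\<^sup>+t. indicator unit_cube t * (\<integral>\<^sup>+n. ennreal (norm (H (t + of_int_vec n))) \<partial>lattice) \<partial>lborel)"
    by (intro nn_integral_cong) (auto simp: indicator_def)
  also have "\<dots> = (\<integral>\<^sup>+x. ennreal (norm (H x)) \<partial>lborel)"
    by (rule nn_integral_unfold[symmetric]) measurable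
  also have "\<dots> < \<infinity>" by (rule nn_integral_norm_finite[OF H])
  finally show ?thesis .
qed

lemma integral_lattice_single:
  "(LINT m|lattice. (c::complex) * indicator {n} m) = c"
proof (cases "c = 0")
  case False
  then have "{m. c * indicator {n} m \<noteq> 0} = {n}" by (auto simp: indicator_def)
  then show ?thesis by (subst lebesgue_integral_count_space_finite_support) auto
qed simp

theorem integral_unfold:
  fixes H :: "real ^ 'n \<Rightarrow> complex"
  assumes H: "integrable lborel H"
  shows "(LBINT t. indicator unit_cube t * (LINT n|lattice. H (t + of_int_vec n))) = (LBINT x. H x)"
proof -
  have [measurable]: "H \<in> borel_measurable borel" using H by auto
  let ?f = "\<lambda>n t. indicator unit_cube t * H (t + of_int_vec n)"
  have m: "case_prod ?f \<in> borel_measurable (lattice \<Otimes>\<^sub>M lborel)" by measurable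
  note fin = lattice_norm_finite_unfold[OF H]
  let ?g = "\<lambda>n x. indicator unit_cube (x - of_int_vec n) * H x"
  have m': "case_prod ?g \<in> borel_measurable (lattice \<Otimes>\<^sub>M lborel)" by measurable
  have t: "(LBINT x. ?g n x) = (LBINT t. ?f n t)" for n
  proof -
    have "(LBINT x. ?g n x) = (LBINT t. ?g n (of_int_vec n + t))"
      by (rule integral_lborel_translate[symmetric]) measurable
    then show ?thesis by (simp add: add.commute)
  qed
  have t': "(\<integral>\<^sup>+x. norm (?g n x) \<partial>lborel) = (\<integral>\<^sup>+t. norm (?f n t) \<partial>lborel)" for n
  proof -
    have "(\<integral>\<^sup>+x. norm (?g n x) \<partial>lborel) = (\<integral>\<^sup>+t. norm (?g n (of_int_vec n + t)) \<partial>lborel)"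
      by (rule nn_integral_lborel_translate[symmetric]) measurable
    then show ?thesis by (simp add: add.commute)
  qed
  have fin': "(\<integral>\<^sup>+n. (\<integral>\<^sup>+x. norm (?g n x) \<partial>lborel) \<partial>lattice) < \<infinity>" using fin by (simp only: t')
  have s: "(LINT n|lattice. ?g n x) = H x" for x
  proof -
    obtain n where n: "x - of_int_vec n \<in> unit_cube" "\<forall>m. x - of_int_vec m \<in> unit_cube \<longrightarrow> m = n"
      by (rule unit_cubeE[of x])
    have eq: "(x - of_int_vec m \<in> unit_cube) = (m = n)" for m using n by blast
    have "(LINT m|lattice. ?g m x) = (LINT m|lattice. H x * indicator {n} m)"
      by (intro Bochner_Integration.integral_cong refl) (simp add: indicator_def eq)
    also have "\<dots> = H x" by (rule integral_lattice_single)
    finally show ?thesis .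
  qed
  have "(LBINT t. indicator unit_cube t * (LINT n|lattice. H (t + of_int_vec n))) = (LBINT t. (LINT n|lattice. ?f n t))"
    by simp
  also have "\<dots> = (LINT n|lattice. (LBINT t. ?f n t))" by (rule LL.Fubini_swap(4)[OF m fin, symmetric])
  also have "\<dots> = (LINT n|lattice. (LBINT x. ?g n x))" by (simp only: t)
  also have "\<dots> = (LBINT x. (LINT n|lattice. ?g n x))" by (rule LL.Fubini_swap(4)[OF m' fin'])
  also have "\<dots> = (LBINT x. H x)" by (simp only: s)
  finally show ?thesis .
qed

text \<open>The function cut off to the shifted cell has the periodic function as its lattice sum,
  so unfolding it compares the two cells.\<close>

lemma integral_periodic_shift:
  fixes C :: "real ^ 'n \<Rightarrow> complex"
  assumes [measurable]: "C \<in> borel_measurable borel" and K: "\<And>x. norm (C x) \<le> K"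
    and per: "\<And>x n. C (x + of_int_vec n) = C x"
  shows "(LBINT t. indicator unit_cube t * C (s + t)) = (LBINT t. indicator unit_cube t * C t)"
proof -
  define H where "H x = indicator unit_cube (x - s) * C x" for x
  have [measurable]: "H \<in> borel_measurable borel" unfolding H_def [abs_def] by measurable
  have HC: "(LINT n|lattice. H (t + of_int_vec n)) = C t" for t
  proof -
    obtain n where n: "(t - s) - of_int_vec n \<in> unit_cube" "\<forall>m. (t - s) - of_int_vec m \<in> unit_cube \<longrightarrow> m = n"
      by (rule unit_cubeE[of "t - s"])
    have "(LINT m|lattice. H (t + of_int_vec m)) = (LINT m|lattice. C t * indicator {- n} m)"
    proof (intro Bochner_Integration.integral_cong refl)
      fix m
      have "(t + of_int_vec m - s \<in> unit_cube) = (m = - n)"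
      proof
        assume "t + of_int_vec m - s \<in> unit_cube"
        then have "(t - s) - of_int_vec (- m) \<in> unit_cube" by (simp add: algebra_simps)
        then have "- m = n" by (rule n(2)[rule_format])
        then show "m = - n" by auto
      next
        assume "m = - n" then show "t + of_int_vec m - s \<in> unit_cube" using n(1) by (simp add: algebra_simps)
      qed
      then show "H (t + of_int_vec m) = C t * indicator {- n} m"
        by (auto simp: H_def per indicator_def)
    qed
    also have "\<dots> = C t" by (rule integral_lattice_single)
    finally show ?thesis .
  qed
  have "integrable lborel (\<lambda>t. indicator unit_cube t * C (s + t))"
    by (rule integrable_unit_cube_mult(1)[OF _ K]) measurable
  then have "integrable lborel (\<lambda>x. indicator unit_cube (x - s) * C (s + (x - s)))"
    by (rule integrable_lborel_translate_minus)
  then have iH: "integrable lborel H" by (simp add: H_def [abs_def])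
  have "(LBINT t. indicator unit_cube t * C (s + t)) = (LBINT t. H (s + t))"
    by (simp add: H_def)
  also have "\<dots> = (LBINT x. H x)"
    by (rule integral_lborel_translate) measurable
  also have "\<dots> = (LBINT t. indicator unit_cube t * (LINT n|lattice. H (t + of_int_vec n)))"
    by (rule integral_unfold[OF iH, symmetric])
  also have "\<dots> = (LBINT t. indicator unit_cube t * C t)"
    by (simp only: HC)
  finally show ?thesis .
qed

text \<open>For \<open>l \<noteq> 0\<close>, a shift by \<open>s\<close> with
  \<open>of_int_vec l \<bullet> s = 1/2\<close> changes the sign of the character, while the
  integral over a cell is invariant under shifts.\<close>

lemma integral_lchar:
  "(LBINT t. indicator unit_cube t * lchar l t) = (if l = 0 then 1 else 0)"
proof (cases "l = 0")
  case True
  have "(LBINT t. complex_of_real (indicator unit_cube (t :: real ^ 'n))) = complex_of_real (LBINT t. indicator unit_cube (t :: real ^ 'n))"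
    by (rule integral_complex_of_real)
  then show ?thesis using True by (simp add: of_real_indicator measure_def emeasure_unit_cube)
next
  case False
  then obtain i where i: "l $ i \<noteq> 0" by (auto simp: vec_eq_iff)
  define s where "s = axis i (1 / (2 * real_of_int (l $ i)))"
  have "of_int_vec l \<bullet> s = 1/2" using i by (simp add: s_def inner_axis of_int_vec_def)
  then have "lchar l s = cis (2 * pi * (1/2))" by (simp only: lchar_def)
  then have s: "lchar l s = -1" by simp
  have "(LBINT t. indicator unit_cube t * lchar l t) = (LBINT t. indicator unit_cube t * lchar l (s + t))"
    by (rule integral_periodic_shift[symmetric, where K = 1]) (auto simp: lchar_add)
  also have "\<dots> = (LBINT t. - (indicator unit_cube t * lchar l t))"
    by (simp add: lchar_add s)
  also have "\<dots> = - (LBINT t. indicator unit_cube t * lchar l t)"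
    by (rule Bochner_Integration.integral_minus)
  finally have "2 * (LBINT t. indicator unit_cube t * lchar l t) = 0" by (simp only: mult_2) (metis add.right_inverse)
  then show ?thesis using False by simp
qed

subsection \<open>Positive trigonometric kernels on the torus\<close>

text \<open>Positivity concerns the Fourier coefficients, not the values. The class is closed under
  products, hence under the powers from which the kernels are built.\<close>

definition tpos :: "(real ^ 'n \<Rightarrow> complex) \<Rightarrow> bool" where
  "tpos P \<longleftrightarrow> (\<exists>m::nat. \<exists>w l. (\<forall>j. 0 \<le> w j) \<and> (\<forall>t. P t = (\<Sum>j<m. complex_of_real (w j) * lchar (l j) t)))"

lemma tpos_char: "0 \<le> v \<Longrightarrow> tpos (\<lambda>t. complex_of_real v * lchar l t)"
  unfolding tpos_def by (intro exI[of _ 1] exI[of _ "\<lambda>_. v"] exI[of _ "\<lambda>_. l"]) simp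

lemma tpos_zero: "tpos (\<lambda>t. 0)"
  using tpos_char[of 0 0] by simp

lemma tpos_add:
  assumes "tpos f" "tpos g" shows "tpos (\<lambda>x. f x + g x)"
proof -
  obtain n :: nat and c a where c: "\<forall>j. 0 \<le> c j" and f: "\<forall>x. f x = (\<Sum>i<n. complex_of_real (c i) * lchar (a i) x)"
    using assms(1) unfolding tpos_def by blast
  obtain m :: nat and c' a' where c': "\<forall>j. 0 \<le> c' j" and g: "\<forall>x. g x = (\<Sum>i<m. complex_of_real (c' i) * lchar (a' i) x)"
    using assms(2) unfolding tpos_def by blast
  let ?c = "\<lambda>i. if i < n then c i else c' (i - n)" and ?a = "\<lambda>i. if i < n then a i else a' (i - n)"
  have "f x + g x = (\<Sum>i<n+m. complex_of_real (?c i) * lchar (?a i) x)" for x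
  proof -
    have "(\<Sum>i<n+m. complex_of_real (?c i) * lchar (?a i) x)
      = (\<Sum>i<n. complex_of_real (c i) * lchar (a i) x) + (\<Sum>i<m. complex_of_real (c' i) * lchar (a' i) x)"
      by (induct m) auto
    then show ?thesis using f g by (simp only:)
  qed
  moreover have "\<forall>j. 0 \<le> ?c j" using c c' by simp
  ultimately have "(\<forall>j. 0 \<le> ?c j) \<and> (\<forall>x. f x + g x = (\<Sum>i<n+m. complex_of_real (?c i) * lchar (?a i) x))" by blast
  then show ?thesis unfolding tpos_def by (intro exI)
qed

lemma tpos_sum:
  "finite I \<Longrightarrow> (\<And>i. i \<in> I \<Longrightarrow> tpos (f i)) \<Longrightarrow> tpos (\<lambda>x. \<Sum>i\<in>I. f i x)"
  by (induct I rule: finite_induct) (auto intro: tpos_add tpos_zero)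

lemma tpos_mult:
  assumes "tpos f" "tpos g" shows "tpos (\<lambda>x. f x * g x)"
proof -
  obtain n :: nat and c a where c: "\<forall>j. 0 \<le> c j" and f: "\<forall>x. f x = (\<Sum>i<n. complex_of_real (c i) * lchar (a i) x)"
    using assms(1) unfolding tpos_def by blast
  obtain m :: nat and c' a' where c': "\<forall>j. 0 \<le> c' j" and g: "\<forall>x. g x = (\<Sum>i<m. complex_of_real (c' i) * lchar (a' i) x)"
    using assms(2) unfolding tpos_def by blast
  have "f x * g x = (\<Sum>i<n. \<Sum>j<m. complex_of_real (c i * c' j) * lchar (a i + a' j) x)" for x
    unfolding f[rule_format] g[rule_format] sum_product by (simp add: lchar_add_left mult_ac)
  then have "(\<lambda>x. f x * g x) = (\<lambda>x. \<Sum>i<n. \<Sum>j<m. complex_of_real (c i * c' j) * lchar (a i + a' j) x)" by (rule ext)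
  then show ?thesis using c c' by (simp only:) (intro tpos_sum tpos_char; simp)
qed

lemma tpos_power: "tpos f \<Longrightarrow> tpos (\<lambda>x. f x ^ N)"
proof (induct N)
  case 0 show ?case using tpos_char[of 1 0] by simp
qed (auto intro: tpos_mult)

text \<open>It equals 1 on the lattice and is smaller elsewhere, and its Fourier coefficients are
  nonnegative. Its normalized powers thus form an approximate identity with nonnegative values and
  nonnegative coefficients.\<close>

definition fej :: "real ^ 'n \<Rightarrow> real" where
  "fej t = (\<Sum>i\<in>UNIV. (1 + cos (2 * pi * t $ i)) / 2) / real CARD('n)"

lemma of_int_vec_axis: "of_int_vec (axis i 1) \<bullet> t = t $ i"
proof -
  have "of_int_vec (axis i 1 :: int ^ 'a) = axis i 1"
    by (auto simp: of_int_vec_def vec_eq_iff axis_def)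
  then show ?thesis by (simp add: inner_axis')
qed

lemma tpos_fej: "tpos (\<lambda>t :: real ^ 'n. complex_of_real (fej t))"
proof -
  let ?d = "real CARD('n)"
  have "complex_of_real (fej t) = (\<Sum>i\<in>UNIV. complex_of_real (1 / (2 * ?d)) * lchar 0 t + complex_of_real (1 / (4 * ?d)) * lchar (axis i 1) t + complex_of_real (1 / (4 * ?d)) * lchar (- axis i 1) t)" for t :: "real ^ 'n"
  proof -
    have "complex_of_real ((1 + cos (2 * pi * t $ i)) / 2 / ?d) = complex_of_real (1 / (2 * ?d)) * lchar 0 t + complex_of_real (1 / (4 * ?d)) * lchar (axis i 1) t + complex_of_real (1 / (4 * ?d)) * lchar (- axis i 1) t" for i
    proof -
      have "lchar (axis i 1) t = cis (2 * pi * t $ i)" by (simp add: lchar_def of_int_vec_axis)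
      then have "lchar (axis i 1) t + lchar (- axis i 1) t = complex_of_real (2 * cos (2 * pi * t $ i))"
        unfolding lchar_minus by (simp add: complex_eq_iff)
      then have "complex_of_real (1 / (2 * ?d)) * lchar 0 t + complex_of_real (1 / (4 * ?d)) * (lchar (axis i 1) t + lchar (- axis i 1) t)
        = complex_of_real (1 / (2 * ?d) + 1 / (4 * ?d) * (2 * cos (2 * pi * t $ i)))" by simp
      also have "1 / (2 * ?d) + 1 / (4 * ?d) * (2 * cos (2 * pi * t $ i)) = (1 + cos (2 * pi * t $ i)) / 2 / ?d"
        by (simp add: field_simps)
      finally show ?thesis by (simp only: distrib_left add.assoc)
    qed
    then show ?thesis
      unfolding fej_def sum_divide_distrib of_real_sum by (intro sum.cong refl) simp
  qed
  then have "(\<lambda>t. complex_of_real (fej t)) = (\<lambda>t :: real ^ 'n. \<Sum>i\<in>UNIV. complex_of_real (1 / (2 * ?d)) * lchar 0 t + complex_of_real (1 / (4 * ?d)) * lchar (axis i 1) t + complex_of_real (1 / (4 * ?d)) * lchar (- axis i 1) t)"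
    by (rule ext)
  then show ?thesis by (simp only:) (intro tpos_sum tpos_add tpos_char; simp)
qed

lemma fej_term: "0 \<le> (1 + cos x) / 2" "(1 + cos x) / 2 \<le> (1::real)"
proof -
  have "0 \<le> 1 + cos x" using cos_ge_minus_one[of x] by linarith
  then show "0 \<le> (1 + cos x) / 2" by simp
  have "1 + cos x \<le> 2" using cos_le_one[of x] by linarith
  then show "(1 + cos x) / 2 \<le> 1" by simp
qed

lemma fej_bounds: "0 \<le> fej t" "fej (t :: real ^ 'n) \<le> 1"
proof -
  show "0 \<le> fej t" unfolding fej_def by (intro divide_nonneg_nonneg sum_nonneg fej_term) auto
  have "(\<Sum>i\<in>UNIV. (1 + cos (2 * pi * t $ i)) / 2) \<le> (\<Sum>i\<in>(UNIV :: 'n set). 1)"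
    by (intro sum_mono fej_term)
  then show "fej t \<le> 1" unfolding fej_def by (simp add: divide_le_eq)
qed

lemma fej_continuous: "continuous_on A fej"
  unfolding fej_def [abs_def] by (intro continuous_intros) auto

lemma fej_0: "fej 0 = 1"
  by (simp add: fej_def)

lemma fej_less_1:
  fixes t :: "real ^ 'n"
  assumes t: "\<And>i. \<bar>t $ i\<bar> \<le> 1/2" and "t \<noteq> 0"
  shows "fej t < 1"
proof -
  obtain i where i: "t $ i \<noteq> 0" using assms(2) by (auto simp: vec_eq_iff)
  have "cos (2 * pi * \<bar>t $ i\<bar>) < cos 0"
    using i t[of i] by (intro cos_monotone_0_pi) auto
  then have "cos (2 * pi * t $ i) < 1" by (cases "t $ i \<ge> 0") auto
  then have "(1 + cos (2 * pi * t $ i)) / 2 < 1" by simp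
  then have "(\<Sum>i\<in>UNIV. (1 + cos (2 * pi * t $ i)) / 2) < (\<Sum>i\<in>(UNIV :: 'n set). 1)"
    by (intro sum_strict_mono_ex1) (auto intro: fej_term exI[of _ i])
  then show ?thesis unfolding fej_def by (simp add: divide_less_eq)
qed

lemma unit_cube_abs: "t \<in> unit_cube \<Longrightarrow> \<bar>t $ i\<bar> \<le> 1/2"
proof -
  assume "t \<in> unit_cube"
  then have "- (1/2) \<le> t $ i \<and> t $ i < 1/2" by (simp add: unit_cube_def)
  then show ?thesis by linarith
qed

lemma fejer_kernel:
  assumes "\<delta> > 0" "\<eta> > 0"
  obtains P :: "real ^ 'n \<Rightarrow> real" where
    "tpos (\<lambda>t. complex_of_real (P t))" "\<forall>t. 0 \<le> P t" "P \<in> borel_measurable borel"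
    "integrable lborel (\<lambda>t. indicator unit_cube t * P t)" "(LBINT t. indicator unit_cube t * P t) = 1"
    "(LBINT t. indicator unit_cube t * (indicator {t. \<delta> \<le> norm t} t * P t)) \<le> \<eta>"
proof -
  define q where "q = (1/2 :: real)"
  \<comment> \<open>The closed cube replaces the half open one, since compactness is what gives a
    maximum strictly below 1 away from 0.\<close>
  define S :: "(real ^ 'n) set" where "S = cbox (\<chi> i. - q) (\<chi> i. q) \<inter> {t. \<delta> \<le> norm t}"
  have "closed {t :: real ^ 'n. \<delta> \<le> norm t}" by (intro closed_Collect_le continuous_intros)
  then have cS: "compact S" unfolding S_def by (intro compact_Int_closed) auto
  obtain \<rho> where \<rho>: "0 \<le> \<rho>" "\<rho> < 1" "\<And>t. t \<in> S \<Longrightarrow> fej t \<le> \<rho>"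
  proof (cases "S = {}")
    case True then show ?thesis using that[of 0] by auto
  next
    case False
    obtain t0 where t0: "t0 \<in> S" "\<And>t. t \<in> S \<Longrightarrow> fej t \<le> fej t0"
      using continuous_attains_sup[OF cS False fej_continuous] by blast
    have "\<bar>t0 $ i\<bar> \<le> 1/2" for i
    proof -
      have "- q \<le> t0 $ i \<and> t0 $ i \<le> q" using t0(1) unfolding S_def by (simp add: mem_box_cart)
      then show ?thesis unfolding q_def by linarith
    qed
    moreover have "t0 \<noteq> 0" using t0(1) assms by (auto simp: S_def)
    ultimately have "fej t0 < 1" by (rule fej_less_1)
    then show ?thesis using that[of "fej t0"] fej_bounds(1)[of t0] t0(2) by auto
  qed
  \<comment> \<open>Strictly between \<rho> and 1: \<open>fej\<close> exceeds it near 0, and the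
    ratio \<open>\<rho> / \<rho>'\<close> is below 1, so powers of \<open>fej\<close> put almost all
    their mass near 0.\<close>
  define \<rho>' where "\<rho>' = (\<rho> + 1) / 2"
  have \<rho>': "\<rho> < \<rho>'" "0 < \<rho>'" "\<rho>' < 1" using \<rho> by (auto simp: \<rho>'_def)
  obtain r where r: "r > 0" "\<forall>t :: real ^ 'n. norm t < r \<longrightarrow> \<rho>' < fej t"
  proof -
    have "isCont fej (0 :: real ^ 'n)" using fej_continuous[of "UNIV :: (real ^ 'n) set"] by (simp add: continuous_on_eq_continuous_at)
    then have "\<forall>e>0. \<exists>d>0. \<forall>t :: real ^ 'n. dist t 0 < d \<longrightarrow> dist (fej t) (fej (0 :: real ^ 'n)) < e"
      unfolding continuous_at_eps_delta .
    moreover have "1 - \<rho>' > 0" using \<rho>' by simp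
    ultimately obtain r where r: "r > 0" "\<forall>t :: real ^ 'n. dist t 0 < r \<longrightarrow> dist (fej t) (fej (0 :: real ^ 'n)) < 1 - \<rho>'"
      by blast
    have "\<rho>' < fej t" if "norm t < r" for t :: "real ^ 'n"
      using r(2)[rule_format, of t] that by (auto simp: fej_0 dist_real_def)
    then show ?thesis using that r(1) by blast
  qed
  \<comment> \<open>A radius of at most 1/2 keeps the ball inside the cell.\<close>
  define r' where "r' = min r (1/2)"
  have r': "r' > 0" "r' \<le> r" "r' \<le> 1/2" using r by (auto simp: r'_def)
  define Bl :: "(real ^ 'n) set" where "Bl = ball 0 r'"
  have BQ: "Bl \<subseteq> unit_cube"
  proof
    fix t assume "t \<in> Bl"
    then have "norm t < 1/2" using r' by (simp add: Bl_def)
    then have "\<bar>t $ i\<bar> < 1/2" for i using component_le_norm_cart[of t i] by linarith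
    then have "- (1/2) \<le> t $ i \<and> t $ i < 1/2" for i by (smt (verit))
    then show "t \<in> unit_cube" unfolding unit_cube_def by blast
  qed
  define vol where "vol = measure lborel Bl"
  have vol: "vol > 0" using content_ball_pos[OF r'(1), of "0 :: real ^ 'n"] by (simp add: vol_def Bl_def)
  have [measurable]: "fej \<in> borel_measurable (borel :: (real ^ 'n) measure)"
    by (rule borel_measurable_continuous_onI[OF fej_continuous])
  have iQ: "integrable lborel (\<lambda>t :: real ^ 'n. indicator unit_cube t :: real)"
    by (intro integrable_real_indicator) (auto simp: emeasure_unit_cube)
  have fb: "0 \<le> fej t ^ N" "fej t ^ N \<le> 1" for N and t :: "real ^ 'n"
    using fej_bounds[of t] by (auto intro: power_le_one)
  have iN: "integrable lborel (\<lambda>t :: real ^ 'n. indicator unit_cube t * fej t ^ N)" for N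
    by (rule Bochner_Integration.integrable_bound[OF iQ]) (use fb in \<open>auto simp: indicator_def abs_le_iff\<close>)
  have iS: "integrable lborel (\<lambda>t :: real ^ 'n. indicator unit_cube t * (indicator {t. \<delta> \<le> norm t} t * fej t ^ N))" for N
    by (rule Bochner_Integration.integrable_bound[OF iQ]) (use fb in \<open>auto simp: indicator_def abs_le_iff\<close>)
  define Z where "Z N = (\<integral>t. indicator unit_cube t * fej t ^ N \<partial>(lborel :: (real ^ 'n) measure))" for N
  have Z: "\<rho>' ^ N * vol \<le> Z N" for N
  proof -
    have iB: "integrable lborel (\<lambda>t. \<rho>' ^ N * indicator Bl t)"
      using emeasure_lborel_ball_finite[of "0 :: real ^ 'n" r'] unfolding Bl_def
      by (intro integrable_mult_right integrable_real_indicator) auto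
    have "\<rho>' ^ N * vol = (LBINT t. \<rho>' ^ N * indicator Bl t)" by (simp add: vol_def)
    also have "\<dots> \<le> Z N" unfolding Z_def
    proof (rule integral_mono[OF iB iN])
      fix t :: "real ^ 'n"
      show "\<rho>' ^ N * indicator Bl t \<le> indicator unit_cube t * fej t ^ N"
      proof (cases "t \<in> Bl")
        case True
        then have "\<rho>' ^ N \<le> fej t ^ N" using r(2)[rule_format, of t] r' \<rho>' by (intro power_mono) (auto simp: Bl_def)
        then show ?thesis using True BQ by (auto simp: indicator_def)
      qed (use fb in \<open>auto simp: indicator_def\<close>)
    qed
    finally show ?thesis .
  qed
  have Zpos: "Z N > 0" for N using Z[of N] vol \<rho>' by (smt (verit) mult_pos_pos zero_less_power)
  define T where "T N = (\<integral>t. indicator unit_cube t * (indicator {t. \<delta> \<le> norm t} t * fej t ^ N) \<partial>(lborel :: (real ^ 'n) measure))" for N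
  have T: "T N \<le> \<rho> ^ N" for N
  proof -
    have "T N \<le> (LBINT t. indicator unit_cube (t :: real ^ 'n) * \<rho> ^ N)" unfolding T_def
    proof (rule integral_mono[OF iS])
      show "integrable lborel (\<lambda>t :: real ^ 'n. indicator unit_cube t * \<rho> ^ N)" using iQ by simp
      fix t :: "real ^ 'n"
      show "indicator unit_cube t * (indicator {t. \<delta> \<le> norm t} t * fej t ^ N) \<le> indicator unit_cube t * \<rho> ^ N"
      proof (cases "t \<in> unit_cube \<and> \<delta> \<le> norm t")
        case True
        then have "- q \<le> t $ i \<and> t $ i \<le> q" for i using unit_cube_abs[of t i] unfolding q_def by (smt (verit))
        then have "t \<in> S" using True by (simp add: S_def mem_box_cart)
        then have "fej t ^ N \<le> \<rho> ^ N" using \<rho> fej_bounds(1)[of t] by (intro power_mono) auto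
        then show ?thesis using True by (simp add: indicator_def)
      qed (use \<rho> in \<open>auto simp: indicator_def\<close>)
    qed
    also have "\<dots> = \<rho> ^ N" by (simp add: measure_def emeasure_unit_cube)
    finally show ?thesis .
  qed
  have "(\<lambda>N. (\<rho> / \<rho>') ^ N / vol) \<longlonglongrightarrow> 0 / vol"
    using \<rho> \<rho>' vol by (intro tendsto_divide LIMSEQ_power_zero tendsto_const) auto
  then have "\<forall>\<^sub>F N in sequentially. (\<rho> / \<rho>') ^ N / vol < \<eta>" using assms(2) by (intro order_tendstoD) auto
  from eventually_happens'[OF sequentially_bot this]
  obtain N where N: "(\<rho> / \<rho>') ^ N / vol < \<eta>" ..
  have TZ: "T N / Z N \<le> \<eta>"
  proof -
    have "T N / Z N \<le> \<rho> ^ N / (\<rho>' ^ N * vol)"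
      using T[of N] Z[of N] \<rho> \<rho>' vol by (intro frac_le) auto
    also have "\<dots> = (\<rho> / \<rho>') ^ N / vol" by (simp add: power_divide)
    finally show ?thesis using N by simp
  qed
  define P where "P t = (1 / Z N) * fej t ^ N" for t :: "real ^ 'n"
  show thesis
  proof (rule that[of P])
    have "tpos (\<lambda>t :: real ^ 'n. (complex_of_real (1 / Z N) * lchar 0 t) * complex_of_real (fej t) ^ N)"
      using Zpos[of N] by (intro tpos_mult tpos_char tpos_power tpos_fej) auto
    then show "tpos (\<lambda>t. complex_of_real (P t))" by (simp add: P_def)
    show "\<forall>t. 0 \<le> P t" using Zpos[of N] fb by (simp add: P_def)
    show "P \<in> borel_measurable borel" unfolding P_def [abs_def] by measurable
    have e: "indicator unit_cube t * P t = (1 / Z N) * (indicator unit_cube t * fej t ^ N)"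
      "indicator unit_cube t * (indicator {t. \<delta> \<le> norm t} t * P t) = (1 / Z N) * (indicator unit_cube t * (indicator {t. \<delta> \<le> norm t} t * fej t ^ N))" for t
      by (simp_all add: P_def)
    show "integrable lborel (\<lambda>t. indicator unit_cube t * P t)" unfolding e using iN by simp
    show "(LBINT t. indicator unit_cube t * P t) = 1" unfolding e using Zpos[of N] by (simp add: Z_def)
    have "(LBINT t. indicator unit_cube t * (indicator {t. \<delta> \<le> norm t} t * P t)) = (1 / Z N) * T N"
      unfolding e T_def by (rule integral_mult_right_zero)
    then show "(LBINT t. indicator unit_cube t * (indicator {t. \<delta> \<le> norm t} t * P t)) \<le> \<eta>"
      using TZ by simp
  qed
qed

text \<open>The \<open>v j\<close> and \<open>l j\<close> are the coefficients and frequencies of a positive kernel that has mass at most \<open>\<eta>\<close>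
  outside the \<open>\<delta>\<close>-ball. Nonnegative coefficients turn summability into convergence in \<open>has_sum_of_fejer\<close>.\<close>

definition fejer_data :: "real \<Rightarrow> real \<Rightarrow> nat \<Rightarrow> (nat \<Rightarrow> real) \<Rightarrow> (nat \<Rightarrow> int ^ 'n) \<Rightarrow> bool" where
  "fejer_data \<delta> \<eta> m v l \<longleftrightarrow> (\<forall>j. 0 \<le> v j) \<and> (\<Sum>j<m. if l j = 0 then v j else 0) = 1 \<and>
    (\<forall>C K. C \<in> borel_measurable borel \<longrightarrow> (\<forall>t. norm (C t) \<le> K) \<longrightarrow>
      norm (\<Sum>j<m. complex_of_real (v j) * (LBINT t. indicator unit_cube t * (C t * lchar (l j) t))) \<le> K) \<and>
    (\<forall>C K e. C \<in> borel_measurable borel \<longrightarrow> (\<forall>t. norm (C t) \<le> K) \<longrightarrow> (\<forall>t. norm t < \<delta> \<longrightarrow> norm (C t - C 0) \<le> e) \<longrightarrow> 0 \<le> e \<longrightarrow>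
      norm ((\<Sum>j<m. complex_of_real (v j) * (LBINT t. indicator unit_cube t * (C t * lchar (l j) t))) - C 0) \<le> e + 2 * K * \<eta>)"

lemma fejer_dataD:
  assumes "fejer_data \<delta> \<eta> m v l"
  shows "0 \<le> v j" "(\<Sum>j<m. if l j = 0 then v j else 0) = 1"
    and "C \<in> borel_measurable borel \<Longrightarrow> (\<And>t. norm (C t) \<le> K) \<Longrightarrow>
      norm (\<Sum>j<m. complex_of_real (v j) * (LBINT t. indicator unit_cube t * (C t * lchar (l j) t))) \<le> K"
    and "C \<in> borel_measurable borel \<Longrightarrow> (\<And>t. norm (C t) \<le> K) \<Longrightarrow> (\<And>t. norm t < \<delta> \<Longrightarrow> norm (C t - C 0) \<le> e) \<Longrightarrow> 0 \<le> e \<Longrightarrow>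
      norm ((\<Sum>j<m. complex_of_real (v j) * (LBINT t. indicator unit_cube t * (C t * lchar (l j) t))) - C 0) \<le> e + 2 * K * \<eta>"
  using assms unfolding fejer_data_def by blast+

text \<open>By linearity the weighted sum of the coefficients of \<open>C\<close> is the integral of
  \<open>C\<close> against the kernel, so both estimates follow from positivity, unit mass and
  concentration of the kernel.\<close>

theorem fejer_approx:
  assumes "\<delta> > 0" "\<eta> > 0"
  obtains m v and l :: "nat \<Rightarrow> int ^ 'n" where "fejer_data \<delta> \<eta> m v l"
proof -
  obtain P :: "real ^ 'n \<Rightarrow> real" where P: "tpos (\<lambda>t. complex_of_real (P t))" "\<forall>t. 0 \<le> P t" "P \<in> borel_measurable borel"
    "integrable lborel (\<lambda>t. indicator unit_cube t * P t)" "(LBINT t. indicator unit_cube t * P t) = 1"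
    "(LBINT t. indicator unit_cube t * (indicator {t. \<delta> \<le> norm t} t * P t)) \<le> \<eta>"
    by (rule fejer_kernel[OF assms])
  note [measurable] = P(3)
  have P2: "0 \<le> P t" for t using P(2) by blast
  obtain m :: nat and v and l :: "nat \<Rightarrow> int ^ 'n" where v: "\<forall>j. 0 \<le> v j"
    and Pr: "\<forall>t. complex_of_real (P t) = (\<Sum>j<m. complex_of_real (v j) * lchar (l j) t)"
    using P(1) unfolding tpos_def by blast
  have rep: "(\<Sum>j<m. complex_of_real (v j) * (LBINT t. indicator unit_cube t * (C t * lchar (l j) t)))
    = (LBINT t. complex_of_real (indicator unit_cube t * P t) * C t)"
    if [measurable]: "C \<in> borel_measurable borel" and K: "\<And>t. norm (C t) \<le> K" for C K
  proof -
    have i: "integrable lborel (\<lambda>t. indicator unit_cube t * (C t * lchar (l j) t))" for j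
      by (rule integrable_unit_cube_mult(1)[where K = K]) (use K in \<open>auto simp: norm_mult\<close>)
    have "(\<Sum>j<m. complex_of_real (v j) * (LBINT t. indicator unit_cube t * (C t * lchar (l j) t)))
      = (LBINT t. (\<Sum>j<m. complex_of_real (v j) * (indicator unit_cube t * (C t * lchar (l j) t))))"
      using i by (simp add: Bochner_Integration.integral_sum)
    also have "\<dots> = (LBINT t. complex_of_real (indicator unit_cube t * P t) * C t)"
    proof (rule Bochner_Integration.integral_cong[OF refl])
      fix t :: "real ^ 'n"
      have "(\<Sum>j<m. complex_of_real (v j) * (indicator unit_cube t * (C t * lchar (l j) t))) = (\<Sum>j<m. complex_of_real (v j) * lchar (l j) t) * (indicator unit_cube t * C t)"
        unfolding sum_distrib_right by (intro sum.cong refl) (simp only: mult_ac)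
      also have "\<dots> = complex_of_real (indicator unit_cube t * P t) * C t"
        unfolding Pr[rule_format, symmetric] by (simp add: of_real_indicator mult_ac)
      finally show "(\<Sum>j<m. complex_of_real (v j) * (indicator unit_cube t * (C t * lchar (l j) t))) = complex_of_real (indicator unit_cube t * P t) * C t" .
    qed
    finally show ?thesis .
  qed
  have iP: "integrable lborel (\<lambda>t. complex_of_real (indicator unit_cube t * P t))" using P(4) by (rule integrable_of_real)
  have nP: "(LBINT t. norm (complex_of_real (indicator unit_cube t * P t))) = 1"
  proof -
    have "norm (complex_of_real (indicator unit_cube t * P t)) = indicator unit_cube t * P t" for t
      unfolding norm_of_real using P2[of t] by (simp add: abs_mult)
    then show ?thesis using P(5) by simp
  qed
  show thesis
  proof (rule that[of m v l], unfold fejer_data_def, intro conjI allI impI)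
    show "0 \<le> v j" for j using v by simp
    \<comment> \<open>Testing on the constant function 1 reads off the total weight carried by the
      frequency 0.\<close>
    have "(\<Sum>j<m. complex_of_real (v j) * (LBINT t. indicator unit_cube t * (1 * lchar (l j) t))) = (LBINT t. complex_of_real (indicator unit_cube t * P t) * 1)"
      by (rule rep[where K = 1]) auto
    also have "\<dots> = complex_of_real (LBINT t. indicator unit_cube t * P t)"
      unfolding mult_1_right by (rule integral_complex_of_real)
    also have "\<dots> = 1" by (simp add: P(5))
    finally have "(\<Sum>j<m. complex_of_real (v j) * (if l j = 0 then 1 else 0)) = 1" by (simp only: mult_1_left integral_lchar)
    moreover have "(\<Sum>j<m. complex_of_real (v j) * (if l j = 0 then 1 else 0)) = complex_of_real (\<Sum>j<m. if l j = 0 then v j else 0)"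
      unfolding of_real_sum by (intro sum.cong) auto
    ultimately show "(\<Sum>j<m. if l j = 0 then v j else 0) = 1" by (metis of_real_eq_1_iff)
  next
    fix C :: "real ^ 'n \<Rightarrow> complex" and K :: real
    assume C0: "C \<in> borel_measurable borel" "\<forall>t. norm (C t) \<le> K"
    then have C: "C \<in> borel_measurable borel" "\<And>t. norm (C t) \<le> K" by auto
    note [measurable] = C(1)
    show "norm (\<Sum>j<m. complex_of_real (v j) * (LBINT t. indicator unit_cube t * (C t * lchar (l j) t))) \<le> K"
      unfolding rep[OF C] using norm_integral_mult_bound[OF iP _ C(2)] nP by simp
  next
    fix C :: "real ^ 'n \<Rightarrow> complex" and K e :: real
    assume C0: "C \<in> borel_measurable borel" "\<forall>t. norm (C t) \<le> K" and e0: "\<forall>t. norm t < \<delta> \<longrightarrow> norm (C t - C 0) \<le> e" "0 \<le> e"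
    have C: "C \<in> borel_measurable borel" "\<And>t. norm (C t) \<le> K" using C0 by auto
    note [measurable] = C(1)
    have e: "\<And>t. norm t < \<delta> \<Longrightarrow> norm (C t - C 0) \<le> e" "0 \<le> e" using e0 by auto
    have K0: "0 \<le> K" using C(2)[of 0] norm_ge_zero order_trans by blast
    have "C 0 = (LBINT t. complex_of_real (indicator unit_cube t * P t) * C 0)"
    proof -
      have "(LBINT t. complex_of_real (indicator unit_cube t * P t)) = complex_of_real (LBINT t. indicator unit_cube t * P t)"
        by (rule integral_complex_of_real)
      then show ?thesis by (simp only: P(5) integral_mult_left_zero of_real_1 mult_1_left)
    qed
    then have "(\<Sum>j<m. complex_of_real (v j) * (LBINT t. indicator unit_cube t * (C t * lchar (l j) t))) - C 0
      = (LBINT t. complex_of_real (indicator unit_cube t * P t) * C t) - (LBINT t. complex_of_real (indicator unit_cube t * P t) * C 0)"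
      using rep[OF C] by simp
    also have "\<dots> = (LBINT t. complex_of_real (indicator unit_cube t * P t) * (C t - C 0))"
      unfolding right_diff_distrib
      by (rule Bochner_Integration.integral_diff[symmetric]) (rule integrable_mult_bounded[OF iP], simp, rule C(2), use iP in simp)
    finally have d: "(\<Sum>j<m. complex_of_real (v j) * (LBINT t. indicator unit_cube t * (C t * lchar (l j) t))) - C 0
      = (LBINT t. complex_of_real (indicator unit_cube t * P t) * (C t - C 0))" .
    have dK: "norm (C t - C 0) \<le> 2 * K" for t using norm_triangle_ineq4[of "C t" "C 0"] C(2)[of t] C(2)[of 0] by linarith
    have iT: "integrable lborel (\<lambda>t. indicator unit_cube t * (indicator {t. \<delta> \<le> norm t} t * P t))"
      by (rule Bochner_Integration.integrable_bound[OF P(4)]) (use P2 in \<open>auto simp: indicator_def\<close>)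
    have "norm (LBINT t. complex_of_real (indicator unit_cube t * P t) * (C t - C 0))
      \<le> (LBINT t. norm (complex_of_real (indicator unit_cube t * P t) * (C t - C 0)))"
      by (rule integral_norm_bound)
    also have "\<dots> \<le> (LBINT t. e * (indicator unit_cube t * P t) + 2 * K * (indicator unit_cube t * (indicator {t. \<delta> \<le> norm t} t * P t)))"
    proof (rule integral_mono)
      show "integrable lborel (\<lambda>t. norm (complex_of_real (indicator unit_cube t * P t) * (C t - C 0)))"
        by (rule integrable_norm, rule integrable_mult_bounded[OF iP _ dK]) measurable
      show "integrable lborel (\<lambda>t. e * (indicator unit_cube t * P t) + 2 * K * (indicator unit_cube t * (indicator {t. \<delta> \<le> norm t} t * P t)))"
        using P(4) iT by simp
      fix t :: "real ^ 'n"
      show "norm (complex_of_real (indicator unit_cube t * P t) * (C t - C 0)) \<le> e * (indicator unit_cube t * P t) + 2 * K * (indicator unit_cube t * (indicator {t. \<delta> \<le> norm t} t * P t))"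
      proof (cases "norm t < \<delta>")
        case True
        then show ?thesis using e(1)[OF True] P2[of t] by (auto simp: norm_mult indicator_def mult.commute[of e] intro!: mult_left_mono)
      next
        case False
        have "P t * norm (C t - C 0) \<le> P t * (2 * K)" by (rule mult_left_mono[OF dK P2])
        moreover have "0 \<le> e * P t" using e(2) P2 by simp
        ultimately show ?thesis using False P2[of t] by (auto simp: norm_mult indicator_def mult_ac)
      qed
    qed
    also have "\<dots> = e + 2 * K * (LBINT t. indicator unit_cube t * (indicator {t. \<delta> \<le> norm t} t * P t))"
      using P(4,5) iT by simp
    also have "\<dots> \<le> e + 2 * K * \<eta>" using P(6) K0 by (intro add_left_mono mult_left_mono) auto
    finally show "norm ((\<Sum>j<m. complex_of_real (v j) * (LBINT t. indicator unit_cube t * (C t * lchar (l j) t))) - C 0) \<le> e + 2 * K * \<eta>"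
      unfolding d .
  qed
qed

subsection \<open>Poisson summation for power spectra\<close>

text \<open>This is the form in which decay is used: a bound on lattice sums, uniform in the offset
  \<open>x\<close>. It dominates both the supremum and the L1 norm and is stable under modulation
  and under differences of translates.\<close>

definition pbound :: "(real ^ 'n \<Rightarrow> complex) \<Rightarrow> real \<Rightarrow> bool" where
  "pbound \<phi> A \<longleftrightarrow> \<phi> \<in> borel_measurable borel \<and> 0 \<le> A \<and>
    (\<forall>x. (\<integral>\<^sup>+n. ennreal (norm (\<phi> (x - of_int_vec n))) \<partial>lattice) \<le> ennreal A)"

lemma nn_integral_lattice_uminus: "(\<integral>\<^sup>+n. f (- n) \<partial>lattice) = (\<integral>\<^sup>+n. f (n :: int ^ 'n) \<partial>lattice)"
  by (rule nn_integral_bij_count_space) (auto intro!: bij_betwI[where g = uminus])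

lemma integral_lattice_uminus:
  fixes f :: "int ^ 'n \<Rightarrow> complex"
  shows "(LINT n|lattice. f (- n)) = (LINT n|lattice. f n)"
  by (rule integral_bij_count_space) (auto intro!: bij_betwI[where g = uminus])

lemma nn_integral_lattice_add: "(\<integral>\<^sup>+n. f (n + m) \<partial>lattice) = (\<integral>\<^sup>+n. f (n :: int ^ 'n) \<partial>lattice)"
  by (rule nn_integral_bij_count_space) (auto intro!: bij_betwI[where g = "\<lambda>n. n - m"])

lemma integral_lattice_add:
  fixes f :: "int ^ 'n \<Rightarrow> complex"
  shows "(LINT n|lattice. f (n + m)) = (LINT n|lattice. f n)"
  by (rule integral_bij_count_space) (auto intro!: bij_betwI[where g = "\<lambda>n. n - m"])

lemma pbound_measurable: "pbound \<phi> A \<Longrightarrow> \<phi> \<in> borel_measurable borel"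
  by (simp add: pbound_def)

lemma pbound_nonneg: "pbound \<phi> A \<Longrightarrow> 0 \<le> A"
  by (simp add: pbound_def)

lemma pbound_minus: "pbound \<phi> A \<Longrightarrow> (\<integral>\<^sup>+n. ennreal (norm (\<phi> (x - of_int_vec n))) \<partial>lattice) \<le> ennreal A"
  by (simp add: pbound_def)

lemma pbound_plus:
  assumes "pbound \<phi> A"
  shows "(\<integral>\<^sup>+n. ennreal (norm (\<phi> (x + of_int_vec n))) \<partial>lattice) \<le> ennreal A"
  using pbound_minus[OF assms, of x] nn_integral_lattice_uminus[of "\<lambda>n. ennreal (norm (\<phi> (x + of_int_vec n)))"] by simp

lemma pbound_integrable:
  fixes \<phi> :: "real ^ 'n \<Rightarrow> complex"
  assumes "pbound \<phi> A"
  shows "integrable lborel \<phi>" "(LBINT x. norm (\<phi> x)) \<le> A"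
proof -
  have [measurable]: "\<phi> \<in> borel_measurable borel" by (rule pbound_measurable[OF assms])
  have "(\<integral>\<^sup>+x. ennreal (norm (\<phi> x)) \<partial>lborel) = (\<integral>\<^sup>+x. indicator unit_cube x * (\<integral>\<^sup>+n. ennreal (norm (\<phi> (x + of_int_vec n))) \<partial>lattice) \<partial>lborel)"
    by (rule nn_integral_unfold) measurable
  also have "\<dots> \<le> (\<integral>\<^sup>+x. indicator (unit_cube :: (real ^ 'n) set) x * ennreal A \<partial>lborel)"
    by (intro nn_integral_mono mult_left_mono pbound_plus[OF assms]) simp
  also have "\<dots> = ennreal A" by (simp add: nn_integral_multc emeasure_unit_cube)
  finally have le: "(\<integral>\<^sup>+x. ennreal (norm (\<phi> x)) \<partial>lborel) \<le> ennreal A" .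
  show i: "integrable lborel \<phi>"
    by (rule integrableI_bounded) (use order_le_less_trans[OF le ennreal_less_top] in auto)
  have "ennreal (LBINT x. norm (\<phi> x)) = (\<integral>\<^sup>+x. ennreal (norm (\<phi> x)) \<partial>lborel)"
    using i by (intro nn_integral_eq_integral[symmetric]) auto
  with le have "ennreal (LBINT x. norm (\<phi> x)) \<le> ennreal A" by simp
  then show "(LBINT x. norm (\<phi> x)) \<le> A" by (rule ennreal_le_iff[OF pbound_nonneg[OF assms], THEN iffD1])
qed

lemma pbound_norm_le:
  assumes "pbound \<phi> A" shows "norm (\<phi> x) \<le> A"
proof -
  have "ennreal (norm (\<phi> (x - of_int_vec 0))) \<le> (\<integral>\<^sup>+n. ennreal (norm (\<phi> (x - of_int_vec n))) \<partial>lattice)"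
    by (rule nn_integral_ge_point) simp
  then have "ennreal (norm (\<phi> x)) \<le> ennreal A" using pbound_minus[OF assms, of x] by simp
  then show ?thesis using pbound_nonneg[OF assms] by simp
qed

lemma pbound_sq_int:
  assumes "pbound \<phi> A" shows "sq_int \<phi>"
proof -
  have [measurable]: "\<phi> \<in> borel_measurable borel" by (rule pbound_measurable[OF assms])
  have i: "integrable lborel (\<lambda>x. A * norm (\<phi> x))" using pbound_integrable(1)[OF assms] by simp
  have "integrable lborel (\<lambda>x. (norm (\<phi> x))\<^sup>2)"
    by (rule Bochner_Integration.integrable_bound[OF i])
      (use pbound_norm_le[OF assms] pbound_nonneg[OF assms] in \<open>auto simp: power2_eq_square intro!: mult_right_mono\<close>)
  then show ?thesis by (auto simp: sq_int_def)
qed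

lemma L1_translation_eps:
  fixes g :: "'a::euclidean_space \<Rightarrow> complex"
  assumes "integrable lborel g" "e > 0"
  obtains \<delta> where "\<delta> > 0" "\<forall>t. norm t < \<delta> \<longrightarrow> (LBINT x. norm (g (x - t) - g x)) < e"
proof (rule ccontr)
  assume a: "\<not> thesis"
  have "\<exists>t. norm t < 1 / real (Suc n) \<and> \<not> (LBINT x. norm (g (x - t) - g x)) < e" for n
    using a that[of "1 / real (Suc n)"] by fastforce
  then obtain t where t: "\<And>n. norm (t n) < 1 / real (Suc n)" "\<And>n. \<not> (LBINT x. norm (g (x - t n) - g x)) < e"
    by metis
  have "t \<longlonglongrightarrow> 0"
  proof (rule Lim_null_comparison)
    show "\<forall>\<^sub>F n in sequentially. norm (t n) \<le> 1 / real (Suc n)" using t(1) by (auto intro!: always_eventually less_imp_le)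
    show "(\<lambda>n. 1 / real (Suc n)) \<longlonglongrightarrow> 0" by real_asymp
  qed
  then have "(\<lambda>n. LBINT x. norm (g (x - t n) - g x)) \<longlonglongrightarrow> 0" by (rule tendsto_L1_translation[OF assms(1)])
  then have "\<forall>\<^sub>F n in sequentially. (LBINT x. norm (g (x - t n) - g x)) < e" using assms(2) by (intro order_tendstoD)
  from eventually_happens'[OF sequentially_bot this] show False using t(2) by blast
qed

text \<open>Summing over the lag before integrating leaves a lattice sum of \<theta>, which is
  bounded uniformly in \<open>x\<close>.\<close>

lemma lattice_correlation_bound:
  fixes \<theta> \<eta> :: "real ^ 'n \<Rightarrow> complex"
  assumes \<theta>: "pbound \<theta> A" and [measurable]: "\<eta> \<in> borel_measurable borel"
  shows "(\<integral>\<^sup>+p. (\<integral>\<^sup>+x. ennreal (norm (\<eta> x) * norm (\<theta> (t + x + of_int_vec p))) \<partial>lborel) \<partial>lattice)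
    \<le> (\<integral>\<^sup>+x. ennreal (norm (\<eta> x)) \<partial>lborel) * ennreal A"
proof -
  have [measurable]: "\<theta> \<in> borel_measurable borel" by (rule pbound_measurable[OF \<theta>])
  have m: "(\<lambda>(p, x). ennreal (norm (\<eta> x) * norm (\<theta> (t + x + of_int_vec p)))) \<in> borel_measurable (lattice \<Otimes>\<^sub>M lborel)"
    by measurable
  have "(\<integral>\<^sup>+p. (\<integral>\<^sup>+x. ennreal (norm (\<eta> x) * norm (\<theta> (t + x + of_int_vec p))) \<partial>lborel) \<partial>lattice)
    = (\<integral>\<^sup>+x. (\<integral>\<^sup>+p. ennreal (norm (\<eta> x) * norm (\<theta> (t + x + of_int_vec p))) \<partial>lattice) \<partial>lborel)"
    by (rule LL.Fubini'[OF m, symmetric])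
  also have "\<dots> = (\<integral>\<^sup>+x. ennreal (norm (\<eta> x)) * (\<integral>\<^sup>+p. ennreal (norm (\<theta> (t + x + of_int_vec p))) \<partial>lattice) \<partial>lborel)"
    by (simp add: nn_integral_cmult ennreal_mult)
  also have "\<dots> \<le> (\<integral>\<^sup>+x. ennreal (norm (\<eta> x)) * ennreal A \<partial>lborel)"
    by (intro nn_integral_mono mult_left_mono pbound_plus[OF \<theta>]) simp
  also have "\<dots> = (\<integral>\<^sup>+x. ennreal (norm (\<eta> x)) \<partial>lborel) * ennreal A"
    by (rule nn_integral_multc) measurable
  finally show ?thesis .
qed

lemma lattice_norm_le:
  fixes f :: "'i \<Rightarrow> complex"
  assumes "(\<integral>\<^sup>+p. ennreal (norm (f p)) \<partial>count_space UNIV) \<le> ennreal K" "0 \<le> K"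
  shows "integrable (count_space UNIV) f" "norm (\<integral>p. f p \<partial>count_space UNIV) \<le> K"
proof -
  show i: "integrable (count_space UNIV) f"
    by (rule integrableI_bounded) (use order_le_less_trans[OF assms(1) ennreal_less_top] in auto)
  have "ennreal (norm (\<integral>p. f p \<partial>count_space UNIV)) \<le> (\<integral>\<^sup>+p. ennreal (norm (f p)) \<partial>count_space UNIV)"
    by (rule integral_norm_bound_ennreal[OF i])
  also note assms(1)
  finally show "norm (\<integral>p. f p \<partial>count_space UNIV) \<le> K" using assms(2) by (simp only: ennreal_le_iff)
qed

text \<open>Kernel-weighted sums of the coefficients recover \<open>C 0\<close>. On a prescribed
  finite set the weights can be made nearly 1, which bounds its partial sum from above. No weight
  exceeds 1, so the plain sum over the frequencies of a single kernel is at least \<open>C 0\<close>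
  up to an error. Nonnegativity of the coefficients is used in both directions.\<close>

lemma has_sum_of_fejer:
  fixes C :: "real ^ 'n \<Rightarrow> complex" and c :: "int ^ 'n \<Rightarrow> real"
  assumes C [measurable]: "C \<in> borel_measurable borel" and K: "\<And>t. norm (C t) \<le> K"
    and cont: "\<And>e. e > 0 \<Longrightarrow> \<exists>\<delta>>0. \<forall>t. norm t < \<delta> \<longrightarrow> norm (C t - C 0) \<le> e"
    and c: "\<And>l. (LBINT t. indicator unit_cube t * (C t * lchar l t)) = complex_of_real (c l)"
    and c0: "\<And>l. 0 \<le> c l"
  shows "(c has_sum Re (C 0)) UNIV"
proof -
  have K0: "0 \<le> K" using K[of 0] norm_ge_zero order_trans by blast
  have lc: "\<exists>\<delta>>0. \<forall>t. norm t < \<delta> \<longrightarrow> norm (lchar l t - 1) \<le> e" if "e > 0" for e and l :: "int ^ 'n"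
  proof -
    have "continuous_on UNIV (lchar l)" unfolding lchar_def [abs_def] by (intro continuous_intros)
    then have "isCont (lchar l) 0" by (simp add: continuous_on_eq_continuous_at)
    then have "\<exists>\<delta>>0. \<forall>t. dist t 0 < \<delta> \<longrightarrow> dist (lchar l t) (lchar l 0) < e"
      using that by (rule continuous_at_eps_delta[THEN iffD1, rule_format])
    then obtain \<delta> where "\<delta> > 0" "\<forall>t. norm t < \<delta> \<longrightarrow> norm (lchar l t - 1) < e"
      by (auto simp: dist_norm lchar_0)
    then show ?thesis by (meson less_imp_le)
  qed
  have le: "sum c F \<le> Re (C 0)" if F: "finite F" for F
  proof (rule field_le_epsilon)
    fix e0 :: real assume "e0 > 0"
    \<comment> \<open>The total loss is \<open>e * (2 * sum c F + 2)\<close>: a proportion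
      \<open>2 * e\<close> of the partial sum, because the weights are only nearly 1, and
      \<open>2 * e\<close> from the approximation of \<open>C 0\<close>.\<close>
    define e where "e = min (1/4) (e0 / (2 * sum c F + 2))"
    have sF: "0 \<le> sum c F" by (intro sum_nonneg c0)
    have e: "e > 0" "e \<le> 1/4" "e * (2 * sum c F + 2) \<le> e0"
    proof -
      have "0 < 2 * sum c F + 2" using sF by linarith
      then show "e > 0" using \<open>e0 > 0\<close> by (auto simp: e_def)
      show "e \<le> 1/4" unfolding e_def by (rule min.cobounded1)
      have "e \<le> e0 / (2 * sum c F + 2)" unfolding e_def by (rule min.cobounded2)
      then show "e * (2 * sum c F + 2) \<le> e0" using \<open>0 < 2 * sum c F + 2\<close> by (simp add: pos_le_divide_eq)
    qed
    obtain \<delta>0 where \<delta>0: "\<delta>0 > 0" "\<forall>t. norm t < \<delta>0 \<longrightarrow> norm (C t - C 0) \<le> e" using cont[OF e(1)] by blast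
    obtain d where d: "\<And>l. d l > 0" "\<And>l :: int ^ 'n. \<forall>t. norm t < d l \<longrightarrow> norm (lchar l t - 1) \<le> e"
      using lc[OF e(1)] by metis
    define \<delta> where "\<delta> = Min (insert \<delta>0 ((\<lambda>l. d (- l)) ` F))"
    have \<delta>: "\<delta> > 0" "\<delta> \<le> \<delta>0" "\<And>l. l \<in> F \<Longrightarrow> \<delta> \<le> d (- l)"
      using F \<delta>0 d by (auto simp: \<delta>_def)
    define \<eta> where "\<eta> = e / (2 * K + 2)"
    have \<eta>: "\<eta> > 0" "2 * K * \<eta> \<le> e" "2 * \<eta> \<le> e"
      using e K0 by (auto simp: \<eta>_def divide_simps add_nonneg_pos)
    obtain m v and l :: "nat \<Rightarrow> int ^ 'n" where fd: "fejer_data \<delta> \<eta> m v l" by (rule fejer_approx[OF \<delta>(1) \<eta>(1)])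
    \<comment> \<open>The total weight that the kernel puts on the frequency \<open>i\<close>.
      Testing the kernel on \<open>lchar (- i)\<close>, which equals 1 at 0, shows that it is close
      to 1.\<close>
    define p where "p i = (\<Sum>j<m. if l j = i then v j else 0)" for i
    have p: "\<bar>p i - 1\<bar> \<le> 2 * e" if "i \<in> F" for i
    proof -
      have "norm ((\<Sum>j<m. complex_of_real (v j) * (LBINT t. indicator unit_cube t * (lchar (- i) t * lchar (l j) t))) - lchar (- i) 0) \<le> e + 2 * 1 * \<eta>"
        by (rule fejer_dataD(4)[OF fd]) (use d(2)[of "- i"] \<delta>(3)[OF that] e in auto)
      also have "(\<Sum>j<m. complex_of_real (v j) * (LBINT t. indicator unit_cube t * (lchar (- i) t * lchar (l j) t))) = complex_of_real (p i)"
        unfolding p_def of_real_sum lchar_add_left[symmetric] integral_lchar by (intro sum.cong) auto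
      finally have "norm (complex_of_real (p i - 1)) \<le> e + 2 * \<eta>" by simp
      then show ?thesis using \<eta> unfolding norm_of_real by linarith
    qed
    have "norm ((\<Sum>j<m. complex_of_real (v j) * (LBINT t. indicator unit_cube t * (C t * lchar (l j) t))) - C 0) \<le> e + 2 * K * \<eta>"
      by (rule fejer_dataD(4)[OF fd C K]) (use \<delta>0 \<delta> e in auto)
    then have "norm (complex_of_real (\<Sum>j<m. v j * c (l j)) - C 0) \<le> 2 * e" using \<eta> by (simp add: c)
    then have u: "(\<Sum>j<m. v j * c (l j)) \<le> Re (C 0) + 2 * e"
      using abs_Re_le_cmod[of "complex_of_real (\<Sum>j<m. v j * c (l j)) - C 0"] by (simp del: of_real_sum of_real_mult)
    have "(1 - 2 * e) * sum c F \<le> (\<Sum>i\<in>F. p i * c i)"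
      unfolding sum_distrib_left by (intro sum_mono mult_right_mono c0) (use p in \<open>fastforce simp: abs_le_iff\<close>)
    also have "\<dots> = (\<Sum>i\<in>F. \<Sum>j<m. if l j = i then v j * c i else 0)"
      unfolding p_def sum_distrib_right by (intro sum.cong refl) auto
    also have "\<dots> = (\<Sum>j<m. \<Sum>i\<in>F. if l j = i then v j * c i else 0)" by (rule sum.swap)
    also have "\<dots> \<le> (\<Sum>j<m. v j * c (l j))"
      using F fejer_dataD(1)[OF fd] c0 by (intro sum_mono) (simp add: sum.delta)
    finally have "(1 - 2 * e) * sum c F \<le> Re (C 0) + 2 * e" using u by linarith
    then have "sum c F \<le> Re (C 0) + e * (2 * sum c F + 2)" by (simp add: algebra_simps)
    then show "sum c F \<le> Re (C 0) + e0" using e(3) by linarith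
  qed
  have ge: "\<exists>F. finite F \<and> Re (C 0) - e0 \<le> sum c F" if "e0 > 0" for e0
  proof -
    define e where "e = e0 / 2"
    have e: "e > 0" using that by (simp add: e_def)
    obtain \<delta> where \<delta>: "\<delta> > 0" "\<forall>t. norm t < \<delta> \<longrightarrow> norm (C t - C 0) \<le> e" using cont[OF e] by blast
    define \<eta> where "\<eta> = e / (2 * K + 2)"
    have \<eta>: "\<eta> > 0" "2 * K * \<eta> \<le> e"
      using e K0 by (auto simp: \<eta>_def divide_simps add_nonneg_pos)
    obtain m v and l :: "nat \<Rightarrow> int ^ 'n" where fd: "fejer_data \<delta> \<eta> m v l" by (rule fejer_approx[OF \<delta>(1) \<eta>(1)])
    define p where "p i = (\<Sum>j<m. if l j = i then v j else 0)" for i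
    have p: "p i \<le> 1" for i
    proof -
      have "norm (\<Sum>j<m. complex_of_real (v j) * (LBINT t. indicator unit_cube t * (lchar (- i) t * lchar (l j) t))) \<le> 1"
        by (rule fejer_dataD(3)[OF fd]) auto
      also have "(\<Sum>j<m. complex_of_real (v j) * (LBINT t. indicator unit_cube t * (lchar (- i) t * lchar (l j) t))) = complex_of_real (p i)"
        unfolding p_def of_real_sum lchar_add_left[symmetric] integral_lchar by (intro sum.cong) auto
      finally show ?thesis by simp
    qed
    have "norm ((\<Sum>j<m. complex_of_real (v j) * (LBINT t. indicator unit_cube t * (C t * lchar (l j) t))) - C 0) \<le> e + 2 * K * \<eta>"
      by (rule fejer_dataD(4)[OF fd C K]) (use \<delta> e in auto)
    then have "norm (complex_of_real (\<Sum>j<m. v j * c (l j)) - C 0) \<le> e0" using \<eta> by (simp add: c e_def)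
    then have u: "Re (C 0) - e0 \<le> (\<Sum>j<m. v j * c (l j))"
      using abs_Re_le_cmod[of "complex_of_real (\<Sum>j<m. v j * c (l j)) - C 0"] by (simp del: of_real_sum of_real_mult)
    define F where "F = l ` {..<m}"
    have "(\<Sum>j<m. v j * c (l j)) = (\<Sum>j<m. \<Sum>i\<in>F. if l j = i then v j * c i else 0)"
      by (intro sum.cong refl) (simp add: F_def sum.delta)
    also have "\<dots> = (\<Sum>i\<in>F. \<Sum>j<m. if l j = i then v j * c i else 0)" by (rule sum.swap)
    also have "\<dots> = (\<Sum>i\<in>F. p i * c i)"
      unfolding p_def sum_distrib_right by (intro sum.cong refl) auto
    also have "\<dots> \<le> sum c F"
      using mult_right_mono[OF p c0] by (intro sum_mono) simp
    finally show ?thesis using u by (intro exI[of _ F]) (auto simp: F_def)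
  qed
  have bdd: "bdd_above (sum c ` {F. finite F \<and> F \<subseteq> UNIV})" using le by (auto intro!: bdd_aboveI2)
  have hs: "(c has_sum (SUP F\<in>{F. finite F \<and> F \<subseteq> UNIV}. sum c F)) UNIV"
    by (rule nonneg_bdd_above_has_sum[OF c0]) (use bdd in \<open>simp add: conj_commute\<close>)
  also have "(SUP F\<in>{F. finite F \<and> F \<subseteq> UNIV}. sum c F) = Re (C 0)"
  proof (rule antisym)
    show "(SUP F\<in>{F. finite F \<and> F \<subseteq> UNIV}. sum c F) \<le> Re (C 0)" by (rule cSUP_least) (use le in auto)
    show "Re (C 0) \<le> (SUP F\<in>{F. finite F \<and> F \<subseteq> UNIV}. sum c F)"
    proof (rule field_le_epsilon)
      fix e :: real assume "e > 0"
      then obtain F where F: "finite F" "Re (C 0) - e \<le> sum c F" using ge by blast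
      have "sum c F \<le> (SUP F\<in>{F. finite F \<and> F \<subseteq> UNIV}. sum c F)" by (rule cSUP_upper[OF _ bdd]) (use F in auto)
      then show "Re (C 0) \<le> (SUP F\<in>{F. finite F \<and> F \<subseteq> UNIV}. sum c F) + e" using F by linarith
    qed
  qed
  finally show ?thesis .
qed

lemma pbound_modulate:
  fixes \<psi> :: "real ^ 'n \<Rightarrow> complex"
  assumes "pbound \<psi> A" shows "pbound (\<lambda>x. \<psi> x * cis (- (x \<bullet> \<xi>))) A"
proof -
  have [measurable]: "\<psi> \<in> borel_measurable borel" by (rule pbound_measurable[OF assms])
  have "(\<lambda>x. \<psi> x * cis (- (x \<bullet> \<xi>))) \<in> borel_measurable borel" by measurable
  then show ?thesis using assms by (simp add: pbound_def norm_mult)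
qed

text \<open>The bound is linear in an L1 bound for \<eta>. Taking for \<eta> a difference of
  translates, it gives continuity of the sum over all lags at once.\<close>

lemma norm_autocorr_diff_le:
  fixes \<theta> \<eta> :: "real ^ 'n \<Rightarrow> complex"
  assumes \<theta>: "pbound \<theta> A" and \<eta>: "integrable lborel \<eta>" and N: "(LBINT x. norm (\<eta> x)) \<le> N"
  shows "(\<integral>\<^sup>+p. ennreal (norm (LBINT z. \<theta> z * cnj (\<eta> (of_int_vec p + z)))) \<partial>lattice) \<le> ennreal (N * A)"
proof -
  have [measurable]: "\<theta> \<in> borel_measurable borel" by (rule pbound_measurable[OF \<theta>])
  have [measurable]: "\<eta> \<in> borel_measurable borel" using \<eta> by auto
  have A: "0 \<le> A" by (rule pbound_nonneg[OF \<theta>])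
  have N0: "0 \<le> N" by (rule order_trans[OF _ N]) simp
  have le: "ennreal (norm (LBINT z. \<theta> z * cnj (\<eta> (of_int_vec p + z))))
      \<le> (\<integral>\<^sup>+x. ennreal (norm (\<eta> x) * norm (\<theta> (0 + x + of_int_vec (- p)))) \<partial>lborel)" for p :: "int ^ 'n"
  proof -
    have "ennreal (norm (LBINT z. \<theta> z * cnj (\<eta> (of_int_vec p + z))))
        \<le> (\<integral>\<^sup>+z. ennreal (norm (\<eta> (of_int_vec p + z)) * norm (\<theta> (0 + (of_int_vec p + z) + of_int_vec (- p)))) \<partial>lborel)"
      using integral_norm_bound_ennreal[of lborel "\<lambda>z. \<theta> z * cnj (\<eta> (of_int_vec p + z))"]
      by (cases "integrable lborel (\<lambda>z. \<theta> z * cnj (\<eta> (of_int_vec p + z)))")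
         (simp_all add: norm_mult mult.commute not_integrable_integral_eq)
    also have "\<dots> = (\<integral>\<^sup>+x. ennreal (norm (\<eta> x) * norm (\<theta> (0 + x + of_int_vec (- p)))) \<partial>lborel)"
      by (rule nn_integral_lborel_translate) measurable
    finally show ?thesis .
  qed
  have "(\<integral>\<^sup>+p. ennreal (norm (LBINT z. \<theta> z * cnj (\<eta> (of_int_vec p + z)))) \<partial>lattice)
    \<le> (\<integral>\<^sup>+p. (\<integral>\<^sup>+x. ennreal (norm (\<eta> x) * norm (\<theta> (0 + x + of_int_vec (- p)))) \<partial>lborel) \<partial>lattice)"
    by (rule nn_integral_mono) (rule le)
  also have "\<dots> = (\<integral>\<^sup>+p. (\<integral>\<^sup>+x. ennreal (norm (\<eta> x) * norm (\<theta> (0 + x + of_int_vec p))) \<partial>lborel) \<partial>lattice)"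
    by (rule nn_integral_lattice_uminus)
  also have "\<dots> \<le> (\<integral>\<^sup>+x. ennreal (norm (\<eta> x)) \<partial>lborel) * ennreal A"
    by (rule lattice_correlation_bound[OF \<theta>]) measurable
  also have "\<dots> = ennreal ((LBINT x. norm (\<eta> x)) * A)"
    using \<eta> A by (simp add: nn_integral_eq_integral ennreal_mult)
  also have "\<dots> \<le> ennreal (N * A)" using N A by (intro ennreal_leI mult_right_mono)
  finally show ?thesis .
qed

text \<open>Poisson summation in a setting where the transform of \<psi> has no known decay. The
  periodized autocorrelation \<open>C\<close> of the modulated function has values of the power
  spectrum as its Fourier coefficients. It is bounded and continuous at 0, and the coefficients are
  nonnegative, so they sum to \<open>C 0\<close>.\<close>

theorem periodized_power_spec:
  fixes \<psi> :: "real ^ 'n \<Rightarrow> complex"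
  assumes \<psi>: "pbound \<psi> A"
  shows "((\<lambda>l. power_spec \<psi> (\<xi> + (2 * pi) *\<^sub>R of_int_vec l)) has_sum
    Re (LINT p|lattice. (LBINT z. \<psi> z * cnj (\<psi> (of_int_vec p + z))) * cis (of_int_vec p \<bullet> \<xi>))) UNIV"
proof -
  \<comment> \<open>Modulation carries the base frequency \<xi> into the function, so that only the
    value of the periodization at \<open>t = 0\<close> is needed.\<close>
  define \<theta> where "\<theta> x = \<psi> x * cis (- (x \<bullet> \<xi>))" for x
  define C where "C t = (LINT p|lattice. autocorr \<theta> 0 (t + of_int_vec p))" for t
  have \<theta>: "pbound \<theta> A" unfolding \<theta>_def [abs_def] by (rule pbound_modulate[OF \<psi>])
  have [measurable]: "\<theta> \<in> borel_measurable borel" by (rule pbound_measurable[OF \<theta>])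
  have A: "0 \<le> A" by (rule pbound_nonneg[OF \<theta>])
  have i\<theta>: "integrable lborel \<theta>" by (rule pbound_integrable(1)[OF \<theta>])
  have ac [measurable]: "autocorr \<theta> 0 \<in> borel_measurable borel"
    unfolding autocorr_def [abs_def] by measurable
  have Cm [measurable]: "C \<in> borel_measurable borel"
    unfolding C_def [abs_def] by (rule lattice.borel_measurable_lebesgue_integral) measurable
  have auto: "autocorr \<theta> 0 (t + of_int_vec p) = (LBINT z. \<theta> z * cnj (\<theta> (t + (of_int_vec p + z))))" for t p
    unfolding autocorr_def by (simp add: add.assoc)
  have i\<theta>t: "integrable lborel (\<lambda>x. \<theta> (t + x))" for t using i\<theta> by (rule integrable_lborel_translate)
  have ip: "integrable lattice (\<lambda>p. autocorr \<theta> 0 (t + of_int_vec p))" and K: "norm (C t) \<le> A * A" for t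
  proof -
    have b: "(\<integral>\<^sup>+p. ennreal (norm (autocorr \<theta> 0 (t + of_int_vec p))) \<partial>lattice) \<le> ennreal (A * A)"
      unfolding auto
      by (rule norm_autocorr_diff_le[OF \<theta> i\<theta>t])
        (use integral_lborel_translate[of "\<lambda>x. norm (\<theta> x)" t] pbound_integrable(2)[OF \<theta>] in simp)
    show "integrable lattice (\<lambda>p. autocorr \<theta> 0 (t + of_int_vec p))" by (rule lattice_norm_le[OF b]) (use A in simp)
    show "norm (C t) \<le> A * A" unfolding C_def by (rule lattice_norm_le[OF b]) (use A in simp)
  qed
  have cont: "\<exists>\<delta>>0. \<forall>t. norm t < \<delta> \<longrightarrow> norm (C t - C 0) \<le> e" if "e > 0" for e
  proof -
    have e: "e / (A + 1) > 0" using that A by simp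
    obtain \<delta> where \<delta>: "\<delta> > 0" "\<forall>t. norm t < \<delta> \<longrightarrow> (LBINT x. norm (\<theta> (x - t) - \<theta> x)) < e / (A + 1)"
      by (rule L1_translation_eps[OF i\<theta> e])
    have "norm (C t - C 0) \<le> e" if t: "norm t < \<delta>" for t
    proof -
      have iz: "integrable lborel (\<lambda>z. \<theta> z * cnj (\<theta> (s + z)))" for s
        using integrable_sq_int_mult[OF pbound_sq_int[OF \<theta>], of "\<lambda>z. \<theta> (s + z)" "\<lambda>_. 1" 1] sq_int_translate[OF pbound_sq_int[OF \<theta>], of s]
        by (simp add: add.commute)
      have n: "(LBINT x. norm (\<theta> (t + x) - \<theta> x)) \<le> e / (A + 1)"
        using \<delta>(2)[rule_format, of "- t"] t by (simp add: add.commute)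
      have "C t - C 0 = (LINT p|lattice. (LBINT z. \<theta> z * cnj (\<theta> (t + (of_int_vec p + z)) - \<theta> (of_int_vec p + z))))"
      proof -
        have "C t - C 0 = (LINT p|lattice. autocorr \<theta> 0 (t + of_int_vec p) - autocorr \<theta> 0 (0 + of_int_vec p))"
          unfolding C_def by (rule Bochner_Integration.integral_diff[symmetric]) (rule ip)+
        also have "\<dots> = (LINT p|lattice. (LBINT z. \<theta> z * cnj (\<theta> (t + (of_int_vec p + z)) - \<theta> (of_int_vec p + z))))"
        proof (rule Bochner_Integration.integral_cong[OF refl])
          fix p :: "int ^ 'n"
          have "autocorr \<theta> 0 (t + of_int_vec p) - autocorr \<theta> 0 (0 + of_int_vec p)
            = (LBINT z. \<theta> z * cnj (\<theta> ((t + of_int_vec p) + z)) - \<theta> z * cnj (\<theta> (of_int_vec p + z)))"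
            using Bochner_Integration.integral_diff[OF iz[of "t + of_int_vec p"] iz[of "of_int_vec p"]]
            by (simp add: autocorr_def)
          then show "autocorr \<theta> 0 (t + of_int_vec p) - autocorr \<theta> 0 (0 + of_int_vec p)
            = (LBINT z. \<theta> z * cnj (\<theta> (t + (of_int_vec p + z)) - \<theta> (of_int_vec p + z)))"
            by (simp add: algebra_simps)
        qed
        finally show ?thesis .
      qed
      moreover have "norm (LINT p|lattice. (LBINT z. \<theta> z * cnj (\<theta> (t + (of_int_vec p + z)) - \<theta> (of_int_vec p + z)))) \<le> e / (A + 1) * A"
        by (rule lattice_norm_le(2)[OF norm_autocorr_diff_le[OF \<theta> _ n]]) (use i\<theta>t i\<theta> mult_nonneg_nonneg[OF less_imp_le[OF e] A] in auto)
      moreover have "e / (A + 1) * A \<le> e" using A \<open>e > 0\<close> by (simp add: divide_simps algebra_simps)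
      ultimately show ?thesis by simp
    qed
    then show ?thesis using \<delta>(1) by blast
  qed
  have "(LBINT t. indicator unit_cube t * (C t * lchar l t)) = complex_of_real (power_spec \<psi> (\<xi> + (2 * pi) *\<^sub>R of_int_vec l))" for l
  proof -
    have lc: "lchar l \<zeta> = cis (\<zeta> \<bullet> ((2 * pi) *\<^sub>R of_int_vec l))" for \<zeta> by (simp add: lchar_def inner_commute)
    have "integrable lborel (\<lambda>\<zeta>. autocorr \<theta> 0 \<zeta> * lchar l \<zeta>)"
      by (rule autocorr_Fubini(2)[OF i\<theta>, of _ 1]) auto
    from integral_unfold[OF this]
    have "(LBINT t. indicator unit_cube t * (C t * lchar l t)) = ctr (autocorr \<theta> 0) ((2 * pi) *\<^sub>R of_int_vec l)"
      by (simp add: C_def lchar_add ctr_def lc)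
    also have "\<dots> = complex_of_real (power_spec \<theta> ((2 * pi) *\<^sub>R of_int_vec l))" by (simp add: ctr_autocorr[OF i\<theta>])
    also have "power_spec \<theta> ((2 * pi) *\<^sub>R of_int_vec l) = power_spec \<psi> (\<xi> + (2 * pi) *\<^sub>R of_int_vec l)"
      by (simp add: power_spec_def ctr_def \<theta>_def cis_cnj cis_mult mult.assoc inner_add_right)
    finally show ?thesis .
  qed
  from has_sum_of_fejer[OF Cm K cont this]
  have "((\<lambda>l. power_spec \<psi> (\<xi> + (2 * pi) *\<^sub>R of_int_vec l)) has_sum Re (C 0)) UNIV"
    using power_spec_bound(1)[OF pbound_integrable(1)[OF \<psi>]] by blast
  also have "C 0 = (LINT p|lattice. (LBINT z. \<psi> z * cnj (\<psi> (of_int_vec p + z))) * cis (of_int_vec p \<bullet> \<xi>))"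
    unfolding C_def
  proof (rule Bochner_Integration.integral_cong[OF refl])
    fix p :: "int ^ 'n"
    have "\<theta> z * cnj (\<theta> (of_int_vec p + z)) = (\<psi> z * cnj (\<psi> (of_int_vec p + z))) * cis (of_int_vec p \<bullet> \<xi>)" for z
      by (simp add: \<theta>_def cis_cnj inner_add_left cis_mult[symmetric] algebra_simps)
        (simp add: cis_mult mult.assoc[symmetric])
    then show "autocorr \<theta> 0 (0 + of_int_vec p) = (LBINT z. \<psi> z * cnj (\<psi> (of_int_vec p + z))) * cis (of_int_vec p \<bullet> \<xi>)"
      by (simp add: autocorr_def)
  qed
  finally show ?thesis .
qed

subsection \<open>Limits of sampled products\<close>

text \<open>The lattice constant \<open>A\<close> and the L1 bound \<open>N\<close> of the kernel
  are kept apart on purpose. For a difference of translates \<open>A\<close> stays bounded while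
  \<open>N\<close> becomes small, which makes the samples equicontinuous uniformly over all
  \<open>w\<close> of bounded norm.\<close>

lemma lattice_filt_bound:
  fixes g w :: "real ^ 'n \<Rightarrow> complex"
  assumes g: "pbound g A" and N: "(LBINT x. norm (g x)) \<le> N"
    and w: "sq_int w" and W: "(LBINT x. (norm (w x))\<^sup>2) \<le> W"
  shows "(\<integral>\<^sup>+n. ennreal ((norm (filt g w (x + of_int_vec n)))\<^sup>2) \<partial>lattice) \<le> ennreal (A * W * N)"
proof -
  let ?k = "\<lambda>n z. ennreal ((norm (w z))\<^sup>2 * norm (g (z - x - of_int_vec n)))"
  have [measurable]: "g \<in> borel_measurable borel" by (rule pbound_measurable[OF g])
  have [measurable]: "w \<in> borel_measurable borel" using w by (simp add: sq_int_def)
  have A: "0 \<le> A" by (rule pbound_nonneg[OF g])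
  have W0: "0 \<le> W" by (rule order_trans[OF _ W]) simp
  have N0: "0 \<le> N" by (rule order_trans[OF _ N]) simp
  have gN: "(\<integral>\<^sup>+z. ennreal (norm (g z)) \<partial>lborel) \<le> ennreal N"
    using pbound_integrable(1)[OF g] N by (simp add: nn_integral_eq_integral ennreal_leI)
  have pt: "ennreal ((norm (filt g w (x + of_int_vec n)))\<^sup>2)
    \<le> (\<integral>\<^sup>+z. ?k n z \<partial>lborel) * ennreal N" for n :: "int ^ 'n"
  proof -
    have "ennreal ((norm (filt g w (x + of_int_vec n)))\<^sup>2)
      \<le> (\<integral>\<^sup>+z. ennreal ((norm (w ((x + of_int_vec n) + z)))\<^sup>2 * norm (cnj (g z))) \<partial>lborel) * (\<integral>\<^sup>+z. ennreal (norm (cnj (g z))) \<partial>lborel)"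
      unfolding filt_def by (rule norm_integral_Cauchy_Schwarz) measurable
    also have "\<dots> \<le> (\<integral>\<^sup>+z. ennreal ((norm (w ((x + of_int_vec n) + z)))\<^sup>2 * norm (cnj (g z))) \<partial>lborel) * ennreal N"
      using gN by (intro mult_left_mono) auto
    also have "(\<integral>\<^sup>+z. ennreal ((norm (w ((x + of_int_vec n) + z)))\<^sup>2 * norm (cnj (g z))) \<partial>lborel)
      = (\<integral>\<^sup>+z. ennreal ((norm (w ((x + of_int_vec n) + z)))\<^sup>2 * norm (g (((x + of_int_vec n) + z) - x - of_int_vec n))) \<partial>lborel)"
      by simp
    also have "\<dots> = (\<integral>\<^sup>+z. ?k n z \<partial>lborel)"
      by (rule nn_integral_lborel_translate) measurable
    finally show ?thesis .
  qed
  have m: "(\<lambda>(n, z). ?k n z) \<in> borel_measurable (lattice \<Otimes>\<^sub>M lborel)"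
    by measurable
  have "(\<integral>\<^sup>+n. ennreal ((norm (filt g w (x + of_int_vec n)))\<^sup>2) \<partial>lattice)
    \<le> (\<integral>\<^sup>+n. (\<integral>\<^sup>+z. ?k n z \<partial>lborel) * ennreal N \<partial>lattice)"
    by (rule nn_integral_mono) (rule pt)
  also have "\<dots> = (\<integral>\<^sup>+n. (\<integral>\<^sup>+z. ?k n z \<partial>lborel) \<partial>lattice) * ennreal N"
    by (rule nn_integral_multc) simp
  also have "(\<integral>\<^sup>+n. (\<integral>\<^sup>+z. ?k n z \<partial>lborel) \<partial>lattice)
    = (\<integral>\<^sup>+z. (\<integral>\<^sup>+n. ?k n z \<partial>lattice) \<partial>lborel)"
    by (rule LL.Fubini'[OF m, symmetric])
  also have "\<dots> = (\<integral>\<^sup>+z. ennreal ((norm (w z))\<^sup>2) * (\<integral>\<^sup>+n. ennreal (norm (g (z - x - of_int_vec n))) \<partial>lattice) \<partial>lborel)"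
    by (simp add: nn_integral_cmult ennreal_mult)
  also have "\<dots> * ennreal N \<le> (\<integral>\<^sup>+z. ennreal ((norm (w z))\<^sup>2) * ennreal A \<partial>lborel) * ennreal N"
    by (intro mult_right_mono nn_integral_mono mult_left_mono pbound_minus[OF g]) simp_all
  also have "\<dots> = (\<integral>\<^sup>+z. ennreal ((norm (w z))\<^sup>2) \<partial>lborel) * ennreal A * ennreal N"
    by (subst nn_integral_multc) simp_all
  also have "\<dots> = ennreal ((LBINT x. (norm (w x))\<^sup>2) * A * N)"
    using A N0 by (simp add: nn_integral_sq_eq[OF w] ennreal_mult)
  also have "\<dots> \<le> ennreal (A * W * N)"
    using W A N0 by (intro ennreal_leI mult_right_mono) (simp_all add: mult.commute mult_left_mono)
  finally show ?thesis .
qed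

lemma pbound_translate_diff:
  fixes \<phi> :: "real ^ 'n \<Rightarrow> complex"
  assumes \<phi>: "pbound \<phi> A"
  shows "pbound (\<lambda>x. \<phi> (x - t) - \<phi> x) (2 * A)"
proof -
  have [measurable]: "\<phi> \<in> borel_measurable borel" by (rule pbound_measurable[OF \<phi>])
  have A: "0 \<le> A" by (rule pbound_nonneg[OF \<phi>])
  have "(\<integral>\<^sup>+n. ennreal (norm (\<phi> (x - of_int_vec n - t) - \<phi> (x - of_int_vec n))) \<partial>lattice) \<le> ennreal (2 * A)" for x
  proof -
    have "(\<integral>\<^sup>+n. ennreal (norm (\<phi> (x - of_int_vec n - t) - \<phi> (x - of_int_vec n))) \<partial>lattice)
      \<le> (\<integral>\<^sup>+n. ennreal (norm (\<phi> ((x - t) - of_int_vec n))) + ennreal (norm (\<phi> (x - of_int_vec n))) \<partial>lattice)"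
    proof (rule nn_integral_mono)
      fix n :: "int ^ 'n"
      have "norm (\<phi> (x - of_int_vec n - t) - \<phi> (x - of_int_vec n)) \<le> norm (\<phi> ((x - t) - of_int_vec n)) + norm (\<phi> (x - of_int_vec n))"
        using norm_triangle_ineq4[of "\<phi> (x - of_int_vec n - t)" "\<phi> (x - of_int_vec n)"] by (simp add: algebra_simps)
      then show "ennreal (norm (\<phi> (x - of_int_vec n - t) - \<phi> (x - of_int_vec n)))
        \<le> ennreal (norm (\<phi> ((x - t) - of_int_vec n))) + ennreal (norm (\<phi> (x - of_int_vec n)))"
        by (simp add: ennreal_plus[symmetric] ennreal_leI del: ennreal_plus)
    qed
    also have "\<dots> = (\<integral>\<^sup>+n. ennreal (norm (\<phi> ((x - t) - of_int_vec n))) \<partial>lattice) + (\<integral>\<^sup>+n. ennreal (norm (\<phi> (x - of_int_vec n))) \<partial>lattice)"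
      by (rule nn_integral_add) simp_all
    also have "\<dots> \<le> ennreal A + ennreal A" by (intro add_mono pbound_minus[OF \<phi>])
    also have "\<dots> = ennreal (2 * A)" using A by (simp add: ennreal_plus[symmetric] del: ennreal_plus)
    finally show ?thesis .
  qed
  then show ?thesis using A unfolding pbound_def by simp
qed

text \<open>A shift of the output is a shift of the kernel, so the continuity of the samples is
  governed by \<phi> and the norm of \<open>w\<close>.\<close>

lemma filt_translate_diff:
  fixes \<phi> :: "real ^ 'n \<Rightarrow> complex"
  assumes \<phi>: "pbound \<phi> A" and w: "sq_int w"
  shows "filt \<phi> w (t + x) - filt \<phi> w x = filt (\<lambda>z. \<phi> (z - t) - \<phi> z) w x"
proof -
  have [measurable]: "\<phi> \<in> borel_measurable borel" by (rule pbound_measurable[OF \<phi>])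
  have [measurable]: "w \<in> borel_measurable borel" using w by (simp add: sq_int_def)
  have i: "integrable lborel (\<lambda>z. w (x + z) * cnj (\<phi> (z - t)))" for t
    using integrable_sq_int_mult[OF sq_int_translate[OF w, of x] sq_int_translate[OF pbound_sq_int[OF \<phi>], of "- t"], of "\<lambda>_. 1" 1]
    by (simp add: add.commute)
  have "filt \<phi> w (t + x) = (LBINT z. w (x + (t + z)) * cnj (\<phi> ((t + z) - t)))"
    by (simp add: filt_def algebra_simps)
  also have "\<dots> = (LBINT z. w (x + z) * cnj (\<phi> (z - t)))" by (rule integral_lborel_translate) measurable
  finally show ?thesis
    using Bochner_Integration.integral_diff[OF i[of t] i[of 0]] by (simp add: filt_def algebra_simps)
qed

lemma am_gm_eps: "(e::real) > 0 \<Longrightarrow> x * y \<le> (x\<^sup>2 / e + e * y\<^sup>2) / 2"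
proof -
  assume e: "e > 0"
  then have "0 \<le> (x - e * y)\<^sup>2 / e" by simp
  also have "\<dots> = x\<^sup>2 / e + e * y\<^sup>2 - 2 * (x * y)" using e by (simp add: power2_eq_square field_simps)
  finally show ?thesis by simp
qed

lemma sq_sum_real:
  fixes a :: "'i \<Rightarrow> complex"
  assumes "(\<integral>\<^sup>+n. ennreal ((norm (a n))\<^sup>2) \<partial>count_space UNIV) \<le> ennreal D" "0 \<le> D"
  shows "integrable (count_space UNIV) (\<lambda>n. (norm (a n))\<^sup>2)" "(\<integral>n. (norm (a n))\<^sup>2 \<partial>count_space UNIV) \<le> D"
proof -
  show i: "integrable (count_space UNIV) (\<lambda>n. (norm (a n))\<^sup>2)"
    by (rule integrableI_bounded) (use order_le_less_trans[OF assms(1) ennreal_less_top] in auto)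
  have "ennreal (\<integral>n. (norm (a n))\<^sup>2 \<partial>count_space UNIV) = (\<integral>\<^sup>+n. ennreal ((norm (a n))\<^sup>2) \<partial>count_space UNIV)"
    by (rule nn_integral_eq_integral[OF i, symmetric]) simp
  then show "(\<integral>n. (norm (a n))\<^sup>2 \<partial>count_space UNIV) \<le> D"
    using assms(1) by (intro ennreal_le_iff[OF assms(2), THEN iffD1]) simp
qed

lemma bilinear_bound:
  "norm (x * (a * cnj b) + y * (u * cnj b + c * cnj v)) \<le> norm x * (norm a * norm b) + norm y * (norm u * norm b + norm c * norm v)"
proof -
  have "norm (x * (a * cnj b) + y * (u * cnj b + c * cnj v)) \<le> norm (x * (a * cnj b)) + norm y * norm (u * cnj b + c * cnj v)"
    by (metis norm_mult norm_triangle_ineq)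
  also have "\<dots> \<le> norm (x * (a * cnj b)) + norm y * (norm (u * cnj b) + norm (c * cnj v))"
    by (intro add_left_mono mult_left_mono norm_triangle_ineq norm_ge_zero)
  finally show ?thesis by (simp add: norm_mult)
qed

text \<open>The mixed terms are estimated by AM-GM with weight \<open>e\<close>: a factor with
  square sum at most \<open>e\<^sup>2\<close> against one with square sum at most \<open>D\<close>
  contributes order \<open>e\<close>.\<close>

lemma lattice_product_diff:
  fixes F F' a a' b b' :: "'i \<Rightarrow> complex"
  assumes a: "(\<integral>\<^sup>+n. ennreal ((norm (a n))\<^sup>2) \<partial>count_space UNIV) \<le> ennreal D"
    and a': "(\<integral>\<^sup>+n. ennreal ((norm (a' n))\<^sup>2) \<partial>count_space UNIV) \<le> ennreal D"
    and b: "(\<integral>\<^sup>+n. ennreal ((norm (b n))\<^sup>2) \<partial>count_space UNIV) \<le> ennreal D"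
    and aa: "(\<integral>\<^sup>+n. ennreal ((norm (a n - a' n))\<^sup>2) \<partial>count_space UNIV) \<le> ennreal (e\<^sup>2)"
    and bb: "(\<integral>\<^sup>+n. ennreal ((norm (b n - b' n))\<^sup>2) \<partial>count_space UNIV) \<le> ennreal (e\<^sup>2)"
    and F: "\<And>n. norm (F n - F' n) \<le> \<omega>" "\<And>n. norm (F' n) \<le> K" and e: "e > 0" and D: "0 \<le> D"
  shows "(\<integral>\<^sup>+n. ennreal (norm (F n * a n * cnj (b n) - F' n * a' n * cnj (b' n))) \<partial>count_space UNIV)
    \<le> ennreal (\<omega> * D + K * (e * (1 + D)))"
proof -
  note A = sq_sum_real[OF a D] and A' = sq_sum_real[OF a' D] and B = sq_sum_real[OF b D]
    and AA = sq_sum_real[OF aa zero_le_power2] and BB = sq_sum_real[OF bb zero_le_power2]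
  have \<omega>: "0 \<le> \<omega>" using F(1)[of undefined] norm_ge_zero order_trans by blast
  have K: "0 \<le> K" using F(2)[of undefined] norm_ge_zero order_trans by blast
  define r where "r n = \<omega> / 2 * (norm (a n))\<^sup>2 + (\<omega> / 2 + K * e / 2) * (norm (b n))\<^sup>2 + K * e / 2 * (norm (a' n))\<^sup>2
    + K / (2 * e) * (norm (a n - a' n))\<^sup>2 + K / (2 * e) * (norm (b n - b' n))\<^sup>2" for n
  have pt: "norm (F n * a n * cnj (b n) - F' n * a' n * cnj (b' n)) \<le> r n" for n
  proof -
    have "norm (F n * a n * cnj (b n) - F' n * a' n * cnj (b' n))
      = norm ((F n - F' n) * (a n * cnj (b n)) + F' n * ((a n - a' n) * cnj (b n) + a' n * cnj (b n - b' n)))"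
      by (simp add: algebra_simps)
    also have "\<dots> \<le> norm (F n - F' n) * (norm (a n) * norm (b n)) + norm (F' n) * (norm (a n - a' n) * norm (b n) + norm (a' n) * norm (b n - b' n))"
      by (rule bilinear_bound)
    also have "\<dots> \<le> \<omega> * (((norm (a n))\<^sup>2 + (norm (b n))\<^sup>2) / 2)
      + K * (((norm (a n - a' n))\<^sup>2 / e + e * (norm (b n))\<^sup>2) / 2 + ((norm (b n - b' n))\<^sup>2 / e + e * (norm (a' n))\<^sup>2) / 2)"
      using am_gm_eps[OF e, of "norm (a n - a' n)" "norm (b n)"] am_gm_eps[OF e, of "norm (b n - b' n)" "norm (a' n)"]
      by (intro add_mono mult_mono F norm_mult_le_sq \<omega> K) (simp_all add: mult.commute)
    also have "\<dots> = r n" by (simp add: r_def field_simps)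
    finally show ?thesis .
  qed
  have r0: "0 \<le> r n" for n by (rule order_trans[OF norm_ge_zero pt])
  have ir: "integrable (count_space UNIV) r"
    unfolding r_def [abs_def] by (intro Bochner_Integration.integrable_add integrable_mult_right A B A' AA BB)
  have "(\<integral>\<^sup>+n. ennreal (norm (F n * a n * cnj (b n) - F' n * a' n * cnj (b' n))) \<partial>count_space UNIV) \<le> (\<integral>\<^sup>+n. ennreal (r n) \<partial>count_space UNIV)"
    by (intro nn_integral_mono ennreal_leI pt)
  also have "\<dots> = ennreal (\<integral>n. r n \<partial>count_space UNIV)" by (rule nn_integral_eq_integral[OF ir]) (simp add: r0)
  also have "(\<integral>n. r n \<partial>count_space UNIV) = \<omega> / 2 * (\<integral>n. (norm (a n))\<^sup>2 \<partial>count_space UNIV) + (\<omega> / 2 + K * e / 2) * (\<integral>n. (norm (b n))\<^sup>2 \<partial>count_space UNIV)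
      + K * e / 2 * (\<integral>n. (norm (a' n))\<^sup>2 \<partial>count_space UNIV)
      + K / (2 * e) * (\<integral>n. (norm (a n - a' n))\<^sup>2 \<partial>count_space UNIV) + K / (2 * e) * (\<integral>n. (norm (b n - b' n))\<^sup>2 \<partial>count_space UNIV)"
    unfolding r_def [abs_def] by (simp only: Bochner_Integration.integral_add Bochner_Integration.integrable_add integrable_mult_right A B A' AA BB integral_mult_right_zero)
  also have "ennreal \<dots> \<le> ennreal (\<omega> / 2 * D + (\<omega> / 2 + K * e / 2) * D + K * e / 2 * D + K / (2 * e) * e\<^sup>2 + K / (2 * e) * e\<^sup>2)"
    by (intro ennreal_leI add_mono mult_left_mono A B A' AA BB) (use \<omega> K e in auto)
  also have "\<omega> / 2 * D + (\<omega> / 2 + K * e / 2) * D + K * e / 2 * D + K / (2 * e) * e\<^sup>2 + K / (2 * e) * e\<^sup>2 = \<omega> * D + K * (e * (1 + D))"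
    using e by (simp add: field_simps power2_eq_square)
  finally show ?thesis .
qed

lemma lattice_product_norm:
  fixes F a b :: "'i \<Rightarrow> complex"
  assumes a: "(\<integral>\<^sup>+n. ennreal ((norm (a n))\<^sup>2) \<partial>count_space UNIV) \<le> ennreal D"
    and b: "(\<integral>\<^sup>+n. ennreal ((norm (b n))\<^sup>2) \<partial>count_space UNIV) \<le> ennreal D"
    and F: "\<And>n. norm (F n) \<le> \<omega>" and D: "0 \<le> D"
  shows "(\<integral>\<^sup>+n. ennreal (norm (F n * a n * cnj (b n))) \<partial>count_space UNIV) \<le> ennreal (\<omega> * D)"
  using lattice_product_diff[OF a a b, of 1 b F "\<lambda>_. 0" \<omega> 0] F D by simp

text \<open>The lattice sum is the value at \<open>t = 0\<close> of a lattice periodic function of \<open>t\<close>. Its mean converges by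
  \<open>filt_limit\<close>, its other Fourier coefficients tend to \<open>0\<close> by \<open>oscillation_vanishes\<close>, and equicontinuity at \<open>0\<close>,
  uniform in \<open>k\<close>, lets a Fejer kernel recover the value.\<close>

theorem sampled_limit:
  fixes w :: "nat \<Rightarrow> real ^ 'n \<Rightarrow> complex"
  assumes W: "wigner_seq w h \<mu> B" and \<phi>: "pbound \<phi> A" and f: "Cc f"
    and S: "\<And>l :: int ^ 'n. l \<noteq> 0 \<Longrightarrow> \<exists>S\<in>sets borel. (AE p in \<mu>. power_spec \<phi> (snd p) = 0 \<or> p \<in> S) \<and>
      (AE p in \<mu>. power_spec \<phi> (snd p) = 0 \<or> (fst p, snd p - (2 * pi) *\<^sub>R of_int_vec l) \<notin> S)"
  shows "(\<lambda>k. LINT n|lattice. f (h k *\<^sub>R of_int_vec n) * filt \<phi> (w k) (of_int_vec n) * cnj (filt \<phi> (w k) (of_int_vec n + of_int_vec p)))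
    \<longlonglongrightarrow> (LINT q|\<mu>. f (fst q) * (cis (- (of_int_vec p \<bullet> snd q)) * complex_of_real (power_spec \<phi> (snd q))))"
    (is "_ \<longlonglongrightarrow> ?L")
proof -
  interpret wigner_seq w h \<mu> B by (rule W)
  have [measurable]: "\<phi> \<in> borel_measurable borel" by (rule pbound_measurable[OF \<phi>])
  have [measurable]: "w k \<in> borel_measurable borel" for k using w[of k] by (simp add: sq_int_def)
  have [measurable]: "f \<in> borel_measurable borel" by (rule Cc_measurable[OF f])
  have i\<phi>: "integrable lborel \<phi>" by (rule pbound_integrable(1)[OF \<phi>])
  have A: "0 \<le> A" by (rule pbound_nonneg[OF \<phi>])
  obtain M where M: "M \<ge> 0" "\<And>x. norm (f x) \<le> M" using Cc_bounded[OF f] by blast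
  define D where "D = A * B * A"
  have D: "0 \<le> D" using A B_nonneg by (simp add: D_def)
  define V where "V k = filt \<phi> (w k)" for k
  define P :: "real ^ 'n" where "P = of_int_vec p"
  define R where "R k t = (LINT n|lattice. f (h k *\<^sub>R (t + of_int_vec n)) * V k (t + of_int_vec n) * cnj (V k (t + P + of_int_vec n)))" for k t
  define H where "H k l x = f (h k *\<^sub>R x) * V k x * cnj (V k (x + P)) * lchar l x" for k x and l :: "int ^ 'n"
  have [measurable]: "V k \<in> borel_measurable borel" for k unfolding V_def [abs_def] by measurable
  have Rm: "R k \<in> borel_measurable borel" for k
    unfolding R_def [abs_def] by (rule lattice.borel_measurable_lebesgue_integral) measurable
  have DB: "(\<integral>\<^sup>+n. ennreal ((norm (V k (x + of_int_vec n)))\<^sup>2) \<partial>lattice) \<le> ennreal D" for k x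
    unfolding V_def D_def by (rule lattice_filt_bound[OF \<phi> pbound_integrable(2)[OF \<phi>] w wB])
  have RK: "norm (R k t) \<le> M * D" for k t
    unfolding R_def by (rule lattice_norm_le(2)[OF lattice_product_norm[OF DB DB]]) (use M D in auto)
  have Ri: "integrable lattice (\<lambda>n. f (h k *\<^sub>R (t + of_int_vec n)) * V k (t + of_int_vec n) * cnj (V k (t + P + of_int_vec n)))" for k t
    by (rule lattice_norm_le(1)[OF lattice_product_norm[OF DB DB]]) (use M D in auto)
  have cont: "\<exists>\<delta>>0. \<forall>k t. norm t < \<delta> \<longrightarrow> norm (R k t - R k 0) \<le> e" if e0: "e > 0" for e
  proof -
    \<comment> \<open>The error is split in half: \<open>e1\<close> controls the change of the
      samples and \<omega> the change of the slow weight.\<close>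
    define e1 where "e1 = e / (2 * (M + 1) * (1 + D))"
    have e1: "e1 > 0" using e0 M D by (simp add: e1_def)
    have "M * (e1 * (1 + D)) \<le> (M + 1) * (e1 * (1 + D))" using e1 D by (intro mult_right_mono) auto
    also have "\<dots> = e1 * (2 * (M + 1) * (1 + D)) / 2" by (simp add: algebra_simps)
    also have "e1 * (2 * (M + 1) * (1 + D)) = e" using M D by (simp add: e1_def)
    finally have e1e: "M * (e1 * (1 + D)) \<le> e / 2" .
    define \<omega> where "\<omega> = e / (2 * (D + 1))"
    have \<omega>: "\<omega> > 0" "\<omega> * D \<le> e / 2" using e0 D by (simp_all add: \<omega>_def field_simps)
    \<comment> \<open>The L1 distance of the translated kernel at which
      \<open>lattice_filt_bound\<close>, with lattice constant \<open>2 * A\<close> for the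
      difference, yields at most \<open>e1\<^sup>2\<close>.\<close>
    define e2 where "e2 = e1\<^sup>2 / (2 * A * B + 1)"
    have e2: "e2 > 0" "2 * A * B * e2 \<le> e1\<^sup>2"
    proof -
      have "0 < 2 * A * B + 1" using A B_nonneg by (simp add: add_nonneg_pos)
      then show "e2 > 0" using e1 by (simp add: e2_def)
      have "2 * A * B * e2 \<le> (2 * A * B + 1) * e2" using \<open>e2 > 0\<close> by (intro mult_right_mono) auto
      also have "\<dots> = e1\<^sup>2" using \<open>0 < 2 * A * B + 1\<close> by (simp add: e2_def)
      finally show "2 * A * B * e2 \<le> e1\<^sup>2" .
    qed
    obtain \<delta>1 where \<delta>1: "\<delta>1 > 0" "\<forall>t. norm t < \<delta>1 \<longrightarrow> (LBINT x. norm (\<phi> (x - t) - \<phi> x)) < e2"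
      by (rule L1_translation_eps[OF i\<phi> e2(1)])
    obtain \<delta>2 where \<delta>2: "\<delta>2 > 0" "\<And>x y. norm (x - y) < \<delta>2 \<Longrightarrow> norm (f x - f y) < \<omega>"
      using Cc_uniform[OF f \<omega>(1)] by blast
    \<comment> \<open>A bound valid for every \<open>h k\<close>, not only for large
      \<open>k\<close>, keeps \<delta> independent of \<open>k\<close>.\<close>
    have "Bseq h" by (rule convergent_imp_Bseq[OF convergentI[OF h0]])
    then obtain H0 where H0: "H0 > 0" "\<And>k. norm (h k) \<le> H0" by (auto elim: BseqE)
    define \<delta> where "\<delta> = min \<delta>1 (\<delta>2 / H0)"
    have \<delta>: "\<delta> > 0" using \<delta>1 \<delta>2 H0 by (simp add: \<delta>_def)
    have "norm (R k t - R k 0) \<le> e" if t: "norm t < \<delta>" for k t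
    proof -
      have fo: "norm (f (h k *\<^sub>R (t + of_int_vec n)) - f (h k *\<^sub>R (0 + of_int_vec n))) \<le> \<omega>" for n :: "int ^ 'n"
      proof (rule less_imp_le, rule \<delta>2(2))
        have "norm (h k *\<^sub>R (t + of_int_vec n) - h k *\<^sub>R (0 + of_int_vec n)) = norm (h k) * norm t"
          by (simp add: scaleR_diff_right[symmetric])
        also have "\<dots> \<le> H0 * norm t" by (intro mult_right_mono H0) simp
        also have "\<dots> < H0 * (\<delta>2 / H0)" using t H0 by (intro mult_strict_left_mono) (auto simp: \<delta>_def)
        finally show "norm (h k *\<^sub>R (t + of_int_vec n) - h k *\<^sub>R (0 + of_int_vec n)) < \<delta>2" using H0 by simp
      qed
      have VV: "(\<integral>\<^sup>+n. ennreal ((norm (V k (t + x + of_int_vec n) - V k (x + of_int_vec n)))\<^sup>2) \<partial>lattice) \<le> ennreal (e1\<^sup>2)" for x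
      proof -
        have "(\<integral>\<^sup>+n. ennreal ((norm (filt (\<lambda>z. \<phi> (z - t) - \<phi> z) (w k) (x + of_int_vec n)))\<^sup>2) \<partial>lattice) \<le> ennreal ((2 * A) * B * e2)"
          by (rule lattice_filt_bound[OF pbound_translate_diff[OF \<phi>] _ w wB]) (use \<delta>1 t in \<open>auto simp: \<delta>_def less_imp_le\<close>)
        then show ?thesis
          using order_trans[OF _ ennreal_leI[OF e2(2)]]
          by (simp add: V_def filt_translate_diff[OF \<phi> w, symmetric] add.assoc)
      qed
      have eq: "R k t - R k 0 = (LINT n|lattice. f (h k *\<^sub>R (t + of_int_vec n)) * V k (t + of_int_vec n) * cnj (V k (t + P + of_int_vec n))
          - f (h k *\<^sub>R (0 + of_int_vec n)) * V k (0 + of_int_vec n) * cnj (V k (0 + P + of_int_vec n)))"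
        unfolding R_def by (rule Bochner_Integration.integral_diff[symmetric]) (rule Ri)+
      have "norm (R k t - R k 0) \<le> \<omega> * D + M * (e1 * (1 + D))"
        unfolding eq
      proof (rule lattice_norm_le(2)[OF lattice_product_diff[OF DB DB DB _ _ fo M(2) e1 D]])
        show "(\<integral>\<^sup>+n. ennreal ((norm (V k (t + of_int_vec n) - V k (0 + of_int_vec n)))\<^sup>2) \<partial>lattice) \<le> ennreal (e1\<^sup>2)"
          using VV[of 0] by simp
        show "(\<integral>\<^sup>+n. ennreal ((norm (V k (t + P + of_int_vec n) - V k (0 + P + of_int_vec n)))\<^sup>2) \<partial>lattice) \<le> ennreal (e1\<^sup>2)"
          using VV[of P] by simp
        show "0 \<le> \<omega> * D + M * (e1 * (1 + D))" using \<omega> e1 M D by simp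
      qed
      then show ?thesis using \<omega> e1e by linarith
    qed
    then show ?thesis using \<delta> by blast
  qed
  have Hi: "integrable lborel (H k l)" for k l
  proof -
    have "integrable lborel (\<lambda>x. (f (h k *\<^sub>R x) * lchar l x) * V k x * cnj (V k (x + P)))"
      unfolding V_def using sq_int_filt[OF i\<phi>, of k 0] sq_int_filt[OF i\<phi>, of k P]
      by (intro integrable_sq_int_mult[where K = M]) (auto simp: norm_mult M)
    then show ?thesis unfolding H_def [abs_def] by (simp add: mult_ac)
  qed
  have coeff: "(LBINT t. indicator unit_cube t * (R k t * lchar l t)) = (LBINT x. H k l x)" for k l
  proof -
    have "(LINT n|lattice. H k l (t + of_int_vec n)) = R k t * lchar l t" for t
      unfolding H_def R_def by (simp add: lchar_add ac_simps)
    then show ?thesis using integral_unfold[OF Hi[of k l]] by simp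
  qed
  have lim: "(\<lambda>k. LBINT x. H k l x) \<longlonglongrightarrow> (if l = 0 then ?L else 0)" for l
  proof (cases "l = 0")
    case True
    show ?thesis using filt_limit[OF i\<phi> f, of 0 P] True by (simp add: H_def V_def P_def)
  next
    case False
    then obtain S where S: "S \<in> sets borel" "AE p in \<mu>. power_spec \<phi> (snd p) = 0 \<or> p \<in> S"
      "AE p in \<mu>. power_spec \<phi> (snd p) = 0 \<or> (fst p, snd p - (2 * pi) *\<^sub>R of_int_vec l) \<notin> S" using S by blast
    from oscillation_vanishes[OF i\<phi> f S, of P] have "(\<lambda>k. LBINT x. H k l x) \<longlonglongrightarrow> 0"
      by (simp add: H_def V_def lchar_def mult_ac)
    then show ?thesis using False by simp
  qed
  have "(\<lambda>k. R k 0) \<longlonglongrightarrow> ?L"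
  proof (rule tendsto_approx)
    fix e :: real assume e: "e > 0"
    obtain \<delta> where \<delta>: "\<delta> > 0" "\<forall>k t. norm t < \<delta> \<longrightarrow> norm (R k t - R k 0) \<le> e / 2" using cont[of "e / 2"] e by auto
    define \<eta> where "\<eta> = e / (4 * (M * D + 1))"
    have "0 \<le> M * D" using M D by simp
    then have \<eta>: "\<eta> > 0" "2 * (M * D) * \<eta> \<le> e / 2"
      using e by (simp_all add: \<eta>_def field_simps)
    obtain m v and l :: "nat \<Rightarrow> int ^ 'n" where fd: "fejer_data \<delta> \<eta> m v l" by (rule fejer_approx[OF \<delta>(1) \<eta>(1)])
    define a where "a k = (\<Sum>j<m. complex_of_real (v j) * (LBINT x. H k (l j) x))" for k
    \<comment> \<open>Only the frequency 0 contributes to the limit, and its total weight is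
      1.\<close>
    have "a \<longlonglongrightarrow> (\<Sum>j<m. complex_of_real (v j) * (if l j = 0 then ?L else 0))"
      unfolding a_def [abs_def] by (intro tendsto_sum tendsto_mult_left lim)
    also have "(\<Sum>j<m. complex_of_real (v j) * (if l j = 0 then ?L else 0)) = complex_of_real (\<Sum>j<m. if l j = 0 then v j else 0) * ?L"
      unfolding of_real_sum sum_distrib_right by (intro sum.cong refl) auto
    finally have lim_a: "a \<longlonglongrightarrow> ?L" by (simp only: fejer_dataD(2)[OF fd]) simp
    have "norm (a k - R k 0) \<le> e" for k
    proof -
      have "norm ((\<Sum>j<m. complex_of_real (v j) * (LBINT t. indicator unit_cube t * (R k t * lchar (l j) t))) - R k 0) \<le> e / 2 + 2 * (M * D) * \<eta>"
        by (rule fejer_dataD(4)[OF fd Rm RK]) (use \<delta> e in auto)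
      then show ?thesis using \<eta> unfolding a_def coeff by linarith
    qed
    then show "\<exists>a b. a \<longlonglongrightarrow> b \<and> (\<forall>k. norm (a k - R k 0) \<le> e) \<and> norm (b - ?L) \<le> e"
      using lim_a e by (intro exI[of _ a] exI[of _ ?L]) simp
  qed
  then show ?thesis by (simp add: R_def V_def P_def add.commute)
qed

subsection \<open>The limit of the reconstructions\<close>

text \<open>Up to a constant it bounds the contribution of the lag \<open>p\<close> to the squared
  reconstruction. Being summable over the lattice, it dominates the passage to the limit under the
  sum over lags.\<close>

definition lag_mass :: "(real ^ 'n \<Rightarrow> complex) \<Rightarrow> int ^ 'n \<Rightarrow> real" where
  "lag_mass \<psi> p = (LBINT x. norm (\<psi> x) * norm (\<psi> (x - of_int_vec p)))"

lemma lag_mass_nonneg: "0 \<le> lag_mass \<psi> p"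
  by (simp add: lag_mass_def)

lemma lag_mass_integrable:
  fixes \<psi> :: "real ^ 'n \<Rightarrow> complex"
  assumes "pbound \<psi> A"
  shows "integrable lborel (\<lambda>x. norm (\<psi> x) * norm (\<psi> (x - of_int_vec p)))"
  using sq_int_prod_integrable(4)[OF pbound_sq_int[OF assms] sq_int_translate[OF pbound_sq_int[OF assms], of "- of_int_vec p"], of "\<lambda>_. 1" 1]
  by simp

lemma nn_integral_lag_mass:
  fixes \<psi> :: "real ^ 'n \<Rightarrow> complex"
  assumes "pbound \<psi> A"
  shows "(\<integral>\<^sup>+x. ennreal (norm (\<psi> x) * norm (\<psi> (x - of_int_vec p))) \<partial>lborel) = ennreal (lag_mass \<psi> p)"
  unfolding lag_mass_def by (rule nn_integral_eq_integral[OF lag_mass_integrable[OF assms]]) simp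

lemma lag_mass_sum:
  fixes \<psi> :: "real ^ 'n \<Rightarrow> complex"
  assumes \<psi>: "pbound \<psi> A"
  shows "(\<integral>\<^sup>+p. ennreal (lag_mass \<psi> p) \<partial>lattice) \<le> ennreal (A * A)" and "integrable lattice (lag_mass \<psi>)"
proof -
  have [measurable]: "\<psi> \<in> borel_measurable borel" by (rule pbound_measurable[OF \<psi>])
  have A: "0 \<le> A" by (rule pbound_nonneg[OF \<psi>])
  have "(\<integral>\<^sup>+p. ennreal (lag_mass \<psi> p) \<partial>lattice) = (\<integral>\<^sup>+p. ennreal (lag_mass \<psi> (- p)) \<partial>lattice)"
    by (rule nn_integral_lattice_uminus[symmetric])
  also have "\<dots> = (\<integral>\<^sup>+p. (\<integral>\<^sup>+x. ennreal (norm (\<psi> x) * norm (\<psi> (0 + x + of_int_vec p))) \<partial>lborel) \<partial>lattice)"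
    by (simp add: nn_integral_lag_mass[OF \<psi>, symmetric])
  also have "\<dots> \<le> (\<integral>\<^sup>+x. ennreal (norm (\<psi> x)) \<partial>lborel) * ennreal A"
    by (rule lattice_correlation_bound[OF \<psi>]) measurable
  also have "\<dots> = ennreal ((LBINT x. norm (\<psi> x)) * A)"
    using pbound_integrable(1)[OF \<psi>] A by (simp add: nn_integral_eq_integral ennreal_mult)
  also have "\<dots> \<le> ennreal (A * A)" using pbound_integrable(2)[OF \<psi>] A by (intro ennreal_leI mult_right_mono)
  finally show le: "(\<integral>\<^sup>+p. ennreal (lag_mass \<psi> p) \<partial>lattice) \<le> ennreal (A * A)" .
  show "integrable lattice (lag_mass \<psi>)"
    by (rule integrableI_nonneg) (use order_le_less_trans[OF le ennreal_less_top] lag_mass_nonneg in auto)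
qed

text \<open>Square summable coefficients are bounded, and a bounded sequence against the translates
  of \<psi> is controlled by the lattice sums of \<psi>.\<close>

lemma synthesis_bound:
  fixes \<psi> :: "real ^ 'n \<Rightarrow> complex" and W :: "int ^ 'n \<Rightarrow> complex"
  assumes \<psi>: "pbound \<psi> A" and D0: "0 \<le> D" and W: "(\<integral>\<^sup>+n. ennreal ((norm (W n))\<^sup>2) \<partial>lattice) \<le> ennreal D"
  shows "(\<integral>\<^sup>+n. ennreal (norm (W n * \<psi> (x - of_int_vec n))) \<partial>lattice) \<le> ennreal (sqrt D * A)"
proof -
  have A: "0 \<le> A" by (rule pbound_nonneg[OF \<psi>])
  have Wb: "norm (W n) \<le> sqrt D" for n
  proof -
    have "ennreal ((norm (W n))\<^sup>2) \<le> ennreal D"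
      by (rule order_trans[OF nn_integral_ge_point W]) simp
    then show ?thesis using D0 by (simp add: real_le_rsqrt)
  qed
  have "(\<integral>\<^sup>+n. ennreal (norm (W n * \<psi> (x - of_int_vec n))) \<partial>lattice) \<le> (\<integral>\<^sup>+n. ennreal (sqrt D) * ennreal (norm (\<psi> (x - of_int_vec n))) \<partial>lattice)"
    by (intro nn_integral_mono) (simp add: norm_mult ennreal_mult[symmetric] D0 ennreal_leI mult_right_mono Wb)
  also have "\<dots> \<le> ennreal (sqrt D) * ennreal A"
    by (subst nn_integral_cmult) (auto intro: mult_left_mono pbound_minus[OF \<psi>])
  finally show ?thesis using A D0 by (simp add: ennreal_mult)
qed

text \<open>The double sum is reindexed by the lag \<open>p\<close> between the two lattice points,
  and translating the integration variable to the first of them isolates a correlation of \<psi>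
  with its translate, weighted by \<open>F\<close>. In this order each term has an accessible limit
  and the terms have a summable majorant.\<close>

lemma quadratic_expansion:
  fixes \<psi> F :: "real ^ 'n \<Rightarrow> complex" and W :: "int ^ 'n \<Rightarrow> complex"
  assumes \<psi>: "pbound \<psi> A" and D0: "0 \<le> D" and W: "(\<integral>\<^sup>+n. ennreal ((norm (W n))\<^sup>2) \<partial>lattice) \<le> ennreal D"
    and F [measurable]: "F \<in> borel_measurable borel" and M: "\<And>x. norm (F x) \<le> M"
  defines "q p \<equiv> (LINT n|lattice. W n * cnj (W (n + p)) * (LBINT x. F (of_int_vec n + x) * (\<psi> x * cnj (\<psi> (x - of_int_vec p)))))"
  shows "(LBINT x. F x * complex_of_real ((norm (LINT n|lattice. W n * \<psi> (x - of_int_vec n)))\<^sup>2)) = (LINT p|lattice. q p)"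
    and "norm (q p) \<le> M * D * lag_mass \<psi> p"
proof -
  have [measurable]: "\<psi> \<in> borel_measurable borel" by (rule pbound_measurable[OF \<psi>])
  have A: "0 \<le> A" by (rule pbound_nonneg[OF \<psi>])
  have M0: "0 \<le> M" using M[of 0] norm_ge_zero order_trans by blast
  define T where "T n p x = W n * cnj (W (n + p)) * (\<psi> (x - of_int_vec n) * cnj (\<psi> (x - of_int_vec n - of_int_vec p)))" for n p x
  let ?Z = "\<lambda>p x. LINT n|lattice. T n p x"
  let ?w = "\<lambda>n p x. norm (\<psi> (x - of_int_vec n)) * norm (\<psi> (x - of_int_vec n - of_int_vec p))"
  let ?m = "\<lambda>n p. norm (complex_of_real M * W n * cnj (W (n + p)))"
  let ?t = "\<lambda>n p x. ennreal (norm (F x * T n p x))"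
  have W': "(\<integral>\<^sup>+n. ennreal ((norm (W (n + p)))\<^sup>2) \<partial>lattice) \<le> ennreal D" for p
    using W nn_integral_lattice_add[of "\<lambda>n. ennreal ((norm (W n))\<^sup>2)" p] by simp
  note Y = synthesis_bound[OF \<psi> D0 W]
  have sA: "0 \<le> sqrt D * A" using A D0 by simp
  have sq: "complex_of_real ((norm (LINT n|lattice. W n * \<psi> (x - of_int_vec n)))\<^sup>2) = (LINT p|lattice. (?Z p x))" for x
  proof -
    define y where "y n = W n * \<psi> (x - of_int_vec n)" for n
    have iy: "integrable lattice y" unfolding y_def [abs_def] by (rule lattice_norm_le(1)[OF Y sA])
    have yT: "y n * cnj (y (p + n)) = T n p x" for n p
      by (simp add: y_def T_def ac_simps diff_diff_eq)
    have "(\<integral>\<^sup>+n. (\<integral>\<^sup>+p. ennreal (norm (T n p x)) \<partial>lattice) \<partial>lattice) \<le> (\<integral>\<^sup>+n. ennreal (norm (y n)) * ennreal (sqrt D * A) \<partial>lattice)"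
    proof (rule nn_integral_mono)
      fix n
      have "(\<integral>\<^sup>+p. ennreal (norm (T n p x)) \<partial>lattice) = (\<integral>\<^sup>+p. ennreal (norm (y n)) * ennreal (norm (y (p + n))) \<partial>lattice)"
        by (simp add: yT[symmetric] norm_mult ennreal_mult)
      also have "\<dots> = ennreal (norm (y n)) * (\<integral>\<^sup>+p. ennreal (norm (y p)) \<partial>lattice)"
        by (simp add: nn_integral_cmult nn_integral_lattice_add[of "\<lambda>p. ennreal (norm (y p))" n])
      also have "\<dots> \<le> ennreal (norm (y n)) * ennreal (sqrt D * A)"
        unfolding y_def by (intro mult_left_mono Y) simp
      finally show "(\<integral>\<^sup>+p. ennreal (norm (T n p x)) \<partial>lattice) \<le> ennreal (norm (y n)) * ennreal (sqrt D * A)" .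
    qed
    also have "\<dots> = (\<integral>\<^sup>+n. ennreal (norm (y n)) \<partial>lattice) * ennreal (sqrt D * A)" by (rule nn_integral_multc) simp
    also have "\<dots> \<le> ennreal (sqrt D * A) * ennreal (sqrt D * A)"
      unfolding y_def by (intro mult_right_mono Y) simp
    also have "\<dots> < \<infinity>" by (simp add: ennreal_mult_less_top)
    finally have fin: "(\<integral>\<^sup>+n. (\<integral>\<^sup>+p. ennreal (norm (T n p x)) \<partial>lattice) \<partial>lattice) < \<infinity>" .
    \<comment> \<open>Summing over all lags from \<open>n\<close> runs through the whole lattice, so
      the inner sum does not depend on \<open>n\<close>.\<close>
    have cy: "(LINT p|lattice. cnj (y (p + n))) = cnj (LINT n|lattice. y n)" for n
      using integral_lattice_add[of "\<lambda>n. cnj (y n)" n] by simp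
    have "complex_of_real ((norm (LINT n|lattice. y n))\<^sup>2) = (LINT n|lattice. y n) * cnj (LINT n|lattice. y n)"
      by (rule complex_norm_square)
    also have "\<dots> = (LINT n|lattice. y n * cnj (LINT n|lattice. y n))" by (rule integral_mult_left_zero[symmetric])
    also have "\<dots> = (LINT n|lattice. (LINT p|lattice. T n p x))"
      by (simp only: yT[symmetric] integral_mult_right_zero cy)
    also have "\<dots> = (LINT p|lattice. (?Z p x))"
      by (rule LL2.Fubini_swap(4)[OF _ fin]) measurable
    finally show ?thesis by (simp add: y_def)
  qed
  have bx: "(\<integral>\<^sup>+x. ?t n p x \<partial>lborel) \<le> ennreal (?m n p) * ennreal (lag_mass \<psi> p)" for n p
  proof -
    have "(\<integral>\<^sup>+x. ?t n p x \<partial>lborel)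
      \<le> (\<integral>\<^sup>+x. ennreal (?m n p) * ennreal (?w n p x) \<partial>lborel)"
    proof (intro nn_integral_mono)
      fix x
      have "norm (F x) * (norm (W n) * norm (W (n + p)) * (?w n p x))
        \<le> M * (norm (W n) * norm (W (n + p)) * (?w n p x))"
        by (intro mult_right_mono M mult_nonneg_nonneg norm_ge_zero)
      then show "?t n p x \<le> ennreal (?m n p) * ennreal (?w n p x)"
        using M0 by (simp add: ennreal_mult[symmetric] T_def norm_mult mult.assoc)
    qed
    also have "\<dots> = ennreal (?m n p) * (\<integral>\<^sup>+x. ennreal (?w n p x) \<partial>lborel)"
      by (rule nn_integral_cmult) measurable
    also have "(\<integral>\<^sup>+x. ennreal (?w n p x) \<partial>lborel) = ennreal (lag_mass \<psi> p)"
      using nn_integral_lborel_translate[of "\<lambda>x. ennreal (norm (\<psi> x) * norm (\<psi> (x - of_int_vec p)))" "- of_int_vec n"]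
      by (simp add: nn_integral_lag_mass[OF \<psi>])
    finally show ?thesis .
  qed
  have bp: "(\<integral>\<^sup>+n. (\<integral>\<^sup>+x. ?t n p x \<partial>lborel) \<partial>lattice) \<le> ennreal (M * D * lag_mass \<psi> p)" for p
  proof -
    have "(\<integral>\<^sup>+n. (\<integral>\<^sup>+x. ?t n p x \<partial>lborel) \<partial>lattice)
      \<le> (\<integral>\<^sup>+n. ennreal (?m n p) * ennreal (lag_mass \<psi> p) \<partial>lattice)"
      by (intro nn_integral_mono bx)
    also have "\<dots> = (\<integral>\<^sup>+n. ennreal (?m n p) \<partial>lattice) * ennreal (lag_mass \<psi> p)"
      by (rule nn_integral_multc) simp
    also have "\<dots> \<le> ennreal (M * D) * ennreal (lag_mass \<psi> p)"
      by (intro mult_right_mono lattice_product_norm[OF W W']) (use M0 D0 in auto)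
    finally show ?thesis by (simp only: ennreal_mult[OF mult_nonneg_nonneg[OF M0 D0] lag_mass_nonneg])
  qed
  have Tm: "(\<lambda>(n, x). F x * T n p x) \<in> borel_measurable (lattice \<Otimes>\<^sub>M lborel)" for p
    unfolding T_def by measurable
  have swap_nx: "(\<integral>\<^sup>+n. (\<integral>\<^sup>+x. ?t n p x \<partial>lborel) \<partial>lattice) = (\<integral>\<^sup>+x. (\<integral>\<^sup>+n. ?t n p x \<partial>lattice) \<partial>lborel)" for p
    unfolding T_def by (rule LL.Fubini'[symmetric]) measurable
  have q: "(LBINT x. F x * (?Z p x)) = q p" for p
  proof -
    have "(LBINT x. F x * (?Z p x)) = (LBINT x. (LINT n|lattice. F x * T n p x))"
      by (simp only: integral_mult_right_zero)
    also have "\<dots> = (LINT n|lattice. (LBINT x. F x * T n p x))"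
      by (rule LL.Fubini_swap(4)[OF Tm, symmetric]) (use order_le_less_trans[OF bp ennreal_less_top] in simp)
    also have "\<dots> = q p"
      unfolding q_def
    proof (rule Bochner_Integration.integral_cong[OF refl])
      fix n
      have "(LBINT x. F x * T n p x) = (LBINT x. W n * cnj (W (n + p)) * (F (of_int_vec n + (x - of_int_vec n)) * (\<psi> (x - of_int_vec n) * cnj (\<psi> (x - of_int_vec n - of_int_vec p)))))"
        by (simp add: T_def mult_ac)
      also have "\<dots> = (LBINT x. W n * cnj (W (n + p)) * (F (of_int_vec n + x) * (\<psi> x * cnj (\<psi> (x - of_int_vec p)))))"
        by (rule integral_lborel_translate_minus) measurable
      finally show "(LBINT x. F x * T n p x) = W n * cnj (W (n + p)) * (LBINT x. F (of_int_vec n + x) * (\<psi> x * cnj (\<psi> (x - of_int_vec p))))"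
        by (simp only: integral_mult_right_zero)
    qed
    finally show ?thesis .
  qed
  have nx: "(\<integral>\<^sup>+x. ennreal (norm (F x * (?Z p x))) \<partial>lborel) \<le> ennreal (M * D * lag_mass \<psi> p)" for p
  proof -
    have "ennreal (norm (F x * (?Z p x))) \<le> (\<integral>\<^sup>+n. ?t n p x \<partial>lattice)" for x
    proof (cases "integrable lattice (\<lambda>n. T n p x)")
      case True
      have "ennreal (norm (LINT n|lattice. F x * T n p x)) \<le> (\<integral>\<^sup>+n. ?t n p x \<partial>lattice)"
        by (rule integral_norm_bound_ennreal) (use True in simp)
      then show ?thesis by (simp only: integral_mult_right_zero)
    qed (simp add: not_integrable_integral_eq)
    then have "(\<integral>\<^sup>+x. ennreal (norm (F x * (?Z p x))) \<partial>lborel) \<le> (\<integral>\<^sup>+x. (\<integral>\<^sup>+n. ?t n p x \<partial>lattice) \<partial>lborel)"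
      by (intro nn_integral_mono)
    also note swap_nx[symmetric]
    also note bp
    finally show ?thesis .
  qed
  have sm: "(\<lambda>(p, x). F x * (?Z p x)) \<in> borel_measurable (lattice \<Otimes>\<^sub>M lborel)"
    unfolding case_prod_beta T_def
    by (intro borel_measurable_times lattice.borel_measurable_lebesgue_integral) measurable
  have "(\<integral>\<^sup>+p. (\<integral>\<^sup>+x. ennreal (norm (F x * (?Z p x))) \<partial>lborel) \<partial>lattice) \<le> (\<integral>\<^sup>+p. ennreal (M * D) * ennreal (lag_mass \<psi> p) \<partial>lattice)"
    using nx by (intro nn_integral_mono) (simp only: ennreal_mult[OF mult_nonneg_nonneg[OF M0 D0] lag_mass_nonneg])
  also have "\<dots> = ennreal (M * D) * (\<integral>\<^sup>+p. ennreal (lag_mass \<psi> p) \<partial>lattice)" by (rule nn_integral_cmult) simp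
  also have "\<dots> \<le> ennreal (M * D) * ennreal (A * A)" by (intro mult_left_mono lag_mass_sum(1)[OF \<psi>]) simp
  also have "\<dots> < \<infinity>" by (simp add: ennreal_mult_less_top)
  finally have fin: "(\<integral>\<^sup>+p. (\<integral>\<^sup>+x. ennreal (norm (F x * (?Z p x))) \<partial>lborel) \<partial>lattice) < \<infinity>" .
  have "(LBINT x. F x * (LINT p|lattice. (?Z p x))) = (LBINT x. (LINT p|lattice. F x * (?Z p x)))"
    by (simp only: integral_mult_right_zero)
  also have "\<dots> = (LINT p|lattice. (LBINT x. F x * (?Z p x)))"
    by (rule LL.Fubini_swap(4)[OF sm fin, symmetric])
  finally show "(LBINT x. F x * complex_of_real ((norm (LINT n|lattice. W n * \<psi> (x - of_int_vec n)))\<^sup>2)) = (LINT p|lattice. q p)"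
    by (simp only: sq q)
  have "ennreal (norm (LBINT x. F x * (?Z p x))) \<le> (\<integral>\<^sup>+x. ennreal (norm (F x * (?Z p x))) \<partial>lborel)"
  proof (cases "integrable lborel (\<lambda>x. F x * (?Z p x))")
    case True then show ?thesis by (rule integral_norm_bound_ennreal)
  qed (simp add: not_integrable_integral_eq)
  also note nx
  finally show "norm (q p) \<le> M * D * lag_mass \<psi> p"
    using M0 D0 lag_mass_nonneg[of \<psi> p] by (simp add: q ennreal_le_iff)
qed

text \<open>Reversing the lag conjugates the lag coefficients of \<psi>. The lattice sum is
  therefore real, which removes the real part from the summation formula.\<close>

lemma periodized_power_spec_infsum:
  fixes \<psi> :: "real ^ 'n \<Rightarrow> complex"
  assumes \<psi>: "pbound \<psi> A"
  shows "(\<lambda>l :: int ^ 'n. power_spec \<psi> (\<xi> + (2 * pi) *\<^sub>R of_int_vec l)) summable_on UNIV"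
    and "(LINT p|lattice. (LBINT x. \<psi> x * cnj (\<psi> (x - of_int_vec p))) * cis (- (of_int_vec p \<bullet> \<xi>)))
      = complex_of_real (\<Sum>\<^sub>\<infinity>l :: int ^ 'n. power_spec \<psi> (\<xi> + (2 * pi) *\<^sub>R of_int_vec l))"
proof -
  have [measurable]: "\<psi> \<in> borel_measurable borel" by (rule pbound_measurable[OF \<psi>])
  define G where "G p = (LBINT z. \<psi> z * cnj (\<psi> (of_int_vec p + z)))" for p :: "int ^ 'n"
  define c where "c = (LINT p|lattice. G p * cis (of_int_vec p \<bullet> \<xi>))"
  have hs: "((\<lambda>l. power_spec \<psi> (\<xi> + (2 * pi) *\<^sub>R of_int_vec l)) has_sum Re c) UNIV"
    unfolding c_def G_def by (rule periodized_power_spec[OF \<psi>])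
  then show "(\<lambda>l :: int ^ 'n. power_spec \<psi> (\<xi> + (2 * pi) *\<^sub>R of_int_vec l)) summable_on UNIV"
    by (rule has_sum_imp_summable)
  have Gc: "cnj (G p) = G (- p)" for p
  proof -
    have "cnj (G p) = (LBINT z. cnj (\<psi> z) * \<psi> (of_int_vec p + z))"
      unfolding G_def by (subst Bochner_Integration.integral_cnj[symmetric]) simp
    also have "\<dots> = (LBINT z. cnj (\<psi> (- of_int_vec p + z)) * \<psi> (of_int_vec p + (- of_int_vec p + z)))"
      by (rule integral_lborel_translate[symmetric]) measurable
    finally show ?thesis by (simp add: G_def mult.commute)
  qed
  have "cnj c = (LINT p|lattice. cnj (G p * cis (of_int_vec p \<bullet> \<xi>)))"
    unfolding c_def by (rule Bochner_Integration.integral_cnj[symmetric])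
  also have "\<dots> = (LINT p|lattice. G (- p) * cis (of_int_vec (- p) \<bullet> \<xi>))" by (simp add: Gc cis_cnj)
  also have "\<dots> = c" unfolding c_def by (rule integral_lattice_uminus)
  finally have "Im c = 0" by (simp add: complex_eq_iff)
  then have cr: "c = complex_of_real (Re c)" by (simp add: complex_eq_iff)
  have "(LINT p|lattice. (LBINT x. \<psi> x * cnj (\<psi> (x - of_int_vec p))) * cis (- (of_int_vec p \<bullet> \<xi>)))
    = (LINT p|lattice. G (- p) * cis (of_int_vec (- p) \<bullet> \<xi>))"
    by (simp add: G_def)
  also have "\<dots> = c" unfolding c_def by (rule integral_lattice_uminus)
  finally show "(LINT p|lattice. (LBINT x. \<psi> x * cnj (\<psi> (x - of_int_vec p))) * cis (- (of_int_vec p \<bullet> \<xi>)))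
      = complex_of_real (\<Sum>\<^sub>\<infinity>l :: int ^ 'n. power_spec \<psi> (\<xi> + (2 * pi) *\<^sub>R of_int_vec l))"
    using cr infsumI[OF hs] by simp
qed

lemma norm_lag_le:
  fixes \<psi> g :: "real ^ 'n \<Rightarrow> complex"
  assumes \<psi>: "pbound \<psi> A" and [measurable]: "g \<in> borel_measurable borel" and g: "\<And>x. norm (g x) \<le> K"
  shows "integrable lborel (\<lambda>x. g x * (\<psi> x * cnj (\<psi> (x - of_int_vec p))))"
    and "norm (LBINT x. g x * (\<psi> x * cnj (\<psi> (x - of_int_vec p)))) \<le> (LBINT x. norm (g x) * (norm (\<psi> x) * norm (\<psi> (x - of_int_vec p))))"
    and "(LBINT x. norm (g x) * (norm (\<psi> x) * norm (\<psi> (x - of_int_vec p)))) \<le> K * lag_mass \<psi> p"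
proof -
  let ?w = "\<lambda>x. norm (\<psi> x) * norm (\<psi> (x - of_int_vec p))"
  have [measurable]: "\<psi> \<in> borel_measurable borel" by (rule pbound_measurable[OF \<psi>])
  have K: "0 \<le> K" using g[of 0] norm_ge_zero order_trans by blast
  have iK: "integrable lborel (\<lambda>x. K * (?w x))"
    by (rule integrable_mult_right[OF lag_mass_integrable[OF \<psi>]])
  have le: "norm (g x) * (?w x) \<le> K * (?w x)" for x
    by (intro mult_right_mono g) simp
  have i: "integrable lborel (\<lambda>x. norm (g x) * (?w x))"
    by (rule Bochner_Integration.integrable_bound[OF iK]) (use le K in \<open>auto intro!: AE_I2\<close>)
  show "integrable lborel (\<lambda>x. g x * (\<psi> x * cnj (\<psi> (x - of_int_vec p))))"
    by (rule Bochner_Integration.integrable_bound[OF i]) (auto simp: norm_mult)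
  show "norm (LBINT x. g x * (\<psi> x * cnj (\<psi> (x - of_int_vec p)))) \<le> (LBINT x. norm (g x) * (?w x))"
    using integral_norm_bound[of lborel "\<lambda>x. g x * (\<psi> x * cnj (\<psi> (x - of_int_vec p)))"] by (simp add: norm_mult)
  have "(LBINT x. norm (g x) * (?w x)) \<le> (LBINT x. K * (?w x))"
    by (rule integral_mono[OF i iK le])
  then show "(LBINT x. norm (g x) * (?w x)) \<le> K * lag_mass \<psi> p"
    by (simp add: lag_mass_def)
qed

text \<open>The cutoff leaves only the part of an integrable function beyond distance of order
  \<open>\<delta> / h k\<close>.\<close>

lemma lag_tail:
  fixes \<psi> :: "real ^ 'n \<Rightarrow> complex"
  assumes \<psi>: "pbound \<psi> A" and h: "h \<longlonglongrightarrow> 0" and \<delta>: "\<delta> > 0"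
  shows "(\<lambda>k. LBINT x. indicator {x. \<delta> \<le> norm (h k *\<^sub>R x)} x * (norm (\<psi> x) * norm (\<psi> (x - of_int_vec p)))) \<longlonglongrightarrow> 0"
proof -
  let ?w = "\<lambda>x. norm (\<psi> x) * norm (\<psi> (x - of_int_vec p))"
  have [measurable]: "\<psi> \<in> borel_measurable borel" by (rule pbound_measurable[OF \<psi>])
  have "(\<lambda>k. LBINT x. indicator {x. \<delta> \<le> norm (h k *\<^sub>R x)} x * (?w x)) \<longlonglongrightarrow> (\<integral>x. 0 \<partial>(lborel :: (real ^ 'n) measure))"
  proof (rule integral_dominated_convergence[where w = "\<lambda>x. norm (\<psi> x) * norm (\<psi> (x - of_int_vec p))"])
    show "integrable lborel (\<lambda>x. norm (\<psi> x) * norm (\<psi> (x - of_int_vec p)))" by (rule lag_mass_integrable[OF \<psi>])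
    show "AE x in lborel. (\<lambda>k. indicator {x. \<delta> \<le> norm (h k *\<^sub>R x)} x * (?w x)) \<longlonglongrightarrow> 0"
    proof (rule AE_I2)
      fix x :: "real ^ 'n"
      have "(\<lambda>k. norm (h k *\<^sub>R x)) \<longlonglongrightarrow> norm (0 *\<^sub>R x)" by (intro tendsto_intros h)
      then have "eventually (\<lambda>k. norm (h k *\<^sub>R x) < \<delta>) sequentially" using \<delta> by (intro order_tendstoD(2)) auto
      then show "(\<lambda>k. indicator {x. \<delta> \<le> norm (h k *\<^sub>R x)} x * (?w x)) \<longlonglongrightarrow> 0"
        by (intro tendsto_eventually) (rule eventually_mono, assumption, simp add: indicator_def)
    qed
    show "\<And>k. AE x in lborel. norm (indicator {x. \<delta> \<le> norm (h k *\<^sub>R x)} x * (?w x)) \<le> norm (\<psi> x) * norm (\<psi> (x - of_int_vec p))"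
      by (intro AE_I2) (auto simp: indicator_def)
  qed measurable
  then show ?thesis by simp
qed

text \<open>The slow weight at \<open>n + x\<close> may be replaced by its value at
  \<open>n\<close>: uniform continuity covers the \<open>x\<close> with
  \<open>norm (h k *\<^sub>R x) < \<delta>\<close>, and integrability of the lag product covers the
  rest. The lag coefficient of \<psi> then factors out of the sampled sum.\<close>

lemma lag_limit:
  fixes \<psi> :: "real ^ 'n \<Rightarrow> complex" and W :: "nat \<Rightarrow> int ^ 'n \<Rightarrow> complex"
  assumes \<psi>: "pbound \<psi> A" and D0: "0 \<le> D" and W: "\<And>k. (\<integral>\<^sup>+n. ennreal ((norm (W k n))\<^sup>2) \<partial>lattice) \<le> ennreal D"
    and f: "Cc f" and h: "h \<longlonglongrightarrow> 0"
    and lim: "(\<lambda>k. LINT n|lattice. f (h k *\<^sub>R of_int_vec n) * W k n * cnj (W k (n + p))) \<longlonglongrightarrow> L"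
  shows "(\<lambda>k. LINT n|lattice. W k n * cnj (W k (n + p)) * (LBINT x. f (h k *\<^sub>R (of_int_vec n + x)) * (\<psi> x * cnj (\<psi> (x - of_int_vec p)))))
    \<longlonglongrightarrow> (LBINT x. \<psi> x * cnj (\<psi> (x - of_int_vec p))) * L"
proof -
  let ?w = "\<lambda>x. norm (\<psi> x) * norm (\<psi> (x - of_int_vec p))"
  have [measurable]: "\<psi> \<in> borel_measurable borel" by (rule pbound_measurable[OF \<psi>])
  have [measurable]: "f \<in> borel_measurable borel" by (rule Cc_measurable[OF f])
  obtain M where M: "M \<ge> 0" "\<And>x. norm (f x) \<le> M" using Cc_bounded[OF f] by blast
  have W': "(\<integral>\<^sup>+n. ennreal ((norm (W k (n + p)))\<^sup>2) \<partial>lattice) \<le> ennreal D" for k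
    using W[of k] nn_integral_lattice_add[of "\<lambda>n. ennreal ((norm (W k n))\<^sup>2)" p] by simp
  define g where "g = lag_mass \<psi> p"
  have g0: "0 \<le> g" by (simp add: g_def lag_mass_nonneg)
  define G where "G = (LBINT x. \<psi> x * cnj (\<psi> (x - of_int_vec p)))"
  define E where "E k n = (LBINT x. f (h k *\<^sub>R (of_int_vec n + x)) * (\<psi> x * cnj (\<psi> (x - of_int_vec p))))" for k n
  define E' where "E' k n = (LBINT x. f (h k *\<^sub>R of_int_vec n) * (\<psi> x * cnj (\<psi> (x - of_int_vec p))))" for k and n :: "int ^ 'n"
  have E'_eq: "E' k n = G * f (h k *\<^sub>R of_int_vec n)" for k n by (simp add: E'_def G_def)
  have Eb: "norm (E k n) \<le> M * g" for k n
    unfolding E_def g_def by (rule order_trans[OF norm_lag_le(2,3)[OF \<psi>]]) (use M in auto)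
  have E'b: "norm (E' k n) \<le> M * g" for k n
    unfolding E'_def g_def by (rule order_trans[OF norm_lag_le(2,3)[OF \<psi>]]) (use M in auto)
  have MgD: "0 \<le> M * g * D" using M g0 D0 by simp
  have iE: "integrable lattice (\<lambda>n. E k n * W k n * cnj (W k (n + p)))" for k
    by (rule lattice_norm_le(1)[OF lattice_product_norm[OF W W' Eb D0] MgD])
  have iE': "integrable lattice (\<lambda>n. E' k n * W k n * cnj (W k (n + p)))" for k
    by (rule lattice_norm_le(1)[OF lattice_product_norm[OF W W' E'b D0] MgD])
  define d where "d k = (LINT n|lattice. (E k n - E' k n) * W k n * cnj (W k (n + p)))" for k
  have d_eq: "d k = (LINT n|lattice. E k n * W k n * cnj (W k (n + p))) - (LINT n|lattice. E' k n * W k n * cnj (W k (n + p)))" for k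
    unfolding d_def left_diff_distrib by (rule Bochner_Integration.integral_diff[OF iE iE'])
  have "d \<longlonglongrightarrow> 0"
  proof (rule metric_LIMSEQ_I)
    fix e :: real assume e: "e > 0"
    define e1 where "e1 = e / (2 * (g * D + 1))"
    have gD: "0 \<le> g * D" using g0 D0 by simp
    have e1: "e1 > 0" "e1 * g * D < e / 2" using e gD by (simp_all add: e1_def field_simps)
    obtain \<delta> where \<delta>: "\<delta> > 0" "\<And>x y. norm (x - y) < \<delta> \<Longrightarrow> norm (f x - f y) < e1" using Cc_uniform[OF f e1(1)] by blast
    define T where "T k = (LBINT x. indicator {x. \<delta> \<le> norm (h k *\<^sub>R x)} x * (?w x))" for k
    have iT: "integrable lborel (\<lambda>x. indicator {x. \<delta> \<le> norm (h k *\<^sub>R x)} x * (?w x))" for k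
      by (rule Bochner_Integration.integrable_bound[OF lag_mass_integrable[OF \<psi>, of p]]) (auto simp: indicator_def intro!: AE_I2)
    have ED: "norm (E k n - E' k n) \<le> e1 * g + 2 * M * T k" for k n
    proof -
      let ?g = "\<lambda>x. f (h k *\<^sub>R (of_int_vec n + x)) - f (h k *\<^sub>R of_int_vec n)"
      have "E k n - E' k n = (LBINT x. ?g x * (\<psi> x * cnj (\<psi> (x - of_int_vec p))))"
        unfolding E_def E'_def left_diff_distrib
        by (intro Bochner_Integration.integral_diff[symmetric] norm_lag_le(1)[OF \<psi>, where K = M] M) measurable
      moreover have "norm (LBINT x. ?g x * (\<psi> x * cnj (\<psi> (x - of_int_vec p))))
          \<le> (LBINT x. norm (?g x) * (?w x))"
        by (rule norm_lag_le(2)[OF \<psi> _ norm_triangle_le_diff[OF add_mono[OF M(2) M(2)]]]) measurable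
      moreover have "(LBINT x. norm (?g x) * (?w x))
          \<le> (LBINT x. e1 * (?w x)
            + 2 * M * (indicator {x. \<delta> \<le> norm (h k *\<^sub>R x)} x * (?w x)))"
      proof (rule integral_mono')
        show "integrable lborel (\<lambda>x. e1 * (?w x)
            + 2 * M * (indicator {x. \<delta> \<le> norm (h k *\<^sub>R x)} x * (?w x)))"
          by (intro Bochner_Integration.integrable_add integrable_mult_right iT lag_mass_integrable[OF \<psi>])
        fix x :: "real ^ 'n"
        have "norm (?g x) \<le> e1 + 2 * M * indicator {x. \<delta> \<le> norm (h k *\<^sub>R x)} x"
        proof (cases "\<delta> \<le> norm (h k *\<^sub>R x)")
          case True
          have "norm (?g x) \<le> M + M" by (intro norm_triangle_le_diff add_mono M)
          then show ?thesis using True e1 by simp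
        next
          case False
          have "norm (h k *\<^sub>R (of_int_vec n + x) - h k *\<^sub>R of_int_vec n) = norm (h k *\<^sub>R x)" by (simp add: scaleR_add_right)
          then show ?thesis using \<delta>(2)[of "h k *\<^sub>R (of_int_vec n + x)" "h k *\<^sub>R of_int_vec n"] False by simp
        qed
        then have "norm (?g x) * (?w x)
          \<le> (e1 + 2 * M * indicator {x. \<delta> \<le> norm (h k *\<^sub>R x)} x) * (?w x)"
          by (intro mult_right_mono) auto
        then show "norm (?g x) * (?w x) \<le> e1 * (?w x)
            + 2 * M * (indicator {x. \<delta> \<le> norm (h k *\<^sub>R x)} x * (?w x))"
          by (simp only: distrib_right mult.assoc)
      qed (use e1 M in \<open>auto intro!: add_nonneg_nonneg mult_nonneg_nonneg\<close>)
      moreover have "(LBINT x. e1 * (?w x)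
            + 2 * M * (indicator {x. \<delta> \<le> norm (h k *\<^sub>R x)} x * (?w x))) = e1 * g + 2 * M * T k"
        unfolding g_def lag_mass_def T_def
        by (simp only: Bochner_Integration.integral_add integrable_mult_right iT lag_mass_integrable[OF \<psi>] integral_mult_right_zero)
      ultimately show ?thesis by (simp only:)
    qed
    have T0: "0 \<le> T k" for k unfolding T_def by (intro Bochner_Integration.integral_nonneg) simp
    have dle: "norm (d k) \<le> (e1 * g + 2 * M * T k) * D" for k
      unfolding d_def by (rule lattice_norm_le(2)[OF lattice_product_norm[OF W W' ED D0]]) (use e1 g0 M T0 D0 in simp)
    have "(\<lambda>k. 2 * M * T k * D) \<longlonglongrightarrow> 2 * M * 0 * D"
      unfolding T_def by (intro tendsto_intros lag_tail[OF \<psi> h \<delta>(1)])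
    then have "eventually (\<lambda>k. 2 * M * T k * D < e / 2) sequentially" using e by (intro order_tendstoD(2)) auto
    then obtain N where N: "\<And>k. k \<ge> N \<Longrightarrow> 2 * M * T k * D < e / 2" by (auto simp: eventually_sequentially)
    have "dist (d k) 0 < e" if "k \<ge> N" for k
      using dle[of k] N[OF that] e1(2) by (simp add: distrib_right)
    then show "\<exists>N. \<forall>k\<ge>N. dist (d k) 0 < e" by blast
  qed
  moreover have "(\<lambda>k. LINT n|lattice. E' k n * W k n * cnj (W k (n + p))) \<longlonglongrightarrow> G * L"
  proof -
    have "(LINT n|lattice. E' k n * W k n * cnj (W k (n + p))) = G * (LINT n|lattice. f (h k *\<^sub>R of_int_vec n) * W k n * cnj (W k (n + p)))" for k
      unfolding E'_eq by (simp only: mult.assoc integral_mult_right_zero)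
    then show ?thesis by (simp only: tendsto_mult_left[OF lim])
  qed
  ultimately have "(\<lambda>k. d k + (LINT n|lattice. E' k n * W k n * cnj (W k (n + p)))) \<longlonglongrightarrow> 0 + G * L"
    by (rule tendsto_add)
  then have "(\<lambda>k. LINT n|lattice. E k n * W k n * cnj (W k (n + p))) \<longlonglongrightarrow> G * L" by (simp add: d_eq)
  then show ?thesis by (simp only: E_def G_def mult_ac)
qed

text \<open>Limits are taken lag by lag and summed under the majorant \<open>lag_mass\<close>.
  Finiteness of \<mu> then allows the lag sum to enter the integral, where at each frequency it is
  the periodized power spectrum of \<psi>.\<close>

theorem reconstruction_limit:
  fixes w :: "nat \<Rightarrow> real ^ 'n \<Rightarrow> complex"
  assumes W: "wigner_seq w h \<mu> B" and \<phi>: "pbound \<phi> A" and \<psi>: "pbound \<psi> A'" and f: "Cc f"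
    and S: "\<And>l :: int ^ 'n. l \<noteq> 0 \<Longrightarrow> \<exists>S\<in>sets borel. (AE p in \<mu>. power_spec \<phi> (snd p) = 0 \<or> p \<in> S) \<and>
      (AE p in \<mu>. power_spec \<phi> (snd p) = 0 \<or> (fst p, snd p - (2 * pi) *\<^sub>R of_int_vec l) \<notin> S)"
  shows "(\<lambda>k. LBINT x. f (h k *\<^sub>R x) * complex_of_real ((norm (LINT n|lattice. filt \<phi> (w k) (of_int_vec n) * \<psi> (x - of_int_vec n)))\<^sup>2))
    \<longlonglongrightarrow> (LINT q|\<mu>. f (fst q) * complex_of_real ((\<Sum>\<^sub>\<infinity>l :: int ^ 'n. power_spec \<psi> (snd q + (2 * pi) *\<^sub>R of_int_vec l)) * power_spec \<phi> (snd q)))"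
    and "integrable \<mu> (\<lambda>q. f (fst q) * complex_of_real ((\<Sum>\<^sub>\<infinity>l :: int ^ 'n. power_spec \<psi> (snd q + (2 * pi) *\<^sub>R of_int_vec l)) * power_spec \<phi> (snd q)))"
proof -
  let ?S = "\<lambda>q. f (fst q) * complex_of_real ((\<Sum>\<^sub>\<infinity>l :: int ^ 'n. power_spec \<psi> (snd q + (2 * pi) *\<^sub>R of_int_vec l)) * power_spec \<phi> (snd q))"
  interpret wigner_seq w h \<mu> B by (rule W)
  interpret LM: pair_sigma_finite "lattice :: (int ^ 'n) measure" \<mu> ..
  have [measurable]: "\<phi> \<in> borel_measurable borel" by (rule pbound_measurable[OF \<phi>])
  have [measurable]: "\<psi> \<in> borel_measurable borel" by (rule pbound_measurable[OF \<psi>])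
  have [measurable]: "f \<in> borel_measurable borel" by (rule Cc_measurable[OF f])
  note [measurable_cong] = sets_mu
  have A: "0 \<le> A" by (rule pbound_nonneg[OF \<phi>])
  obtain M where M: "M \<ge> 0" "\<And>x. norm (f x) \<le> M" using Cc_bounded[OF f] by blast
  define D where "D = A * B * A"
  have D: "0 \<le> D" using A B_nonneg by (simp add: D_def)
  define V where "V k n = filt \<phi> (w k) (of_int_vec n)" for k and n :: "int ^ 'n"
  have DB: "(\<integral>\<^sup>+n. ennreal ((norm (V k n))\<^sup>2) \<partial>lattice) \<le> ennreal D" for k
    using lattice_filt_bound[OF \<phi> pbound_integrable(2)[OF \<phi>] w[of k] wB[of k], of 0] by (simp add: V_def D_def)
  define q where "q k p = (LINT n|lattice. V k n * cnj (V k (n + p)) * (LBINT x. f (h k *\<^sub>R (of_int_vec n + x)) * (\<psi> x * cnj (\<psi> (x - of_int_vec p)))))" for k p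
  define I where "I p = (LINT q|\<mu>. f (fst q) * (cis (- (of_int_vec p \<bullet> snd q)) * complex_of_real (power_spec \<phi> (snd q))))" for p :: "int ^ 'n"
  define G where "G p = (LBINT x. \<psi> x * cnj (\<psi> (x - of_int_vec p)))" for p
  have qe: "(LBINT x. f (h k *\<^sub>R x) * complex_of_real ((norm (LINT n|lattice. V k n * \<psi> (x - of_int_vec n)))\<^sup>2)) = (LINT p|lattice. q k p)" for k
    unfolding q_def by (rule quadratic_expansion(1)[OF \<psi> D DB, where M = M]) (use M in auto)
  have qb: "norm (q k p) \<le> M * D * lag_mass \<psi> p" for k p
    unfolding q_def by (rule quadratic_expansion(2)[OF \<psi> D DB]) (use M in auto)
  have ql: "(\<lambda>k. q k p) \<longlonglongrightarrow> G p * I p" for p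
    unfolding q_def G_def
  proof (rule lag_limit[OF \<psi> D DB f h0])
    show "(\<lambda>k. LINT n|lattice. f (h k *\<^sub>R of_int_vec n) * V k n * cnj (V k (n + p))) \<longlonglongrightarrow> I p"
      using sampled_limit[OF W \<phi> f S, of p] by (simp add: V_def I_def)
  qed
  have lim: "(\<lambda>k. LINT p|lattice. q k p) \<longlonglongrightarrow> (LINT p|lattice. G p * I p)"
    by (rule integral_dominated_convergence[where w = "\<lambda>p. M * D * lag_mass \<psi> p"])
      (use ql qb lag_mass_sum(2)[OF \<psi>] in auto)
  have Gb: "norm (G p) \<le> lag_mass \<psi> p" for p
    using norm_lag_le(2)[OF \<psi>, of "\<lambda>_. 1" 1 p] by (simp add: G_def lag_mass_def)
  define X where "X p q = G p * (f (fst q) * (cis (- (of_int_vec p \<bullet> snd q)) * complex_of_real (power_spec \<phi> (snd q))))" for p q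
  have Xm: "case_prod X \<in> borel_measurable (lattice \<Otimes>\<^sub>M \<mu>)"
    unfolding X_def case_prod_beta by measurable
  have ps: "power_spec \<phi> \<xi> \<le> A\<^sup>2" for \<xi>
    by (rule order_trans[OF power_spec_bound(2)[OF pbound_integrable(1)[OF \<phi>]]])
      (intro power_mono pbound_integrable(2)[OF \<phi>], simp)
  have Xb: "norm (X p q) \<le> lag_mass \<psi> p * (M * A\<^sup>2)" for p q
    unfolding X_def norm_mult norm_cis norm_of_real mult_1_left
    using ps power_spec_bound(1)[OF pbound_integrable(1)[OF \<phi>]] M Gb lag_mass_nonneg
    by (intro mult_mono) (auto simp: abs_of_nonneg)
  have "(\<integral>\<^sup>+p. (\<integral>\<^sup>+q. ennreal (norm (X p q)) \<partial>\<mu>) \<partial>lattice) \<le> (\<integral>\<^sup>+p. (\<integral>\<^sup>+q. ennreal (lag_mass \<psi> p * (M * A\<^sup>2)) \<partial>\<mu>) \<partial>lattice)"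
    by (intro nn_integral_mono ennreal_leI Xb)
  also have "\<dots> = (\<integral>\<^sup>+p. ennreal (lag_mass \<psi> p) * (ennreal (M * A\<^sup>2) * emeasure \<mu> (space \<mu>)) \<partial>lattice)"
    by (simp only: nn_integral_const ennreal_mult[OF lag_mass_nonneg mult_nonneg_nonneg[OF M(1) zero_le_power2]] mult.assoc)
  also have "\<dots> = (\<integral>\<^sup>+p. ennreal (lag_mass \<psi> p) \<partial>lattice) * (ennreal (M * A\<^sup>2) * emeasure \<mu> (space \<mu>))"
    by (rule nn_integral_multc) simp
  also have "\<dots> \<le> ennreal (A' * A') * (ennreal (M * A\<^sup>2) * emeasure \<mu> (space \<mu>))"
    by (intro mult_right_mono lag_mass_sum(1)[OF \<psi>]) simp
  also have "\<dots> < \<infinity>" by (simp add: ennreal_mult_less_top emeasure_eq_measure)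
  finally have fin: "(\<integral>\<^sup>+p. (\<integral>\<^sup>+q. ennreal (norm (X p q)) \<partial>\<mu>) \<partial>lattice) < \<infinity>" .
  have XP: "(LINT p|lattice. X p q) = ?S q" for q
  proof -
    have "(LINT p|lattice. X p q) = (LINT p|lattice. (f (fst q) * complex_of_real (power_spec \<phi> (snd q))) * (G p * cis (- (of_int_vec p \<bullet> snd q))))"
      by (intro Bochner_Integration.integral_cong refl) (simp only: X_def mult_ac)
    also have "\<dots> = (f (fst q) * complex_of_real (power_spec \<phi> (snd q))) * (LINT p|lattice. G p * cis (- (of_int_vec p \<bullet> snd q)))"
      by (rule integral_mult_right_zero)
    finally show ?thesis by (simp add: G_def periodized_power_spec_infsum(2)[OF \<psi>])
  qed
  have "(LINT p|lattice. G p * I p) = (LINT p|lattice. (LINT q|\<mu>. X p q))"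
    unfolding I_def X_def by (simp only: integral_mult_right_zero)
  also have "\<dots> = (LINT q|\<mu>. (LINT p|lattice. X p q))" by (rule LM.Fubini_swap(4)[OF Xm fin])
  finally have "(LINT p|lattice. G p * I p) = (LINT q|\<mu>. ?S q)"
    by (simp only: XP)
  with lim show "(\<lambda>k. LBINT x. f (h k *\<^sub>R x) * complex_of_real ((norm (LINT n|lattice. filt \<phi> (w k) (of_int_vec n) * \<psi> (x - of_int_vec n)))\<^sup>2))
    \<longlonglongrightarrow> (LINT q|\<mu>. ?S q)"
    by (simp only: qe[symmetric] V_def)
  show "integrable \<mu> (\<lambda>q. ?S q)"
    using LM.Fubini_swap(3)[OF Xm fin] by (simp only: XP)
qed

subsection \<open>Borel representatives and decay\<close>

text \<open>Completeness of Lebesgue measure: preimages under the two functions differ by a subset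
  of a null set.\<close>

lemma measurable_lebesgue_AE:
  fixes g g' :: "'a::euclidean_space \<Rightarrow> 'b::topological_space"
  assumes g': "g' \<in> borel_measurable lebesgue" and ae: "AE x in lborel. g x = g' x"
  shows "g \<in> borel_measurable lebesgue"
proof (rule measurableI)
  fix A :: "'b set" assume A: "A \<in> sets borel"
  have "AE x in lebesgue. g x = g' x" using ae by (simp only: AE_completion_iff)
  then have ae': "AE x in lebesgue. x \<in> g' -` A \<inter> space lebesgue \<longleftrightarrow> x \<in> g -` A \<inter> space lebesgue"
    by (rule eventually_mono) auto
  show "g -` A \<inter> space lebesgue \<in> sets lebesgue"
    by (rule complete_measure.in_sets_AE[OF _ ae' measurable_sets[OF g' A]]) (auto intro: completion.complete_measure_axioms)
qed simp

lemma integral_lebesgue_AE: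
  fixes g g' :: "'a::euclidean_space \<Rightarrow> 'b::{banach, second_countable_topology}"
  assumes g': "g' \<in> borel_measurable borel" and ae: "AE x in lborel. g x = g' x"
  shows "(LINT x|lebesgue. g x) = (LBINT x. g' x)"
proof -
  have m: "g' \<in> borel_measurable lebesgue" using g' by (intro measurable_completion) simp
  have "(LINT x|lebesgue. g x) = (LINT x|lebesgue. g' x)"
    by (rule integral_cong_AE[OF measurable_lebesgue_AE[OF m ae] m]) (use ae in \<open>simp only: AE_completion_iff\<close>)
  also have "\<dots> = (LBINT x. g' x)" by (rule integral_completion) (use g' in simp)
  finally show ?thesis .
qed

text \<open>No measurability is needed here: two functions that agree almost everywhere are both
  Lebesgue measurable or both not, and in the second case both integrals are \<open>0\<close>.\<close>

lemma integral_lebesgue_cong_AE: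
  fixes f g :: "'a::euclidean_space \<Rightarrow> 'b::{banach, second_countable_topology}"
  assumes ae: "AE x in lborel. f x = g x"
  shows "(LINT x|lebesgue. f x) = (LINT x|lebesgue. g x)"
proof (cases "f \<in> borel_measurable lebesgue")
  case True
  have "AE x in lborel. g x = f x" using ae by eventually_elim simp
  then have g: "g \<in> borel_measurable lebesgue" by (rule measurable_lebesgue_AE[OF True])
  have "AE x in lebesgue. f x = g x" using ae by (simp only: AE_completion_iff)
  with True g show ?thesis by (rule integral_cong_AE)
next
  case False
  then have "g \<notin> borel_measurable lebesgue" using measurable_lebesgue_AE[OF _ ae] by blast
  then have "\<not> integrable lebesgue g" "\<not> integrable lebesgue f" using False borel_measurable_integrable by blast+
  then show ?thesis by (simp add: not_integrable_integral_eq)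
qed

lemma borel_version:
  fixes g :: "'a::euclidean_space \<Rightarrow> complex"
  assumes "g \<in> borel_measurable lebesgue"
  obtains g' where "g' \<in> borel_measurable borel" "AE x in lborel. g x = g' x"
proof -
  obtain r where r: "r \<in> borel_measurable lborel" "AE x in lborel. Re (g x) = r x"
    using completion_ex_borel_measurable_real[of "\<lambda>x. Re (g x)" lborel] assms by auto
  obtain i where i: "i \<in> borel_measurable lborel" "AE x in lborel. Im (g x) = i x"
    using completion_ex_borel_measurable_real[of "\<lambda>x. Im (g x)" lborel] assms by auto
  show thesis
  proof
    have [measurable]: "r \<in> borel_measurable borel" "i \<in> borel_measurable borel" using r i by simp_all
    show "(\<lambda>x. complex_of_real (r x) + \<i> * complex_of_real (i x)) \<in> borel_measurable borel" by measurable
    show "AE x in lborel. g x = complex_of_real (r x) + \<i> * complex_of_real (i x)"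
      using r(2) i(2) by eventually_elim (simp add: complex_eq_iff)
  qed
qed

text \<open>A Borel null set containing the exceptional points has a null preimage under an
  invertible affine map, by the change of variables applied to its indicator.\<close>

lemma AE_lborel_affine:
  fixes c :: real and t :: "'a::euclidean_space"
  assumes ae: "AE x in lborel. P x" and c: "c \<noteq> 0"
  shows "AE x in lborel. P (c *\<^sub>R x - t)"
proof -
  obtain N where N: "{x. \<not> P x} \<subseteq> N" "N \<in> null_sets lborel"
    using ae by (auto elim!: AE_E simp: null_sets_def)
  have [measurable]: "N \<in> sets borel" using N by auto
  have "(\<integral>\<^sup>+x. indicator N x \<partial>lborel) = (\<integral>\<^sup>+x. indicator N (- t + x) \<partial>(lborel :: 'a measure))"
    by (rule nn_integral_lborel_translate[symmetric]) measurable
  also have "\<dots> = ennreal (\<bar>c\<bar> ^ DIM('a)) * (\<integral>\<^sup>+x. indicator N (- t + c *\<^sub>R x) \<partial>(lborel :: 'a measure))"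
    by (rule nn_integral_lborel_scale[OF _ c]) measurable
  finally have "(\<integral>\<^sup>+x. indicator N (- t + c *\<^sub>R x) \<partial>(lborel :: 'a measure)) = 0"
    using N c by (simp add: null_sets_def)
  then have "AE x in lborel. indicator N (- t + c *\<^sub>R x) = (0::ennreal)"
    by (subst (asm) nn_integral_0_iff_AE) measurable
  then show ?thesis by eventually_elim (use N in \<open>auto simp: indicator_def split: if_splits\<close>)
qed

text \<open>Dyadic decomposition: where \<open>1 + norm x\<close> is of order \<open>2 ^ j\<close>
  the weight is at most \<open>2 powr (- q * j)\<close>, and the ball containing these points has
  volume of order \<open>2 ^ (d * j)\<close>. A geometric series of ratio
  \<open>2 powr (- \<epsilon>)\<close> remains.\<close>

lemma nn_integral_decay_finite:
  fixes \<epsilon> :: real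
  assumes \<epsilon>: "\<epsilon> > 0"
  shows "(\<integral>\<^sup>+x. ennreal ((1 + norm x) powr (- real DIM('a) - \<epsilon>)) \<partial>(lborel :: 'a::euclidean_space measure)) < \<infinity>"
proof -
  define d where "d = DIM('a)"
  define q where "q = real d + \<epsilon>"
  have q: "q > 0" using \<epsilon> by (simp add: q_def)
  define c where "c j = (2::real) powr (- q * real j)" for j :: nat
  have pt: "ennreal ((1 + norm x) powr (- q)) \<le> (\<Sum>j. ennreal (c j) * indicator (cball 0 (2 ^ Suc j)) x)" for x :: 'a
  proof -
    \<comment> \<open>The dyadic index is taken of \<open>1 + norm x\<close> rather than of
      \<open>norm x\<close>, so that the logarithm is nonnegative.\<close>
    define j where "j = nat \<lfloor>log 2 (1 + norm x)\<rfloor>"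
    have "0 \<le> log 2 (1 + norm x)" by (subst zero_le_log_cancel_iff) (simp_all add: add_pos_nonneg)
    then have j: "real j \<le> log 2 (1 + norm x)" "log 2 (1 + norm x) < real j + 1" by (simp_all add: j_def)
    have l: "2 powr log 2 (1 + norm x) = 1 + norm x" by (simp add: add_pos_nonneg)
    have lo: "2 powr real j \<le> 1 + norm x" using powr_mono[OF j(1), of 2] l by simp
    have "1 + norm x \<le> 2 powr (real j + 1)" using powr_mono[OF less_imp_le[OF j(2)], of 2] l by simp
    also have "\<dots> = 2 ^ Suc j" using powr_realpow[of 2 "Suc j"] by (simp add: add.commute)
    finally have hi: "x \<in> cball 0 (2 ^ Suc j)" by simp
    have "(1 + norm x) powr (- q) \<le> (2 powr real j) powr (- q)" using q lo by (intro powr_mono2') auto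
    also have "\<dots> = c j" by (simp add: c_def powr_powr mult.commute)
    finally have "ennreal ((1 + norm x) powr (- q)) \<le> ennreal (c j) * indicator (cball 0 (2 ^ Suc j)) x"
      using hi by (simp add: ennreal_leI)
    also have "\<dots> \<le> (\<Sum>j. ennreal (c j) * indicator (cball 0 (2 ^ Suc j)) x)"
    proof -
      define F where "F j = ennreal (c j) * indicator (cball 0 (2 ^ Suc j)) x" for j
      have "F j \<le> suminf F" using sum_le_suminf[of F "{j}"] by simp
      then show ?thesis by (simp only: F_def [abs_def])
    qed
    finally show ?thesis .
  qed
  define V where "V = unit_ball_vol (real d) * 2 ^ d"
  have V: "0 \<le> V" by (simp add: V_def)
  have shell: "(\<integral>\<^sup>+x. ennreal (c j) * indicator (cball 0 (2 ^ Suc j)) x \<partial>(lborel :: 'a measure)) = ennreal (V * (2 powr (- \<epsilon>)) ^ j)" for j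
  proof -
    have "(\<integral>\<^sup>+x. ennreal (c j) * indicator (cball 0 (2 ^ Suc j)) x \<partial>(lborel :: 'a measure)) = ennreal (c j) * emeasure lborel (cball (0::'a) (2 ^ Suc j))"
      by (simp add: nn_integral_cmult_indicator)
    also have "\<dots> = ennreal (c j * (unit_ball_vol (real d) * (2 ^ Suc j) ^ d))"
      by (subst emeasure_cball) (simp_all add: d_def c_def ennreal_mult[symmetric])
    also have "c j * (unit_ball_vol (real d) * (2 ^ Suc j) ^ d) = V * (2 powr (- \<epsilon>)) ^ j"
    proof -
      have "(2 ^ Suc j) ^ d = (2::real) ^ d * 2 powr (real d * real j)"
        by (simp add: power_mult_distrib powr_realpow[symmetric] powr_powr mult.commute powr_power flip: power_mult)
      moreover have "c j * 2 powr (real d * real j) = (2 powr (- \<epsilon>)) ^ j"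
        by (simp add: c_def q_def powr_add[symmetric] powr_power algebra_simps)
      ultimately show ?thesis by (simp add: V_def mult_ac)
    qed
    finally show ?thesis .
  qed
  have r: "2 powr (- \<epsilon>) < 1" using \<epsilon> powr_less_mono[of "- \<epsilon>" 0 2] by simp
  have sm: "summable (\<lambda>j. V * (2 powr (- \<epsilon>)) ^ j)" using r by (intro summable_mult summable_geometric) simp
  have "(\<integral>\<^sup>+x. ennreal ((1 + norm x) powr (- q)) \<partial>(lborel :: 'a measure)) \<le> (\<integral>\<^sup>+x. (\<Sum>j. ennreal (c j) * indicator (cball 0 (2 ^ Suc j)) x) \<partial>(lborel :: 'a measure))"
    by (intro nn_integral_mono pt)
  also have "\<dots> = (\<Sum>j. ennreal (V * (2 powr (- \<epsilon>)) ^ j))"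
    by (subst nn_integral_suminf) (simp_all only: shell borel_measurable_times_ennreal borel_measurable_const borel_measurable_indicator borel_closed closed_cball sets_lborel)
  also have "\<dots> = ennreal (\<Sum>j. V * (2 powr (- \<epsilon>)) ^ j)" by (rule suminf_ennreal2[OF _ sm]) (use V in simp)
  also have "\<dots> < \<infinity>" by simp
  finally show ?thesis by (simp add: q_def d_def)
qed

text \<open>On each unit cell the weight \<open>(1 + \<bar>x\<bar>) powr - p\<close> is comparable to its mean, so its lattice
  sums are controlled by its integral.\<close>

lemma pbound_of_decay:
  fixes \<phi> :: "real ^ 'n \<Rightarrow> complex"
  assumes [measurable]: "\<phi> \<in> borel_measurable borel" and \<epsilon>: "\<epsilon> > 0" and C: "C > 0"
    and dec: "\<And>x. norm (\<phi> x) \<le> C * (1 + norm x) powr (- real CARD('n) - \<epsilon>)"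
  obtains A where "pbound \<phi> A"
proof -
  define q where "q = real CARD('n) + \<epsilon>"
  have q: "q > 0" using \<epsilon> by (simp add: q_def add_nonneg_pos)
  define g where "g x = (1 + norm x) powr (- q)" for x :: "real ^ 'n"
  have [measurable]: "g \<in> borel_measurable borel" unfolding g_def [abs_def] by measurable
  \<comment> \<open>By the l1 bound the cell lies in the ball of radius \<open>CARD('n)\<close>, so
    moving by a point of the cell enlarges \<open>1 + norm x\<close> by a factor of at most
    \<open>K\<close>.\<close>
  define K where "K = 1 + real CARD('n)"
  have K: "K > 0" by (simp add: K_def add_pos_nonneg)
  have gg: "g z \<le> K powr q * g (y + z)" if y: "y \<in> unit_cube" for y z
  proof -
    have "norm y \<le> (\<Sum>i\<in>UNIV. \<bar>y $ i\<bar>)" by (rule norm_le_l1_cart)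
    also have "\<dots> \<le> (\<Sum>i\<in>(UNIV :: 'n set). 1)" 
    proof (rule sum_mono)
      fix i
      have "- (1/2) \<le> y $ i" "y $ i < 1/2" using y by (auto simp: unit_cube_def)
      then show "\<bar>y $ i\<bar> \<le> 1" by linarith
    qed
    finally have "norm y \<le> real CARD('n)" by simp
    then have "1 + norm (y + z) \<le> K + norm z" using norm_triangle_ineq[of y z] by (simp add: K_def)
    also have "\<dots> \<le> K * (1 + norm z)" using mult_right_mono[of 1 K "norm z"] by (simp add: K_def algebra_simps)
    finally have "(1 + norm (y + z)) \<le> K * (1 + norm z)" .
    then have "(K * (1 + norm z)) powr (- q) \<le> (1 + norm (y + z)) powr (- q)"
      using q by (intro powr_mono2') (auto simp: add_pos_nonneg)
    then have "K powr (- q) * g z \<le> g (y + z)" using K by (simp add: g_def powr_mult)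
    then have "K powr q * (K powr (- q) * g z) \<le> K powr q * g (y + z)" by (intro mult_left_mono) auto
    then show ?thesis using K by (simp add: mult.assoc[symmetric] powr_add[symmetric])
  qed
  define J where "J = (\<integral>\<^sup>+x. ennreal (g x) \<partial>lborel)"
  have J: "J < \<infinity>" using nn_integral_decay_finite[OF \<epsilon>, where 'a = "real ^ 'n"] by (simp add: J_def g_def q_def)
  have sum_le: "(\<integral>\<^sup>+n. ennreal (norm (\<phi> (x - of_int_vec n))) \<partial>lattice) \<le> ennreal (C * K powr q) * J" for x
  proof -
    have "(\<integral>\<^sup>+n. ennreal (norm (\<phi> (x - of_int_vec n))) \<partial>lattice) = (\<integral>\<^sup>+n. ennreal (norm (\<phi> (x + of_int_vec n))) \<partial>lattice)"
      using nn_integral_lattice_uminus[of "\<lambda>n. ennreal (norm (\<phi> (x + of_int_vec n)))"] by simp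
    \<comment> \<open>An average over the cell, which has measure 1, is introduced so that the
      lattice sum can be compared with the integral of \<open>g\<close>.\<close>
    also have "\<dots> = (\<integral>\<^sup>+y. indicator unit_cube y * (\<integral>\<^sup>+n. ennreal (norm (\<phi> (x + of_int_vec n))) \<partial>lattice) \<partial>(lborel :: (real ^ 'n) measure))"
      by (simp add: nn_integral_multc emeasure_unit_cube)
    also have "\<dots> \<le> (\<integral>\<^sup>+y. indicator unit_cube y * (\<integral>\<^sup>+n. ennreal (C * K powr q) * ennreal (g (x + (y + of_int_vec n))) \<partial>lattice) \<partial>lborel)"
    proof (rule nn_integral_mono)
      fix y :: "real ^ 'n"
      have "ennreal (norm (\<phi> (x + of_int_vec n))) \<le> ennreal (C * K powr q) * ennreal (g (x + (y + of_int_vec n)))" if y: "y \<in> unit_cube" for n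
      proof -
        have "norm (\<phi> (x + of_int_vec n)) \<le> C * g (x + of_int_vec n)"
          using dec[of "x + of_int_vec n"] by (simp add: g_def q_def)
        also have "\<dots> \<le> C * (K powr q * g (y + (x + of_int_vec n)))" using C gg[OF y] by (intro mult_left_mono) auto
        finally show ?thesis using C by (simp add: ennreal_mult[symmetric] ennreal_leI g_def add_ac mult_ac)
      qed
      then show "indicator unit_cube y * (\<integral>\<^sup>+n. ennreal (norm (\<phi> (x + of_int_vec n))) \<partial>lattice)
        \<le> indicator unit_cube y * (\<integral>\<^sup>+n. ennreal (C * K powr q) * ennreal (g (x + (y + of_int_vec n))) \<partial>lattice)"
        by (auto simp: indicator_def intro!: nn_integral_mono)
    qed
    also have "\<dots> = (\<integral>\<^sup>+y. ennreal (C * K powr q) * ennreal (g (x + y)) \<partial>lborel)"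
      by (rule nn_integral_unfold[symmetric]) measurable
    also have "\<dots> = ennreal (C * K powr q) * J"
      unfolding J_def by (simp add: nn_integral_cmult nn_integral_lborel_translate[of "\<lambda>x. ennreal (g x)"])
    finally show ?thesis .
  qed
  obtain A where A: "0 \<le> A" "ennreal (C * K powr q) * J = ennreal A"
    using J by (cases "ennreal (C * K powr q) * J") (auto simp: ennreal_mult_eq_top_iff)
  then have "pbound \<phi> A" using sum_le by (simp add: pbound_def)
  then show thesis by (rule that)
qed

section \<open>Transfer of transform, sampling and reconstruction to Borel representatives\<close>

lemma norm_fourier_sq:
  fixes g g' :: "'a::euclidean_space \<Rightarrow> complex"
  assumes [measurable]: "g' \<in> borel_measurable borel" and ae: "AE x in lborel. g x = g' x"
  shows "(cmod (fourier g \<xi>))\<^sup>2 = power_spec g' \<xi>"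
proof -
  have "AE x in lborel. g x * exp (- \<i> * complex_of_real (x \<bullet> \<xi>)) = g' x * cis (- (x \<bullet> \<xi>))"
    using ae by eventually_elim (simp add: cis_conv_exp)
  then have "fourier g \<xi> = (LBINT x. g' x * cis (- (x \<bullet> \<xi>)))"
    unfolding fourier_def by (intro integral_lebesgue_AE) measurable
  moreover have "ctr (\<lambda>z. cnj (g' z)) \<xi> = cnj (LBINT x. g' x * cis (- (x \<bullet> \<xi>)))"
    unfolding ctr_def by (subst Bochner_Integration.integral_cnj[symmetric]) (simp add: cis_cnj)
  ultimately show ?thesis by (simp add: power_spec_def)
qed

text \<open>The factor \<open>sqrt h ^ CARD('n)\<close> is the counterpart for samples of the L2
  normalization in \<open>unit_scale\<close>: it absorbs the prefactor of the sampling operator and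
  the Jacobian of the rescaling.\<close>

lemma sampling_eq_filt:
  fixes \<phi> \<phi>' u u' :: "real ^ 'n \<Rightarrow> complex"
  assumes [measurable]: "\<phi>' \<in> borel_measurable borel" "u' \<in> borel_measurable borel"
    and \<phi>: "AE x in lborel. \<phi> x = \<phi>' x" and u: "AE x in lborel. u x = u' x" and h: "h > 0"
  shows "complex_of_real (sqrt h ^ CARD('n)) * sampling \<phi> h u n = filt \<phi>' (unit_scale h u') (of_int_vec n)"
proof -
  have "AE x in lborel. \<phi> (x /\<^sub>R h - of_int_vec n) = \<phi>' (x /\<^sub>R h - of_int_vec n)"
    by (rule AE_lborel_affine[OF \<phi>]) (use h in simp)
  with u have "AE x in lborel. u x * cnj (\<phi> (x /\<^sub>R h - of_int_vec n)) = u' x * cnj (\<phi>' (x /\<^sub>R h - of_int_vec n))"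
    by eventually_elim simp
  then have "(LINT x|lebesgue. u x * cnj (\<phi> (x /\<^sub>R h - of_int_vec n))) = (LBINT x. u' x * cnj (\<phi>' (x /\<^sub>R h - of_int_vec n)))"
    by (intro integral_lebesgue_AE) measurable
  also have "\<dots> = \<bar>h\<bar> ^ DIM(real ^ 'n) *\<^sub>R (LBINT x. u' (h *\<^sub>R x) * cnj (\<phi>' ((h *\<^sub>R x) /\<^sub>R h - of_int_vec n)))"
    by (rule integral_lborel_scale) (measurable, use h in simp)
  also have "(LBINT x. u' (h *\<^sub>R x) * cnj (\<phi>' ((h *\<^sub>R x) /\<^sub>R h - of_int_vec n))) = (LBINT x. u' (h *\<^sub>R x) * cnj (\<phi>' (x - of_int_vec n)))"
    using h by simp
  also have "\<dots> = (LBINT x. u' (h *\<^sub>R (of_int_vec n + x)) * cnj (\<phi>' ((of_int_vec n + x) - of_int_vec n)))"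
    by (rule integral_lborel_translate[symmetric]) measurable
  finally have s: "sampling \<phi> h u n = (LBINT x. u' (h *\<^sub>R (of_int_vec n + x)) * cnj (\<phi>' x))"
    using h by (simp add: sampling_def scaleR_conv_of_real)
  show ?thesis
    unfolding s filt_def unit_scale_def by (simp add: mult.assoc)
qed

text \<open>Countably many translates have a common exceptional null set. Off it, absolute
  summability identifies the unordered sum with the integral over the lattice.\<close>

lemma reconstruction_AE:
  fixes \<psi> \<psi>' :: "real ^ 'n \<Rightarrow> complex"
  assumes \<psi>': "pbound \<psi>' A" and \<psi>: "AE x in lborel. \<psi> x = \<psi>' x" and h: "h > 0"
    and D: "0 \<le> D" and U: "(\<integral>\<^sup>+n. ennreal ((norm (U n))\<^sup>2) \<partial>lattice) \<le> ennreal D"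
  shows "AE x in lborel. reconstruction \<psi> h U x = (LINT n|lattice. U n * \<psi>' (x /\<^sub>R h - of_int_vec n))"
proof -
  have "AE x in lborel. \<psi> (x /\<^sub>R h - of_int_vec n) = \<psi>' (x /\<^sub>R h - of_int_vec n)" for n :: "int ^ 'n"
    by (rule AE_lborel_affine[OF \<psi>]) (use h in simp)
  then have "AE x in lborel. \<forall>n :: int ^ 'n. \<psi> (x /\<^sub>R h - of_int_vec n) = \<psi>' (x /\<^sub>R h - of_int_vec n)"
    by (simp add: AE_all_countable)
  then show ?thesis
  proof eventually_elim
    case (elim x)
    have i: "integrable lattice (\<lambda>n. U n * \<psi>' (x /\<^sub>R h - of_int_vec n))"
      by (rule lattice_norm_le(1)[OF synthesis_bound[OF \<psi>' D U]]) (use D pbound_nonneg[OF \<psi>'] in simp)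
    then have "Infinite_Set_Sum.abs_summable_on (\<lambda>n. U n * \<psi>' (x /\<^sub>R h - of_int_vec n)) UNIV"
      by (simp add: abs_summable_on_def)
    from infsetsum_infsum[OF this] show ?case
      using elim by (simp add: reconstruction_def infsetsum_def)
  qed
qed

text \<open>A Borel representative may violate the bound on a null set. It is reset to 0 there, so
  that the decay holds at every point, as uniform bounds on lattice sums require.\<close>

lemma decay_version:
  fixes g :: "real ^ 'n \<Rightarrow> complex"
  assumes g: "g \<in> borel_measurable lebesgue" and \<epsilon>: "\<epsilon> > 0" and C: "C > 0"
    and dec: "\<And>x. cmod (g x) \<le> C * (1 + norm x) powr (- real CARD('n) - \<epsilon>)"
  obtains g' A where "pbound g' A" "AE x in lborel. g x = g' x"
proof -
  obtain g0 where [measurable]: "g0 \<in> borel_measurable borel" and g0: "AE x in lborel. g x = g0 x" by (rule borel_version[OF g])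
  define g' where "g' x = (if norm (g0 x) \<le> C * (1 + norm x) powr (- real CARD('n) - \<epsilon>) then g0 x else 0)" for x
  have [measurable]: "g' \<in> borel_measurable borel" unfolding g'_def [abs_def] by measurable
  have "norm (g' x) \<le> C * (1 + norm x) powr (- real CARD('n) - \<epsilon>)" for x using C by (simp add: g'_def)
  then obtain A where A: "pbound g' A" by (rule pbound_of_decay[rotated 3]) (use \<epsilon> C in simp_all)
  have "AE x in lborel. g x = g' x" using g0 by eventually_elim (metis dec g'_def)
  with A show thesis by (rule that)
qed

lemma square_integrable_version:
  fixes u :: "'a::euclidean_space \<Rightarrow> complex"
  assumes "square_integrable u"
  shows "\<exists>u'. sq_int u' \<and> (AE x in lborel. u x = u' x) \<and> (LBINT x. (norm (u' x))\<^sup>2) = (L2_norm u)\<^sup>2"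
proof -
  have u: "u \<in> borel_measurable lebesgue" "integrable lebesgue (\<lambda>x. (cmod (u x))\<^sup>2)"
    using assms by (simp_all add: square_integrable_def)
  obtain u' where u' [measurable]: "u' \<in> borel_measurable borel" and ae: "AE x in lborel. u x = u' x" by (rule borel_version[OF u(1)])
  have ae2: "AE x in lborel. (cmod (u x))\<^sup>2 = (cmod (u' x))\<^sup>2" using ae by eventually_elim simp
  have m: "(\<lambda>x. (cmod (u' x))\<^sup>2) \<in> borel_measurable borel" by measurable
  have m2: "(\<lambda>x. (cmod (u' x))\<^sup>2) \<in> borel_measurable lebesgue" using m by (intro measurable_completion) simp
  have "AE x in lebesgue. (cmod (u x))\<^sup>2 = (cmod (u' x))\<^sup>2" using ae2 by (simp only: AE_completion_iff)
  from integrable_cong_AE_imp[OF u(2) m2 this]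
  have "integrable lebesgue (\<lambda>x. (cmod (u' x))\<^sup>2)" .
  then have "integrable lborel (\<lambda>x. (cmod (u' x))\<^sup>2)" by (subst (asm) integrable_completion) (use m in simp_all)
  moreover have "(LBINT x. (cmod (u' x))\<^sup>2) = (L2_norm u)\<^sup>2"
    unfolding L2_norm_def integral_lebesgue_AE[OF m ae2] by simp
  ultimately show ?thesis using u' ae by (intro exI[of _ u'] conjI) (simp_all add: sq_int_def)
qed

text \<open>Pulled back to \<mu>, the shift inside the density cancels the shift of the image
  measure: the density at the shifted point is \<open>P\<close> at the original frequency.\<close>

lemma density_freq_shift_null:
  fixes P :: "real ^ 'n \<Rightarrow> real" and l :: "int ^ 'n"
  assumes s: "sets \<mu> = sets borel" and [measurable]: "P \<in> borel_measurable borel" and P: "\<And>\<xi>. 0 \<le> P \<xi>"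
    and A [measurable]: "A \<in> sets borel"
    and null: "emeasure (density (freq_shift \<mu> l) (\<lambda>(x, \<xi>). ennreal (P (\<xi> + (2 * pi) *\<^sub>R of_int_vec l)))) A = 0"
  shows "AE p in \<mu>. P (snd p) = 0 \<or> (fst p, snd p - (2 * pi) *\<^sub>R of_int_vec l) \<notin> A"
proof -
  define T where "T = (\<lambda>(x, \<xi>). (x :: real ^ 'n, \<xi> - (2 * pi) *\<^sub>R (of_int_vec l :: real ^ 'n)))"
  define g where "g = (\<lambda>(x :: real ^ 'n, \<xi>). ennreal (P (\<xi> + (2 * pi) *\<^sub>R of_int_vec l)))"
  have "T \<in> borel_measurable borel"
    unfolding T_def case_prod_beta by (intro borel_measurable_continuous_onI continuous_intros)
  then have [measurable]: "T \<in> borel_measurable \<mu>" by (simp add: measurable_cong_sets[OF s refl])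
  have "(\<lambda>p. snd p + (2 * pi) *\<^sub>R of_int_vec l) \<in> borel_measurable (borel :: ((real ^ 'n) \<times> (real ^ 'n)) measure)"
    by (intro borel_measurable_continuous_onI continuous_intros)
  then have "(\<lambda>p. ennreal (P (snd p + (2 * pi) *\<^sub>R of_int_vec l))) \<in> borel_measurable (borel :: ((real ^ 'n) \<times> (real ^ 'n)) measure)"
    by measurable
  then have [measurable]: "g \<in> borel_measurable borel" by (simp add: g_def case_prod_beta')
  have "(\<integral>\<^sup>+z. g z * indicator A z \<partial>distr \<mu> borel T) = 0"
    using null unfolding freq_shift_def T_def[symmetric] g_def[symmetric]
    by (subst (asm) emeasure_density) measurable
  then have "AE z in distr \<mu> borel T. g z * indicator A z = 0"
    by (subst (asm) nn_integral_0_iff_AE) measurable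
  then have "AE p in \<mu>. g (T p) * indicator A (T p) = 0"
    by (subst (asm) AE_distr_iff) measurable
  then show ?thesis
    by eventually_elim (use P in \<open>auto simp: g_def T_def case_prod_beta indicator_def ennreal_eq_0_iff intro: antisym split: if_splits\<close>)
qed

text \<open>\<open>S\<close> is the complement of the set that is null for the unshifted measure. It
  carries that measure, while the measure shifted by \<open>l\<close> lives on the discarded
  set.\<close>

lemma mutually_singular_separation:
  fixes P :: "real ^ 'n \<Rightarrow> real" and l :: "int ^ 'n"
  assumes s: "sets \<mu> = sets borel" and P: "P \<in> borel_measurable borel" "\<And>\<xi>. 0 \<le> P \<xi>"
    and ms: "mutually_singular
      (density (freq_shift \<mu> 0) (\<lambda>(x, \<xi>). ennreal (P (\<xi> + (2 * pi) *\<^sub>R of_int_vec (0 :: int ^ 'n)))))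
      (density (freq_shift \<mu> l) (\<lambda>(x, \<xi>). ennreal (P (\<xi> + (2 * pi) *\<^sub>R of_int_vec l))))"
  shows "\<exists>S\<in>sets borel. (AE p in \<mu>. P (snd p) = 0 \<or> p \<in> S) \<and>
      (AE p in \<mu>. P (snd p) = 0 \<or> (fst p, snd p - (2 * pi) *\<^sub>R of_int_vec l) \<notin> S)"
proof -
  obtain A where A: "A \<in> sets borel"
    "emeasure (density (freq_shift \<mu> 0) (\<lambda>(x, \<xi>). ennreal (P (\<xi> + (2 * pi) *\<^sub>R of_int_vec (0 :: int ^ 'n))))) A = 0"
    "emeasure (density (freq_shift \<mu> l) (\<lambda>(x, \<xi>). ennreal (P (\<xi> + (2 * pi) *\<^sub>R of_int_vec l)))) (UNIV - A) = 0"
    using ms by (auto simp: mutually_singular_def freq_shift_def)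
  have "AE p in \<mu>. P (snd p) = 0 \<or> (fst p, snd p - (2 * pi) *\<^sub>R of_int_vec (0 :: int ^ 'n)) \<notin> A"
    by (rule density_freq_shift_null[OF s P A(1,2)])
  moreover have "AE p in \<mu>. P (snd p) = 0 \<or> (fst p, snd p - (2 * pi) *\<^sub>R of_int_vec l) \<notin> UNIV - A"
    by (rule density_freq_shift_null[OF s P _ A(3)]) (use A(1) in auto)
  ultimately show ?thesis using A(1) by (intro bexI[of _ "UNIV - A"]) auto
qed

lemma Cc_of_test_function:
  assumes "test_function f" shows "Cc f"
proof -
  have "bounded {x. f x \<noteq> 0}"
    using assms by (auto simp: test_function_def intro: bounded_subset[OF compact_imp_bounded closure_subset])
  then obtain R where "\<forall>x\<in>{x. f x \<noteq> 0}. norm x \<le> R" by (auto simp: bounded_iff)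
  then have "\<forall>x. norm x > R \<longrightarrow> f x = 0" by force
  then show ?thesis using assms by (auto simp: Cc_def test_function_def)
qed

text \<open>The normalization of the samples contributes \<open>1 / h ^ CARD('n)\<close> to the
  square and the substitution in \<open>x\<close> contributes the inverse factor, so no power of
  \<open>h\<close> is left at unit scale.\<close>

lemma integral_reconstruction_density:
  fixes \<phi> \<phi>' \<psi> \<psi>' u u' f :: "real ^ 'n \<Rightarrow> complex"
  assumes \<phi>': "pbound \<phi>' A" and \<psi>': "pbound \<psi>' A'" and u': "sq_int u'"
    and \<phi>: "AE x in lborel. \<phi> x = \<phi>' x" and \<psi>: "AE x in lborel. \<psi> x = \<psi>' x" and u: "AE x in lborel. u x = u' x"
    and h: "h > 0" and f: "Cc f"
  shows "(\<integral>x. f x \<partial>density lebesgue (\<lambda>x. ennreal ((cmod (reconstruction \<psi> h (sampling \<phi> h u) x))\<^sup>2)))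
    = (LBINT x. f (h *\<^sub>R x) * complex_of_real ((norm (LINT n|lattice. filt \<phi>' (unit_scale h u') (of_int_vec n) * \<psi>' (x - of_int_vec n)))\<^sup>2))"
proof -
  have [measurable]: "\<phi>' \<in> borel_measurable borel" by (rule pbound_measurable[OF \<phi>'])
  have [measurable]: "\<psi>' \<in> borel_measurable borel" by (rule pbound_measurable[OF \<psi>'])
  have [measurable]: "u' \<in> borel_measurable borel" using u' by (simp add: sq_int_def)
  have [measurable]: "f \<in> borel_measurable borel" by (rule Cc_measurable[OF f])
  define s where "s = sqrt h ^ CARD('n)"
  have s: "s > 0" "s\<^sup>2 = h ^ CARD('n)" using h by (simp_all add: s_def power2_eq_square power_mult_distrib[symmetric])
  define V where "V n = filt \<phi>' (unit_scale h u') (of_int_vec n)" for n :: "int ^ 'n"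
  define U where "U = sampling \<phi> h u"
  have UV: "U n = V n / complex_of_real s" for n
  proof -
    have "complex_of_real s * U n = V n"
      unfolding U_def V_def s_def by (rule sampling_eq_filt[OF _ _ \<phi> u h]) measurable
    then show ?thesis using s by (auto simp: eq_divide_eq mult.commute)
  qed
  define W where "W = (LBINT x. (norm (u' x))\<^sup>2)"
  have W0: "0 \<le> W" by (simp add: W_def)
  have A: "0 \<le> A" by (rule pbound_nonneg[OF \<phi>'])
  have "(\<integral>\<^sup>+n. ennreal ((norm (V n))\<^sup>2) \<partial>lattice) \<le> ennreal (A * W * A)"
    using lattice_filt_bound[OF \<phi>' pbound_integrable(2)[OF \<phi>'] sq_int_unit_scale(1)[OF u' h], of W 0] sq_int_unit_scale(2)[OF u' h]
    by (simp add: V_def W_def)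
  then have VD: "ennreal (1 / s\<^sup>2) * (\<integral>\<^sup>+n. ennreal ((norm (V n))\<^sup>2) \<partial>lattice) \<le> ennreal (1 / s\<^sup>2) * ennreal (A * W * A)"
    by (rule mult_left_mono) simp
  have "ennreal ((norm (U n))\<^sup>2) = ennreal (1 / s\<^sup>2) * ennreal ((norm (V n))\<^sup>2)" for n
    by (simp add: UV norm_divide power_divide ennreal_mult[symmetric])
  then have "(\<integral>\<^sup>+n. ennreal ((norm (U n))\<^sup>2) \<partial>lattice) = ennreal (1 / s\<^sup>2) * (\<integral>\<^sup>+n. ennreal ((norm (V n))\<^sup>2) \<partial>lattice)"
    by (simp only: nn_integral_cmult borel_measurable_count_space)
  also note VD
  also have "ennreal (1 / s\<^sup>2) * ennreal (A * W * A) = ennreal (1 / s\<^sup>2 * (A * W * A))"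
    by (rule ennreal_mult[symmetric]) (use A W0 in auto)
  finally have UD: "(\<integral>\<^sup>+n. ennreal ((norm (U n))\<^sup>2) \<partial>lattice) \<le> ennreal (1 / s\<^sup>2 * (A * W * A))" .
  define Y where "Y x = (LINT n|lattice. U n * \<psi>' (x - of_int_vec n))" for x
  have [measurable]: "Y \<in> borel_measurable borel"
    unfolding Y_def [abs_def] by (rule lattice.borel_measurable_lebesgue_integral) measurable
  have R: "AE x in lborel. reconstruction \<psi> h U x = Y (x /\<^sub>R h)"
    unfolding Y_def by (rule reconstruction_AE[OF \<psi>' \<psi> h _ UD]) (intro mult_nonneg_nonneg A W0, simp)
  have R2: "AE x in lborel. (cmod (reconstruction \<psi> h U x))\<^sup>2 = (cmod (Y (x /\<^sub>R h)))\<^sup>2" using R by eventually_elim simp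
  have Ym: "(\<lambda>x. (cmod (Y (x /\<^sub>R h)))\<^sup>2) \<in> borel_measurable borel" by measurable
  have Rm: "(\<lambda>x. (cmod (reconstruction \<psi> h U x))\<^sup>2) \<in> borel_measurable lebesgue"
    by (rule measurable_lebesgue_AE[OF measurable_completion R2]) (use Ym in simp)
  have hx: "(h *\<^sub>R x) /\<^sub>R h = x" for x :: "real ^ 'n" using h by simp
  have fm: "f \<in> borel_measurable lebesgue" by (rule measurable_completion) simp
  have "(\<integral>x. f x \<partial>density lebesgue (\<lambda>x. ennreal ((cmod (reconstruction \<psi> h U x))\<^sup>2)))
    = (LINT x|lebesgue. (cmod (reconstruction \<psi> h U x))\<^sup>2 *\<^sub>R f x)"
    by (rule integral_density[OF fm Rm]) simp
  also have "\<dots> = (LBINT x. (cmod (Y (x /\<^sub>R h)))\<^sup>2 *\<^sub>R f x)"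
    by (rule integral_lebesgue_AE) (measurable, use R2 in eventually_elim, simp)
  also have "\<dots> = \<bar>h\<bar> ^ DIM(real ^ 'n) *\<^sub>R (LBINT x. (cmod (Y ((h *\<^sub>R x) /\<^sub>R h)))\<^sup>2 *\<^sub>R f (h *\<^sub>R x))"
    by (rule integral_lborel_scale) (measurable, use h in simp)
  also have "\<dots> = (LBINT x. s\<^sup>2 *\<^sub>R ((cmod (Y x))\<^sup>2 *\<^sub>R f (h *\<^sub>R x)))"
    using h by (simp add: s(2) hx del: scaleR_scaleR)
  also have "\<dots> = (LBINT x. f (h *\<^sub>R x) * complex_of_real ((norm (LINT n|lattice. V n * \<psi>' (x - of_int_vec n)))\<^sup>2))"
  proof (intro Bochner_Integration.integral_cong refl)
    fix x
    have "(LINT n|lattice. V n * \<psi>' (x - of_int_vec n)) = (LINT n|lattice. complex_of_real s * (U n * \<psi>' (x - of_int_vec n)))"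
      using s by (simp add: UV)
    also have "\<dots> = complex_of_real s * Y x" unfolding Y_def by (rule integral_mult_right_zero)
    finally have "(norm (LINT n|lattice. V n * \<psi>' (x - of_int_vec n)))\<^sup>2 = s\<^sup>2 * (cmod (Y x))\<^sup>2"
      by (simp add: norm_mult power_mult_distrib)
    then show "s\<^sup>2 *\<^sub>R ((cmod (Y x))\<^sup>2 *\<^sub>R f (h *\<^sub>R x)) = f (h *\<^sub>R x) * complex_of_real ((norm (LINT n|lattice. V n * \<psi>' (x - of_int_vec n)))\<^sup>2)"
      by (simp add: scaleR_conv_of_real[where 'a = complex])
  qed
  finally show ?thesis by (simp only: U_def V_def)
qed

text \<open>The distribution attached to \<open>u k\<close> does not see null sets, so convergence
  on Gaussian pairs passes to the Borel representatives, where it becomes a statement about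
  correlations at unit scale.\<close>

lemma wigner_seq_unit_scale:
  fixes u u' :: "nat \<Rightarrow> 'a::euclidean_space \<Rightarrow> complex"
  assumes u': "\<And>k. sq_int (u' k)" "\<And>k. AE x in lborel. u k x = u' k x" "\<And>k. (LBINT x. (norm (u' k x))\<^sup>2) \<le> B"
    and h: "is_scale h" and wig: "is_wigner_measure \<mu> h u"
  shows "wigner_seq (\<lambda>k. unit_scale (h k) (u' k)) h \<mu> B"
proof
  have hpos: "h k > 0" for k using h by (simp add: is_scale_def)
  show "sq_int (unit_scale (h k) (u' k))" for k by (rule sq_int_unit_scale(1)[OF u'(1) hpos])
  show "(LBINT x. (norm (unit_scale (h k) (u' k) x))\<^sup>2) \<le> B" for k
    using u'(3) by (simp add: sq_int_unit_scale(2)[OF u'(1) hpos])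
  show "0 < h k" for k by (rule hpos)
  show "h \<longlonglongrightarrow> 0" using h by (simp add: is_scale_def)
  show "sets \<mu> = sets borel" using wig by (simp add: is_wigner_measure_def radon_measure_def)
  fix \<sigma> s :: real and y a :: 'a assume pos: "\<sigma> > 0" "s > 0"
  have S: "schwartz (gauss_pair \<sigma> y s a)" by (rule schwartz_gauss_pair[OF pos])
  show "integrable \<mu> (gauss_pair \<sigma> y s a)" using wig S by (simp add: is_wigner_measure_def)
  have "dist_of_fun (u k) = dist_of_fun (u' k)" for k
  proof
    fix \<theta>
    show "dist_of_fun (u k) \<theta> = dist_of_fun (u' k) \<theta>"
      unfolding dist_of_fun_def by (rule integral_lebesgue_cong_AE) (use u'(2)[of k] in eventually_elim, simp)
  qed
  moreover have "(\<lambda>k. wigner_distribution (h k) (dist_of_fun (u k)) (gauss_pair \<sigma> y s a)) \<longlonglongrightarrow> (LINT z|\<mu>. gauss_pair \<sigma> y s a z)"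
    using wig S by (simp add: is_wigner_measure_def)
  ultimately show "(\<lambda>k. LBINT z. complex_of_real (gauss s (z - a)) * corr (unit_scale (h k) (u' k)) (\<lambda>X. complex_of_real (gauss \<sigma> (h k *\<^sub>R X - y))) z)
      \<longlonglongrightarrow> (LINT p|\<mu>. gauss_pair \<sigma> y s a p)"
    by (simp only: wigner_gauss[OF u'(1) hpos pos])
qed

theorem corollary1p4:
  fixes \<phi> \<psi> :: "real ^ 'n \<Rightarrow> complex"
    and C \<epsilon> :: real
    and h :: "nat \<Rightarrow> real"
    and u :: "nat \<Rightarrow> real ^ 'n \<Rightarrow> complex"
    and \<mu> :: "((real ^ 'n) \<times> (real ^ 'n)) measure"
    and \<nu> :: "(real ^ 'n) measure"
  assumes "\<phi> \<in> borel_measurable lebesgue"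
    and "\<psi> \<in> borel_measurable lebesgue"
    and "C > 0" and "\<epsilon> > 0"
    and "\<And>x. cmod (\<phi> x) \<le> C * (1 + norm x) powr (- real CARD('n) - \<epsilon>)"
    and "\<And>x. cmod (\<psi> x) \<le> C * (1 + norm x) powr (- real CARD('n) - \<epsilon>)"
    and "is_scale h"
    and "\<And>k. square_integrable (u k)"
    and "\<exists>B. \<forall>k. L2_norm (u k) \<le> B"
    and "is_wigner_measure \<mu> h u"
    and "\<And>m n :: int ^ 'n. m \<noteq> n \<Longrightarrow> mutually_singular
           (density (freq_shift \<mu> m)
              (\<lambda>(x, \<xi>). ennreal ((cmod (fourier \<phi> (\<xi> + (2 * pi) *\<^sub>R of_int_vec m)))\<^sup>2)))
           (density (freq_shift \<mu> n)
              (\<lambda>(x, \<xi>). ennreal ((cmod (fourier \<phi> (\<xi> + (2 * pi) *\<^sub>R of_int_vec n)))\<^sup>2)))"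
    and "radon_measure \<nu>"
    and "weakly_converges
           (\<lambda>k. density lebesgue
              (\<lambda>x. ennreal ((cmod (reconstruction \<psi> (h k) (sampling \<phi> (h k) (u k)) x))\<^sup>2))) \<nu>"
  shows "(\<forall>\<xi>. (\<lambda>k :: int ^ 'n. (cmod (fourier \<psi> (\<xi> + (2 * pi) *\<^sub>R of_int_vec k)))\<^sup>2)
                summable_on UNIV) \<and>
         (\<forall>f. test_function f \<longrightarrow>
            integrable \<mu> (\<lambda>(x, \<xi>). f x * complex_of_real
              ((\<Sum>\<^sub>\<infinity>k :: int ^ 'n. (cmod (fourier \<psi> (\<xi> + (2 * pi) *\<^sub>R of_int_vec k)))\<^sup>2)
                 * (cmod (fourier \<phi> \<xi>))\<^sup>2)) \<and>
            (\<integral>x. f x \<partial>\<nu>) =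
            (\<integral>(x, \<xi>). f x * complex_of_real
              ((\<Sum>\<^sub>\<infinity>k :: int ^ 'n. (cmod (fourier \<psi> (\<xi> + (2 * pi) *\<^sub>R of_int_vec k)))\<^sup>2)
                 * (cmod (fourier \<phi> \<xi>))\<^sup>2) \<partial>\<mu>))"
proof -
  note C = \<open>C > 0\<close> and \<epsilon> = \<open>\<epsilon> > 0\<close>
  obtain \<phi>' A where \<phi>': "pbound \<phi>' A" and ae\<phi>: "AE x in lborel. \<phi> x = \<phi>' x"
    by (rule decay_version[OF assms(1) \<epsilon> C assms(5)])
  obtain \<psi>' A' where \<psi>': "pbound \<psi>' A'" and ae\<psi>: "AE x in lborel. \<psi> x = \<psi>' x"
    by (rule decay_version[OF assms(2) \<epsilon> C assms(6)])
  have m: "\<phi>' \<in> borel_measurable borel" "\<psi>' \<in> borel_measurable borel"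
    by (rule pbound_measurable[OF \<phi>'], rule pbound_measurable[OF \<psi>'])
  note F\<phi> = norm_fourier_sq[OF m(1) ae\<phi>] and F\<psi> = norm_fourier_sq[OF m(2) ae\<psi>]
  have hpos: "h k > 0" for k using \<open>is_scale h\<close> by (simp add: is_scale_def)
  have "\<forall>k. \<exists>u'. sq_int u' \<and> (AE x in lborel. u k x = u' x) \<and> (LBINT x. (norm (u' x))\<^sup>2) = (L2_norm (u k))\<^sup>2"
    using square_integrable_version[OF assms(8)] by blast
  then obtain u' where u': "\<And>k. sq_int (u' k)" "\<And>k. AE x in lborel. u k x = u' k x"
    "\<And>k. (LBINT x. (norm (u' k x))\<^sup>2) = (L2_norm (u k))\<^sup>2"
    by metis
  obtain B where B: "\<And>k. L2_norm (u k) \<le> B" using assms(9) by blast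
  have W: "wigner_seq (\<lambda>k. unit_scale (h k) (u' k)) h \<mu> (B\<^sup>2)"
  proof (rule wigner_seq_unit_scale[OF u'(1,2) _ \<open>is_scale h\<close> \<open>is_wigner_measure \<mu> h u\<close>])
    show "(LBINT x. (norm (u' k x))\<^sup>2) \<le> B\<^sup>2" for k
      unfolding u'(3) by (rule power_mono[OF B]) (simp add: L2_norm_def)
  qed
  have s: "sets \<mu> = sets borel" using \<open>is_wigner_measure \<mu> h u\<close> by (simp add: is_wigner_measure_def radon_measure_def)
  have P: "power_spec \<phi>' \<in> borel_measurable borel" using measurable_power_spec[OF m(1) measurable_ident] by simp
  have S: "\<exists>S\<in>sets borel. (AE p in \<mu>. power_spec \<phi>' (snd p) = 0 \<or> p \<in> S) \<and>
      (AE p in \<mu>. power_spec \<phi>' (snd p) = 0 \<or> (fst p, snd p - (2 * pi) *\<^sub>R of_int_vec l) \<notin> S)"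
    if "l \<noteq> 0" for l :: "int ^ 'n"
    by (rule mutually_singular_separation[OF s P power_spec_bound(1)[OF pbound_integrable(1)[OF \<phi>']]])
      (use assms(11)[OF not_sym[OF that]] in \<open>simp only: F\<phi>\<close>)
  have "integrable \<mu> (\<lambda>q. f (fst q) * complex_of_real ((\<Sum>\<^sub>\<infinity>l :: int ^ 'n. power_spec \<psi>' (snd q + (2 * pi) *\<^sub>R of_int_vec l)) * power_spec \<phi>' (snd q)))
    \<and> (\<integral>x. f x \<partial>\<nu>) = (\<integral>q. f (fst q) * complex_of_real ((\<Sum>\<^sub>\<infinity>l :: int ^ 'n. power_spec \<psi>' (snd q + (2 * pi) *\<^sub>R of_int_vec l)) * power_spec \<phi>' (snd q)) \<partial>\<mu>)"
    if tf: "test_function f" for f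
  proof -
    have f: "Cc f" by (rule Cc_of_test_function[OF tf])
    have "(\<lambda>k. \<integral>x. f x \<partial>density lebesgue (\<lambda>x. ennreal ((cmod (reconstruction \<psi> (h k) (sampling \<phi> (h k) (u k)) x))\<^sup>2))) \<longlonglongrightarrow> (\<integral>x. f x \<partial>\<nu>)"
      using assms(13) tf unfolding weakly_converges_def by blast
    then have "(\<lambda>k. LBINT x. f (h k *\<^sub>R x) * complex_of_real ((norm (\<integral>n. filt \<phi>' (unit_scale (h k) (u' k)) (of_int_vec n) * \<psi>' (x - of_int_vec n) \<partial>lattice))\<^sup>2))
      \<longlonglongrightarrow> (\<integral>x. f x \<partial>\<nu>)"
      by (simp only: integral_reconstruction_density[OF \<phi>' \<psi>' u'(1) ae\<phi> ae\<psi> u'(2) hpos f])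
    \<comment> \<open>The same sequence converges to the integral against \<nu> by weak convergence
      and to the integral against \<mu> by the limit of the reconstructions.\<close>
    from LIMSEQ_unique[OF this reconstruction_limit(1)[OF W \<phi>' \<psi>' f S]] reconstruction_limit(2)[OF W \<phi>' \<psi>' f S]
    show ?thesis by blast
  qed
  then show ?thesis
    unfolding F\<phi> F\<psi> case_prod_beta using periodized_power_spec_infsum(1)[OF \<psi>'] by blast
qed

end
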